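(* Let $(A,[\cdot,\cdot],\rho)$ be a Lie algebroid over a smooth manifold $M$. If $(\pi,N,\psi,H)$ is a Poisson quasi-Nijenhuis structure with background on $A$, then $$\big(A^*_\pi,\ d_N^H,\ \psi+i_NH\big)$$ is a Lie quasi-bialgebroid, where $A^*_\pi$ is the Lie algebroid $(A^*,[\cdot,\cdot]_\pi,\rho\circ\pi^\sharp)$ and $d_N^H$ is the degree one derivation of $(\Gamma(\bigwedge^\bullet A^* ),\wedge)$ given by $d_N^H(f)=d_Nf$ for $f\in C^\infty(M)$ and $$d_N^H(\alpha)=d_N(\alpha)-i_{\pi^\sharp(\alpha)}H\qquad\text{for all }\alpha\in\Gamma(A^* ).$$
   Context: Conventions. $(A,[\cdot,\cdot],\rho)$ is a Lie algebroid with differential $d$ on $\Gamma(\bigwedge^\bullet A^* )$ and Lie derivative $\mathcal L_X=i_Xd+di_X$. For $\pi\in\Gamma(\bigwedge^2A)$, $\pi^\sharp(\alpha)=\pi(\alpha,\cdot)$, i.e. $\beta(\pi^\sharp\alpha)=\pi(\alpha,\beta)$. ${}^tN:A^*\to A^*$ is the transpose of $N:A\to A$. For 3-forms, here $(i_{X\wedge Y}H)(Z)=H(X,Y,Z)$. Deformations. $[X,Y]_N=[NX,Y]+[X,NY]-N[X,Y]$. $i_N$ is the degree $0$ derivation of $\Gamma(\bigwedge^\bullet A^* )$ vanishing on functions with $i_N\alpha={}^tN\alpha$ on 1-forms, so $(i_N\eta)(X_1,\dots,X_k)=\sum_j\eta(X_1,\dots,NX_j,\dots,X_k)$. $d_N=i_N\circ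 d-d\circ i_N$. $\mathcal L^N_X=i_Xd_N+d_Ni_X$. $T_N(X,Y)=[NX,NY]-N([X,Y]_N)$. On $\Gamma(A^* )$: $[\alpha,\beta]_\pi=\mathcal L_{\pi^\sharp\alpha}\beta-\mathcal L_{\pi^\sharp\beta}\alpha-d(\pi(\alpha,\beta))$. A bivector $\pi$ is Poisson if its Schouten-Nijenhuis bracket with itself vanishes. Define $$C_{\pi,N}(\alpha,\beta)=\Big(\mathcal L^N_{\pi^\sharp\alpha}\beta-\mathcal L^N_{\pi^\sharp\beta}\alpha-d_N(\pi(\alpha,\beta))\Big)-\Big([{}^tN\alpha,\beta]_\pi+[\alpha,{}^tN\beta]_\pi-{}^tN[\alpha,\beta]_\pi\Big).$$ Poisson quasi-Nijenhuis structure with background on $A$: a quadruple $(\pi,N,\psi,H)$ with $\pi\in\Gamma(\bigwedge^2A)$, $N\in\Gamma(A\otimes A^* )$, $\psi,H\in\Gamma(\bigwedge^3A^* )$ such that $N\circ\pi^\sharp=\pi^\sharp\circ{}^tN$, $d\psi=0$, $dH=0$, and for all $X,Y\in\Gamma(A)$, $\alpha,\beta\in\Gamma(A^* )$: (1) $\pi$ is a Poisson bivector; (2) $C_{\pi,N}(\alpha,\beta)=-2\,i_{\pi^\sharp\alpha\wedge\pi^\sharp\beta}H$; (3) $T_N(X,Y)=\pi^\sharp\big(i_{NX\wedge Y}H-i_{NY\wedge X}H+i_{X\wedge Y}\psi\big)$; (4) $d_N\psi=d\mathcal H$, where $\mathcal H(X,Y,Z)=H(NX,NY,Z)+H(NY,NZ,X)+H(NZ,NX,Y)$.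 A Lie quasi-bialgebroid is a triple $(B,\delta,\varphi)$ where $B$ is a Lie algebroid, $\delta$ is a degree one derivation of the Gerstenhaber algebra $(\Gamma(\bigwedge^\bullet B),\wedge,[\cdot,\cdot])$ (that is, a derivation of both the wedge product and the Schouten bracket $[\cdot,\cdot]$ extending the bracket of $B$, with $[X,f]=\rho_B(X)f$), and $\varphi\in\Gamma(\bigwedge^3B)$ satisfies $\delta^2=[\varphi,\cdot]$ and $\delta\varphi=0$. Here $B=A^*_\pi$. *)

theory Defs
  imports "HOL-Analysis.Analysis" "HOL-Library.Function_Algebras"
begin

section \<open>Smooth manifolds\<close>

text \<open>
  Model spaces and model fibres are finite-dimensional inner product spaces given as types of
  class \<open>real_inner\<close>.  (The class \<open>euclidean_space\<close> would rule out dimension 0, hence Lie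
  algebras as Lie algebroids over a point, and bundles of rank 0.)
\<close>

definition finite_dim :: "'v::real_vector itself \<Rightarrow> bool" where
  "finite_dim _ \<longleftrightarrow> (\<exists>B::'v set. finite B \<and> span B = UNIV)"

primrec Ck_on :: "nat \<Rightarrow> 'e::real_normed_vector set \<Rightarrow> ('e \<Rightarrow> 'b::real_normed_vector) \<Rightarrow> bool" where
  "Ck_on 0 S f \<longleftrightarrow> continuous_on S f"
| "Ck_on (Suc n) S f \<longleftrightarrow>
     (\<forall>x\<in>S. f differentiable (at x)) \<and> (\<forall>v. Ck_on n S (\<lambda>x. frechet_derivative f (at x) v))"

text \<open>Used for open sets in finite-dimensional spaces only.\<close>

definition smooth_on :: "'e::real_normed_vector set \<Rightarrow> ('e \<Rightarrow> 'b::real_normed_vector) \<Rightarrow> bool" where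
  "smooth_on S f \<longleftrightarrow> (\<forall>n. Ck_on n S f)"

text \<open>The manifold is a whole type \<open>'m\<close>; a chart is a pair of its domain and its coordinate map.\<close>

type_synonym ('m, 'e) atlas = "('m set \<times> ('m \<Rightarrow> 'e)) set"

definition smooth_manifold ::
  "('m::{t2_space, second_countable_topology}, 'e::real_inner) atlas \<Rightarrow> bool" where
  "smooth_manifold M \<longleftrightarrow>
     finite_dim TYPE('e) \<and>
     (\<Union>(U, \<phi>)\<in>M. U) = UNIV \<and>
     (\<forall>(U, \<phi>)\<in>M. open U \<and> open (\<phi> ` U) \<and> homeomorphism U (\<phi> ` U) \<phi> (inv_into U \<phi>)) \<and>
     (\<forall>(U, \<phi>)\<in>M. \<forall>(V, \<psi>)\<in>M. smooth_on (\<phi> ` (U \<inter> V)) (\<lambda>z. \<psi> (inv_into U \<phi> z)))"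

definition smooth_map_on ::
  "('m, 'e::real_inner) atlas \<Rightarrow> 'm set \<Rightarrow> ('m \<Rightarrow> 'b::real_normed_vector) \<Rightarrow> bool" where
  "smooth_map_on M W f \<longleftrightarrow> (\<forall>(U, \<phi>)\<in>M. smooth_on (\<phi> ` (U \<inter> W)) (\<lambda>z. f (inv_into U \<phi> z)))"

definition smooth_funs :: "('m, 'e::real_inner) atlas \<Rightarrow> ('m \<Rightarrow> real) set" where
  "smooth_funs M = {f. smooth_map_on M UNIV f}"

section \<open>Vector bundles, dual bundles and exterior powers\<close>

text \<open>
  Each fibre \<open>A\<^sub>x\<close> is identified, as a bare vector space and separately for every point
  \<open>x\<close>, with the model fibre \<open>'v\<close>.  These identifications need not depend continuously on
  \<open>x\<close>; the topology and the smooth structure of the bundle are carried only by the atlas of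
  local trivializations \<open>(U, g)\<close>, where \<open>g x : A\<^sub>x \<rightarrow> 'v\<close> is a linear isomorphism for
  \<open>x \<in> U\<close>.  So non-trivial bundles are covered, and sections are plain functions.

  A functional on \<open>A\<^sub>x\<close> is represented by the vector \<open>a\<close> with \<open>a \<bullet> v\<close> as its value at
  \<open>v\<close>.  The inner product of \<open>'v\<close> serves only for this encoding of dual spaces: trivializations
  are not required to be isometries, so no metric on \<open>A\<close> is involved.  The dual bundle then has
  the same model fibre and the contragredient trivializations, and the bidual bundle is the bundle.
\<close>

type_synonym ('m, 'v) triv = "('m set \<times> ('m \<Rightarrow> 'v \<Rightarrow> 'v)) set"

definition vector_bundle ::
  "('m::topological_space, 'e::real_inner) atlas \<Rightarrow> ('m, 'v::real_inner) triv \<Rightarrow> bool" where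
  "vector_bundle M E \<longleftrightarrow>
     finite_dim TYPE('v) \<and>
     (\<Union>(U, g)\<in>E. U) = UNIV \<and>
     (\<forall>(U, g)\<in>E. open U \<and> (\<forall>x\<in>U. linear (g x) \<and> bij (g x))) \<and>
     (\<forall>(U, g)\<in>E. \<forall>(V, h)\<in>E. \<forall>v. smooth_map_on M (U \<inter> V) (\<lambda>x. h x (inv (g x) v)))"

definition dual_bundle :: "('m, 'v::real_inner) triv \<Rightarrow> ('m, 'v) triv" where
  "dual_bundle E = (\<lambda>(U, g). (U, \<lambda>x. adjoint (inv (g x)))) ` E"

definition sections ::
  "('m, 'e::real_inner) atlas \<Rightarrow> ('m, 'v::real_inner) triv \<Rightarrow> ('m \<Rightarrow> 'v) set" where
  "sections M E = {s. \<forall>(U, g)\<in>E. smooth_map_on M U (\<lambda>x. g x (s x))}"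

definition bundle_endos ::
  "('m, 'e::real_inner) atlas \<Rightarrow> ('m, 'v::real_inner) triv \<Rightarrow> ('m \<Rightarrow> 'v \<Rightarrow> 'v) set" where
  "bundle_endos M E =
     {N. (\<forall>x. linear (N x)) \<and>
         (\<forall>(U, g)\<in>E. \<forall>v. smooth_map_on M U (\<lambda>x. g x (N x (inv (g x) v))))}"

text \<open>
  \<open>k\<close>-vectors of a vector space are represented as alternating \<open>k\<close>-linear functions on its dual,
  extended by 0 to lists of length other than \<open>k\<close>.
\<close>

definition alternating :: "nat \<Rightarrow> ('v::real_vector list \<Rightarrow> real) \<Rightarrow> bool" where
  "alternating k f \<longleftrightarrow>
     (\<forall>vs. length vs \<noteq> k \<longrightarrow> f vs = 0) \<and>
     (\<forall>vs. \<forall>i<k. length vs = k \<longrightarrow> linear (\<lambda>v. f (vs[i := v]))) \<and>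
     (\<forall>vs. \<forall>i<k. \<forall>j<k. length vs = k \<longrightarrow> i \<noteq> j \<longrightarrow> vs ! i = vs ! j \<longrightarrow> f vs = 0)"

type_synonym ('m, 'v) multi = "'m \<Rightarrow> 'v list \<Rightarrow> real"

text \<open>
  The space of smooth sections of the \<open>k\<close>-th exterior power of \<open>E\<close>.  A trivialization \<open>g x\<close> of
  \<open>E\<close> identifies the dual of the model fibre with the dual of \<open>E\<^sub>x\<close> through the adjoint of
  \<open>g x\<close>.
\<close>

definition ext_power ::
  "('m, 'e::real_inner) atlas \<Rightarrow> ('m, 'v::real_inner) triv \<Rightarrow> nat \<Rightarrow> ('m, 'v) multi set" where
  "ext_power M E k =
     {P. (\<forall>x. alternating k (P x)) \<and>
         (\<forall>(U, g)\<in>E. \<forall>ws. length ws = k \<longrightarrow>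
            smooth_map_on M U (\<lambda>x. P x (map (adjoint (g x)) ws)))}"

definition of_fun :: "('m \<Rightarrow> real) \<Rightarrow> ('m, 'v) multi" where
  "of_fun f = (\<lambda>x vs. if vs = [] then f x else 0)"

definition of_sec :: "('m \<Rightarrow> 'v::real_inner) \<Rightarrow> ('m, 'v) multi" where
  "of_sec s = (\<lambda>x vs. case vs of [v] \<Rightarrow> s x \<bullet> v | _ \<Rightarrow> 0)"

definition riesz :: "('v::real_inner \<Rightarrow> real) \<Rightarrow> 'v" where
  "riesz l = (THE a. \<forall>v. a \<bullet> v = l v)"

text \<open>Inverse to \<^const>\<open>of_sec\<close> on multisections of degree 1.\<close>

definition to_sec :: "('m, 'v::real_inner) multi \<Rightarrow> 'm \<Rightarrow> 'v" where
  "to_sec P = (\<lambda>x. riesz (\<lambda>v. P x [v]))"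

text \<open>
  The wedge product as a sum over shuffles; \<open>S\<close> is the set of argument positions given to the
  first factor.  Summands where \<open>S\<close> does not have the right size vanish.
\<close>

definition shuffle_sign :: "nat set \<Rightarrow> real" where
  "shuffle_sign S = (- 1) ^ card {(i, j). i \<in> S \<and> j \<notin> S \<and> j < i}"

definition wedge :: "('m, 'v) multi \<Rightarrow> ('m, 'v) multi \<Rightarrow> ('m, 'v) multi" (infixr "\<and>\<and>" 70) where
  "P \<and>\<and> Q = (\<lambda>x vs. \<Sum>S\<in>Pow {..<length vs}.
      shuffle_sign S * P x (nths vs S) * Q x (nths vs (- S)))"

definition app :: "('m \<Rightarrow> 'v \<Rightarrow> 'v) \<Rightarrow> ('m \<Rightarrow> 'v) \<Rightarrow> 'm \<Rightarrow> 'v" where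
  "app F s = (\<lambda>x. F x (s x))"

definition transp :: "('m \<Rightarrow> 'v::real_inner \<Rightarrow> 'v) \<Rightarrow> 'm \<Rightarrow> 'v \<Rightarrow> 'v" where
  "transp N = (\<lambda>x. adjoint (N x))"

section \<open>Lie algebroids\<close>

text \<open>
  Tangent vectors at \<open>x\<close> are derivations at \<open>x\<close> of the algebra of smooth functions; \<open>anc A x v\<close>
  is the tangent vector \<open>\<rho>(v)\<close> for \<open>v\<close> in the fibre over \<open>x\<close>.
\<close>

record ('m, 'e, 'v) lie_alg_data =
  base :: "('m, 'e) atlas"
  vbundle :: "('m, 'v) triv"
  brk :: "('m \<Rightarrow> 'v) \<Rightarrow> ('m \<Rightarrow> 'v) \<Rightarrow> 'm \<Rightarrow> 'v"
  anc :: "'m \<Rightarrow> 'v \<Rightarrow> ('m \<Rightarrow> real) \<Rightarrow> real"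

definition tangent_vector ::
  "('m, 'e::real_inner) atlas \<Rightarrow> 'm \<Rightarrow> (('m \<Rightarrow> real) \<Rightarrow> real) \<Rightarrow> bool" where
  "tangent_vector M x D \<longleftrightarrow>
     (\<forall>f\<in>smooth_funs M. \<forall>h\<in>smooth_funs M.
        D (\<lambda>y. f y + h y) = D f + D h \<and> D (\<lambda>y. f y * h y) = D f * h x + f x * D h) \<and>
     (\<forall>c. \<forall>f\<in>smooth_funs M. D (\<lambda>y. c * f y) = c * D f)"

abbreviation secs :: "('m, 'e::real_inner, 'v::real_inner) lie_alg_data \<Rightarrow> ('m \<Rightarrow> 'v) set" where
  "secs A \<equiv> sections (base A) (vbundle A)"

abbreviation cosecs :: "('m, 'e::real_inner, 'v::real_inner) lie_alg_data \<Rightarrow> ('m \<Rightarrow> 'v) set" where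
  "cosecs A \<equiv> sections (base A) (dual_bundle (vbundle A))"

abbreviation multivectors ::
  "('m, 'e::real_inner, 'v::real_inner) lie_alg_data \<Rightarrow> nat \<Rightarrow> ('m, 'v) multi set" where
  "multivectors A \<equiv> ext_power (base A) (vbundle A)"

abbreviation forms ::
  "('m, 'e::real_inner, 'v::real_inner) lie_alg_data \<Rightarrow> nat \<Rightarrow> ('m, 'v) multi set" where
  "forms A \<equiv> ext_power (base A) (dual_bundle (vbundle A))"

definition anchor_deriv ::
  "('m, 'e, 'v) lie_alg_data \<Rightarrow> ('m \<Rightarrow> 'v) \<Rightarrow> ('m \<Rightarrow> real) \<Rightarrow> 'm \<Rightarrow> real" where
  "anchor_deriv A X f = (\<lambda>x. anc A x (X x) f)"

definition lie_algebroid ::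
  "('m::{t2_space, second_countable_topology}, 'e::real_inner, 'v::real_inner) lie_alg_data
     \<Rightarrow> bool" where
  "lie_algebroid A \<longleftrightarrow>
     smooth_manifold (base A) \<and> vector_bundle (base A) (vbundle A) \<and>
     (\<forall>x v. tangent_vector (base A) x (anc A x v)) \<and>
     (\<forall>x. \<forall>f\<in>smooth_funs (base A). linear (\<lambda>v. anc A x v f)) \<and>
     (\<forall>X\<in>secs A. \<forall>f\<in>smooth_funs (base A). anchor_deriv A X f \<in> smooth_funs (base A)) \<and>
     (\<forall>X\<in>secs A. \<forall>Y\<in>secs A. brk A X Y \<in> secs A \<and> brk A X Y = - brk A Y X) \<and>
     (\<forall>X\<in>secs A. \<forall>Y\<in>secs A. \<forall>Z\<in>secs A. brk A X (Y + Z) = brk A X Y + brk A X Z) \<and>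
     (\<forall>c. \<forall>X\<in>secs A. \<forall>Y\<in>secs A. brk A X (\<lambda>x. c *\<^sub>R Y x) = (\<lambda>x. c *\<^sub>R brk A X Y x)) \<and>
     (\<forall>X\<in>secs A. \<forall>Y\<in>secs A. \<forall>Z\<in>secs A.
        brk A X (brk A Y Z) + brk A Y (brk A Z X) + brk A Z (brk A X Y) = 0) \<and>
     (\<forall>X\<in>secs A. \<forall>Y\<in>secs A. \<forall>f\<in>smooth_funs (base A).
        brk A X (\<lambda>x. f x *\<^sub>R Y x) = (\<lambda>x. f x *\<^sub>R brk A X Y x + anchor_deriv A X f x *\<^sub>R Y x))"

text \<open>The usual formula for the differential, for \<open>\<eta>\<close> of degree \<open>k\<close> and \<open>k + 1\<close> sections.\<close>

definition cartan_formula ::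
  "('m, 'e, 'v) lie_alg_data \<Rightarrow> ('m, 'v) multi \<Rightarrow> ('m \<Rightarrow> 'v) list \<Rightarrow> 'm \<Rightarrow> real" where
  "cartan_formula A \<eta> Xs = (\<lambda>x.
     (\<Sum>i<length Xs. (- 1) ^ i *
        anchor_deriv A (Xs ! i) (\<lambda>y. \<eta> y (map (\<lambda>X. X y) (nths Xs (- {i})))) x) +
     (\<Sum>j<length Xs. \<Sum>i<j. (- 1) ^ (i + j) *
        \<eta> x (brk A (Xs ! i) (Xs ! j) x # map (\<lambda>X. X x) (nths Xs (- {i, j})))))"

definition extend ::
  "('m, 'e::real_inner, 'v::real_inner) lie_alg_data \<Rightarrow> 'm \<Rightarrow> 'v \<Rightarrow> 'm \<Rightarrow> 'v" where
  "extend A x v = (SOME X. X \<in> secs A \<and> X x = v)"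

text \<open>
  The formula is tensorial, so its value at \<open>x\<close> depends only on the values at \<open>x\<close> of the
  sections inserted, and the choice of the extensions is immaterial.
\<close>

definition ext_d ::
  "('m, 'e::real_inner, 'v::real_inner) lie_alg_data \<Rightarrow> ('m, 'v) multi \<Rightarrow> ('m, 'v) multi" where
  "ext_d A \<eta> = (\<lambda>x vs. cartan_formula A \<eta> (map (extend A x) vs) x)"

definition ins :: "('m \<Rightarrow> 'v) \<Rightarrow> ('m, 'v) multi \<Rightarrow> ('m, 'v) multi" where
  "ins X \<eta> = (\<lambda>x vs. \<eta> x (X x # vs))"

text \<open>\<open>ins2 X Y H = H(X, Y, \<cdot>)\<close>, the contraction with \<open>X \<and> Y\<close>.\<close>

definition ins2 :: "('m \<Rightarrow> 'v) \<Rightarrow> ('m \<Rightarrow> 'v) \<Rightarrow> ('m, 'v) multi \<Rightarrow> ('m, 'v) multi" where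
  "ins2 X Y \<eta> = (\<lambda>x vs. \<eta> x (X x # Y x # vs))"

definition lie_deriv ::
  "('m, 'e::real_inner, 'v::real_inner) lie_alg_data \<Rightarrow> ('m \<Rightarrow> 'v) \<Rightarrow>
     ('m, 'v) multi \<Rightarrow> ('m, 'v) multi" where
  "lie_deriv A X \<eta> = ins X (ext_d A \<eta>) + ext_d A (ins X \<eta>)"

section \<open>Schouten brackets and Lie quasi-bialgebroids\<close>

text \<open>
  \<open>schouten_bracket B b\<close>: \<open>b\<close> is the Schouten bracket of the Lie algebroid \<open>B\<close> on multivectors,
  i.e. the unique graded antisymmetric biderivation extending the bracket and the anchor.  The
  graded Jacobi identity follows from the Jacobi identity of \<open>B\<close> and is not needed to single out
  the bracket.  The signs \<open>(-1)^((p - 1) q)\<close> and \<open>(-1)^((p - 1) (q - 1))\<close> are written with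
  \<open>p + 1\<close> and \<open>q + 1\<close> to avoid truncated subtraction.  The degree \<open>p + q - 1\<close> is truncated only
  for \<open>p = q = 0\<close>, where the bracket is 0.
\<close>

definition schouten_bracket ::
  "('m, 'e::real_inner, 'v::real_inner) lie_alg_data \<Rightarrow>
     (('m, 'v) multi \<Rightarrow> ('m, 'v) multi \<Rightarrow> ('m, 'v) multi) \<Rightarrow> bool" where
  "schouten_bracket B b \<longleftrightarrow>
     (\<forall>p q. \<forall>P\<in>multivectors B p. \<forall>Q\<in>multivectors B q.
        b P Q \<in> multivectors B (p + q - 1) \<and>
        b P Q = (\<lambda>x vs. - ((- 1) ^ ((p + 1) * (q + 1)) * b Q P x vs)) \<and>
        (\<forall>Q'\<in>multivectors B q. b P (Q + Q') = b P Q + b P Q') \<and>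
        (\<forall>c. b P (\<lambda>x vs. c * Q x vs) = (\<lambda>x vs. c * b P Q x vs)) \<and>
        (\<forall>r. \<forall>R\<in>multivectors B r.
           b P (Q \<and>\<and> R) = (b P Q \<and>\<and> R) + (\<lambda>x vs. (- 1) ^ ((p + 1) * q) * (Q \<and>\<and> b P R) x vs))) \<and>
     (\<forall>X\<in>secs B. \<forall>Y\<in>secs B. b (of_sec X) (of_sec Y) = of_sec (brk B X Y)) \<and>
     (\<forall>X\<in>secs B. \<forall>f\<in>smooth_funs (base B).
        b (of_sec X) (of_fun f) = of_fun (anchor_deriv B X f)) \<and>
     (\<forall>f\<in>smooth_funs (base B). \<forall>h\<in>smooth_funs (base B). b (of_fun f) (of_fun h) = 0)"

definition wedge_derivation ::
  "('m, 'e::real_inner, 'v::real_inner) lie_alg_data \<Rightarrow>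
     (('m, 'v) multi \<Rightarrow> ('m, 'v) multi) \<Rightarrow> bool" where
  "wedge_derivation B \<delta> \<longleftrightarrow>
     (\<forall>p. \<forall>P\<in>multivectors B p.
        \<delta> P \<in> multivectors B (p + 1) \<and>
        (\<forall>Q\<in>multivectors B p. \<delta> (P + Q) = \<delta> P + \<delta> Q) \<and>
        (\<forall>c. \<delta> (\<lambda>x vs. c * P x vs) = (\<lambda>x vs. c * \<delta> P x vs)) \<and>
        (\<forall>q. \<forall>Q\<in>multivectors B q.
           \<delta> (P \<and>\<and> Q) = (\<delta> P \<and>\<and> Q) + (\<lambda>x vs. (- 1) ^ p * (P \<and>\<and> \<delta> Q) x vs)))"

definition bracket_derivation ::
  "('m, 'e::real_inner, 'v::real_inner) lie_alg_data \<Rightarrow>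
     (('m, 'v) multi \<Rightarrow> ('m, 'v) multi \<Rightarrow> ('m, 'v) multi) \<Rightarrow>
     (('m, 'v) multi \<Rightarrow> ('m, 'v) multi) \<Rightarrow> bool" where
  "bracket_derivation B b \<delta> \<longleftrightarrow>
     (\<forall>p q. \<forall>P\<in>multivectors B p. \<forall>Q\<in>multivectors B q.
        \<delta> (b P Q) = b (\<delta> P) Q + (\<lambda>x vs. (- 1) ^ (p + 1) * b P (\<delta> Q) x vs))"

definition lie_quasi_bialgebroid ::
  "('m::{t2_space, second_countable_topology}, 'e::real_inner, 'v::real_inner) lie_alg_data \<Rightarrow>
     (('m, 'v) multi \<Rightarrow> ('m, 'v) multi) \<Rightarrow> ('m, 'v) multi \<Rightarrow> bool" where
  "lie_quasi_bialgebroid B \<delta> \<phi> \<longleftrightarrow>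
     lie_algebroid B \<and> \<phi> \<in> multivectors B 3 \<and> wedge_derivation B \<delta> \<and>
     (\<exists>b. schouten_bracket B b \<and> bracket_derivation B b \<delta> \<and>
        (\<forall>p. \<forall>P\<in>multivectors B p. \<delta> (\<delta> P) = b \<phi> P)) \<and>
     \<delta> \<phi> = 0"

section \<open>Poisson quasi-Nijenhuis structures with background\<close>

definition poisson_bivector ::
  "('m, 'e::real_inner, 'v::real_inner) lie_alg_data \<Rightarrow> ('m, 'v) multi \<Rightarrow> bool" where
  "poisson_bivector A \<pi> \<longleftrightarrow>
     \<pi> \<in> multivectors A 2 \<and> (\<exists>b. schouten_bracket A b \<and> b \<pi> \<pi> = 0)"

definition sharp :: "('m, 'v::real_inner) multi \<Rightarrow> 'm \<Rightarrow> 'v \<Rightarrow> 'v" where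
  "sharp \<pi> = (\<lambda>x a. riesz (\<lambda>b. \<pi> x [a, b]))"

definition pair :: "('m, 'v) multi \<Rightarrow> ('m \<Rightarrow> 'v) \<Rightarrow> ('m \<Rightarrow> 'v) \<Rightarrow> ('m, 'v) multi" where
  "pair \<pi> \<alpha> \<beta> = of_fun (\<lambda>x. \<pi> x [\<alpha> x, \<beta> x])"

definition brk_pi ::
  "('m, 'e::real_inner, 'v::real_inner) lie_alg_data \<Rightarrow> ('m, 'v) multi \<Rightarrow>
     ('m \<Rightarrow> 'v) \<Rightarrow> ('m \<Rightarrow> 'v) \<Rightarrow> 'm \<Rightarrow> 'v" where
  "brk_pi A \<pi> \<alpha> \<beta> = to_sec
     (lie_deriv A (app (sharp \<pi>) \<alpha>) (of_sec \<beta>) - lie_deriv A (app (sharp \<pi>) \<beta>) (of_sec \<alpha>)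
        - ext_d A (pair \<pi> \<alpha> \<beta>))"

definition dual_algebroid ::
  "('m, 'e::real_inner, 'v::real_inner) lie_alg_data \<Rightarrow> ('m, 'v) multi \<Rightarrow>
     ('m, 'e, 'v) lie_alg_data" where
  "dual_algebroid A \<pi> =
     \<lparr> base = base A, vbundle = dual_bundle (vbundle A), brk = brk_pi A \<pi>,
       anc = (\<lambda>x a. anc A x (sharp \<pi> x a)) \<rparr>"

definition brk_N ::
  "('m, 'e, 'v::real_inner) lie_alg_data \<Rightarrow> ('m \<Rightarrow> 'v \<Rightarrow> 'v) \<Rightarrow>
     ('m \<Rightarrow> 'v) \<Rightarrow> ('m \<Rightarrow> 'v) \<Rightarrow> 'm \<Rightarrow> 'v" where
  "brk_N A N X Y = brk A (app N X) Y + brk A X (app N Y) - app N (brk A X Y)"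

definition torsion ::
  "('m, 'e, 'v::real_inner) lie_alg_data \<Rightarrow> ('m \<Rightarrow> 'v \<Rightarrow> 'v) \<Rightarrow>
     ('m \<Rightarrow> 'v) \<Rightarrow> ('m \<Rightarrow> 'v) \<Rightarrow> 'm \<Rightarrow> 'v" where
  "torsion A N X Y = brk A (app N X) (app N Y) - app N (brk_N A N X Y)"

definition ins_N :: "('m \<Rightarrow> 'v \<Rightarrow> 'v) \<Rightarrow> ('m, 'v) multi \<Rightarrow> ('m, 'v) multi" where
  "ins_N N \<eta> = (\<lambda>x vs. \<Sum>j<length vs. \<eta> x (vs[j := N x (vs ! j)]))"

definition d_N ::
  "('m, 'e::real_inner, 'v::real_inner) lie_alg_data \<Rightarrow> ('m \<Rightarrow> 'v \<Rightarrow> 'v) \<Rightarrow>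
     ('m, 'v) multi \<Rightarrow> ('m, 'v) multi" where
  "d_N A N \<eta> = ins_N N (ext_d A \<eta>) - ext_d A (ins_N N \<eta>)"

definition lie_deriv_N ::
  "('m, 'e::real_inner, 'v::real_inner) lie_alg_data \<Rightarrow> ('m \<Rightarrow> 'v \<Rightarrow> 'v) \<Rightarrow>
     ('m \<Rightarrow> 'v) \<Rightarrow> ('m, 'v) multi \<Rightarrow> ('m, 'v) multi" where
  "lie_deriv_N A N X \<eta> = ins X (d_N A N \<eta>) + d_N A N (ins X \<eta>)"

definition C_piN ::
  "('m, 'e::real_inner, 'v::real_inner) lie_alg_data \<Rightarrow> ('m, 'v) multi \<Rightarrow>
     ('m \<Rightarrow> 'v \<Rightarrow> 'v) \<Rightarrow> ('m \<Rightarrow> 'v) \<Rightarrow> ('m \<Rightarrow> 'v) \<Rightarrow> ('m, 'v) multi" where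
  "C_piN A \<pi> N \<alpha> \<beta> =
     (lie_deriv_N A N (app (sharp \<pi>) \<alpha>) (of_sec \<beta>)
        - lie_deriv_N A N (app (sharp \<pi>) \<beta>) (of_sec \<alpha>)
        - d_N A N (pair \<pi> \<alpha> \<beta>))
     - of_sec (brk_pi A \<pi> (app (transp N) \<alpha>) \<beta> + brk_pi A \<pi> \<alpha> (app (transp N) \<beta>)
        - app (transp N) (brk_pi A \<pi> \<alpha> \<beta>))"

definition calH :: "('m \<Rightarrow> 'v \<Rightarrow> 'v) \<Rightarrow> ('m, 'v) multi \<Rightarrow> ('m, 'v) multi" where
  "calH N H = (\<lambda>x vs. case vs of
       [u, v, w] \<Rightarrow> H x [N x u, N x v, w] + H x [N x v, N x w, u] + H x [N x w, N x u, v]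
     | _ \<Rightarrow> 0)"

definition pqn_background ::
  "('m, 'e::real_inner, 'v::real_inner) lie_alg_data \<Rightarrow> ('m, 'v) multi \<Rightarrow>
     ('m \<Rightarrow> 'v \<Rightarrow> 'v) \<Rightarrow> ('m, 'v) multi \<Rightarrow> ('m, 'v) multi \<Rightarrow> bool" where
  "pqn_background A \<pi> N \<psi> H \<longleftrightarrow>
     \<pi> \<in> multivectors A 2 \<and> N \<in> bundle_endos (base A) (vbundle A) \<and>
     \<psi> \<in> forms A 3 \<and> H \<in> forms A 3 \<and>
     (\<forall>x a. N x (sharp \<pi> x a) = sharp \<pi> x (transp N x a)) \<and>
     ext_d A \<psi> = 0 \<and> ext_d A H = 0 \<and>
     poisson_bivector A \<pi> \<and>
     (\<forall>\<alpha>\<in>cosecs A. \<forall>\<beta>\<in>cosecs A.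
        C_piN A \<pi> N \<alpha> \<beta> = (\<lambda>x vs. - 2 * ins2 (app (sharp \<pi>) \<alpha>) (app (sharp \<pi>) \<beta>) H x vs)) \<and>
     (\<forall>X\<in>secs A. \<forall>Y\<in>secs A.
        torsion A N X Y = app (sharp \<pi>)
          (to_sec (ins2 (app N X) Y H - ins2 (app N Y) X H + ins2 X Y \<psi>))) \<and>
     d_N A N \<psi> = ext_d A (calH N H)"

text \<open>
  The defining properties of \<open>d_N^H\<close>.  They determine \<open>\<delta>\<close> on smooth forms; its values elsewhere
  are irrelevant.
\<close>

definition is_d_NH ::
  "('m, 'e::real_inner, 'v::real_inner) lie_alg_data \<Rightarrow> ('m, 'v) multi \<Rightarrow>
     ('m \<Rightarrow> 'v \<Rightarrow> 'v) \<Rightarrow> ('m, 'v) multi \<Rightarrow> (('m, 'v) multi \<Rightarrow> ('m, 'v) multi) \<Rightarrow> bool" where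
  "is_d_NH A \<pi> N H \<delta> \<longleftrightarrow>
     wedge_derivation (dual_algebroid A \<pi>) \<delta> \<and>
     (\<forall>f\<in>smooth_funs (base A). \<delta> (of_fun f) = d_N A N (of_fun f)) \<and>
     (\<forall>\<alpha>\<in>cosecs A. \<delta> (of_sec \<alpha>) = d_N A N (of_sec \<alpha>) - ins (app (sharp \<pi>) \<alpha>) H)"

end

theory Submission
  imports Defs
begin

text \<open>
  All objects of the theorem are derivations or biderivations of the graded algebra of forms, and such
  operators are determined by their values on functions and 1-forms. The bivector defines a biderivation
  \<open>\<kappa>\<close> of degree \<open>-2\<close> with \<open>\<kappa>(\<alpha>, \<beta>) = - \<pi>(\<alpha>, \<beta>)\<close> on 1-forms. The Schouten bracket of \<open>A\<^sup>*\<^sub>\<pi>\<close> is, up to a sign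
  convention, the bracket \<open>b\<close> that \<open>d\<close> generates from \<open>\<kappa>\<close>, that is, the defect of \<open>d\<close> being a derivation of
  \<open>\<kappa>\<close>; and \<open>d\<^sub>N\<^sup>H\<close> is \<open>\<delta> = d\<^sub>N - K\<close> with \<open>K = \<kappa>(H, \<cdot>)\<close>. Writing \<open>n\<close> for \<open>i\<^sub>N\<close>, one has \<open>d\<^sub>N = [n, d]\<close>.

  Each axiom of a Lie quasi-bialgebroid then follows from one of the structure equations, once this
  has been extended from generators to all forms.

  \<^item> The Poisson condition says that \<open>\<pi>\<^sup>\<sharp>\<close> is a morphism of brackets; this gives the Jacobi identity of
    \<open>A\<^sup>*\<^sub>\<pi>\<close> (theorem \<open>b_jacobi\<close>).

  \<^item> The condition on \<open>C\<^bsub>\<pi>,N\<^esub>\<close> becomes \<open>C = - KK\<close>, where \<open>KK\<close> is the defect of \<open>K\<close> on \<open>\<kappa>\<close>. As \<open>d\<^sup>2 = 0\<close>, twice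
    the defect of \<open>d\<^sub>N\<close> on \<open>b\<close> is the defect of \<open>d\<close> on \<open>- C\<close>. As \<open>H\<close> is closed and \<open>\<pi>\<close> is Poisson, twice the
    defect of \<open>K\<close> on \<open>b\<close> is the defect of \<open>d\<close> on \<open>KK\<close>. So \<open>\<delta>\<close> is a derivation of the bracket
    (theorem \<open>\<delta>_b\<close>).

  \<^item> The torsion condition becomes \<open>[n, d\<^sub>N] = [i\<^bsub>NN\<^esub>, d] - \<tau>\<close> with a derivation \<open>\<tau>\<close> that is built from \<open>\<psi>\<close> and
    \<open>H\<close>. Its commutator with \<open>d\<close> computes \<open>d\<^sub>N\<^sup>2\<close>, and together with \<open>C(H, \<cdot>) = - KK(H, \<cdot>)\<close> this yields
    \<open>\<delta>\<^sup>2 = b(\<psi> + i\<^sub>N H, \<cdot>)\<close> (theorem \<open>\<delta>_\<delta>\<close>).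

  \<^item> The torsion condition applied to \<open>H\<close>, together with the condition on \<open>d\<^sub>N \<psi>\<close>, shows that \<open>\<psi> + i\<^sub>N H\<close> is
    annihilated by \<open>\<delta>\<close> (theorem \<open>\<delta>_closed\<close>).

  These arguments are carried out in an abstract graded algebra. To apply them, forms are described by
  their values on global smooth sections (\<open>ext_power_dual\<close>), where localization is done by bump
  functions that are 1 at a given point (\<open>frame_at\<close>); the differential is constructed with its derivation rule, and
  \<open>forms_determined\<close> shows that functions and 1-forms generate. The Schouten bracket of \<open>A\<close>, which enters
  through the condition \<open>[\<pi>, \<pi>] = 0\<close> only, is evaluated from its characterization in the same way.
\<close>


section \<open>Smooth functions on open subsets of a finite-dimensional space\<close>

lemma frechet_derivative_cong_open:
  assumes "open S" "x \<in> S" "\<And>y. y \<in> S \<Longrightarrow> f y = g y"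
  shows "f differentiable (at x) \<longleftrightarrow> g differentiable (at x)"
    and "frechet_derivative f (at x) = frechet_derivative g (at x)"
proof -
  have eq: "(f has_derivative D) (at x) \<longleftrightarrow> (g has_derivative D) (at x)" for D
    using assms by (metis has_derivative_transform_within_open)
  show "f differentiable (at x) \<longleftrightarrow> g differentiable (at x)"
    unfolding differentiable_def eq ..
  show "frechet_derivative f (at x) = frechet_derivative g (at x)"
    unfolding frechet_derivative_def eq ..
qed

lemma Ck_on_cong:
  assumes "open S" "\<And>y. y \<in> S \<Longrightarrow> f y = g y"
  shows "Ck_on n S f \<longleftrightarrow> Ck_on n S g"
  using assms(2)
proof (induction n arbitrary: f g)
  case 0
  then show ?case by (simp cong: continuous_on_cong)
next
  case (Suc n)
  have "Ck_on n S (\<lambda>x. frechet_derivative f (at x) v) \<longleftrightarrow> Ck_on n S (\<lambda>x. frechet_derivative g (at x) v)" for v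
    by (rule Suc.IH) (metis assms(1) Suc.prems frechet_derivative_cong_open(2))
  moreover have "(\<forall>x\<in>S. f differentiable (at x)) \<longleftrightarrow> (\<forall>x\<in>S. g differentiable (at x))"
    using assms(1) Suc.prems frechet_derivative_cong_open(1) by metis
  ultimately show ?case by simp
qed

lemma Ck_on_subset: "Ck_on n S f \<Longrightarrow> T \<subseteq> S \<Longrightarrow> Ck_on n T f"
  by (induction n arbitrary: f) (auto intro: continuous_on_subset)

lemma Ck_on_Union:
  assumes "\<And>T. T \<in> F \<Longrightarrow> open T" "\<And>T. T \<in> F \<Longrightarrow> Ck_on n T f"
  shows "Ck_on n (\<Union>F) f"
  using assms(2)
  by (induction n arbitrary: f) (auto intro: continuous_on_open_Union assms(1))

lemma Ck_on_decrease: "Ck_on (Suc n) S f \<Longrightarrow> Ck_on n S f"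
proof (induction n arbitrary: f)
  case 0
  then show ?case
    by (simp add: continuous_at_imp_continuous_on differentiable_imp_continuous_within)
next
  case (Suc n)
  then show ?case by auto
qed

lemma Ck_on_const: "Ck_on n S (\<lambda>x. c)"
proof (induction n arbitrary: c)
  case (Suc n)
  then show ?case by (simp add: frechet_derivative_const)
qed simp

lemma Ck_on_add:
  assumes "open S" "Ck_on n S f" "Ck_on n S g"
  shows "Ck_on n S (\<lambda>x. f x + g x)"
  using assms(2,3)
proof (induction n arbitrary: f g)
  case 0
  then show ?case by (simp add: continuous_on_add)
next
  case (Suc n)
  have "frechet_derivative (\<lambda>x. f x + g x) (at x) v
      = frechet_derivative f (at x) v + frechet_derivative g (at x) v" if "x \<in> S" for x v
  proof -
    have "f differentiable (at x)" "g differentiable (at x)" using Suc.prems that by auto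
    then have "((\<lambda>x. f x + g x) has_derivative
        (\<lambda>v. frechet_derivative f (at x) v + frechet_derivative g (at x) v)) (at x)"
      by (intro has_derivative_add) (simp_all add: frechet_derivative_works[symmetric])
    from fun_cong[OF frechet_derivative_at[OF this], of v] show ?thesis by simp
  qed
  then have "Ck_on n S (\<lambda>x. frechet_derivative (\<lambda>x. f x + g x) (at x) v)" for v
    using Suc by (subst Ck_on_cong[OF assms(1)]) auto
  then show ?case using Suc.prems by (simp add: differentiable_add)
qed

lemma Ck_on_bilinear:
  assumes "bounded_bilinear bl" "open S" "Ck_on n S f" "Ck_on n S g"
  shows "Ck_on n S (\<lambda>x. bl (f x) (g x))"
  using assms(3,4)
proof (induction n arbitrary: f g)
  case 0
  then show ?case using bounded_bilinear.continuous_on[OF assms(1)] by auto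
next
  case (Suc n)
  have D: "((\<lambda>x. bl (f x) (g x)) has_derivative
       (\<lambda>v. bl (f x) (frechet_derivative g (at x) v) + bl (frechet_derivative f (at x) v) (g x))) (at x)"
    if "x \<in> S" for x
  proof -
    have "f differentiable (at x)" "g differentiable (at x)" using Suc.prems that by auto
    then show ?thesis
      by (intro bounded_bilinear.FDERIV[OF assms(1)]) (simp_all add: frechet_derivative_works[symmetric])
  qed
  then have "frechet_derivative (\<lambda>x. bl (f x) (g x)) (at x) v =
       bl (f x) (frechet_derivative g (at x) v) + bl (frechet_derivative f (at x) v) (g x)"
    if "x \<in> S" for x v
    using fun_cong[OF frechet_derivative_at[OF D[OF that]], of v] by simp
  moreover have "Ck_on n S (\<lambda>x. bl (f x) (frechet_derivative g (at x) v) + bl (frechet_derivative f (at x) v) (g x))" for v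
    using Suc.prems by (intro Ck_on_add[OF assms(2)] Suc.IH) (auto intro: Ck_on_decrease)
  ultimately have "Ck_on n S (\<lambda>x. frechet_derivative (\<lambda>x. bl (f x) (g x)) (at x) v)" for v
    by (subst Ck_on_cong[OF assms(2)]) auto
  then show ?case using D by (auto simp: differentiable_def)
qed

text \<open>
  The chain rule turns a derivative of \<open>h \<circ> f\<close> into \<open>h' \<circ> f\<close> times a derivative of \<open>f\<close>. The induction on
  the order therefore needs all members of a family \<open>F\<close> of outer functions that is closed under
  differentiation; below, \<open>F\<close> consists of the multiples of powers of \<open>1/t\<close>, or of flat functions.
\<close>

lemma Ck_on_compose_real:
  fixes f :: "'e::real_normed_vector \<Rightarrow> real" and F :: "(real \<Rightarrow> real) set"
  assumes F: "\<And>h. h \<in> F \<Longrightarrow> \<exists>h'\<in>F. \<forall>t\<in>T. (h has_real_derivative h' t) (at t)"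
    and S: "open S" "\<And>x. x \<in> S \<Longrightarrow> f x \<in> T" and f: "Ck_on n S f" and h: "h \<in> F"
  shows "Ck_on n S (\<lambda>x. h (f x))"
  using f h
proof (induction n arbitrary: h)
  case 0
  obtain h' where "\<And>t. t \<in> T \<Longrightarrow> (h has_real_derivative h' t) (at t)"
    using F[OF 0(2)] by auto
  then have "continuous_on T h"
    by (meson DERIV_continuous_on has_field_derivative_at_within)
  with 0 S(2) show ?case
    by (auto intro: continuous_on_compose2)
next
  case (Suc n)
  obtain h' where h': "h' \<in> F" "\<And>t. t \<in> T \<Longrightarrow> (h has_real_derivative h' t) (at t)"
    using F[OF Suc.prems(2)] by auto
  have D: "((\<lambda>x. h (f x)) has_derivative (\<lambda>v. h' (f x) * frechet_derivative f (at x) v)) (at x)"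
    if "x \<in> S" for x
  proof -
    have "(f has_derivative frechet_derivative f (at x)) (at x)"
      using Suc.prems(1) that frechet_derivative_works by auto
    from has_derivative_compose[OF this h'(2)[OF S(2)[OF that], unfolded has_field_derivative_def]]
    show ?thesis by (simp add: mult.commute)
  qed
  have "frechet_derivative (\<lambda>x. h (f x)) (at x) v = h' (f x) * frechet_derivative f (at x) v"
    if "x \<in> S" for x v
    using fun_cong[OF frechet_derivative_at[OF D[OF that]], of v] by simp
  moreover have "Ck_on n S (\<lambda>x. h' (f x) * frechet_derivative f (at x) v)" for v
    using Suc.prems Suc.IH[OF Ck_on_decrease[OF Suc.prems(1)] h'(1)]
    by (intro Ck_on_bilinear[OF bounded_bilinear_mult S(1)]) auto
  ultimately have "Ck_on n S (\<lambda>x. frechet_derivative (\<lambda>x. h (f x)) (at x) v)" for v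
    by (subst Ck_on_cong[OF S(1)]) auto
  then show ?case using D by (auto simp: differentiable_def)
qed

lemma smooth_on_cong: "open S \<Longrightarrow> (\<And>y. y \<in> S \<Longrightarrow> f y = g y) \<Longrightarrow> smooth_on S f \<longleftrightarrow> smooth_on S g"
  unfolding smooth_on_def using Ck_on_cong by metis

lemma smooth_on_subset: "smooth_on S f \<Longrightarrow> T \<subseteq> S \<Longrightarrow> smooth_on T f"
  unfolding smooth_on_def using Ck_on_subset by metis

lemma smooth_on_const: "smooth_on S (\<lambda>x. c)"
  unfolding smooth_on_def using Ck_on_const by metis

lemma smooth_on_add: "open S \<Longrightarrow> smooth_on S f \<Longrightarrow> smooth_on S g \<Longrightarrow> smooth_on S (\<lambda>x. f x + g x)"
  unfolding smooth_on_def using Ck_on_add by metis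

lemma smooth_on_bilinear:
  "bounded_bilinear bl \<Longrightarrow> open S \<Longrightarrow> smooth_on S f \<Longrightarrow> smooth_on S g
    \<Longrightarrow> smooth_on S (\<lambda>x. bl (f x) (g x))"
  unfolding smooth_on_def using Ck_on_bilinear by metis

lemma smooth_on_imp_continuous_on: "smooth_on S f \<Longrightarrow> continuous_on S f"
  unfolding smooth_on_def using Ck_on.simps(1) by metis

lemma smooth_on_inverse:
  fixes f :: "'e::real_normed_vector \<Rightarrow> real"
  assumes "open S" "\<And>x. x \<in> S \<Longrightarrow> f x \<noteq> 0" "smooth_on S f"
  shows "smooth_on S (\<lambda>x. inverse (f x))"
proof -
  define F :: "(real \<Rightarrow> real) set" where "F = range (\<lambda>(c, k) t. c * inverse t ^ k)"
  have F: "(\<lambda>t. c * inverse t ^ k) \<in> F" for c k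
    unfolding F_def by (rule image_eqI[of _ _ "(c, k)"]) auto
  have D: "\<exists>h'\<in>F. \<forall>t\<in>- {0}. (h has_real_derivative h' t) (at t)" if hF: "h \<in> F" for h
  proof -
    from hF obtain ck where "h = (\<lambda>(c, k) t. c * inverse t ^ k) ck" unfolding F_def by (rule imageE)
    then obtain c k where h: "h = (\<lambda>t. c * inverse t ^ k)" by (cases ck) auto
    have "(h has_real_derivative ((- c * real k) * inverse t ^ (Suc k))) (at t)" if "t \<noteq> 0" for t
    proof (cases k)
      case (Suc m)
      show ?thesis unfolding h Suc
        by (rule DERIV_cong[OF DERIV_cmult[OF DERIV_power_Suc[OF DERIV_inverse[OF that]]]])
          (simp add: algebra_simps)
    qed (simp add: h)
    then show ?thesis using F[of "- c * real k" "Suc k"]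
      by (intro bexI[of _ "\<lambda>t. (- c * real k) * inverse t ^ (Suc k)"]) simp_all
  qed
  have "(\<lambda>t. inverse t) \<in> F" using F[of 1 1] by simp
  from Ck_on_compose_real[OF D assms(1) _ _ this] show ?thesis
    using assms(2,3) by (simp add: smooth_on_def)
qed

subsection \<open>A flat function\<close>

text \<open>
  The functions \<open>p(1/t) exp(-1/t)\<close> for \<open>t > 0\<close>, extended by 0, are closed under differentiation,
  because exponential decay beats every polynomial; hence each of them is smooth.
\<close>

definition flat :: "real poly \<Rightarrow> real \<Rightarrow> real" where
  "flat p t = (if t \<le> 0 then 0 else poly p (inverse t) * exp (- inverse t))"

lemma poly_exp_at_top: "((\<lambda>s::real. poly p s * exp (- s)) \<longlongrightarrow> 0) at_top"
proof (induction p)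
  case (pCons a p)
  have "((\<lambda>s::real. s ^ i * coeff (pCons a p) i * exp (- s)) \<longlongrightarrow> 0) at_top" for i
    using tendsto_mult[OF tendsto_power_div_exp_0[of i] tendsto_const[of "coeff (pCons a p) i"]]
    by (simp add: exp_minus field_simps)
  then have "((\<lambda>s::real. \<Sum>i\<le>degree (pCons a p). s ^ i * coeff (pCons a p) i * exp (- s)) \<longlongrightarrow> (\<Sum>i\<le>degree (pCons a p). 0)) at_top"
    by (intro tendsto_sum) auto
  then show ?case
    by (simp add: poly_altdef sum_distrib_right sum_distrib_left mult_ac)
qed simp

lemma flat_at_right_0: "(flat p \<longlongrightarrow> 0) (at_right 0)"
proof -
  have "((\<lambda>t. poly p (inverse t) * exp (- inverse t)) \<longlongrightarrow> 0) (at_right 0)"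
    by (rule filterlim_compose[OF poly_exp_at_top filterlim_inverse_at_top_right])
  then show ?thesis
    by (rule Lim_transform_eventually) (auto simp: eventually_at_filter flat_def)
qed

lemma flat_tendsto_0: "(flat p \<longlongrightarrow> 0) (at 0)"
proof -
  have "(flat p \<longlongrightarrow> 0) (at_left 0)"
    by (rule Lim_transform_eventually[OF tendsto_const]) (auto simp: eventually_at_filter flat_def)
  with flat_at_right_0 show ?thesis by (simp add: filterlim_at_split)
qed

lemma DERIV_flat: "(flat p has_real_derivative flat ([:0, 0, 1:] * (p - pderiv p)) t) (at t)"
proof -
  consider "t < 0" | "t = 0" | "t > 0" by linarith
  then show ?thesis
  proof cases
    case 1
    have "((\<lambda>t. 0) has_real_derivative 0) (at t)" by simp
    then have "(flat p has_real_derivative 0) (at t)"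
      by (rule DERIV_cong_ev[THEN iffD1, rotated -1])
        (use 1 in \<open>auto simp: flat_def eventually_nhds intro!: exI[of _ "{..<0}"]\<close>)
    with 1 show ?thesis by (simp add: flat_def)
  next
    case 2
    have "((\<lambda>h. flat (pCons 0 p) h) \<longlongrightarrow> 0) (at 0)" by (rule flat_tendsto_0)
    then have "((\<lambda>h. (flat p (0 + h) - flat p 0) / h) \<longlongrightarrow> 0) (at 0)"
      by (rule Lim_transform_eventually) (auto simp: eventually_at_filter flat_def field_simps)
    with 2 show ?thesis by (simp add: DERIV_def flat_def)
  next
    case 3
    have "((\<lambda>t. poly p (inverse t) * exp (- inverse t)) has_real_derivative
      flat ([:0, 0, 1:] * (p - pderiv p)) t) (at t)"
      using 3
      by (auto intro!: derivative_eq_intros poly_DERIV DERIV_chain2[where f = "poly p"]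
          simp: flat_def field_simps power2_eq_square)
    then show ?thesis
      by (rule DERIV_cong_ev[THEN iffD1, rotated -1])
        (use 3 in \<open>auto simp: flat_def eventually_nhds intro!: exI[of _ "{0<..}"]\<close>)
  qed
qed

lemma smooth_on_flat:
  fixes f :: "'e::real_normed_vector \<Rightarrow> real"
  assumes "open S" "smooth_on S f"
  shows "smooth_on S (\<lambda>x. flat p (f x))"
proof -
  have "\<exists>h'\<in>range flat. \<forall>t\<in>UNIV. (h has_real_derivative h' t) (at t)" if "h \<in> range flat" for h
    using that DERIV_flat by auto
  from Ck_on_compose_real[OF this assms(1) UNIV_I _ rangeI] show ?thesis
    using assms(2) by (simp add: smooth_on_def)
qed

section \<open>Finite-dimensional linear algebra without a distinguished basis\<close>

text \<open>
  The model spaces have class \<open>real_inner\<close> only, which provides no basis. All that is used of an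
  orthonormal basis is the expansion of vectors.
\<close>

definition orthonormal_basis :: "'v::real_inner set \<Rightarrow> bool" where
  "orthonormal_basis B \<longleftrightarrow> finite B \<and> (\<forall>v. (\<Sum>b\<in>B. (b \<bullet> v) *\<^sub>R b) = v)"

lemma orthonormal_basis_exists:
  assumes "finite_dim TYPE('v::real_inner)"
  shows "\<exists>B::'v set. orthonormal_basis B"
proof -
  obtain S :: "'v set" where S: "finite S" "span S = UNIV"
    using assms unfolding finite_dim_def by auto
  obtain C :: "'v set" where C: "finite C" "span C = span S" "pairwise orthogonal C"
    using basis_orthogonal[OF S(1)] by metis
  define B where "B = (\<lambda>c. (1 / norm c) *\<^sub>R c) ` (C - {0})"
  have fB: "finite B" unfolding B_def using C(1) by simp
  have on: "b \<bullet> c = (if b = c then 1 else 0)" if bc: "b \<in> B" "c \<in> B" for b c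
  proof -
    obtain b' c' where b': "b' \<in> C - {0}" "b = (1 / norm b') *\<^sub>R b'"
      and c': "c' \<in> C - {0}" "c = (1 / norm c') *\<^sub>R c'" using bc unfolding B_def by auto
    show ?thesis
    proof (cases "b' = c'")
      case True
      then show ?thesis using b' c' by (simp add: dot_square_norm power2_eq_square)
    next
      case False
      then have "b' \<bullet> c' = 0" using C(3) b' c' by (auto simp: pairwise_def orthogonal_def)
      then have z: "b \<bullet> c = 0" using b' c' by simp
      moreover have "b \<bullet> b \<noteq> 0" using b' by simp
      ultimately have "b \<noteq> c" by auto
      with z show ?thesis by simp
    qed
  qed
  have "C \<subseteq> span B"
  proof
    fix c assume "c \<in> C"
    show "c \<in> span B"
    proof (cases "c = 0")
      case False
      then have "(1 / norm c) *\<^sub>R c \<in> B" using \<open>c \<in> C\<close> by (auto simp: B_def)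
      then have "norm c *\<^sub>R ((1 / norm c) *\<^sub>R c) \<in> span B" by (intro span_scale span_base)
      with False show ?thesis by simp
    qed (simp add: span_zero)
  qed
  then have "span B = UNIV" using C(2) S(2) span_minimal[OF _ subspace_span] by blast
  have "(\<Sum>b\<in>B. (b \<bullet> v) *\<^sub>R b) = v" for v
  proof -
    have "v \<in> span B" using \<open>span B = UNIV\<close> by simp
    then show ?thesis
    proof (induction rule: span_induct_alt)
      case (step r c w)
      have "(\<Sum>b\<in>B. (b \<bullet> c) *\<^sub>R b) = (\<Sum>b\<in>B. if b = c then b else 0)"
        using on step(1) by (intro sum.cong) auto
      then have "(\<Sum>b\<in>B. (b \<bullet> c) *\<^sub>R b) = c" using step(1) fB by simp
      with step show ?case
        by (simp add: inner_add_right scaleR_add_left sum.distrib scaleR_sum_right[symmetric]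
            flip: scaleR_scaleR)
    qed simp
  qed
  with fB show ?thesis unfolding orthonormal_basis_def by blast
qed

lemma linear_basis_expand:
  assumes "orthonormal_basis B" "linear l"
  shows "l v = (\<Sum>b\<in>B. (b \<bullet> v) *\<^sub>R l b)"
proof -
  have "l v = l (\<Sum>b\<in>B. (b \<bullet> v) *\<^sub>R b)" using assms(1) by (simp add: orthonormal_basis_def)
  also have "\<dots> = (\<Sum>b\<in>B. (b \<bullet> v) *\<^sub>R l b)"
    using assms(2) by (simp add: linear_sum linear_cmul)
  finally show ?thesis .
qed

lemma riesz_inner:
  fixes l :: "'v::real_inner \<Rightarrow> real"
  assumes "finite_dim TYPE('v)" "linear l"
  shows "riesz l \<bullet> v = l v"
proof -
  obtain B :: "'v set" where B: "orthonormal_basis B" using orthonormal_basis_exists[OF assms(1)] ..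
  have "(\<Sum>b\<in>B. l b *\<^sub>R b) \<bullet> v = l v" for v
    using linear_basis_expand[OF B assms(2), of v] by (simp add: inner_sum_left mult.commute)
  then have "\<exists>a. \<forall>v. a \<bullet> v = l v" by (intro exI allI)
  then have "\<exists>!a. \<forall>v. a \<bullet> v = l v"
    by (rule ex_ex1I) (metis inner_commute vector_eq_ldot)
  from theI'[OF this] show ?thesis unfolding riesz_def by auto
qed

lemma adjoint_inner:
  fixes f :: "'v::real_inner \<Rightarrow> 'v"
  assumes "finite_dim TYPE('v)" "linear f"
  shows "adjoint f y \<bullet> x = y \<bullet> f x"
proof -
  have "linear (\<lambda>x. y \<bullet> f x)" for y
    using linear_compose[OF assms(2) bounded_linear.linear[OF bounded_linear_inner_right]]
    by (simp add: o_def)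
  then have "f x \<bullet> y = x \<bullet> riesz (\<lambda>x. y \<bullet> f x)" for x y
    using riesz_inner[OF assms(1), of "\<lambda>x. y \<bullet> f x" x] by (simp add: inner_commute)
  then have "\<exists>g. \<forall>x y. f x \<bullet> y = x \<bullet> g y" by (intro exI allI)
  then have "\<forall>x y. f x \<bullet> y = x \<bullet> adjoint f y" unfolding adjoint_def by (rule someI_ex)
  then show ?thesis by (simp add: inner_commute)
qed

lemma eq_iff_inner: "a = b \<longleftrightarrow> (\<forall>x. a \<bullet> x = b \<bullet> x)" for a b :: "'v::real_inner"
  by (metis inner_commute vector_eq_ldot)

lemma adjoint_eqI:
  fixes f :: "'v::real_inner \<Rightarrow> 'v"
  assumes "finite_dim TYPE('v)" "linear f" "\<And>x y. g y \<bullet> x = y \<bullet> f x"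
  shows "adjoint f = g"
  by (rule ext) (simp add: eq_iff_inner adjoint_inner[OF assms(1,2)] assms(3))

lemma linear_adjoint:
  fixes f :: "'v::real_inner \<Rightarrow> 'v"
  assumes "finite_dim TYPE('v)" "linear f"
  shows "linear (adjoint f)"
  by (rule linearI) (simp_all add: eq_iff_inner inner_add_left adjoint_inner[OF assms])

lemma adjoint_adjoint':
  fixes f :: "'v::real_inner \<Rightarrow> 'v"
  assumes "finite_dim TYPE('v)" "linear f"
  shows "adjoint (adjoint f) = f"
proof (rule adjoint_eqI[OF assms(1) linear_adjoint[OF assms]])
  show "f y \<bullet> x = y \<bullet> adjoint f x" for x y
    using adjoint_inner[OF assms, of x y] by (simp add: inner_commute)
qed

lemma adjoint_compose:
  fixes f g :: "'v::real_inner \<Rightarrow> 'v"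
  assumes "finite_dim TYPE('v)" "linear f" "linear g"
  shows "adjoint f (adjoint g v) = adjoint (\<lambda>x. g (f x)) v"
proof -
  have "adjoint (\<lambda>x. g (f x)) = (\<lambda>v. adjoint f (adjoint g v))"
    by (rule adjoint_eqI[OF assms(1) linear_compose[OF assms(2,3), unfolded o_def]])
      (simp add: adjoint_inner assms)
  then show ?thesis by simp
qed

lemma linear_inv_of_bij: "linear f \<Longrightarrow> bij f \<Longrightarrow> linear (inv f)"
  for f :: "'v::real_vector \<Rightarrow> 'v"
  by (rule linearI) (auto intro!: inv_f_eq simp: bij_is_inj linear_add linear_cmul bij_is_surj surj_f_inv_f)

lemma inv_adjoint:
  fixes f :: "'v::real_inner \<Rightarrow> 'v"
  assumes "finite_dim TYPE('v)" "linear f" "bij f"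
  shows "inv (adjoint f) = adjoint (inv f)" "bij (adjoint f)"
proof -
  have l: "linear (inv f)" by (rule linear_inv_of_bij[OF assms(2,3)])
  have id: "adjoint (\<lambda>x. x) = (\<lambda>x::'v. x)"
    by (rule adjoint_eqI[OF assms(1)]) (auto simp: linear_iff)
  have 1: "adjoint f (adjoint (inv f) v) = v" for v
    using assms(3) by (simp add: adjoint_compose[OF assms(1,2) l] id bij_is_inj)
  have 2: "adjoint (inv f) (adjoint f v) = v" for v
    using assms(3) by (simp add: adjoint_compose[OF assms(1) l assms(2)] id bij_is_surj surj_f_inv_f)
  show "bij (adjoint f)" by (rule o_bij[of "adjoint (inv f)"]) (simp_all add: fun_eq_iff 1 2)
  show "inv (adjoint f) = adjoint (inv f)" by (rule inv_equality) (simp_all add: 1 2)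
qed

text \<open>
  Heine-Borel: in the coordinates of an orthonormal basis the ball lies in a product of intervals.
  Compactness of closed balls is what makes bump functions extend by zero in a Hausdorff manifold.
\<close>

lemma compact_cball_finite_dim:
  assumes "finite_dim TYPE('v::real_inner)"
  shows "compact (cball (a::'v) r)"
proof -
  obtain B :: "'v set" where B: "orthonormal_basis B" using orthonormal_basis_exists[OF assms] ..
  then have fB: "finite B" by (simp add: orthonormal_basis_def)
  define R where "R b = {norm b * - (norm a + \<bar>r\<bar>)..norm b * (norm a + \<bar>r\<bar>)}" for b :: 'v
  have "compact {\<Sum>b\<in>C. c b *\<^sub>R b | c. \<forall>b\<in>C. c b \<in> R b}" if "finite C" for C :: "'v set"
    using that
  proof (induction C)
    case (insert d C)
    have "compact ((\<lambda>t. t *\<^sub>R d) ` R d)"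
      unfolding R_def by (intro compact_continuous_image continuous_intros compact_Icc)
    from compact_sums[OF this insert.IH]
    have "compact {x + y |x y. x \<in> (\<lambda>t. t *\<^sub>R d) ` R d \<and> y \<in> {\<Sum>b\<in>C. c b *\<^sub>R b | c. \<forall>b\<in>C. c b \<in> R b}}" .
    moreover have "{x + y |x y. x \<in> (\<lambda>t. t *\<^sub>R d) ` R d \<and> y \<in> {\<Sum>b\<in>C. c b *\<^sub>R b | c. \<forall>b\<in>C. c b \<in> R b}}
      = {\<Sum>b\<in>insert d C. c b *\<^sub>R b | c. \<forall>b\<in>insert d C. c b \<in> R b}" (is "?X = ?Y")
    proof
      show "?X \<subseteq> ?Y"
      proof
        fix z assume "z \<in> ?X"
        then obtain t c where z: "t \<in> R d" "\<forall>b\<in>C. c b \<in> R b" "z = t *\<^sub>R d + (\<Sum>b\<in>C. c b *\<^sub>R b)"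
          by auto
        have "(\<Sum>b\<in>C. c b *\<^sub>R b) = (\<Sum>b\<in>C. (c(d := t)) b *\<^sub>R b)"
          using insert.hyps by (intro sum.cong) auto
        then have "z = (\<Sum>b\<in>insert d C. (c(d := t)) b *\<^sub>R b)"
          using z insert.hyps by simp
        moreover have "\<forall>b\<in>insert d C. (c(d := t)) b \<in> R b" using z by auto
        ultimately show "z \<in> ?Y" by blast
      qed
      show "?Y \<subseteq> ?X" using insert.hyps by fastforce
    qed
    ultimately show ?case by simp
  qed simp
  from this[OF fB] have cpt: "compact {\<Sum>b\<in>B. c b *\<^sub>R b | c. \<forall>b\<in>B. c b \<in> R b}" .
  have "cball a r \<subseteq> {\<Sum>b\<in>B. c b *\<^sub>R b | c. \<forall>b\<in>B. c b \<in> R b}"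
  proof
    fix v assume v: "v \<in> cball a r"
    have "norm v \<le> norm a + norm (v - a)" by (metis add_diff_cancel_left' diff_add_cancel norm_triangle_ineq add.commute)
    also have "\<dots> \<le> norm a + \<bar>r\<bar>" using v by (simp add: dist_norm norm_minus_commute)
    finally have "\<bar>b \<bullet> v\<bar> \<le> norm b * (norm a + \<bar>r\<bar>)" for b
      using Cauchy_Schwarz_ineq2[of b v] by (meson mult_left_mono norm_ge_zero order_trans)
    then have "b \<bullet> v \<in> R b" for b unfolding R_def by (smt (verit) atLeastAtMost_iff minus_mult_right)
    moreover have "v = (\<Sum>b\<in>B. (b \<bullet> v) *\<^sub>R b)" using B by (simp add: orthonormal_basis_def)
    ultimately show "v \<in> {\<Sum>b\<in>B. c b *\<^sub>R b | c. \<forall>b\<in>B. c b \<in> R b}"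
      by (intro CollectI exI[of _ "\<lambda>b. b \<bullet> v"]) auto
  qed
  then show ?thesis using compact_Int_closed[OF cpt closed_cball[of a r]] by (simp add: Int_absorb1)
qed

section \<open>Smooth functions on a manifold\<close>

locale manifold =
  fixes M :: "('m::{t2_space, second_countable_topology}, 'e::real_inner) atlas"
  assumes smooth_manifold: "smooth_manifold M"
begin

lemma fd_model: "finite_dim TYPE('e)"
  using smooth_manifold by (simp add: smooth_manifold_def)

lemma chart_at: obtains U \<phi> where "(U, \<phi>) \<in> M" "x \<in> U"
proof -
  have "x \<in> (\<Union>(U, \<phi>)\<in>M. U)" using smooth_manifold by (simp add: smooth_manifold_def)
  then show ?thesis using that by auto
qed

lemma
  assumes "(U, \<phi>) \<in> M"
  shows open_chart: "open U"
    and open_chart_image: "open W \<Longrightarrow> open (\<phi> ` (U \<inter> W))"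
    and inv_chart: "x \<in> U \<Longrightarrow> inv_into U \<phi> (\<phi> x) = x"
    and continuous_chart: "continuous_on U \<phi>"
    and continuous_inv_chart: "continuous_on (\<phi> ` U) (inv_into U \<phi>)"
proof -
  have *: "open U" "open (\<phi> ` U)" and hom: "homeomorphism U (\<phi> ` U) \<phi> (inv_into U \<phi>)"
    using smooth_manifold assms by (auto simp: smooth_manifold_def)
  show "open U" by fact
  show "x \<in> U \<Longrightarrow> inv_into U \<phi> (\<phi> x) = x" using hom by (simp add: homeomorphism_def)
  show "continuous_on U \<phi>" "continuous_on (\<phi> ` U) (inv_into U \<phi>)"
    using hom by (simp_all add: homeomorphism_def)
  assume "open W"
  then have "openin (top_of_set (\<phi> ` U)) (\<phi> ` (U \<inter> W))"
    by (intro homeomorphism_imp_open_map[OF hom]) (simp add: openin_open_Int)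
  then show "open (\<phi> ` (U \<inter> W))" using *(2) openin_open_eq by blast
qed

lemma smooth_chart: "(U, \<phi>) \<in> M \<Longrightarrow> smooth_map_on M U \<phi>"
  using smooth_manifold by (fastforce simp: smooth_manifold_def smooth_map_on_def)

lemma smooth_map_on_cong:
  assumes "open W" "\<And>y. y \<in> W \<Longrightarrow> f y = g y" "smooth_map_on M W f"
  shows "smooth_map_on M W g"
  unfolding smooth_map_on_def
proof clarify
  fix U \<phi> assume c: "(U, \<phi>) \<in> M"
  have "smooth_on (\<phi> ` (U \<inter> W)) (\<lambda>z. f (inv_into U \<phi> z))"
    using assms(3) c by (auto simp: smooth_map_on_def)
  moreover have "f (inv_into U \<phi> z) = g (inv_into U \<phi> z)" if "z \<in> \<phi> ` (U \<inter> W)" for z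
    using that assms(2) inv_chart[OF c] by auto
  ultimately show "smooth_on (\<phi> ` (U \<inter> W)) (\<lambda>z. g (inv_into U \<phi> z))"
    using smooth_on_cong[OF open_chart_image[OF c assms(1)], of "\<lambda>z. f (inv_into U \<phi> z)" "\<lambda>z. g (inv_into U \<phi> z)"] by simp
qed

lemma smooth_map_on_subset: "smooth_map_on M W f \<Longrightarrow> W' \<subseteq> W \<Longrightarrow> smooth_map_on M W' f"
  unfolding smooth_map_on_def by (fast intro: smooth_on_subset)

lemma smooth_map_on_const: "smooth_map_on M W (\<lambda>x. c)"
  unfolding smooth_map_on_def using smooth_on_const by auto

lemma smooth_map_on_add:
  assumes "open W" "smooth_map_on M W f" "smooth_map_on M W g"
  shows "smooth_map_on M W (\<lambda>x. f x + g x)"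
  using assms unfolding smooth_map_on_def by (auto intro!: smooth_on_add open_chart_image)

lemma smooth_map_on_bilinear:
  assumes "bounded_bilinear bl" "open W" "smooth_map_on M W f" "smooth_map_on M W g"
  shows "smooth_map_on M W (\<lambda>x. bl (f x) (g x))"
  using assms unfolding smooth_map_on_def
  by (auto intro!: smooth_on_bilinear[OF assms(1)] open_chart_image)

lemmas smooth_map_on_mult = smooth_map_on_bilinear[OF bounded_bilinear_mult]
lemmas smooth_map_on_inner = smooth_map_on_bilinear[OF bounded_bilinear_inner]
lemmas smooth_map_on_scaleR = smooth_map_on_bilinear[OF bounded_bilinear_scaleR]

lemma smooth_map_on_sum:
  assumes "open W" "\<And>i. i \<in> I \<Longrightarrow> smooth_map_on M W (f i)"
  shows "smooth_map_on M W (\<lambda>x. \<Sum>i\<in>I. f i x)"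
  using assms(2)
  by (induction I rule: infinite_finite_induct)
    (simp_all add: smooth_map_on_const smooth_map_on_add[OF assms(1)])

lemma smooth_map_on_flat:
  assumes "open W" "smooth_map_on M W f"
  shows "smooth_map_on M W (\<lambda>x. flat p (f x))"
  using assms unfolding smooth_map_on_def by (auto intro!: smooth_on_flat open_chart_image)

lemma smooth_map_on_inverse:
  fixes f :: "'m \<Rightarrow> real"
  assumes "open W" "smooth_map_on M W f" "\<And>x. x \<in> W \<Longrightarrow> f x \<noteq> 0"
  shows "smooth_map_on M W (\<lambda>x. inverse (f x))"
  unfolding smooth_map_on_def
proof clarify
  fix U \<phi> assume c: "(U, \<phi>) \<in> M"
  have "f (inv_into U \<phi> z) \<noteq> 0" if "z \<in> \<phi> ` (U \<inter> W)" for z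
    using that assms(3) inv_chart[OF c] by auto
  then show "smooth_on (\<phi> ` (U \<inter> W)) (\<lambda>z. inverse (f (inv_into U \<phi> z)))"
    using assms(2) c by (intro smooth_on_inverse open_chart_image[OF c assms(1)]) (auto simp: smooth_map_on_def)
qed

lemma smooth_map_on_local:
  assumes "\<And>x. x \<in> W \<Longrightarrow> \<exists>V. open V \<and> x \<in> V \<and> smooth_map_on M V f"
  shows "smooth_map_on M W f"
  unfolding smooth_map_on_def
proof clarify
  fix U \<phi> assume c: "(U, \<phi>) \<in> M"
  define F where "F = {\<phi> ` (U \<inter> V) | V. open V \<and> smooth_map_on M V f}"
  have "smooth_on (\<Union>F) (\<lambda>z. f (inv_into U \<phi> z))"
    unfolding smooth_on_def
  proof (intro allI Ck_on_Union)
    show "open T" if "T \<in> F" for T using that open_chart_image[OF c] by (auto simp: F_def)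
    show "Ck_on n T (\<lambda>z. f (inv_into U \<phi> z))" if "T \<in> F" for T n
      using that c unfolding F_def smooth_map_on_def smooth_on_def by auto
  qed
  moreover have "\<phi> ` (U \<inter> W) \<subseteq> \<Union>F"
  proof
    fix z assume "z \<in> \<phi> ` (U \<inter> W)"
    then obtain x where x: "x \<in> U" "x \<in> W" "z = \<phi> x" by auto
    with assms[of x] show "z \<in> \<Union>F" unfolding F_def by auto
  qed
  ultimately show "smooth_on (\<phi> ` (U \<inter> W)) (\<lambda>z. f (inv_into U \<phi> z))"
    by (rule smooth_on_subset)
qed

lemma smooth_map_on_imp_continuous_on:
  assumes "open W" "smooth_map_on M W f"
  shows "continuous_on W f"
proof -
  have "continuous_on (U \<inter> W) f" if c: "(U, \<phi>) \<in> M" for U \<phi>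
  proof -
    have "continuous_on (\<phi> ` (U \<inter> W)) (\<lambda>z. f (inv_into U \<phi> z))"
      using assms(2) c by (intro smooth_on_imp_continuous_on) (auto simp: smooth_map_on_def)
    then have "continuous_on (U \<inter> W) (\<lambda>x. f (inv_into U \<phi> (\<phi> x)))"
      by (rule continuous_on_compose2) (auto intro: continuous_on_subset[OF continuous_chart[OF c]])
    then show ?thesis by (rule continuous_on_eq) (simp add: inv_chart[OF c])
  qed
  then have "continuous_on (\<Union>((\<lambda>(U, \<phi>). U \<inter> W) ` M)) f"
    using assms(1) open_chart by (intro continuous_on_open_Union) auto
  moreover have "W \<subseteq> \<Union>((\<lambda>(U, \<phi>). U \<inter> W) ` M)"
  proof
    fix x assume "x \<in> W"
    obtain U \<phi> where "(U, \<phi>) \<in> M" "x \<in> U" by (rule chart_at)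
    with \<open>x \<in> W\<close> show "x \<in> \<Union>((\<lambda>(U, \<phi>). U \<inter> W) ` M)"
      by (intro UnionI[of "U \<inter> W"] image_eqI[of _ _ "(U, \<phi>)"]) auto
  qed
  ultimately show ?thesis by (rule continuous_on_subset)
qed

text \<open>
  In a chart around \<open>x\<close> the flat function of \<open>e\<^sup>2 - \<bar>z - \<phi>(x)\<bar>\<^sup>2\<close> vanishes outside a ball. The closed ball is
  compact, so its preimage \<open>C\<close> is closed in the Hausdorff space \<open>M\<close>, and the function and zero agree on
  the overlap of the open sets \<open>U\<close> and \<open>- C\<close>.
\<close>

lemma smooth_bump:
  assumes "open W" "x \<in> W"
  obtains \<zeta> C where "\<zeta> \<in> smooth_funs M" "\<zeta> x = 1" "closed C" "C \<subseteq> W" "\<forall>y. y \<notin> C \<longrightarrow> \<zeta> y = 0"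
proof -
  obtain U \<phi> where c: "(U, \<phi>) \<in> M" "x \<in> U" by (rule chart_at)
  have "open (\<phi> ` (U \<inter> W))" "\<phi> x \<in> \<phi> ` (U \<inter> W)"
    using open_chart_image[OF c(1) assms(1)] c(2) assms(2) by auto
  then obtain e where e: "e > 0" "cball (\<phi> x) e \<subseteq> \<phi> ` (U \<inter> W)"
    using open_contains_cball by blast
  define C where "C = inv_into U \<phi> ` cball (\<phi> x) e"
  have "compact C" unfolding C_def using e(2)
    by (intro compact_continuous_image compact_cball_finite_dim[OF fd_model]
        continuous_on_subset[OF continuous_inv_chart[OF c(1)]]) auto
  then have C: "closed C" by (rule compact_imp_closed)
  have CW: "C \<subseteq> U \<inter> W"
  proof
    fix y assume "y \<in> C"
    then obtain z where z: "z \<in> cball (\<phi> x) e" "y = inv_into U \<phi> z" by (auto simp: C_def)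
    then obtain w where "w \<in> U \<inter> W" "z = \<phi> w" using e(2) by auto
    then show "y \<in> U \<inter> W" using z inv_chart[OF c(1)] by auto
  qed
  define h where "h y = e\<^sup>2 - (\<phi> y - \<phi> x) \<bullet> (\<phi> y - \<phi> x)" for y
  define \<zeta> where "\<zeta> y = (if y \<in> U then flat 1 (h y) / flat 1 (h x) else 0)" for y
  have zero: "\<zeta> y = 0" if "y \<notin> C" for y
  proof (cases "y \<in> U")
    case True
    have "\<phi> y \<notin> cball (\<phi> x) e"
    proof
      assume "\<phi> y \<in> cball (\<phi> x) e"
      then have "inv_into U \<phi> (\<phi> y) \<in> C" by (auto simp: C_def)
      then show False using that inv_chart[OF c(1) True] by simp
    qed
    then have "e < norm (\<phi> y - \<phi> x)" by (simp add: dist_norm norm_minus_commute)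
    then have "e\<^sup>2 < (norm (\<phi> y - \<phi> x))\<^sup>2" using e(1) by (intro power_strict_mono) auto
    then have "h y \<le> 0" unfolding h_def by (simp add: dot_square_norm)
    then show ?thesis by (simp add: \<zeta>_def flat_def)
  qed (simp add: \<zeta>_def)
  have "h x > 0" using e(1) by (simp add: h_def)
  then have one: "\<zeta> x = 1" using c(2) by (simp add: \<zeta>_def flat_def)
  have sU: "smooth_map_on M U \<zeta>"
  proof (rule smooth_map_on_cong[OF open_chart[OF c(1)]])
    have "smooth_map_on M U (\<lambda>y. \<phi> y + (- \<phi> x))"
      by (intro smooth_map_on_add open_chart[OF c(1)] smooth_chart[OF c(1)] smooth_map_on_const)
    then have "smooth_map_on M U (\<lambda>y. (-1) * ((\<phi> y + (- \<phi> x)) \<bullet> (\<phi> y + (- \<phi> x))))"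
      by (intro smooth_map_on_mult smooth_map_on_inner open_chart[OF c(1)] smooth_map_on_const)
    from smooth_map_on_add[OF open_chart[OF c(1)] smooth_map_on_const this]
    have "smooth_map_on M U (\<lambda>y. flat 1 (e\<^sup>2 + (-1) * ((\<phi> y + (- \<phi> x)) \<bullet> (\<phi> y + (- \<phi> x)))))"
      by (intro smooth_map_on_flat open_chart[OF c(1)])
    then have "smooth_map_on M U (\<lambda>y. flat 1 (h y))"
      by (rule smooth_map_on_cong[OF open_chart[OF c(1)], rotated]) (simp add: h_def)
    then show "smooth_map_on M U (\<lambda>y. flat 1 (h y) * inverse (flat 1 (h x)))"
      by (intro smooth_map_on_mult smooth_map_on_const open_chart[OF c(1)])
  qed (simp add: \<zeta>_def divide_inverse)
  have "smooth_map_on M (- C) \<zeta>"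
    by (rule smooth_map_on_cong[OF _ _ smooth_map_on_const[of _ 0]]) (use C zero in auto)
  then have "smooth_map_on M UNIV \<zeta>"
    using sU open_chart[OF c(1)] C CW
    by (intro smooth_map_on_local) (metis ComplI IntD1 open_Compl subsetD)
  then have "\<zeta> \<in> smooth_funs M" by (simp add: smooth_funs_def)
  with one C CW zero show ?thesis by (intro that[of \<zeta> C]) auto
qed

lemma smooth_funs_const: "(\<lambda>x. c) \<in> smooth_funs M"
  by (simp add: smooth_funs_def smooth_map_on_const)

lemma smooth_funs_add: "f \<in> smooth_funs M \<Longrightarrow> g \<in> smooth_funs M \<Longrightarrow> (\<lambda>x. f x + g x) \<in> smooth_funs M"
  by (simp add: smooth_funs_def smooth_map_on_add)

lemma smooth_funs_mult: "f \<in> smooth_funs M \<Longrightarrow> g \<in> smooth_funs M \<Longrightarrow> (\<lambda>x. f x * g x) \<in> smooth_funs M"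
  by (simp add: smooth_funs_def smooth_map_on_mult)

lemma smooth_funs_minus: "f \<in> smooth_funs M \<Longrightarrow> (\<lambda>x. - f x) \<in> smooth_funs M"
  using smooth_funs_mult[OF smooth_funs_const[of "-1"]] by simp

lemma smooth_funs_diff: "f \<in> smooth_funs M \<Longrightarrow> g \<in> smooth_funs M \<Longrightarrow> (\<lambda>x. f x - g x) \<in> smooth_funs M"
  using smooth_funs_add[OF _ smooth_funs_minus] by simp

text \<open>
  Smoothness may be tested after multiplication with a smooth function that does not vanish at the point
  in question. Global sections cut off by bump functions can thus serve as test objects, and local
  sections never appear.
\<close>

lemma smooth_map_on_local_division:
  assumes "\<And>x. x \<in> W \<Longrightarrow> \<exists>\<zeta>\<in>smooth_funs M. \<zeta> x \<noteq> 0 \<and> (\<lambda>y. \<zeta> y * f y) \<in> smooth_funs M"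
  shows "smooth_map_on M W f"
proof (rule smooth_map_on_local)
  fix x assume "x \<in> W"
  from assms[OF this] obtain \<zeta> where \<zeta>: "\<zeta> \<in> smooth_funs M" "\<zeta> x \<noteq> 0"
    "(\<lambda>y. \<zeta> y * f y) \<in> smooth_funs M" by (elim bexE conjE)
  have "continuous_on UNIV \<zeta>"
    using \<zeta>(1) by (intro smooth_map_on_imp_continuous_on) (auto simp: smooth_funs_def)
  then have o: "open {y. \<zeta> y \<noteq> 0}"
    using open_vimage[of "- {0}" \<zeta>] by (simp add: vimage_def open_Compl)
  have "smooth_map_on M {y. \<zeta> y \<noteq> 0} (\<lambda>y. (\<zeta> y * f y) * inverse (\<zeta> y))"
    using \<zeta> by (intro smooth_map_on_mult[where f = "\<lambda>y. \<zeta> y * f y"] smooth_map_on_inverse o)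
      (auto simp: smooth_funs_def intro: smooth_map_on_subset)
  then have "smooth_map_on M {y. \<zeta> y \<noteq> 0} f"
    by (rule smooth_map_on_cong[OF o, rotated]) (simp add: field_simps)
  then show "\<exists>V. open V \<and> x \<in> V \<and> smooth_map_on M V f" using o \<zeta>(2) by (intro exI[of _ "{y. \<zeta> y \<noteq> 0}"]) simp
qed

lemma smooth_funs_local_division:
  assumes "\<And>x. \<exists>\<zeta>\<in>smooth_funs M. \<zeta> x \<noteq> 0 \<and> (\<lambda>y. \<zeta> y * f y) \<in> smooth_funs M"
  shows "f \<in> smooth_funs M"
  using smooth_map_on_local_division[of UNIV f, OF assms] by (simp add: smooth_funs_def)

lemma smooth_map_on_funs: "f \<in> smooth_funs M \<Longrightarrow> smooth_map_on M W f"
  unfolding smooth_funs_def by (auto intro: smooth_map_on_subset)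

end

section \<open>Sections of a vector bundle\<close>

locale smooth_bundle = manifold M
  for M :: "('m::{t2_space, second_countable_topology}, 'e::real_inner) atlas" +
  fixes E :: "('m, 'v::real_inner) triv"
  assumes vector_bundle: "vector_bundle M E"
begin

lemma fd: "finite_dim TYPE('v)"
  using vector_bundle by (simp add: vector_bundle_def)

lemma triv_at: obtains U g where "(U, g) \<in> E" "x \<in> U"
proof -
  have "x \<in> (\<Union>(U, g)\<in>E. U)" using vector_bundle by (simp add: vector_bundle_def)
  then show ?thesis using that by auto
qed

lemma
  assumes "(U, g) \<in> E"
  shows open_triv: "open U"
    and linear_triv: "x \<in> U \<Longrightarrow> linear (g x)"
    and bij_triv: "x \<in> U \<Longrightarrow> bij (g x)"
    and linear_inv_triv: "x \<in> U \<Longrightarrow> linear (inv (g x))"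
    and inv_triv: "x \<in> U \<Longrightarrow> inv (g x) (g x v) = v"
proof -
  have *: "open U \<and> (\<forall>x\<in>U. linear (g x) \<and> bij (g x))"
    using vector_bundle assms by (auto simp: vector_bundle_def)
  then show "open U" "x \<in> U \<Longrightarrow> linear (g x)" "x \<in> U \<Longrightarrow> bij (g x)" by auto
  assume "x \<in> U"
  with * have "linear (g x)" "bij (g x)" by auto
  then show "linear (inv (g x))" "inv (g x) (g x v) = v"
    by (auto intro: linear_inv_of_bij simp: bij_is_inj)
qed

lemma smooth_transition:
  "(U, g) \<in> E \<Longrightarrow> (V, h) \<in> E \<Longrightarrow> smooth_map_on M (U \<inter> V) (\<lambda>x. h x (inv (g x) v))"
  using vector_bundle by (fastforce simp: vector_bundle_def)

text \<open>
  For a field of linear maps it suffices that its values on fixed vectors are smooth, because the argument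
  can be expanded in a fixed basis of the model fibre.
\<close>

lemma smooth_map_on_apply:
  assumes "open W" "\<And>x. x \<in> W \<Longrightarrow> linear (F x)" "\<And>b. smooth_map_on M W (\<lambda>x. F x b)"
    "smooth_map_on M W s"
  shows "smooth_map_on M W (\<lambda>x. F x (s x :: 'v))"
proof -
  obtain B :: "'v set" where B: "orthonormal_basis B" using orthonormal_basis_exists[OF fd] ..
  show ?thesis
  proof (rule smooth_map_on_cong[OF assms(1)])
    show "smooth_map_on M W (\<lambda>x. \<Sum>b\<in>B. (b \<bullet> s x) *\<^sub>R F x b)"
      using assms by (intro smooth_map_on_sum smooth_map_on_scaleR smooth_map_on_inner
          smooth_map_on_const) auto
  qed (simp add: linear_basis_expand[OF B assms(2), symmetric])
qed

lemma smooth_map_on_coords: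
  assumes "open W" "\<And>b. smooth_map_on M W (\<lambda>x. b \<bullet> s x)"
  shows "smooth_map_on M W (s :: 'm \<Rightarrow> 'v)"
proof -
  obtain B :: "'v set" where B: "orthonormal_basis B" using orthonormal_basis_exists[OF fd] ..
  show ?thesis
  proof (rule smooth_map_on_cong[OF assms(1)])
    show "smooth_map_on M W (\<lambda>x. \<Sum>b\<in>B. (b \<bullet> s x) *\<^sub>R b)"
      using assms by (intro smooth_map_on_sum smooth_map_on_scaleR smooth_map_on_const) auto
  qed (use B in \<open>simp add: orthonormal_basis_def\<close>)
qed

lemma smooth_map_on_adjoint:
  assumes "open W" "\<And>x. x \<in> W \<Longrightarrow> linear (F x)" "\<And>b. smooth_map_on M W (\<lambda>x. F x b)"
  shows "smooth_map_on M W (\<lambda>x. adjoint (F x :: 'v \<Rightarrow> 'v) v)"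
proof (rule smooth_map_on_coords[OF assms(1)])
  fix b
  show "smooth_map_on M W (\<lambda>x. b \<bullet> adjoint (F x) v)"
    by (rule smooth_map_on_cong[OF assms(1) _ smooth_map_on_inner[OF assms(1) smooth_map_on_const[of _ v] assms(3)[of b]]])
      (simp add: adjoint_inner[OF fd assms(2)] inner_commute[of b])
qed

lemma mem_sections: "s \<in> sections M E \<longleftrightarrow> (\<forall>U g. (U, g) \<in> E \<longrightarrow> smooth_map_on M U (\<lambda>x. g x (s x)))"
  by (auto simp: sections_def)

lemma sections_add:
  assumes "s \<in> sections M E" "t \<in> sections M E"
  shows "(\<lambda>x. s x + t x) \<in> sections M E"
  unfolding mem_sections
proof (intro allI impI)
  fix U g assume U: "(U, g) \<in> E"
  show "smooth_map_on M U (\<lambda>x. g x (s x + t x))"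
    by (rule smooth_map_on_cong[OF open_triv[OF U] _ smooth_map_on_add[OF open_triv[OF U], of "\<lambda>x. g x (s x)" "\<lambda>x. g x (t x)"]])
      (use assms U in \<open>auto simp: mem_sections linear_add linear_triv[OF U]\<close>)
qed

lemma sections_scale:
  assumes "f \<in> smooth_funs M" "s \<in> sections M E"
  shows "(\<lambda>x. f x *\<^sub>R s x) \<in> sections M E"
  unfolding mem_sections
proof (intro allI impI)
  fix U g assume U: "(U, g) \<in> E"
  show "smooth_map_on M U (\<lambda>x. g x (f x *\<^sub>R s x))"
    by (rule smooth_map_on_cong[OF open_triv[OF U] _ smooth_map_on_scaleR[OF open_triv[OF U], of f "\<lambda>x. g x (s x)"]])
      (use assms U in \<open>auto simp: mem_sections linear_cmul linear_triv[OF U] smooth_map_on_funs\<close>)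
qed

lemma sections_zero: "(\<lambda>x. 0) \<in> sections M E"
  unfolding mem_sections
proof (intro allI impI)
  fix U g assume U: "(U, g) \<in> E"
  show "smooth_map_on M U (\<lambda>x. g x 0)"
    by (rule smooth_map_on_cong[OF open_triv[OF U] _ smooth_map_on_const[of _ 0]])
      (use linear_triv[OF U] in \<open>auto simp: linear_0\<close>)
qed

lemma sections_sum: "(\<And>i. i \<in> I \<Longrightarrow> s i \<in> sections M E) \<Longrightarrow> (\<lambda>x. \<Sum>i\<in>I. s i x) \<in> sections M E"
  by (induction I rule: infinite_finite_induct) (simp_all add: sections_zero sections_add)

lemma sections_cmul: "s \<in> sections M E \<Longrightarrow> (\<lambda>x. c *\<^sub>R s x) \<in> sections M E"
  by (rule sections_scale[OF smooth_funs_const])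

lemma sections_cutoff:
  assumes U: "open U" and \<zeta>: "\<zeta> \<in> smooth_funs M" "closed C" "C \<subseteq> U" "\<forall>y. y \<notin> C \<longrightarrow> \<zeta> y = 0"
    and s: "\<And>V h. (V, h) \<in> E \<Longrightarrow> smooth_map_on M (U \<inter> V) (\<lambda>x. h x (s x))"
  shows "(\<lambda>x. \<zeta> x *\<^sub>R s x) \<in> sections M E"
  unfolding mem_sections
proof (intro allI impI)
  fix V h assume V: "(V, h) \<in> E"
  have o: "open (U \<inter> V)" "open (- C \<inter> V)" using U open_triv[OF V] \<zeta>(2) by auto
  have 1: "smooth_map_on M (U \<inter> V) (\<lambda>x. h x (\<zeta> x *\<^sub>R s x))"
    by (rule smooth_map_on_cong[OF o(1) _ smooth_map_on_scaleR[OF o(1), of \<zeta> "\<lambda>x. h x (s x)"]])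
      (use s V \<zeta>(1) in \<open>auto simp: linear_cmul linear_triv[OF V] smooth_map_on_funs\<close>)
  have 2: "smooth_map_on M (- C \<inter> V) (\<lambda>x. h x (\<zeta> x *\<^sub>R s x))"
    by (rule smooth_map_on_cong[OF o(2) _ smooth_map_on_const[of _ 0]])
      (use \<zeta>(4) in \<open>auto simp: linear_0 linear_triv[OF V]\<close>)
  show "smooth_map_on M V (\<lambda>x. h x (\<zeta> x *\<^sub>R s x))"
  proof (rule smooth_map_on_local)
    fix x assume "x \<in> V"
    then have "x \<in> U \<inter> V \<or> x \<in> - C \<inter> V" using \<zeta>(3) by auto
    then show "\<exists>W. open W \<and> x \<in> W \<and> smooth_map_on M W (\<lambda>x. h x (\<zeta> x *\<^sub>R s x))"
      using o 1 2 by metis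
  qed
qed

lemma mem_dual_bundle:
  "(U, k) \<in> dual_bundle E \<longleftrightarrow> (\<exists>g. (U, g) \<in> E \<and> k = (\<lambda>x. adjoint (inv (g x))))"
proof
  assume "\<exists>g. (U, g) \<in> E \<and> k = (\<lambda>x. adjoint (inv (g x)))"
  then obtain g where "(U, g) \<in> E" "k = (\<lambda>x. adjoint (inv (g x)))" by auto
  then show "(U, k) \<in> dual_bundle E" unfolding dual_bundle_def by (intro image_eqI[of _ _ "(U, g)"]) auto
qed (auto simp: dual_bundle_def)

lemma mem_dual_sections: "\<alpha> \<in> sections M (dual_bundle E) \<longleftrightarrow>
    (\<forall>U g. (U, g) \<in> E \<longrightarrow> smooth_map_on M U (\<lambda>x. adjoint (inv (g x)) (\<alpha> x)))"
  by (auto simp: sections_def dual_bundle_def)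

lemma dual_triv:
  assumes "(U, g) \<in> E" "x \<in> U"
  shows "inv (adjoint (inv (g x))) = adjoint (g x)" "linear (adjoint (inv (g x)))" "bij (adjoint (inv (g x)))"
    "adjoint (adjoint (inv (g x))) = inv (g x)"
proof -
  have b: "bij (inv (g x))" using bij_triv[OF assms] by (simp add: bij_imp_bij_inv)
  show "inv (adjoint (inv (g x))) = adjoint (g x)" "bij (adjoint (inv (g x)))"
    using inv_adjoint[OF fd linear_inv_triv[OF assms] b] bij_triv[OF assms] by (auto simp: inv_inv_eq)
  show "linear (adjoint (inv (g x)))" "adjoint (adjoint (inv (g x))) = inv (g x)"
    using linear_adjoint[OF fd linear_inv_triv[OF assms]] adjoint_adjoint'[OF fd linear_inv_triv[OF assms]] by auto
qed

lemma smooth_dual_transition: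
  assumes U: "(U, g) \<in> E" and V: "(V, h) \<in> E"
  shows "smooth_map_on M (U \<inter> V) (\<lambda>x. adjoint (inv (h x)) (adjoint (g x) v))"
proof -
  have o: "open (U \<inter> V)" using open_triv U V by blast
  have l: "linear (\<lambda>w. g x (inv (h x) w))" if "x \<in> U \<inter> V" for x
    using linear_compose[OF linear_inv_triv[OF V] linear_triv[OF U], of x x] that by (simp add: o_def)
  have "smooth_map_on M (U \<inter> V) (\<lambda>x. adjoint (\<lambda>w. g x (inv (h x) w)) v)"
    using smooth_transition[OF V U] by (intro smooth_map_on_adjoint o l) (simp_all add: Int_commute)
  then show ?thesis
    by (rule smooth_map_on_cong[OF o, rotated])
      (use adjoint_compose[OF fd linear_inv_triv[OF V] linear_triv[OF U]] in auto)
qed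

lemma vector_bundle_dual: "vector_bundle M (dual_bundle E)"
  unfolding vector_bundle_def
proof (intro conjI)
  have "(\<Union>(U, g)\<in>dual_bundle E. U) = (\<Union>(U, g)\<in>E. U)" by (auto simp: dual_bundle_def)
  then show "(\<Union>(U, g)\<in>dual_bundle E. U) = UNIV" using vector_bundle by (simp add: vector_bundle_def)
  show "\<forall>(U, g)\<in>dual_bundle E. open U \<and> (\<forall>x\<in>U. linear (g x) \<and> bij (g x))"
    by (auto simp: mem_dual_bundle open_triv dual_triv)
  show "\<forall>(U, g)\<in>dual_bundle E. \<forall>(V, h)\<in>dual_bundle E. \<forall>v.
      smooth_map_on M (U \<inter> V) (\<lambda>x. h x (inv (g x) v))"
  proof clarify
    fix U k V l v assume "(U, k) \<in> dual_bundle E" "(V, l) \<in> dual_bundle E"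
    then obtain g h where *: "(U, g) \<in> E" "k = (\<lambda>x. adjoint (inv (g x)))" "(V, h) \<in> E" "l = (\<lambda>x. adjoint (inv (h x)))"
      by (auto simp: mem_dual_bundle)
    show "smooth_map_on M (U \<inter> V) (\<lambda>x. l x (inv (k x) v))"
      by (rule smooth_map_on_cong[OF _ _ smooth_dual_transition[OF *(1,3), of v]])
        (use * in \<open>auto simp: open_triv dual_triv\<close>)
  qed
qed (rule fd)

lemma bundle_dual: "smooth_bundle M (dual_bundle E)"
  by unfold_locales (rule vector_bundle_dual)

lemma local_frame_sections:
  assumes U: "(U, g) \<in> E" and \<zeta>: "\<zeta> \<in> smooth_funs M" "closed C" "C \<subseteq> U" "\<forall>y. y \<notin> C \<longrightarrow> \<zeta> y = 0"
  shows "(\<lambda>x. \<zeta> x *\<^sub>R inv (g x) w) \<in> sections M E"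
    and "(\<lambda>x. \<zeta> x *\<^sub>R adjoint (g x) w) \<in> sections M (dual_bundle E)"
proof -
  show "(\<lambda>x. \<zeta> x *\<^sub>R inv (g x) w) \<in> sections M E"
    by (rule sections_cutoff[OF open_triv[OF U] \<zeta>]) (rule smooth_transition[OF U])
  interpret dual: smooth_bundle M "dual_bundle E" by (rule bundle_dual)
  show "(\<lambda>x. \<zeta> x *\<^sub>R adjoint (g x) w) \<in> sections M (dual_bundle E)"
    by (rule dual.sections_cutoff[OF open_triv[OF U] \<zeta>]) (auto simp: mem_dual_bundle smooth_dual_transition[OF U])
qed

text \<open>
  Squaring a bump function that is supported in the domain of a trivialization makes both the frame and
  the coframe extend by zero to global sections. This global partial resolution of the identity
  replaces local computations throughout: only the value 1 of the cutoff at one point is used.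
\<close>

lemma frame_at:
  obtains \<zeta> B e \<theta> where "\<zeta> \<in> smooth_funs M" "\<zeta> x = 1" "finite (B :: 'v set)"
    "\<forall>b. e b \<in> sections M E" "\<forall>b. \<theta> b \<in> sections M (dual_bundle E)"
    "\<forall>y v. (\<Sum>b\<in>B. (\<theta> b y \<bullet> v) *\<^sub>R e b y) = \<zeta> y *\<^sub>R v"
proof -
  obtain U g where U: "(U, g) \<in> E" "x \<in> U" by (rule triv_at)
  obtain \<zeta> C where \<zeta>: "\<zeta> \<in> smooth_funs M" "\<zeta> x = 1" "closed C" "C \<subseteq> U" "\<forall>y. y \<notin> C \<longrightarrow> \<zeta> y = 0"
    using smooth_bump[OF open_triv[OF U(1)] U(2)] by metis
  obtain B :: "'v set" where B: "orthonormal_basis B" using orthonormal_basis_exists[OF fd] ..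
  define e where "e b x = \<zeta> x *\<^sub>R inv (g x) b" for b x
  define \<theta> where "\<theta> b x = \<zeta> x *\<^sub>R adjoint (g x) b" for b x
  have sum: "(\<Sum>b\<in>B. (\<theta> b y \<bullet> v) *\<^sub>R e b y) = (\<zeta> y * \<zeta> y) *\<^sub>R v" for y v
  proof (cases "y \<in> U")
    case True
    have "(\<Sum>b\<in>B. (\<theta> b y \<bullet> v) *\<^sub>R e b y) = (\<zeta> y * \<zeta> y) *\<^sub>R (\<Sum>b\<in>B. (b \<bullet> g y v) *\<^sub>R inv (g y) b)"
      by (simp add: e_def \<theta>_def adjoint_inner[OF fd linear_triv[OF U(1) True]] scaleR_sum_right mult_ac)
    also have "\<dots> = (\<zeta> y * \<zeta> y) *\<^sub>R inv (g y) (g y v)"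
      by (simp add: linear_basis_expand[OF B linear_inv_triv[OF U(1) True], of "g y v"])
    finally show ?thesis using inv_triv[OF U(1) True] by simp
  next
    case False
    then have "\<zeta> y = 0" using \<zeta> by auto
    then show ?thesis by (simp add: e_def)
  qed
  have "e b \<in> sections M E" "\<theta> b \<in> sections M (dual_bundle E)" for b
    unfolding e_def[abs_def] \<theta>_def[abs_def] using local_frame_sections[OF U(1) \<zeta>(1,3-5)] by auto
  moreover have "finite B" using B by (simp add: orthonormal_basis_def)
  ultimately show ?thesis
    using that[of "\<lambda>y. \<zeta> y * \<zeta> y" B e \<theta>] sum smooth_funs_mult[OF \<zeta>(1) \<zeta>(1)] \<zeta>(2) by simp
qed

lemma section_through: obtains s where "s \<in> sections M E" "s x = v"
proof -
  obtain \<zeta> B e \<theta> where *: "\<zeta> \<in> smooth_funs M" "\<zeta> x = 1" "finite (B :: 'v set)"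
    "\<forall>b. e b \<in> sections M E" "\<forall>b. \<theta> b \<in> sections M (dual_bundle E)"
    "\<forall>y v. (\<Sum>b\<in>B. (\<theta> b y \<bullet> v) *\<^sub>R e b y) = \<zeta> y *\<^sub>R v"
    by (rule frame_at[of x])
  have "(\<lambda>y. \<Sum>b\<in>B. (\<theta> b x \<bullet> v) *\<^sub>R e b y) \<in> sections M E"
    using *(4) by (intro sections_sum sections_cmul) simp
  then show ?thesis by (rule that) (use *(2,6) in simp)
qed

lemma smooth_funs_pairing:
  assumes "s \<in> sections M E" "\<alpha> \<in> sections M (dual_bundle E)"
  shows "(\<lambda>x. \<alpha> x \<bullet> s x) \<in> smooth_funs M"
  unfolding smooth_funs_def
proof (rule CollectI, rule smooth_map_on_local)
  fix x
  obtain U g where U: "(U, g) \<in> E" "x \<in> U" by (rule triv_at)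
  have "smooth_map_on M U (\<lambda>x. adjoint (inv (g x)) (\<alpha> x))"
    using assms(2) U(1) by (simp add: mem_dual_sections)
  then have "smooth_map_on M U (\<lambda>x. adjoint (inv (g x)) (\<alpha> x) \<bullet> g x (s x))"
    using assms(1) U(1) by (intro smooth_map_on_inner open_triv[OF U(1)]) (auto simp: mem_sections)
  then have "smooth_map_on M U (\<lambda>x. \<alpha> x \<bullet> s x)"
    by (rule smooth_map_on_cong[OF open_triv[OF U(1)], rotated])
      (simp add: adjoint_inner[OF fd linear_inv_triv[OF U(1)]] inv_triv[OF U(1)])
  then show "\<exists>V. open V \<and> x \<in> V \<and> smooth_map_on M V (\<lambda>x. \<alpha> x \<bullet> s x)"
    using U open_triv[OF U(1)] by (intro exI[of _ U]) simp
qed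

text \<open>
  Smoothness of a covector field is detected by its pairings with global sections. This replaces the
  trivializations by a condition that is stable under all algebraic operations; \<open>ext_power_dual\<close> is
  the same statement for forms of any degree.
\<close>

lemma dual_sections_iff:
  "\<alpha> \<in> sections M (dual_bundle E) \<longleftrightarrow> (\<forall>s\<in>sections M E. (\<lambda>x. \<alpha> x \<bullet> s x) \<in> smooth_funs M)"
proof
  assume *: "\<forall>s\<in>sections M E. (\<lambda>x. \<alpha> x \<bullet> s x) \<in> smooth_funs M"
  have "smooth_map_on M U (\<lambda>x. adjoint (inv (g x)) (\<alpha> x))" if U: "(U, g) \<in> E" for U g
  proof (rule smooth_map_on_coords[OF open_triv[OF U]])
    fix b
    have "smooth_map_on M U (\<lambda>y. \<alpha> y \<bullet> inv (g y) b)"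
    proof (rule smooth_map_on_local_division)
      fix x assume "x \<in> U"
      then obtain \<zeta> C where \<zeta>: "\<zeta> \<in> smooth_funs M" "\<zeta> x = 1" "closed C" "C \<subseteq> U" "\<forall>y. y \<notin> C \<longrightarrow> \<zeta> y = 0"
        using smooth_bump[OF open_triv[OF U]] by metis
      have "(\<lambda>y. \<alpha> y \<bullet> (\<zeta> y *\<^sub>R inv (g y) b)) \<in> smooth_funs M"
        using bspec[OF * local_frame_sections(1)[OF U \<zeta>(1,3-5), of b]] .
      then show "\<exists>\<zeta>\<in>smooth_funs M. \<zeta> x \<noteq> 0 \<and> (\<lambda>y. \<zeta> y * (\<alpha> y \<bullet> inv (g y) b)) \<in> smooth_funs M"
        using \<zeta>(1,2) by (intro bexI[of _ \<zeta>]) auto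
    qed
    then show "smooth_map_on M U (\<lambda>x. b \<bullet> adjoint (inv (g x)) (\<alpha> x))"
      by (rule smooth_map_on_cong[OF open_triv[OF U], rotated])
        (simp add: adjoint_inner[OF fd linear_inv_triv[OF U]] inner_commute[of b])
  qed
  then show "\<alpha> \<in> sections M (dual_bundle E)" by (simp add: mem_dual_sections)
qed (use smooth_funs_pairing in auto)

lemma sections_dual_dual: "sections M (dual_bundle (dual_bundle E)) = sections M E"
proof -
  interpret dual: smooth_bundle M "dual_bundle E" by (rule bundle_dual)
  have "smooth_map_on M U (\<lambda>x. adjoint (inv (adjoint (inv (g x)))) (s x)) \<longleftrightarrow> smooth_map_on M U (\<lambda>x. g x (s x))"
    if U: "(U, g) \<in> E" for U g s
    by (rule iffI; rule smooth_map_on_cong[OF open_triv[OF U], rotated], assumption)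
      (simp_all add: dual_triv[OF U] adjoint_adjoint'[OF fd linear_triv[OF U]])
  moreover have "s \<in> sections M (dual_bundle (dual_bundle E)) \<longleftrightarrow> (\<forall>U g. (U, g) \<in> E \<longrightarrow>
      smooth_map_on M U (\<lambda>x. adjoint (inv (adjoint (inv (g x)))) (s x)))" for s
    by (auto simp: sections_def dual_bundle_def)
  ultimately show ?thesis by (simp add: set_eq_iff mem_sections)
qed

lemma ext_power_dual_dual: "ext_power M (dual_bundle (dual_bundle E)) k = ext_power M E k"
proof -
  interpret dual: smooth_bundle M "dual_bundle E" by (rule bundle_dual)
  have eq: "adjoint (adjoint (inv (adjoint (inv (g x))))) = adjoint (g x)" if "(U, g) \<in> E" "x \<in> U" for U g x
    by (simp add: dual_triv[OF that] adjoint_adjoint'[OF fd linear_triv[OF that]])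
  have "smooth_map_on M U (\<lambda>x. P x (map (adjoint (adjoint (inv (adjoint (inv (g x)))))) ws))
      \<longleftrightarrow> smooth_map_on M U (\<lambda>x. P x (map (adjoint (g x)) ws))"
    if U: "(U, g) \<in> E" for U g ws and P :: "('m, 'v) multi"
    by (rule iffI; rule smooth_map_on_cong[OF open_triv[OF U], rotated], assumption)
      (simp_all add: eq[OF U])
  moreover have "P \<in> ext_power M (dual_bundle (dual_bundle E)) k \<longleftrightarrow> (\<forall>x. alternating k (P x)) \<and>
      (\<forall>U g. (U, g) \<in> E \<longrightarrow> (\<forall>ws. length ws = k \<longrightarrow>
        smooth_map_on M U (\<lambda>x. P x (map (adjoint (adjoint (inv (adjoint (inv (g x)))))) ws))))" for P
    by (auto simp: ext_power_def dual_bundle_def)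
  moreover have "P \<in> ext_power M E k \<longleftrightarrow> (\<forall>x. alternating k (P x)) \<and>
      (\<forall>U g. (U, g) \<in> E \<longrightarrow> (\<forall>ws. length ws = k \<longrightarrow> smooth_map_on M U (\<lambda>x. P x (map (adjoint (g x)) ws))))" for P
    by (auto simp: ext_power_def)
  ultimately show ?thesis by (simp add: set_eq_iff)
qed

lemma sections_iff_pairing:
  "s \<in> sections M E \<longleftrightarrow> (\<forall>\<alpha>\<in>sections M (dual_bundle E). (\<lambda>x. \<alpha> x \<bullet> s x) \<in> smooth_funs M)"
proof -
  interpret dual: smooth_bundle M "dual_bundle E" by (rule bundle_dual)
  show ?thesis using dual.dual_sections_iff[of s] sections_dual_dual by (simp add: inner_commute)
qed

lemma app_endo_sections:
  assumes "N \<in> bundle_endos M E" "s \<in> sections M E"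
  shows "app N s \<in> sections M E"
  unfolding mem_sections app_def
proof (intro allI impI)
  fix U g assume U: "(U, g) \<in> E"
  have lN: "linear (N x)" for x using assms(1) by (auto simp: bundle_endos_def)
  have l: "linear (\<lambda>v. g x (N x (inv (g x) v)))" if "x \<in> U" for x
    using linear_compose[OF linear_compose[OF linear_inv_triv[OF U that] lN] linear_triv[OF U that]]
    by (simp add: o_def)
  have "smooth_map_on M U (\<lambda>x. g x (N x (inv (g x) (g x (s x)))))"
    by (rule smooth_map_on_apply[OF open_triv[OF U] l, where s = "\<lambda>x. g x (s x)"])
      (use assms U in \<open>auto simp: bundle_endos_def mem_sections\<close>)
  then show "smooth_map_on M U (\<lambda>x. g x (N x (s x)))"
    by (rule smooth_map_on_cong[OF open_triv[OF U], rotated]) (simp add: inv_triv[OF U])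
qed

lemma app_transp_sections:
  assumes "N \<in> bundle_endos M E" "\<alpha> \<in> sections M (dual_bundle E)"
  shows "app (transp N) \<alpha> \<in> sections M (dual_bundle E)"
  unfolding dual_sections_iff
proof
  fix s assume s: "s \<in> sections M E"
  have lN: "linear (N x)" for x using assms(1) by (auto simp: bundle_endos_def)
  show "(\<lambda>x. app (transp N) \<alpha> x \<bullet> s x) \<in> smooth_funs M"
    using smooth_funs_pairing[OF app_endo_sections[OF assms(1) s] assms(2)]
    by (simp add: app_def transp_def adjoint_inner[OF fd lN])
qed

end

section \<open>Alternating forms as operations on sections\<close>

text \<open>
  Alternation is only required for adjacent arguments, and in all degrees at once: in this shape it is
  inherited by insertion of a first argument, which is what the inductions over argument lists need.
\<close>

definition altf :: "('v::real_vector list \<Rightarrow> real) \<Rightarrow> bool" where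
  "altf f \<longleftrightarrow> (\<forall>us vs. linear (\<lambda>v. f (us @ v # vs))) \<and> (\<forall>us v vs. f (us @ v # v # vs) = 0)"

definition of_deg :: "nat \<Rightarrow> ('m, 'v) multi \<Rightarrow> bool" where
  "of_deg k P \<longleftrightarrow> (\<forall>x vs. length vs \<noteq> k \<longrightarrow> P x vs = 0)"

definition ev :: "('m, 'v) multi \<Rightarrow> ('m \<Rightarrow> 'v) list \<Rightarrow> 'm \<Rightarrow> real" where
  "ev P Xs = (\<lambda>x. P x (map (\<lambda>X. X x) Xs))"

definition Forms :: "('m, 'e::real_inner) atlas \<Rightarrow> ('m, 'v::real_inner) triv \<Rightarrow> ('m, 'v) multi set" where
  "Forms M E = {P. (\<forall>x. altf (P x)) \<and> (\<forall>Xs. set Xs \<subseteq> sections M E \<longrightarrow> ev P Xs \<in> smooth_funs M)}"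

lemma altf_linear: "altf f \<Longrightarrow> linear (\<lambda>v. f (us @ v # vs))"
  and altf_adjacent: "altf f \<Longrightarrow> f (us @ v # v # vs) = 0"
  by (simp_all add: altf_def)

lemma altf_add: "altf f \<Longrightarrow> f (us @ (v + w) # vs) = f (us @ v # vs) + f (us @ w # vs)"
  using linear_add[OF altf_linear] by metis

lemma altf_scale: "altf f \<Longrightarrow> f (us @ (c *\<^sub>R v) # vs) = c * f (us @ v # vs)"
  using linear_cmul[OF altf_linear] by (metis real_scaleR_def)

lemma altf_zero: "altf f \<Longrightarrow> f (us @ 0 # vs) = 0"
  using linear_0[OF altf_linear] by metis

lemma altf_swap:
  assumes "altf f"
  shows "f (us @ v # w # vs) = - f (us @ w # v # vs)"
proof -
  have "f (us @ (v + w) # (v + w) # vs) = 0" by (rule altf_adjacent[OF assms])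
  then show ?thesis
    using altf_add[OF assms, of us v w "(v + w) # vs"] altf_add[OF assms, of "us @ [v]" v w vs]
      altf_add[OF assms, of "us @ [w]" v w vs] altf_adjacent[OF assms, of us v vs] altf_adjacent[OF assms, of us w vs]
    by simp
qed

lemma altf_repeated: "altf f \<Longrightarrow> f (us @ v # ws @ v # vs) = 0"
proof (induction ws arbitrary: us)
  case Nil
  then show ?case by (simp add: altf_adjacent)
next
  case (Cons w ws)
  then show ?case using altf_swap[OF Cons.prems, of us v w "ws @ v # vs"] Cons.IH[of "us @ [w]"] by simp
qed

lemma altf_move: "altf f \<Longrightarrow> f (us @ ws @ v # vs) = (- 1) ^ length ws * f (us @ v # ws @ vs)"
proof (induction ws arbitrary: us)
  case (Cons w ws)
  then show ?case using altf_swap[OF Cons.prems, of us w v "ws @ vs"] Cons.IH[of "us @ [w]"] by simp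
qed simp

lemma altf_Cons: "altf f \<Longrightarrow> altf (\<lambda>vs. f (v # vs))"
  using altf_linear[of f "v # _"] altf_adjacent[of f "v # _"] by (simp add: altf_def)

lemma alternating_imp_altf:
  assumes "alternating k f"
  shows "altf f"
proof -
  have len: "f vs = 0" if "length vs \<noteq> k" for vs using assms that by (simp add: alternating_def)
  show ?thesis
    unfolding altf_def
  proof (intro conjI allI)
    fix us vs :: "'a list"
    show "linear (\<lambda>v. f (us @ v # vs))"
    proof (cases "length us + Suc (length vs) = k")
      case True
      then have "linear (\<lambda>v. f ((us @ 0 # vs)[length us := v]))"
        using assms unfolding alternating_def by (metis length_Cons length_append less_add_same_cancel1 zero_less_Suc)
      then show ?thesis by simp
    next
      case False
      then have "(\<lambda>v. f (us @ v # vs)) = (\<lambda>v. 0)" using len by auto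
      then show ?thesis by (simp add: linear_zero)
    qed
    fix v
    show "f (us @ v # v # vs) = 0"
    proof (cases "length us + Suc (Suc (length vs)) = k")
      case True
      have "(us @ v # v # vs) ! length us = (us @ v # v # vs) ! Suc (length us)"
        by (simp add: nth_append)
      moreover have "length us < k" "Suc (length us) < k" "length (us @ v # v # vs) = k"
        using True by auto
      ultimately show ?thesis using assms unfolding alternating_def by (metis n_not_Suc_n)
    next
      case False
      then show ?thesis using len by simp
    qed
  qed
qed

lemma altf_imp_alternating:
  assumes "altf f" "\<And>vs. length vs \<noteq> k \<Longrightarrow> f vs = 0"
  shows "alternating k f"
  unfolding alternating_def
proof (intro conjI allI impI)
  fix vs :: "'a list" and i assume i: "i < k" "length vs = k"
  then have "(\<lambda>v. f (vs[i := v])) = (\<lambda>v. f (take i vs @ v # drop (Suc i) vs))"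
    by (simp add: upd_conv_take_nth_drop)
  then show "linear (\<lambda>v. f (vs[i := v]))" using altf_linear[OF assms(1)] by simp
next
  have *: "f vs = 0" if "length vs = k" "i < j" "j < k" "vs ! i = vs ! j" for vs i j
  proof -
    have "vs = take i vs @ vs ! i # drop (Suc i) vs" using that by (intro id_take_nth_drop) simp
    also have "drop (Suc i) vs = take (j - Suc i) (drop (Suc i) vs) @ drop (Suc i) vs ! (j - Suc i) # drop (Suc (j - Suc i)) (drop (Suc i) vs)"
      using that by (intro id_take_nth_drop) simp
    also have "drop (Suc i) vs ! (j - Suc i) = vs ! i" using that by simp
    finally have "vs = take i vs @ vs ! i # take (j - Suc i) (drop (Suc i) vs) @ vs ! i # drop (Suc (j - Suc i)) (drop (Suc i) vs)" .
    then show ?thesis using altf_repeated[OF assms(1)] by metis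
  qed
  fix vs :: "'a list" and i j
  assume "i < k" "j < k" "length vs = k" "i \<noteq> j" "vs ! i = vs ! j"
  then show "f vs = 0" using *[of vs i j] *[of vs j i] by (metis nat_neq_iff)
qed (rule assms(2))

lemma alternating_iff: "alternating k f \<longleftrightarrow> altf f \<and> (\<forall>vs. length vs \<noteq> k \<longrightarrow> f vs = 0)"
  using alternating_imp_altf altf_imp_alternating by (metis alternating_def)

context smooth_bundle
begin

lemma smooth_form_on_sections:
  assumes U: "(U, g) \<in> E" and P: "\<And>x. altf (P x)"
    and s: "\<And>ws. length ws = k \<Longrightarrow> smooth_map_on M U (\<lambda>x. P x (map (inv (g x)) ws))"
    and Xs: "set Xs \<subseteq> sections M E"
  shows "length ws + length Xs = k \<Longrightarrow>
    smooth_map_on M U (\<lambda>x. P x (map (inv (g x)) ws @ map (\<lambda>X. X x) Xs))"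
  using Xs
proof (induction Xs arbitrary: ws)
  case Nil
  then show ?case using s by simp
next
  case (Cons X Xs)
  obtain B :: "'v set" where B: "orthonormal_basis B" using orthonormal_basis_exists[OF fd] ..
  show ?case
  proof (rule smooth_map_on_cong[OF open_triv[OF U]])
    have "smooth_map_on M U (\<lambda>x. g x (X x))" using Cons.prems U by (auto simp: mem_sections)
    moreover have "smooth_map_on M U (\<lambda>x. P x (map (inv (g x)) ws @ inv (g x) b # map (\<lambda>X. X x) Xs))" for b
      using Cons.IH[of "ws @ [b]"] Cons.prems by simp
    ultimately show "smooth_map_on M U (\<lambda>x. \<Sum>b\<in>B. (b \<bullet> g x (X x)) *
        P x (map (inv (g x)) ws @ inv (g x) b # map (\<lambda>X. X x) Xs))"
      by (intro smooth_map_on_sum smooth_map_on_mult smooth_map_on_inner smooth_map_on_const open_triv[OF U])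
    fix x assume x: "x \<in> U"
    have "linear (\<lambda>v. P x (map (inv (g x)) ws @ inv (g x) v # map (\<lambda>X. X x) Xs))"
      using linear_compose[OF linear_inv_triv[OF U x] altf_linear[OF P]] by (simp add: o_def)
    from linear_basis_expand[OF B this, of "g x (X x)"]
    show "(\<Sum>b\<in>B. (b \<bullet> g x (X x)) * P x (map (inv (g x)) ws @ inv (g x) b # map (\<lambda>X. X x) Xs))
        = P x (map (inv (g x)) ws @ map (\<lambda>X. X x) (X # Xs))"
      by (simp add: inv_triv[OF U x])
  qed
qed

lemma altf_scale_all:
  "altf f \<Longrightarrow> f (us @ map (\<lambda>w. c *\<^sub>R h w) ws) = c ^ length ws * f (us @ map h ws)"
proof (induction ws arbitrary: us)
  case (Cons w ws)
  then show ?case using altf_scale[OF Cons.prems, of us c "h w" "map (\<lambda>w. c *\<^sub>R h w) ws"] Cons.IH[of "us @ [h w]"]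
    by simp
qed simp

text \<open>
  Forms are exactly the fields of alternating functions whose values on global smooth sections are
  smooth. In one direction the arguments are expanded in a local frame; in the other, the frame is cut
  off and the powers of the cutoff are divided out. From here on, forms are
  handled through these values.
\<close>

theorem ext_power_dual: "ext_power M (dual_bundle E) k = {P \<in> Forms M E. of_deg k P}"
proof (intro set_eqI iffI)
  fix P assume P: "P \<in> ext_power M (dual_bundle E) k"
  have alt: "alternating k (P x)" for x using P by (simp add: ext_power_def)
  then have a: "altf (P x)" for x by (simp add: alternating_iff)
  have deg: "of_deg k P" using alt by (simp add: of_deg_def alternating_iff)
  have s: "smooth_map_on M U (\<lambda>x. P x (map (inv (g x)) ws))" if U: "(U, g) \<in> E" "length ws = k" for U g ws
  proof -
    have "smooth_map_on M U (\<lambda>x. P x (map (adjoint (adjoint (inv (g x)))) ws))"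
      using P U by (auto simp: ext_power_def dual_bundle_def)
    then show ?thesis
      by (rule smooth_map_on_cong[OF open_triv[OF U(1)], rotated]) (simp add: dual_triv[OF U(1)])
  qed
  have "ev P Xs \<in> smooth_funs M" if Xs: "set Xs \<subseteq> sections M E" for Xs
  proof (cases "length Xs = k")
    case True
    show ?thesis unfolding smooth_funs_def ev_def
    proof (rule CollectI, rule smooth_map_on_local)
      fix x
      obtain U g where U: "(U, g) \<in> E" "x \<in> U" by (rule triv_at)
      have "smooth_map_on M U (\<lambda>x. P x (map (\<lambda>X. X x) Xs))"
        using smooth_form_on_sections[OF U(1) a s[OF U(1)] Xs, where ws = "[]"] True by simp
      then show "\<exists>V. open V \<and> x \<in> V \<and> smooth_map_on M V (\<lambda>x. P x (map (\<lambda>X. X x) Xs))"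
        using U open_triv[OF U(1)] by (intro exI[of _ U]) simp
    qed
  next
    case False
    then have "ev P Xs = (\<lambda>x. 0)" using deg by (simp add: ev_def of_deg_def)
    then show ?thesis by (simp add: smooth_funs_const)
  qed
  with a deg show "P \<in> {P \<in> Forms M E. of_deg k P}" by (simp add: Forms_def)
next
  fix P assume "P \<in> {P \<in> Forms M E. of_deg k P}"
  then have a: "\<And>x. altf (P x)" and ev: "\<And>Xs. set Xs \<subseteq> sections M E \<Longrightarrow> ev P Xs \<in> smooth_funs M"
    and deg: "of_deg k P" by (auto simp: Forms_def)
  have "smooth_map_on M U (\<lambda>x. P x (map (adjoint (adjoint (inv (g x)))) ws))" if U: "(U, g) \<in> E" for U g ws
  proof (rule smooth_map_on_cong[OF open_triv[OF U]])
    show "smooth_map_on M U (\<lambda>x. P x (map (inv (g x)) ws))"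
    proof (rule smooth_map_on_local_division)
      fix x assume "x \<in> U"
      then obtain \<zeta> C where \<zeta>: "\<zeta> \<in> smooth_funs M" "\<zeta> x = 1" "closed C" "C \<subseteq> U" "\<forall>y. y \<notin> C \<longrightarrow> \<zeta> y = 0"
        using smooth_bump[OF open_triv[OF U]] by metis
      let ?Xs = "map (\<lambda>w x. \<zeta> x *\<^sub>R inv (g x) w) ws"
      have "ev P ?Xs \<in> smooth_funs M"
        using local_frame_sections(1)[OF U \<zeta>(1,3-5)] by (intro ev) auto
      moreover have "ev P ?Xs = (\<lambda>y. \<zeta> y ^ length ws * P y (map (inv (g y)) ws))"
      proof
        fix y
        show "ev P ?Xs y = \<zeta> y ^ length ws * P y (map (inv (g y)) ws)"
          using altf_scale_all[OF a[of y], of "[]" "\<zeta> y" "inv (g y)" ws] by (simp add: ev_def o_def)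
      qed
      moreover have "(\<lambda>y. \<zeta> y ^ n) \<in> smooth_funs M" for n
        by (induction n) (auto intro: smooth_funs_const smooth_funs_mult \<zeta>(1))
      ultimately show "\<exists>\<zeta>\<in>smooth_funs M. \<zeta> x \<noteq> 0 \<and> (\<lambda>y. \<zeta> y * P y (map (inv (g y)) ws)) \<in> smooth_funs M"
        using \<zeta>(2) by (intro bexI[of _ "\<lambda>y. \<zeta> y ^ length ws"]) auto
    qed
  qed (simp add: dual_triv[OF U])
  then show "P \<in> ext_power M (dual_bundle E) k"
    using a deg by (auto simp: ext_power_def alternating_iff of_deg_def dual_bundle_def)
qed

end

section \<open>The wedge product\<close>

lemmas multi_apply = plus_fun_apply zero_fun_apply minus_apply uminus_apply

declare multi_apply [simp del]

lemma multi_apply2 [simp]: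
  fixes P Q :: "'m \<Rightarrow> 'l \<Rightarrow> real"
  shows "(P + Q) x vs = P x vs + Q x vs" "(P - Q) x vs = P x vs - Q x vs" "(- P) x vs = - P x vs"
    "(0 :: 'm \<Rightarrow> 'l \<Rightarrow> real) x vs = 0"
  by (simp_all add: multi_apply)

text \<open>The parity involution, which carries the signs of all graded identities below.\<close>

definition sg :: "('m, 'v) multi \<Rightarrow> ('m, 'v) multi" where
  "sg P = (\<lambda>x vs. (- 1) ^ length vs * P x vs)"

definition fsc :: "('m \<Rightarrow> real) \<Rightarrow> ('m, 'v) multi \<Rightarrow> ('m, 'v) multi" where
  "fsc f P = (\<lambda>x vs. f x * P x vs)"

abbreviation altm :: "('m, 'v::real_vector) multi \<Rightarrow> bool" where
  "altm P \<equiv> (\<forall>x. altf (P x))"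

lemma Pow_lessThan_Suc:
  "Pow {..<Suc n} = (\<lambda>T. insert 0 (Suc ` T)) ` Pow {..<n} \<union> (\<lambda>T. Suc ` T) ` Pow {..<n}"
proof (intro equalityI subsetI)
  fix S assume "S \<in> Pow {..<Suc n}"
  then have S: "S \<subseteq> {..<Suc n}" by auto
  define T where "T = {j. Suc j \<in> S}"
  have T: "T \<in> Pow {..<n}" using S by (auto simp: T_def)
  have ST: "S - {0} = Suc ` T"
    unfolding T_def image_def by (auto simp: gr0_conv_Suc)
  show "S \<in> (\<lambda>T. insert 0 (Suc ` T)) ` Pow {..<n} \<union> (\<lambda>T. Suc ` T) ` Pow {..<n}"
  proof (cases "0 \<in> S")
    case True
    then have "S = insert 0 (Suc ` T)" using ST by auto
    with T show ?thesis by blast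
  next
    case False
    then have "S = Suc ` T" using ST by auto
    with T show ?thesis by blast
  qed
qed auto

lemma shuffle_sign_insert: "shuffle_sign (insert 0 (Suc ` T)) = shuffle_sign T"
proof -
  have "{(i, j). i \<in> insert 0 (Suc ` T) \<and> j \<notin> insert 0 (Suc ` T) \<and> j < i}
      = (\<lambda>(i, j). (Suc i, Suc j)) ` {(i, j). i \<in> T \<and> j \<notin> T \<and> j < i}"
  proof (intro equalityI subsetI)
    fix p assume "p \<in> {(i, j). i \<in> insert 0 (Suc ` T) \<and> j \<notin> insert 0 (Suc ` T) \<and> j < i}"
    then obtain i j where p: "p = (Suc i, j)" "i \<in> T" "j \<notin> insert 0 (Suc ` T)" "j < Suc i" by auto
    then obtain k where "j = Suc k" by (cases j) auto
    with p show "p \<in> (\<lambda>(i, j). (Suc i, Suc j)) ` {(i, j). i \<in> T \<and> j \<notin> T \<and> j < i}"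
      by (intro image_eqI[of _ _ "(i, k)"]) auto
  qed auto
  moreover have "inj_on (\<lambda>(i, j). (Suc i, Suc j)) X" for X by (auto simp: inj_on_def)
  ultimately show ?thesis by (simp add: shuffle_sign_def card_image)
qed

lemma shuffle_sign_shift:
  assumes "finite T"
  shows "shuffle_sign (Suc ` T) = (- 1) ^ card T * shuffle_sign T"
proof -
  let ?A = "{(i, j). i \<in> T \<and> j \<notin> T \<and> j < i}"
  have fA: "finite ?A"
    by (rule finite_subset[of _ "Sigma T (\<lambda>i. {..<i})"]) (use assms in auto)
  have "{(i, j). i \<in> Suc ` T \<and> j \<notin> Suc ` T \<and> j < i}
      = (\<lambda>(i, j). (Suc i, Suc j)) ` ?A \<union> (\<lambda>i. (Suc i, 0)) ` T"
  proof (intro equalityI subsetI)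
    fix p assume "p \<in> {(i, j). i \<in> Suc ` T \<and> j \<notin> Suc ` T \<and> j < i}"
    then obtain i j where p: "p = (Suc i, j)" "i \<in> T" "j \<notin> Suc ` T" "j < Suc i" by auto
    show "p \<in> (\<lambda>(i, j). (Suc i, Suc j)) ` ?A \<union> (\<lambda>i. (Suc i, 0)) ` T"
    proof (cases j)
      case (Suc k)
      with p have "(i, k) \<in> ?A" by auto
      then have "(Suc i, Suc k) \<in> (\<lambda>(i, j). (Suc i, Suc j)) ` ?A"
        by (intro image_eqI[of _ _ "(i, k)"]) auto
      with p Suc show ?thesis by auto
    qed (use p in auto)
  qed auto
  moreover have "card ((\<lambda>(i, j). (Suc i, Suc j)) ` ?A \<union> (\<lambda>i. (Suc i, 0)) ` T) = card ?A + card T"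
    using fA assms by (subst card_Un_disjoint) (auto simp: card_image inj_on_def)
  ultimately show ?thesis by (simp add: shuffle_sign_def power_add)
qed

lemma wedge_Nil: "(P \<and>\<and> Q) x [] = P x [] * Q x []"
proof -
  have e: "{(i::nat, j). False} = {}" by auto
  show ?thesis by (simp add: wedge_def shuffle_sign_def e)
qed

text \<open>
  Separating the shuffles according to the factor that receives the first argument yields a recursion
  over the argument list. With it, associativity, graded commutativity and all derivation rules reduce
  to short inductions without any combinatorics of shuffles.
\<close>

lemma wedge_Cons: "(P \<and>\<and> Q) x (v # vs) = (ins (\<lambda>_. v) P \<and>\<and> Q) x vs + (sg P \<and>\<and> ins (\<lambda>_. v) Q) x vs"
proof -
  let ?n = "length vs" and ?f = "\<lambda>T::nat set. insert 0 (Suc ` T)" and ?g = "\<lambda>T::nat set. Suc ` T"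
  let ?h = "\<lambda>S. shuffle_sign S * P x (nths (v # vs) S) * Q x (nths (v # vs) (- S))"
  have inj: "inj_on ?f (Pow {..<?n})" "inj_on ?g (Pow {..<?n})"
    unfolding inj_on_def by (auto simp: set_eq_iff)
  have n1: "nths (v # vs) (?f T) = v # nths vs T" "nths (v # vs) (- ?f T) = nths vs (- T)"
    "nths (v # vs) (?g T) = nths vs T" "nths (v # vs) (- ?g T) = v # nths vs (- T)" for T
  proof -
    have "{j. Suc j \<in> ?f T} = T" "{j. Suc j \<in> - ?f T} = - T" "{j. Suc j \<in> ?g T} = T" "{j. Suc j \<in> - ?g T} = - T"
      by auto
    then show "nths (v # vs) (?f T) = v # nths vs T" "nths (v # vs) (- ?f T) = nths vs (- T)"
      "nths (v # vs) (?g T) = nths vs T" "nths (v # vs) (- ?g T) = v # nths vs (- T)"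
      by (simp_all only: nths_Cons) auto
  qed
  have "(P \<and>\<and> Q) x (v # vs) = (\<Sum>S\<in>Pow {..<Suc ?n}. ?h S)" by (simp add: wedge_def)
  also have "\<dots> = (\<Sum>S\<in>?f ` Pow {..<?n}. ?h S) + (\<Sum>S\<in>?g ` Pow {..<?n}. ?h S)"
    unfolding Pow_lessThan_Suc by (rule sum.union_disjoint) auto
  also have "(\<Sum>S\<in>?f ` Pow {..<?n}. ?h S) = (\<Sum>T\<in>Pow {..<?n}. ?h (?f T))"
    by (rule sum.reindex_cong[OF inj(1) refl refl])
  also have "\<dots> = (ins (\<lambda>_. v) P \<and>\<and> Q) x vs"
    by (simp only: n1 shuffle_sign_insert) (simp add: wedge_def ins_def)
  also have "(\<Sum>S\<in>?g ` Pow {..<?n}. ?h S) = (\<Sum>T\<in>Pow {..<?n}. ?h (?g T))"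
    by (rule sum.reindex_cong[OF inj(2) refl refl])
  also have "\<dots> = (sg P \<and>\<and> ins (\<lambda>_. v) Q) x vs"
  proof -
    have "shuffle_sign (?g T) = (- 1) ^ length (nths vs T) * shuffle_sign T" if "T \<in> Pow {..<?n}" for T
    proof -
      have "{i. i < length vs \<and> i \<in> T} = T" using that by auto
      then have "length (nths vs T) = card T" by (simp add: length_nths)
      moreover have "finite T" using that finite_subset by auto
      ultimately show ?thesis by (simp add: shuffle_sign_shift)
    qed
    then show ?thesis by (simp only: n1) (simp add: wedge_def ins_def sg_def mult_ac)
  qed
  finally show ?thesis .
qed

lemma wedge_local: "P x = P' x \<Longrightarrow> Q x = Q' x \<Longrightarrow> (P \<and>\<and> Q) x = (P' \<and>\<and> Q') x"
  by (simp add: wedge_def)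

lemma ins_wedge: "ins X (P \<and>\<and> Q) = (ins X P \<and>\<and> Q) + (sg P \<and>\<and> ins X Q)"
proof (intro ext)
  fix x vs
  have "(ins (\<lambda>_. X x) P \<and>\<and> Q) x = (ins X P \<and>\<and> Q) x" "(sg P \<and>\<and> ins (\<lambda>_. X x) Q) x = (sg P \<and>\<and> ins X Q) x"
    by (rule wedge_local; simp add: ins_def)+
  then show "ins X (P \<and>\<and> Q) x vs = ((ins X P \<and>\<and> Q) + (sg P \<and>\<and> ins X Q)) x vs"
    using wedge_Cons[of P Q x "X x" vs] by (simp add: ins_def)
qed

lemma ev_Nil: "ev P [] = (\<lambda>x. P x [])"
  and ev_Cons: "ev P (X # Xs) = ev (ins X P) Xs"
  and ev_add: "ev (P + Q) Xs = (\<lambda>x. ev P Xs x + ev Q Xs x)"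
  and ev_diff: "ev (P - Q) Xs = (\<lambda>x. ev P Xs x - ev Q Xs x)"
  and ev_minus: "ev (- P) Xs = (\<lambda>x. - ev P Xs x)"
  and ev_zero: "ev 0 Xs = (\<lambda>x. 0)"
  and ev_fsc: "ev (fsc f P) Xs = (\<lambda>x. f x * ev P Xs x)"
  and ev_sg: "ev (sg P) Xs = (\<lambda>x. (- 1) ^ length Xs * ev P Xs x)"
  by (simp_all add: ev_def ins_def fsc_def sg_def fun_eq_iff multi_apply)

lemma ins_add: "ins X (P + Q) = ins X P + ins X Q"
  and ins_minus: "ins X (- P) = - ins X P"
  and ins_zero: "ins X 0 = 0"
  and ins_fsc: "ins X (fsc f P) = fsc f (ins X P)"
  and ins_sg: "ins X (sg P) = - sg (ins X P)"
  and ins_of_fun: "ins X (of_fun f) = 0"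
  by (simp_all add: ins_def fsc_def sg_def of_fun_def fun_eq_iff multi_apply)

lemma ins_of_sec: "ins X (of_sec \<alpha>) = of_fun (\<lambda>x. \<alpha> x \<bullet> X x)"
  by (auto simp: ins_def of_fun_def of_sec_def fun_eq_iff multi_apply split: list.splits)

lemma sg_add: "sg (P + Q) = sg P + sg Q"
  and sg_zero: "sg 0 = 0"
  and sg_sg: "sg (sg P) = P"
  and sg_of_fun: "sg (of_fun f) = of_fun f"
  by (simp_all add: fsc_def sg_def of_fun_def fun_eq_iff multi_apply algebra_simps flip: power_add mult_2)

lemma sg_of_sec: "sg (of_sec \<alpha>) = - of_sec \<alpha>"
  by (auto simp: sg_def of_sec_def fun_eq_iff multi_apply split: list.splits)

lemma wedge_add_left: "(P + P') \<and>\<and> Q = (P \<and>\<and> Q) + (P' \<and>\<and> Q)"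
  and wedge_add_right: "P \<and>\<and> (Q + Q') = (P \<and>\<and> Q) + (P \<and>\<and> Q')"
  and wedge_diff_left: "(P - P') \<and>\<and> Q = (P \<and>\<and> Q) - (P' \<and>\<and> Q)"
  and wedge_diff_right: "P \<and>\<and> (Q - Q') = (P \<and>\<and> Q) - (P \<and>\<and> Q')"
  and wedge_minus_left: "(- P) \<and>\<and> Q = - (P \<and>\<and> Q)"
  and wedge_minus_right: "P \<and>\<and> (- Q) = - (P \<and>\<and> Q)"
  and wedge_zero_left: "0 \<and>\<and> Q = 0"
  and wedge_zero_right: "P \<and>\<and> 0 = 0"
  and wedge_fsc_left: "fsc f P \<and>\<and> Q = fsc f (P \<and>\<and> Q)"
  and wedge_fsc_right: "P \<and>\<and> fsc f Q = fsc f (P \<and>\<and> Q)"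
  by (simp_all add: wedge_def fsc_def fun_eq_iff multi_apply algebra_simps sum.distrib sum_subtractf sum_negf sum_distrib_left)

lemma wedge_sum_left: "(\<Sum>i\<in>I. P i) \<and>\<and> Q = (\<Sum>i\<in>I. P i \<and>\<and> Q)"
  and wedge_sum_right: "Q \<and>\<and> (\<Sum>i\<in>I. P i) = (\<Sum>i\<in>I. Q \<and>\<and> P i)"
  by (induction I rule: infinite_finite_induct)
    (simp_all add: wedge_add_left wedge_add_right wedge_zero_left wedge_zero_right)

lemma ins_sum: "ins X (\<Sum>i\<in>I. P i) = (\<Sum>i\<in>I. ins X (P i))"
  by (induction I rule: infinite_finite_induct) (simp_all add: ins_add ins_zero del: multi_apply2)

text \<open>
  The recursion replaces the factors of a product by their insertions. An induction on the argument list
  therefore has to be carried out for all factors at once, pointwise.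
\<close>

lemma sg_wedge: "sg (P \<and>\<and> Q) = sg P \<and>\<and> sg Q"
proof -
  have "sg (P \<and>\<and> Q) x vs = (sg P \<and>\<and> sg Q) x vs" for x vs
  proof (induction vs arbitrary: P Q)
    case Nil
    show ?case by (simp add: sg_def wedge_Nil)
  next
    case (Cons v vs)
    have "sg (P \<and>\<and> Q) x (v # vs) = - sg (ins (\<lambda>_. v) P \<and>\<and> Q) x vs - sg (sg P \<and>\<and> ins (\<lambda>_. v) Q) x vs"
      by (simp add: sg_def wedge_Cons algebra_simps)
    also have "\<dots> = (sg P \<and>\<and> sg Q) x (v # vs)"
      by (simp add: Cons.IH wedge_Cons ins_sg wedge_minus_left wedge_minus_right)
    finally show ?case .
  qed
  then show ?thesis by (simp add: fun_eq_iff multi_apply)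
qed

lemma wedge_assoc: "(P \<and>\<and> Q) \<and>\<and> R = P \<and>\<and> (Q \<and>\<and> R)"
proof -
  have "((P \<and>\<and> Q) \<and>\<and> R) x vs = (P \<and>\<and> (Q \<and>\<and> R)) x vs" for x vs
  proof (induction vs arbitrary: P Q R)
    case (Cons v vs)
    show ?case
      by (simp add: wedge_Cons ins_wedge wedge_add_left wedge_add_right sg_wedge Cons.IH)
  qed (simp add: wedge_Nil)
  then show ?thesis by (simp add: fun_eq_iff multi_apply)
qed

lemma of_fun_wedge: "of_fun f \<and>\<and> P = fsc f P"
proof -
  have "(of_fun f \<and>\<and> P) x vs = f x * P x vs" for x vs
  proof (induction vs arbitrary: P)
    case (Cons v vs)
    show ?case by (simp add: wedge_Cons ins_of_fun sg_of_fun wedge_zero_left Cons.IH) (simp add: ins_def)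
  qed (simp add: wedge_Nil of_fun_def)
  then show ?thesis by (simp add: fun_eq_iff multi_apply fsc_def)
qed

lemma of_deg_sg: "of_deg p P \<Longrightarrow> sg P = (if even p then P else - P)"
  by (intro ext, rename_tac x vs, case_tac "length vs = p") (auto simp: of_deg_def sg_def)

lemma of_deg_ins: "of_deg (Suc p) P \<Longrightarrow> of_deg p (ins X P)"
  and of_deg_0_ins: "of_deg 0 P \<Longrightarrow> ins X P = 0"
  and of_deg_add: "of_deg p P \<Longrightarrow> of_deg p Q \<Longrightarrow> of_deg p (P + Q)"
  and of_deg_minus: "of_deg p P \<Longrightarrow> of_deg p (- P)"
  and of_deg_zero: "of_deg p 0"
  and of_deg_fsc: "of_deg p P \<Longrightarrow> of_deg p (fsc f P)"
  and of_deg_of_fun: "of_deg 0 (of_fun f)"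
  by (simp_all add: of_deg_def ins_def fsc_def of_fun_def fun_eq_iff multi_apply)

lemma of_deg_of_sec: "of_deg 1 (of_sec \<alpha>)"
  by (auto simp: of_deg_def of_sec_def split: list.splits)

lemma of_deg_sum: "(\<And>i. i \<in> I \<Longrightarrow> of_deg p (P i)) \<Longrightarrow> of_deg p (\<Sum>i\<in>I. P i)"
  by (induction I rule: infinite_finite_induct) (simp_all add: of_deg_zero of_deg_add)

lemma of_deg_wedge: "of_deg p P \<Longrightarrow> of_deg q Q \<Longrightarrow> of_deg (p + q) (P \<and>\<and> Q)"
proof -
  have "length vs \<noteq> p + q \<Longrightarrow> of_deg p P \<Longrightarrow> of_deg q Q \<Longrightarrow> (P \<and>\<and> Q) x vs = 0" for vs x
  proof (induction vs arbitrary: p q P Q)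
    case Nil
    then show ?case by (auto simp: wedge_Nil of_deg_def)
  next
    case (Cons v vs)
    have sgP: "of_deg p (sg P)" using Cons.prems(2) by (simp add: of_deg_def sg_def)
    have "(ins (\<lambda>_. v) P \<and>\<and> Q) x vs = 0"
    proof (cases p)
      case 0
      with Cons.prems(2) show ?thesis by (simp add: of_deg_0_ins wedge_zero_left)
    next
      case (Suc p')
      with Cons.prems show ?thesis by (intro Cons.IH[of p' q] of_deg_ins) auto
    qed
    moreover have "(sg P \<and>\<and> ins (\<lambda>_. v) Q) x vs = 0"
    proof (cases q)
      case 0
      with Cons.prems(3) show ?thesis by (simp add: of_deg_0_ins wedge_zero_right)
    next
      case (Suc q')
      with Cons.prems sgP show ?thesis by (intro Cons.IH[of p q'] of_deg_ins) auto
    qed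
    ultimately show ?case by (simp add: wedge_Cons)
  qed
  then show "of_deg p P \<Longrightarrow> of_deg q Q \<Longrightarrow> of_deg (p + q) (P \<and>\<and> Q)" by (simp add: of_deg_def)
qed

lemma wedge_commute:
  assumes "of_deg p P" "of_deg q Q"
  shows "P \<and>\<and> Q = (if even (p * q) then Q \<and>\<and> P else - (Q \<and>\<and> P))"
proof -
  have "(P \<and>\<and> Q) x vs = (- 1) ^ (p * q) * (Q \<and>\<and> P) x vs" for x vs
    using assms
  proof (induction vs arbitrary: p q P Q)
    case Nil
    then show ?case by (cases "p = 0 \<or> q = 0") (auto simp: wedge_Nil of_deg_def)
  next
    case (Cons v vs)
    have sgP: "(sg P \<and>\<and> R) x vs = (- 1) ^ p * (P \<and>\<and> R) x vs"
      and sgQ: "(sg Q \<and>\<and> R) x vs = (- 1) ^ q * (Q \<and>\<and> R) x vs" for R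
      using Cons.prems by (simp_all add: of_deg_sg wedge_minus_left)
    have 1: "(ins (\<lambda>_. v) P \<and>\<and> Q) x vs = (- 1) ^ (p * q) * ((- 1) ^ q * (Q \<and>\<and> ins (\<lambda>_. v) P) x vs)"
    proof (cases p)
      case 0
      with Cons.prems(1) show ?thesis by (simp add: of_deg_0_ins wedge_zero_left wedge_zero_right)
    next
      case (Suc p')
      with Cons.IH[of p' "ins (\<lambda>_. v) P" q Q] Cons.prems show ?thesis
        by (cases "even q"; cases "even p'") (simp_all add: of_deg_ins)
    qed
    have 2: "(P \<and>\<and> ins (\<lambda>_. v) Q) x vs = (- 1) ^ (p * q) * ((- 1) ^ p * (ins (\<lambda>_. v) Q \<and>\<and> P) x vs)"
    proof (cases q)
      case 0
      with Cons.prems(2) show ?thesis by (simp add: of_deg_0_ins wedge_zero_left wedge_zero_right)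
    next
      case (Suc q')
      with Cons.IH[of p P q' "ins (\<lambda>_. v) Q"] Cons.prems show ?thesis
        by (cases "even p"; cases "even q'") (simp_all add: of_deg_ins)
    qed
    show ?case
      by (simp add: wedge_Cons sgP sgQ 1 2) (cases "even p"; cases "even q"; simp)
  qed
  then show ?thesis by (cases "even (p * q)") (simp_all add: fun_eq_iff multi_apply)
qed

section \<open>Closure properties of alternating forms\<close>

lemma altm_add: "altm P \<Longrightarrow> altm Q \<Longrightarrow> altm (P + Q)"
  by (simp add: altf_def linear_compose_add multi_apply)

lemma linear_mult_const: "linear f \<Longrightarrow> linear (\<lambda>v. c * f v :: real)"
  using linear_compose_scale_right[of f c] by simp

lemma altm_fsc: "altm P \<Longrightarrow> altm (fsc f P)"
  by (simp add: altf_def fsc_def linear_mult_const)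

lemma altm_sg: "altm P \<Longrightarrow> altm (sg P)"
  unfolding altf_def sg_def by (simp add: linear_mult_const del: power_Suc add: power_add)

lemma altm_minus: "altm P \<Longrightarrow> altm (- P)"
  by (simp add: altf_def linear_compose_neg multi_apply)

lemma altm_zero: "altm 0"
  by (simp add: altf_def linear_zero multi_apply)

lemma altm_ins: "altm P \<Longrightarrow> altm (ins X P)"
  by (simp add: ins_def altf_Cons)

lemma altm_of_fun: "altm (of_fun f)"
  by (auto simp: altf_def of_fun_def linear_zero)

lemma altm_of_sec: "altm (of_sec \<alpha>)"
proof -
  have "linear (\<lambda>v. of_sec \<alpha> x (us @ v # vs))" for x us vs
  proof (cases "us = [] \<and> vs = []")
    case True
    then show ?thesis by (simp add: of_sec_def bounded_linear.linear[OF bounded_linear_inner_right])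
  next
    case False
    then have "(\<lambda>v. of_sec \<alpha> x (us @ v # vs)) = (\<lambda>v. 0)"
      by (auto simp: of_sec_def fun_eq_iff multi_apply split: list.splits) (auto simp: append_eq_Cons_conv)
    then show ?thesis by (simp add: linear_zero)
  qed
  moreover have "of_sec \<alpha> x (us @ v # v # vs) = 0" for x us v vs
    by (auto simp: of_sec_def split: list.splits)
  ultimately show ?thesis by (simp add: altf_def)
qed

lemma ins_plus:
  assumes "altm P"
  shows "ins (\<lambda>x. X x + Y x) P = ins X P + ins Y P"
  using altf_add[of "P _" "[]"] assms by (simp add: ins_def fun_eq_iff multi_apply)

lemma ins_scale:
  assumes "altm P"
  shows "ins (\<lambda>x. f x *\<^sub>R X x) P = fsc f (ins X P)"
  using altf_scale[of "P _" "[]"] assms by (simp add: ins_def fsc_def fun_eq_iff multi_apply)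

lemma ins_zero_section:
  assumes "altm P"
  shows "ins (\<lambda>x. 0) P = 0"
  using altf_zero[of "P _" "[]"] assms by (simp add: ins_def fun_eq_iff multi_apply)

lemma ins_sum_section:
  assumes "altm P"
  shows "ins (\<lambda>x. \<Sum>i\<in>I. X i x) P = (\<Sum>i\<in>I. ins (X i) P)"
  by (induction I rule: infinite_finite_induct) (simp_all add: ins_zero_section[OF assms] ins_plus[OF assms])

lemma ins_swap:
  assumes "altm P"
  shows "ins X (ins Y P) = - ins Y (ins X P)"
proof (intro ext)
  show "ins X (ins Y P) x vs = (- ins Y (ins X P)) x vs" for x vs
    using altf_swap[of "P x" "[]" "Y x" "X x" vs] assms by (simp add: ins_def)
qed

lemma ins_ins: "altm P \<Longrightarrow> ins X (ins X P) = 0"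
  using altf_adjacent[of "P _" "[]"] by (simp add: ins_def fun_eq_iff multi_apply)

lemma fsc_add: "fsc f (P + Q) = fsc f P + fsc f Q"
  and fsc_zero: "fsc f 0 = 0"
  by (simp_all add: fsc_def fun_eq_iff multi_apply algebra_simps)

lemma altm_wedge:
  assumes "altm P" "altm Q"
  shows "altm (P \<and>\<and> Q)"
proof
  fix x
  have "linear (\<lambda>v. (P \<and>\<and> Q) x (us @ v # vs))" for us vs
    using assms
  proof (induction us arbitrary: P Q)
    case Nil
    show ?case
      using Nil
      by (auto intro!: linearI simp: wedge_Cons ins_plus altm_sg wedge_add_left wedge_add_right
          ins_scale[where f = "\<lambda>_. _"] wedge_fsc_left wedge_fsc_right)
        (simp add: fsc_def algebra_simps)
  next
    case (Cons u us)
    then show ?case by (simp add: wedge_Cons linear_compose_add altm_ins altm_sg)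
  qed
  moreover have "(P \<and>\<and> Q) x (us @ v # v # vs) = 0" for us v vs
    using assms
  proof (induction us arbitrary: P Q)
    case Nil
    then show ?case
      by (simp add: wedge_Cons ins_ins ins_sg sg_sg wedge_zero_left wedge_zero_right wedge_minus_left)
  next
    case (Cons u us)
    then show ?case by (simp add: wedge_Cons altm_ins altm_sg)
  qed
  ultimately show "altf ((P \<and>\<and> Q) x)" by (simp add: altf_def)
qed

context smooth_bundle
begin

lemma FormsI: "altm P \<Longrightarrow> (\<And>Xs. set Xs \<subseteq> sections M E \<Longrightarrow> ev P Xs \<in> smooth_funs M) \<Longrightarrow> P \<in> Forms M E"
  and Forms_altm: "P \<in> Forms M E \<Longrightarrow> altm P"
  and Forms_smooth: "P \<in> Forms M E \<Longrightarrow> set Xs \<subseteq> sections M E \<Longrightarrow> ev P Xs \<in> smooth_funs M"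
  by (auto simp: Forms_def)

lemma Forms_add: "P \<in> Forms M E \<Longrightarrow> Q \<in> Forms M E \<Longrightarrow> P + Q \<in> Forms M E"
  by (rule FormsI[OF altm_add[OF Forms_altm Forms_altm]]) (simp_all add: ev_add smooth_funs_add Forms_smooth)

lemma Forms_fsc: "f \<in> smooth_funs M \<Longrightarrow> P \<in> Forms M E \<Longrightarrow> fsc f P \<in> Forms M E"
  by (rule FormsI[OF altm_fsc[OF Forms_altm]]) (simp_all add: ev_fsc smooth_funs_mult Forms_smooth)

lemma Forms_minus: "P \<in> Forms M E \<Longrightarrow> - P \<in> Forms M E"
  by (rule FormsI[OF altm_minus[OF Forms_altm]]) (simp_all add: ev_minus smooth_funs_minus Forms_smooth)

lemma Forms_zero: "0 \<in> Forms M E"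
  by (rule FormsI[OF altm_zero]) (simp add: ev_zero smooth_funs_const)

lemma Forms_sum: "(\<And>i. i \<in> I \<Longrightarrow> P i \<in> Forms M E) \<Longrightarrow> (\<Sum>i\<in>I. P i) \<in> Forms M E"
  by (induction I rule: infinite_finite_induct) (simp_all add: Forms_zero Forms_add)

lemma Forms_sg: "P \<in> Forms M E \<Longrightarrow> sg P \<in> Forms M E"
  by (rule FormsI[OF altm_sg[OF Forms_altm]]) (simp_all add: ev_sg smooth_funs_mult smooth_funs_const Forms_smooth)

lemma Forms_ins: "X \<in> sections M E \<Longrightarrow> P \<in> Forms M E \<Longrightarrow> ins X P \<in> Forms M E"
  by (rule FormsI[OF altm_ins[OF Forms_altm]]) (simp_all add: Forms_smooth flip: ev_Cons)

lemma Forms_wedge: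
  assumes "P \<in> Forms M E" "Q \<in> Forms M E"
  shows "P \<and>\<and> Q \<in> Forms M E"
proof (rule FormsI[OF altm_wedge[OF Forms_altm[OF assms(1)] Forms_altm[OF assms(2)]]])
  fix Xs assume "set Xs \<subseteq> sections M E"
  then show "ev (P \<and>\<and> Q) Xs \<in> smooth_funs M"
    using assms
  proof (induction Xs arbitrary: P Q)
    case Nil
    then show ?case using Forms_smooth[of P "[]"] Forms_smooth[of Q "[]"]
      by (simp add: ev_Nil wedge_Nil smooth_funs_mult)
  next
    case (Cons X Xs)
    then show ?case by (simp add: ev_Cons ins_wedge ev_add smooth_funs_add Forms_ins Forms_sg)
  qed
qed

lemma Forms_of_fun: "of_fun f \<in> Forms M E \<longleftrightarrow> f \<in> smooth_funs M"
proof
  assume "of_fun f \<in> Forms M E"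
  from Forms_smooth[OF this, of "[]"] show "f \<in> smooth_funs M" by (simp add: ev_Nil of_fun_def)
next
  assume f: "f \<in> smooth_funs M"
  show "of_fun f \<in> Forms M E"
  proof (rule FormsI)
    show "ev (of_fun f) Xs \<in> smooth_funs M" for Xs
      using f smooth_funs_const by (cases Xs) (simp_all add: ev_def of_fun_def)
  qed (rule altm_of_fun)
qed

lemma Forms_of_sec: "of_sec \<alpha> \<in> Forms M E \<longleftrightarrow> \<alpha> \<in> sections M (dual_bundle E)"
proof
  assume "of_sec \<alpha> \<in> Forms M E"
  from Forms_smooth[OF this, of "[_]"] show "\<alpha> \<in> sections M (dual_bundle E)"
    unfolding dual_sections_iff by (simp add: ev_def of_sec_def)
next
  assume \<alpha>: "\<alpha> \<in> sections M (dual_bundle E)"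
  show "of_sec \<alpha> \<in> Forms M E"
  proof (rule FormsI)
    fix Xs assume "set Xs \<subseteq> sections M E"
    then show "ev (of_sec \<alpha>) Xs \<in> smooth_funs M"
    proof (cases Xs)
      case (Cons X Ys)
      with \<open>set Xs \<subseteq> sections M E\<close> \<alpha> show ?thesis
        by (cases Ys) (simp_all add: ev_def of_sec_def smooth_funs_pairing smooth_funs_const)
    qed (simp add: ev_def of_sec_def smooth_funs_const)
  qed (rule altm_of_sec)
qed

lemma of_sec_to_sec:
  fixes P :: "('m, 'v) multi"
  assumes "altm P" "of_deg 1 P"
  shows "of_sec (to_sec P) = P"
proof (intro ext)
  fix x vs
  show "of_sec (to_sec P) x vs = P x vs"
  proof (cases "length vs = 1")
    case True
    then obtain v where v: "vs = [v]" by (cases vs) auto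
    have "linear (\<lambda>v. P x [v])" using altf_linear[of "P x" "[]" "[]"] assms(1) by simp
    then show ?thesis using v riesz_inner[OF fd] by (simp add: of_sec_def to_sec_def)
  next
    case False
    then show ?thesis using assms(2) by (auto simp: of_sec_def of_deg_def split: list.splits)
  qed
qed

lemma to_sec_of_sec: "to_sec (of_sec \<alpha>) = (\<alpha> :: 'm \<Rightarrow> 'v)"
proof (rule ext)
  fix x
  have l: "linear (\<lambda>v. \<alpha> x \<bullet> v)" by (simp add: bounded_linear.linear[OF bounded_linear_inner_right])
  show "to_sec (of_sec \<alpha>) x = \<alpha> x"
    by (rule eq_iff_inner[THEN iffD2, OF allI]) (simp add: to_sec_def of_sec_def riesz_inner[OF fd l])
qed

lemma of_deg_0_eq: "of_deg 0 P \<Longrightarrow> P = of_fun (\<lambda>x. P x [])"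
  by (auto simp: of_deg_def of_fun_def fun_eq_iff multi_apply)

text \<open>
  Through every vector of a fibre passes a global section, so evaluation on global sections separates
  points. Identities between forms are proved in this way.
\<close>

lemma multi_eqI:
  assumes "\<And>Xs. set Xs \<subseteq> sections M E \<Longrightarrow> ev P Xs = ev Q Xs"
  shows "P = Q"
proof (intro ext)
  fix x vs
  have "\<exists>Xs. set Xs \<subseteq> sections M E \<and> map (\<lambda>X. X x) Xs = vs"
  proof (induction vs)
    case (Cons v vs)
    then obtain Xs where "set Xs \<subseteq> sections M E" "map (\<lambda>X. X x) Xs = vs" by auto
    moreover obtain X where "X \<in> sections M E" "X x = v" by (rule section_through)
    ultimately show ?case by (intro exI[of _ "X # Xs"]) auto
  qed simp
  then obtain Xs where "set Xs \<subseteq> sections M E" "map (\<lambda>X. X x) Xs = vs" by auto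
  with fun_cong[OF assms[of Xs], of x] show "P x vs = Q x vs" by (simp add: ev_def)
qed

end

declare multi_apply2 [simp del]

section \<open>Tensorial operations on sections\<close>

context smooth_bundle
begin

text \<open>
  An operation on sections that is linear over the smooth functions in every argument comes from a
  field of multilinear functions. This is how a form is obtained from a formula that involves
  derivatives of the arguments.
\<close>

definition tensorial :: "(('m \<Rightarrow> 'v) list \<Rightarrow> 'm \<Rightarrow> real) \<Rightarrow> bool" where
  "tensorial F \<longleftrightarrow> (\<forall>Us Vs. set Us \<subseteq> sections M E \<longrightarrow> set Vs \<subseteq> sections M E \<longrightarrow>
     (\<forall>X\<in>sections M E.
        (\<forall>Y\<in>sections M E. F (Us @ (\<lambda>x. X x + Y x) # Vs) = (\<lambda>x. F (Us @ X # Vs) x + F (Us @ Y # Vs) x)) \<and>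
        (\<forall>f\<in>smooth_funs M. F (Us @ (\<lambda>x. f x *\<^sub>R X x) # Vs) = (\<lambda>x. f x * F (Us @ X # Vs) x))))"

definition section_at :: "'m \<Rightarrow> 'v \<Rightarrow> 'm \<Rightarrow> 'v" where
  "section_at x v = (SOME X. X \<in> sections M E \<and> X x = v)"

definition tens :: "(('m \<Rightarrow> 'v) list \<Rightarrow> 'm \<Rightarrow> real) \<Rightarrow> ('m, 'v) multi" where
  "tens F = (\<lambda>x vs. F (map (section_at x) vs) x)"

lemma section_at: "section_at x v \<in> sections M E" "section_at x v x = v"
proof -
  obtain X where "X \<in> sections M E \<and> X x = v" using section_through by metis
  from someI[of "\<lambda>X. X \<in> sections M E \<and> X x = v", OF this]
  show "section_at x v \<in> sections M E" "section_at x v x = v" by (simp_all add: section_at_def)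
qed

lemma
  assumes "tensorial F" "set Us \<subseteq> sections M E" "set Vs \<subseteq> sections M E" "X \<in> sections M E"
  shows tensorial_add: "Y \<in> sections M E \<Longrightarrow> F (Us @ (\<lambda>x. X x + Y x) # Vs) = (\<lambda>x. F (Us @ X # Vs) x + F (Us @ Y # Vs) x)"
    and tensorial_scale: "f \<in> smooth_funs M \<Longrightarrow> F (Us @ (\<lambda>x. f x *\<^sub>R X x) # Vs) = (\<lambda>x. f x * F (Us @ X # Vs) x)"
  using assms unfolding tensorial_def by blast+

lemma tensorial_zero:
  assumes "tensorial F" "set Us \<subseteq> sections M E" "set Vs \<subseteq> sections M E"
  shows "F (Us @ (\<lambda>x. 0) # Vs) = (\<lambda>x. 0)"
  using tensorial_scale[OF assms sections_zero smooth_funs_const[of 0]] by simp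

lemma tensorial_sum:
  assumes "tensorial F" "set Us \<subseteq> sections M E" "set Vs \<subseteq> sections M E" "\<forall>i. X i \<in> sections M E"
  shows "F (Us @ (\<lambda>x. \<Sum>i\<in>I. X i x) # Vs) = (\<lambda>x. \<Sum>i\<in>I. F (Us @ X i # Vs) x)"
proof (induction I rule: infinite_finite_induct)
  case (insert i I)
  have "(\<lambda>x. \<Sum>i\<in>I. X i x) \<in> sections M E" using assms(4) by (intro sections_sum) simp
  with insert tensorial_add[OF assms(1-3)] assms(4) show ?case by simp
qed (simp_all add: tensorial_zero[OF assms(1-3)])

text \<open>
  The value at \<open>x\<close> only depends on the value of the argument at \<open>x\<close>: expand the argument in the
  partial frame around \<open>x\<close>.
\<close>

lemma tensorial_slot:
  assumes F: "tensorial F" and Us: "set Us \<subseteq> sections M E" and Vs: "set Vs \<subseteq> sections M E"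
    and X: "X \<in> sections M E" "Y \<in> sections M E" "X x = Y x"
  shows "F (Us @ X # Vs) x = F (Us @ Y # Vs) x"
proof -
  obtain \<zeta> B e \<theta> where fr: "\<zeta> \<in> smooth_funs M" "\<zeta> x = 1" "finite (B :: 'v set)"
    "\<forall>b. e b \<in> sections M E" "\<forall>b. \<theta> b \<in> sections M (dual_bundle E)"
    "\<forall>y v. (\<Sum>b\<in>B. (\<theta> b y \<bullet> v) *\<^sub>R e b y) = \<zeta> y *\<^sub>R v"
    by (rule frame_at[of x])
  have *: "F (Us @ Z # Vs) x = (\<Sum>b\<in>B. (\<theta> b x \<bullet> Z x) * F (Us @ e b # Vs) x)" if Z: "Z \<in> sections M E" for Z
  proof -
    have c: "(\<lambda>x. \<theta> b x \<bullet> Z x) \<in> smooth_funs M" for b using fr(5) Z by (intro smooth_funs_pairing) auto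
    have s: "\<forall>b. (\<lambda>y. (\<theta> b y \<bullet> Z y) *\<^sub>R e b y) \<in> sections M E" using c fr(4) by (auto intro: sections_scale)
    have "F (Us @ Z # Vs) x = F (Us @ (\<lambda>y. \<zeta> y *\<^sub>R Z y) # Vs) x"
      using tensorial_scale[OF F Us Vs Z fr(1)] fr(2) by simp
    also have "(\<lambda>y. \<zeta> y *\<^sub>R Z y) = (\<lambda>y. \<Sum>b\<in>B. (\<theta> b y \<bullet> Z y) *\<^sub>R e b y)" using fr(6) by simp
    also have "F (Us @ \<dots> # Vs) x = (\<Sum>b\<in>B. F (Us @ (\<lambda>y. (\<theta> b y \<bullet> Z y) *\<^sub>R e b y) # Vs) x)"
      by (simp add: tensorial_sum[OF F Us Vs s])
    also have "\<dots> = (\<Sum>b\<in>B. (\<theta> b x \<bullet> Z x) * F (Us @ e b # Vs) x)"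
    proof (rule sum.cong[OF refl])
      fix b
      have "e b \<in> sections M E" using fr(4) by simp
      from tensorial_scale[OF F Us Vs this c[of b]]
      show "F (Us @ (\<lambda>y. (\<theta> b y \<bullet> Z y) *\<^sub>R e b y) # Vs) x = (\<theta> b x \<bullet> Z x) * F (Us @ e b # Vs) x"
        by simp
    qed
    finally show ?thesis .
  qed
  show ?thesis using *[OF X(1)] *[OF X(2)] X(3) by simp
qed

lemma tensorial_pointwise:
  assumes F: "tensorial F"
  shows "set Us \<subseteq> sections M E \<Longrightarrow> set Xs \<subseteq> sections M E \<Longrightarrow> set Ys \<subseteq> sections M E \<Longrightarrow>
    map (\<lambda>X. X x) Xs = map (\<lambda>X. X x) Ys \<Longrightarrow> F (Us @ Xs) x = F (Us @ Ys) x"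
proof (induction Xs arbitrary: Us Ys)
  case Nil
  then show ?case by simp
next
  case (Cons X Xs)
  then obtain Y Ys' where Ys: "Ys = Y # Ys'" by (cases Ys) auto
  have "F (Us @ X # Xs) x = F (Us @ Y # Xs) x"
    using Cons.prems Ys by (intro tensorial_slot[OF F]) auto
  also have "\<dots> = F ((Us @ [Y]) @ Ys') x"
    using Cons.IH[of "Us @ [Y]" Ys'] Cons.prems Ys by simp
  finally show ?case using Ys by simp
qed

lemma ev_tens:
  assumes "tensorial F" "set Xs \<subseteq> sections M E"
  shows "ev (tens F) Xs = F Xs"
proof
  fix x
  show "ev (tens F) Xs x = F Xs x"
    unfolding ev_def tens_def
    by (rule tensorial_pointwise[OF assms(1), where Us = "[]", simplified])
      (use assms(2) in \<open>auto simp: section_at\<close>)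
qed

lemma altm_tens:
  assumes F: "tensorial F"
    and alt: "\<And>Us X Vs x. set Us \<subseteq> sections M E \<Longrightarrow> set Vs \<subseteq> sections M E \<Longrightarrow> X \<in> sections M E \<Longrightarrow>
      F (Us @ X # X # Vs) x = 0"
  shows "altm (tens F)"
proof
  fix x
  have s: "set (map (section_at x) vs) \<subseteq> sections M E" for vs by (auto simp: section_at)
  have m: "map (\<lambda>X. X x) (map (section_at x) vs) = vs" for vs by (simp add: section_at o_def)
  have eq: "tens F x (us @ X x # vs) = F (map (section_at x) us @ X # map (section_at x) vs) x"
    if "X \<in> sections M E" for us X vs
    unfolding tens_def map_append list.map
    by (rule tensorial_slot[OF F s s section_at(1) that section_at(2)])
  have "linear (\<lambda>v. tens F x (us @ v # vs))" for us vs
  proof (rule linearI)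
    fix v w c
    have "(\<lambda>y. section_at x v y + section_at x w y) \<in> sections M E" by (intro sections_add section_at)
    from eq[OF this] show "tens F x (us @ (v + w) # vs) = tens F x (us @ v # vs) + tens F x (us @ w # vs)"
      using tensorial_add[OF F s s section_at(1)[of x v] section_at(1)[of x w]] by (simp add: section_at(2)) (simp add: tens_def)
    have "(\<lambda>y. c *\<^sub>R section_at x v y) \<in> sections M E" by (intro sections_cmul section_at)
    from eq[OF this] show "tens F x (us @ (c *\<^sub>R v) # vs) = c *\<^sub>R tens F x (us @ v # vs)"
      using tensorial_scale[OF F s s section_at(1)[of x v] smooth_funs_const[of c]] by (simp add: section_at(2)) (simp add: tens_def)
  qed
  moreover have "tens F x (us @ v # v # vs) = 0" for us v vs
    using alt[OF s s section_at(1)] by (simp add: tens_def)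
  ultimately show "altf (tens F x)" by (simp add: altf_def)
qed

lemma Forms_tens:
  assumes "tensorial F" "\<And>Us X Vs x. set Us \<subseteq> sections M E \<Longrightarrow> set Vs \<subseteq> sections M E \<Longrightarrow> X \<in> sections M E \<Longrightarrow>
      F (Us @ X # X # Vs) x = 0"
    and "\<And>Xs. set Xs \<subseteq> sections M E \<Longrightarrow> F Xs \<in> smooth_funs M"
  shows "tens F \<in> Forms M E"
  by (rule FormsI[OF altm_tens[OF assms(1,2)]]) (simp_all add: ev_tens[OF assms(1)] assms(3))

section \<open>Lie derivatives\<close>

text \<open>
  A derivation of functions together with a compatible operator on sections extends to a derivation of
  all forms. This covers the Lie derivative along a section both on forms and on multivectors.
\<close>

definition der_pair :: "(('m \<Rightarrow> real) \<Rightarrow> 'm \<Rightarrow> real) \<Rightarrow> (('m \<Rightarrow> 'v) \<Rightarrow> 'm \<Rightarrow> 'v) \<Rightarrow> bool" where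
  "der_pair D0 D1 \<longleftrightarrow>
     (\<forall>f\<in>smooth_funs M. D0 f \<in> smooth_funs M) \<and> (\<forall>c. D0 (\<lambda>x. c) = (\<lambda>x. 0)) \<and>
     (\<forall>f\<in>smooth_funs M. \<forall>g\<in>smooth_funs M. D0 (\<lambda>x. f x + g x) = (\<lambda>x. D0 f x + D0 g x) \<and>
        D0 (\<lambda>x. f x * g x) = (\<lambda>x. D0 f x * g x + f x * D0 g x)) \<and>
     (\<forall>X\<in>sections M E. D1 X \<in> sections M E) \<and>
     (\<forall>X\<in>sections M E. \<forall>Y\<in>sections M E. D1 (\<lambda>x. X x + Y x) = (\<lambda>x. D1 X x + D1 Y x)) \<and>
     (\<forall>X\<in>sections M E. \<forall>f\<in>smooth_funs M. D1 (\<lambda>x. f x *\<^sub>R X x) = (\<lambda>x. f x *\<^sub>R D1 X x + D0 f x *\<^sub>R X x))"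

text \<open>
  The recursion is the commutation rule \<open>i\<^sub>X D = D i\<^sub>X - i\<^bsub>D X\<^esub>\<close>, read as a definition by recursion over the
  arguments. It matches the recursion for the wedge product, so that the derivation rule can be proved
  by induction.
\<close>

primrec lieD :: "(('m \<Rightarrow> real) \<Rightarrow> 'm \<Rightarrow> real) \<Rightarrow> (('m \<Rightarrow> 'v) \<Rightarrow> 'm \<Rightarrow> 'v) \<Rightarrow> ('m, 'v) multi \<Rightarrow>
    ('m \<Rightarrow> 'v) list \<Rightarrow> 'm \<Rightarrow> real" where
  "lieD D0 D1 P [] = D0 (ev P [])"
| "lieD D0 D1 P (X # Xs) = (\<lambda>x. lieD D0 D1 (ins X P) Xs x - ev P (D1 X # Xs) x)" for P

definition LD :: "(('m \<Rightarrow> real) \<Rightarrow> 'm \<Rightarrow> real) \<Rightarrow> (('m \<Rightarrow> 'v) \<Rightarrow> 'm \<Rightarrow> 'v) \<Rightarrow> ('m, 'v) multi \<Rightarrow> ('m, 'v) multi" where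
  "LD D0 D1 P = tens (lieD D0 D1 P)"

end

locale derivation_pair = smooth_bundle M E
  for M :: "('m::{t2_space, second_countable_topology}, 'e::real_inner) atlas"
    and E :: "('m, 'v::real_inner) triv" +
  fixes D0 :: "('m \<Rightarrow> real) \<Rightarrow> 'm \<Rightarrow> real" and D1 :: "('m \<Rightarrow> 'v) \<Rightarrow> 'm \<Rightarrow> 'v"
  assumes der_pair: "der_pair D0 D1"
begin

abbreviation "S \<equiv> sections M E"
abbreviation "C \<equiv> smooth_funs M"

lemma D0_smooth: "f \<in> C \<Longrightarrow> D0 f \<in> C"
  and D0_const: "D0 (\<lambda>x. c) = (\<lambda>x. 0)"
  and D0_add: "f \<in> C \<Longrightarrow> g \<in> C \<Longrightarrow> D0 (\<lambda>x. f x + g x) = (\<lambda>x. D0 f x + D0 g x)"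
  and D0_mult: "f \<in> C \<Longrightarrow> g \<in> C \<Longrightarrow> D0 (\<lambda>x. f x * g x) = (\<lambda>x. D0 f x * g x + f x * D0 g x)"
  and D1_sec: "X \<in> S \<Longrightarrow> D1 X \<in> S"
  and D1_add: "X \<in> S \<Longrightarrow> Y \<in> S \<Longrightarrow> D1 (\<lambda>x. X x + Y x) = (\<lambda>x. D1 X x + D1 Y x)"
  and D1_scale: "X \<in> S \<Longrightarrow> f \<in> C \<Longrightarrow> D1 (\<lambda>x. f x *\<^sub>R X x) = (\<lambda>x. f x *\<^sub>R D1 X x + D0 f x *\<^sub>R X x)"
  using der_pair unfolding der_pair_def by blast+

abbreviation "L \<equiv> lieD D0 D1"

lemma lieD_smooth: "P \<in> Forms M E \<Longrightarrow> set Xs \<subseteq> S \<Longrightarrow> L P Xs \<in> C"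
  by (induction Xs arbitrary: P)
    (simp_all add: D0_smooth Forms_smooth smooth_funs_diff Forms_ins D1_sec)

lemma lieD_add:
  "P \<in> Forms M E \<Longrightarrow> Q \<in> Forms M E \<Longrightarrow> set Xs \<subseteq> S \<Longrightarrow> L (P + Q) Xs x = L P Xs x + L Q Xs x"
proof (induction Xs arbitrary: P Q)
  case Nil
  then show ?case using D0_add[OF Forms_smooth[of P "[]"] Forms_smooth[of Q "[]"]] by (simp add: ev_add)
next
  case (Cons X Xs)
  then show ?case by (simp add: ins_add ev_add Forms_ins)
qed

lemma lieD_fsc:
  "P \<in> Forms M E \<Longrightarrow> f \<in> C \<Longrightarrow> set Xs \<subseteq> S \<Longrightarrow> L (fsc f P) Xs x = f x * L P Xs x + D0 f x * ev P Xs x"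
proof (induction Xs arbitrary: P)
  case Nil
  then show ?case using D0_mult[OF _ Forms_smooth[of P "[]"]] by (simp add: ev_fsc)
next
  case (Cons X Xs)
  then show ?case by (simp add: ins_fsc ev_fsc Forms_ins algebra_simps ev_Cons)
qed

lemma lieD_cmult:
  "P \<in> Forms M E \<Longrightarrow> set Xs \<subseteq> S \<Longrightarrow> L (fsc (\<lambda>_. c) P) Xs x = c * L P Xs x"
  using lieD_fsc[OF _ smooth_funs_const[of c]] by (simp add: D0_const)

lemma lieD_minus: "P \<in> Forms M E \<Longrightarrow> set Xs \<subseteq> S \<Longrightarrow> L (- P) Xs x = - L P Xs x"
proof -
  have "- P = fsc (\<lambda>_. -1) P" by (simp add: fsc_def fun_eq_iff multi_apply2)
  then show "P \<in> Forms M E \<Longrightarrow> set Xs \<subseteq> S \<Longrightarrow> L (- P) Xs x = - L P Xs x" using lieD_cmult[of P Xs "-1"] by simp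
qed

lemma lieD_zero: "set Xs \<subseteq> S \<Longrightarrow> L 0 Xs x = 0"
  using lieD_add[OF Forms_zero Forms_zero] by simp

lemma lieD_sg: "P \<in> Forms M E \<Longrightarrow> set Xs \<subseteq> S \<Longrightarrow> L (sg P) Xs x = (- 1) ^ length Xs * L P Xs x"
proof (induction Xs arbitrary: P)
  case Nil
  then show ?case by (simp add: ev_def sg_def)
next
  case (Cons X Xs)
  then show ?case by (simp add: ins_sg lieD_minus Forms_sg Forms_ins ev_sg algebra_simps)
qed

lemma tensorial_lieD:
  assumes "P \<in> Forms M E"
  shows "tensorial (L P)"
proof -
  have "L P (Us @ (\<lambda>x. X x + Y x) # Vs) x = L P (Us @ X # Vs) x + L P (Us @ Y # Vs) x"
    if "set Us \<subseteq> S" "set Vs \<subseteq> S" "X \<in> S" "Y \<in> S" for Us Vs X Y x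
    using that assms
  proof (induction Us arbitrary: P)
    case Nil
    then show ?case
      by (simp add: ins_plus[OF Forms_altm] lieD_add Forms_ins D1_add ev_Cons ev_add)
  next
    case (Cons U Us)
    have "ev Q (Us @ (\<lambda>x. X x + Y x) # Vs) x = ev Q (Us @ X # Vs) x + ev Q (Us @ Y # Vs) x"
      if "altm Q" for Q using that altf_add[of "Q x"] by (simp add: ev_def)
    with Cons show ?case by (simp add: Forms_ins ev_Cons altm_ins Forms_altm)
  qed
  moreover have "L P (Us @ (\<lambda>x. f x *\<^sub>R X x) # Vs) x = f x * L P (Us @ X # Vs) x"
    if "set Us \<subseteq> S" "set Vs \<subseteq> S" "X \<in> S" "f \<in> C" for Us Vs X f x
    using that assms
  proof (induction Us arbitrary: P)
    case Nil
    then show ?case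
      by (simp add: ins_scale[OF Forms_altm] lieD_fsc Forms_ins D1_scale D1_sec ev_Cons ev_add ev_fsc
          ins_plus[OF Forms_altm] algebra_simps)
  next
    case (Cons U Us)
    have "ev Q (Us @ (\<lambda>x. f x *\<^sub>R X x) # Vs) x = f x * ev Q (Us @ X # Vs) x"
      if "altm Q" for Q using that altf_scale[of "Q x"] by (simp add: ev_def)
    with Cons show ?case by (simp add: Forms_ins ev_Cons altm_ins Forms_altm algebra_simps)
  qed
  ultimately show ?thesis unfolding tensorial_def by (intro allI impI ballI conjI ext)
qed

lemma lieD_alternating:
  "set Us \<subseteq> S \<Longrightarrow> set Vs \<subseteq> S \<Longrightarrow> X \<in> S \<Longrightarrow> P \<in> Forms M E \<Longrightarrow> L P (Us @ X # X # Vs) x = 0"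
proof (induction Us arbitrary: P)
  case Nil
  have "ev (ins X (ins (D1 X) P)) Vs x = - ev (ins (D1 X) (ins X P)) Vs x"
    using ins_swap[OF Forms_altm[OF Nil(4)], of X "D1 X"] by (simp add: ev_minus)
  with Nil show ?case by (simp add: ins_ins[OF Forms_altm] lieD_zero ev_Cons)
next
  case (Cons U Us)
  have "ev Q (Us @ X # X # Vs) x = 0" if "altm Q" for Q
    using that altf_adjacent[of "Q x"] by (simp add: ev_def)
  with Cons show ?case by (simp add: Forms_ins ev_Cons altm_ins Forms_altm)
qed

lemma ev_LD: "P \<in> Forms M E \<Longrightarrow> set Xs \<subseteq> S \<Longrightarrow> ev (LD D0 D1 P) Xs = L P Xs"
  by (simp add: LD_def ev_tens tensorial_lieD)

lemma Forms_LD: "P \<in> Forms M E \<Longrightarrow> LD D0 D1 P \<in> Forms M E"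
  unfolding LD_def by (intro Forms_tens tensorial_lieD lieD_alternating lieD_smooth)

lemma of_deg_LD:
  assumes "of_deg p P" "P \<in> Forms M E"
  shows "of_deg p (LD D0 D1 P)"
proof -
  have "length Xs \<noteq> p \<Longrightarrow> of_deg p P \<Longrightarrow> L P Xs x = 0" for Xs x
  proof (induction Xs arbitrary: p P)
    case Nil
    then have "ev P [] = (\<lambda>x. 0)" by (simp add: of_deg_def ev_def)
    then show ?case by (simp add: D0_const)
  next
    case (Cons X Xs)
    have "ev P (D1 X # Xs) x = 0" using Cons.prems by (simp add: of_deg_def ev_def)
    moreover have "L (ins X P) Xs x = 0"
    proof (cases p)
      case 0
      then have "ins X P = 0" using Cons.prems of_deg_0_ins by auto
      then have "of_deg (Suc (length Xs)) (ins X P)" by (simp add: of_deg_zero)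
      then show ?thesis using Cons.IH[of "Suc (length Xs)" "ins X P"] by simp
    next
      case (Suc q)
      then show ?thesis using Cons.prems by (intro Cons.IH of_deg_ins) auto
    qed
    ultimately show ?case by simp
  qed
  with assms(1) show ?thesis by (simp add: of_deg_def LD_def tens_def)
qed

lemma LD_add:
  assumes "P \<in> Forms M E" "Q \<in> Forms M E"
  shows "LD D0 D1 (P + Q) = LD D0 D1 P + LD D0 D1 Q"
  by (rule multi_eqI, rule ext) (simp add: ev_LD ev_add assms lieD_add Forms_add)

lemma LD_sg:
  assumes "P \<in> Forms M E"
  shows "LD D0 D1 (sg P) = sg (LD D0 D1 P)"
  by (rule multi_eqI, rule ext) (simp add: ev_LD ev_sg assms lieD_sg Forms_sg)

lemma ins_LD:
  assumes "P \<in> Forms M E" "X \<in> S"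
  shows "ins X (LD D0 D1 P) = LD D0 D1 (ins X P) - ins (D1 X) P"
  by (rule multi_eqI, rule ext)
    (use assms in \<open>simp add: ev_LD ev_diff Forms_ins flip: ev_Cons\<close>)

text \<open>
  Both sides obey the same recursion under insertion of a section; in degree 0 this is the product rule
  for functions.
\<close>

lemma LD_wedge:
  assumes "P \<in> Forms M E" "Q \<in> Forms M E"
  shows "LD D0 D1 (P \<and>\<and> Q) = (LD D0 D1 P \<and>\<and> Q) + (P \<and>\<and> LD D0 D1 Q)"
proof (rule multi_eqI, rule ext)
  fix Xs x assume "set Xs \<subseteq> S"
  then have "L (P \<and>\<and> Q) Xs x = ev ((LD D0 D1 P \<and>\<and> Q) + (P \<and>\<and> LD D0 D1 Q)) Xs x"
    using assms
  proof (induction Xs arbitrary: P Q)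
    case Nil
    have "D0 (\<lambda>x. P x []) = (\<lambda>x. LD D0 D1 P x [])" "D0 (\<lambda>x. Q x []) = (\<lambda>x. LD D0 D1 Q x [])"
      using ev_LD[of P "[]"] ev_LD[of Q "[]"] Nil by (simp_all add: ev_Nil)
    moreover have "ev (P \<and>\<and> Q) [] = (\<lambda>x. ev P [] x * ev Q [] x)" by (simp add: ev_Nil wedge_Nil)
    ultimately show ?case
      using D0_mult[OF Forms_smooth[of P "[]"] Forms_smooth[of Q "[]"]] Nil
      by (simp add: ev_Nil wedge_Nil multi_apply2)
  next
    case (Cons X Xs)
    then show ?case
      by (simp add: ins_wedge lieD_add Forms_ins Forms_wedge Forms_sg ev_Cons ev_add ev_diff ins_add ins_LD LD_sg
          wedge_diff_left wedge_diff_right algebra_simps)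
  qed
  then show "ev (LD D0 D1 (P \<and>\<and> Q)) Xs x = ev ((LD D0 D1 P \<and>\<and> Q) + (P \<and>\<and> LD D0 D1 Q)) Xs x"
    using assms \<open>set Xs \<subseteq> S\<close> by (simp add: ev_LD Forms_wedge)
qed

end

section \<open>The differential\<close>

text \<open>
  The axioms of a Lie algebroid without the Jacobi identity. The differential and its derivation rule
  are constructed at this level so that they are available for \<open>A\<^sup>*\<close> with the bracket of an arbitrary
  bivector: the Poisson condition is brought into usable form by means of that differential, and the
  Jacobi identity of \<open>A\<^sup>*\<close> is a consequence of it.
\<close>

locale almost_algebroid = smooth_bundle "base A" "vbundle A"
  for A :: "('m::{t2_space, second_countable_topology}, 'e::real_inner, 'v::real_inner) lie_alg_data" +
  assumes tangent_anc: "tangent_vector (base A) x (anc A x v)"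
    and linear_anc: "f \<in> smooth_funs (base A) \<Longrightarrow> linear (\<lambda>v. anc A x v f)"
    and anchor_smooth: "X \<in> secs A \<Longrightarrow> f \<in> smooth_funs (base A) \<Longrightarrow> anchor_deriv A X f \<in> smooth_funs (base A)"
    and brk_sec: "X \<in> secs A \<Longrightarrow> Y \<in> secs A \<Longrightarrow> brk A X Y \<in> secs A"
    and brk_antisym: "X \<in> secs A \<Longrightarrow> Y \<in> secs A \<Longrightarrow> brk A X Y = - brk A Y X"
    and brk_add: "X \<in> secs A \<Longrightarrow> Y \<in> secs A \<Longrightarrow> Z \<in> secs A \<Longrightarrow> brk A X (Y + Z) = brk A X Y + brk A X Z"
    and brk_leibniz: "X \<in> secs A \<Longrightarrow> Y \<in> secs A \<Longrightarrow> f \<in> smooth_funs (base A) \<Longrightarrow>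
      brk A X (\<lambda>x. f x *\<^sub>R Y x) = (\<lambda>x. f x *\<^sub>R brk A X Y x + anchor_deriv A X f x *\<^sub>R Y x)"
begin

abbreviation "S \<equiv> secs A"
abbreviation "C \<equiv> smooth_funs (base A)"
abbreviation "\<Omega> \<equiv> Forms (base A) (vbundle A)"

lemma brk_same: "X \<in> S \<Longrightarrow> brk A X X = (\<lambda>x. 0)"
proof -
  assume "X \<in> S"
  then have "brk A X X x = - brk A X X x" for x using fun_cong[OF brk_antisym, of X X x] by (simp add: uminus_apply)
  then have "2 *\<^sub>R brk A X X x = 0" for x by (metis scaleR_2 add.right_inverse)
  then show "brk A X X = (\<lambda>x. 0)" by (simp add: fun_eq_iff)
qed

lemma anchor_const: "anchor_deriv A X (\<lambda>x. c) = (\<lambda>x. 0)"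
proof
  fix x
  have T: "tangent_vector (base A) x (anc A x (X x))" by (rule tangent_anc)
  let ?D = "anc A x (X x)"
  have c: "(\<lambda>y. 1) \<in> C" by (rule smooth_funs_const)
  have "\<forall>f\<in>C. \<forall>h\<in>C. ?D (\<lambda>y. f y * h y) = ?D f * h x + f x * ?D h"
    using T by (simp add: tangent_vector_def)
  from bspec[OF bspec[OF this c] c] have "?D (\<lambda>y. 1) = 0" by simp
  moreover have "\<forall>f\<in>C. ?D (\<lambda>y. c * f y) = c * ?D f"
    using T by (simp add: tangent_vector_def)
  from bspec[OF this c] have "?D (\<lambda>y. c) = c * ?D (\<lambda>y. 1)" by simp
  ultimately show "anchor_deriv A X (\<lambda>x. c) x = 0" by (simp add: anchor_deriv_def)
qed

lemma anchor_add:
  assumes "f \<in> C" "g \<in> C"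
  shows "anchor_deriv A X (\<lambda>x. f x + g x) = (\<lambda>x. anchor_deriv A X f x + anchor_deriv A X g x)"
  using tangent_anc assms unfolding tangent_vector_def anchor_deriv_def by blast

lemma anchor_mult:
  assumes "f \<in> C" "g \<in> C"
  shows "anchor_deriv A X (\<lambda>x. f x * g x) = (\<lambda>x. anchor_deriv A X f x * g x + f x * anchor_deriv A X g x)"
  using tangent_anc assms unfolding tangent_vector_def anchor_deriv_def by blast

lemma anchor_section_add:
  assumes "f \<in> C"
  shows "anchor_deriv A (\<lambda>x. X x + Y x) f = (\<lambda>x. anchor_deriv A X f x + anchor_deriv A Y f x)"
  using linear_add[OF linear_anc[OF assms]] by (simp add: anchor_deriv_def)

lemma anchor_section_scale:
  assumes "f \<in> C"
  shows "anchor_deriv A (\<lambda>x. h x *\<^sub>R X x) f = (\<lambda>x. h x * anchor_deriv A X f x)"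
  using linear_cmul[OF linear_anc[OF assms]] by (simp add: anchor_deriv_def)

lemma brk_scale_left:
  assumes "X \<in> S" "Y \<in> S" "f \<in> C"
  shows "brk A (\<lambda>x. f x *\<^sub>R X x) Y = (\<lambda>x. f x *\<^sub>R brk A X Y x - anchor_deriv A Y f x *\<^sub>R X x)"
  using brk_antisym[OF sections_scale[OF assms(3,1)] assms(2)] brk_leibniz[OF assms(2,1,3)] brk_antisym[OF assms(1,2)]
  by (simp add: fun_eq_iff uminus_apply)

lemma brk_add_right:
  assumes "X \<in> S" "Y \<in> S" "Z \<in> S"
  shows "brk A X (\<lambda>x. Y x + Z x) = (\<lambda>x. brk A X Y x + brk A X Z x)"
  using brk_add[OF assms] by (simp add: plus_fun_def)

lemma brk_add_left:
  assumes "X \<in> S" "Y \<in> S" "Z \<in> S"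
  shows "brk A (\<lambda>x. X x + Y x) Z = (\<lambda>x. brk A X Z x + brk A Y Z x)"
  using brk_antisym[OF sections_add[OF assms(1,2)] assms(3)] brk_add_right[OF assms(3,1,2)]
    brk_antisym[OF assms(1,3)] brk_antisym[OF assms(2,3)]
  by (simp add: fun_eq_iff uminus_apply)

lemma derivation_pair: "X \<in> S \<Longrightarrow> derivation_pair (base A) (vbundle A) (anchor_deriv A X) (brk A X)"
  by unfold_locales
    (simp add: der_pair_def anchor_smooth anchor_const anchor_add anchor_mult brk_sec brk_add_right brk_leibniz)

abbreviation "L X \<equiv> lieD (anchor_deriv A X) (brk A X)"
abbreviation "\<L> X \<equiv> LD (anchor_deriv A X) (brk A X)"

lemma lieD_closed_form:
  "L X P Ys x = anchor_deriv A X (ev P Ys) x - (\<Sum>j<length Ys. ev P (Ys[j := brk A X (Ys ! j)]) x)"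
proof (induction Ys arbitrary: P)
  case (Cons Y Ys)
  show ?case by (simp add: Cons.IH ev_Cons sum.lessThan_Suc_shift del: sum.lessThan_Suc)
qed simp

lemma nths_Compl_0: "nths (X # Xs) (- {0}) = Xs"
  and nths_Compl_Suc: "nths (X # Xs) (- {Suc i}) = X # nths Xs (- {i})"
  and nths_Compl_0_Suc: "nths (X # Xs) (- {0, Suc j}) = nths Xs (- {j})"
  and nths_Compl_Suc_Suc: "nths (X # Xs) (- {Suc i, Suc j}) = X # nths Xs (- {i, j})"
proof -
  have "{j. Suc j \<in> - {0}} = UNIV" "{j. Suc j \<in> - {Suc i}} = - {i}" "{k. Suc k \<in> - {0, Suc j}} = - {j}"
    "{k. Suc k \<in> - {Suc i, Suc j}} = - {i, j}" by auto
  then show "nths (X # Xs) (- {0}) = Xs" "nths (X # Xs) (- {Suc i}) = X # nths Xs (- {i})"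
    "nths (X # Xs) (- {0, Suc j}) = nths Xs (- {j})" "nths (X # Xs) (- {Suc i, Suc j}) = X # nths Xs (- {i, j})"
    by (simp_all only: nths_Cons) (simp_all add: nths_all)
qed

lemma nths_Compl_singleton: "j < length Xs \<Longrightarrow> nths Xs (- {j}) = take j Xs @ drop (Suc j) Xs"
proof (induction Xs arbitrary: j)
  case (Cons X Xs)
  then show ?case by (cases j) (simp_all add: nths_Compl_0 nths_Compl_Suc)
qed simp

text \<open>
  This is the recursion \<open>i\<^sub>X d = \<L>\<^sub>X - d i\<^sub>X\<close> for the differential.
\<close>

primrec cart :: "('m, 'v) multi \<Rightarrow> ('m \<Rightarrow> 'v) list \<Rightarrow> 'm \<Rightarrow> real" where
  "cart P [] = (\<lambda>x. 0)"
| "cart P (X # Xs) = (\<lambda>x. L X P Xs x - cart (ins X P) Xs x)" for P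

text \<open>
  The terms of the formula for the differential are sorted according to whether they involve the first
  argument; those that do add up to the Lie derivative.
\<close>

lemma cartan_formula_eq_cart: "altm P \<Longrightarrow> cartan_formula A P Xs = cart P Xs"
proof (induction Xs arbitrary: P)
  case Nil
  show ?case by (simp add: cartan_formula_def)
next
  case (Cons X Xs)
  show ?case
  proof
    fix x
    let ?n = "length Xs"
    have 1: "(\<Sum>i<length (X # Xs). (- 1) ^ i * anchor_deriv A ((X # Xs) ! i) (\<lambda>y. P y (map (\<lambda>X. X y) (nths (X # Xs) (- {i})))) x)
      = anchor_deriv A X (ev P Xs) x
        - (\<Sum>i<?n. (- 1) ^ i * anchor_deriv A (Xs ! i) (\<lambda>y. ins X P y (map (\<lambda>X. X y) (nths Xs (- {i})))) x)"
      by (simp add: sum.lessThan_Suc_shift nths_Compl_0 nths_Compl_Suc ev_def ins_def sum_negf del: sum.lessThan_Suc)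
    have move: "(- 1) ^ j * P x (brk A X (Xs ! j) x # map (\<lambda>X. X x) (nths Xs (- {j}))) = ev P (Xs[j := brk A X (Xs ! j)]) x"
      if "j < ?n" for j
      using that altf_move[OF Cons.prems[rule_format, of x], of "[]" "map (\<lambda>X. X x) (take j Xs)" "brk A X (Xs ! j) x"]
      by (simp add: ev_def upd_conv_take_nth_drop nths_Compl_singleton)
    have swap: "P x (u # X x # vs) = - ins X P x (u # vs)" for u vs
      using altf_swap[OF Cons.prems[rule_format, of x], of "[]" u "X x" vs] by (simp add: ins_def)
    have "(\<Sum>j<length (X # Xs). \<Sum>i<j. (- 1) ^ (i + j) *
        P x (brk A ((X # Xs) ! i) ((X # Xs) ! j) x # map (\<lambda>X. X x) (nths (X # Xs) (- {i, j}))))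
      = (\<Sum>j<?n. - ev P (Xs[j := brk A X (Xs ! j)]) x
          - (\<Sum>i<j. (- 1) ^ (i + j) * ins X P x (brk A (Xs ! i) (Xs ! j) x # map (\<lambda>X. X x) (nths Xs (- {i, j})))))"
      using move
      by (simp add: sum.lessThan_Suc_shift nths_Compl_0_Suc nths_Compl_Suc_Suc swap sum_negf sum_subtractf sum.distrib
          del: sum.lessThan_Suc)
    then have 2: "(\<Sum>j<length (X # Xs). \<Sum>i<j. (- 1) ^ (i + j) *
        P x (brk A ((X # Xs) ! i) ((X # Xs) ! j) x # map (\<lambda>X. X x) (nths (X # Xs) (- {i, j}))))
      = - (\<Sum>j<?n. ev P (Xs[j := brk A X (Xs ! j)]) x)
          - (\<Sum>j<?n. \<Sum>i<j. (- 1) ^ (i + j) * ins X P x (brk A (Xs ! i) (Xs ! j) x # map (\<lambda>X. X x) (nths Xs (- {i, j}))))"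
      by (simp add: sum_negf sum_subtractf)
    have "cartan_formula A P (X # Xs) x = L X P Xs x - cartan_formula A (ins X P) Xs x"
      unfolding cartan_formula_def 1 2 lieD_closed_form by simp
    then show "cartan_formula A P (X # Xs) x = cart P (X # Xs) x"
      using Cons.IH[OF altm_ins[OF Cons.prems]] by simp
  qed
qed

text \<open>
  The differential of a function as a form; it carries the defect of linearity over functions of the
  Lie derivative in the direction \<open>X\<close> and of the differential.
\<close>

definition anchor_form :: "('m \<Rightarrow> real) \<Rightarrow> ('m, 'v) multi" where
  "anchor_form f = (\<lambda>x vs. case vs of [v] \<Rightarrow> anc A x v f | _ \<Rightarrow> 0)"

lemma ins_anchor_form: "ins X (anchor_form f) = of_fun (anchor_deriv A X f)"
  and sg_anchor_form: "sg (anchor_form f) = - anchor_form f"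
  by (auto simp: ins_def sg_def anchor_form_def of_fun_def anchor_deriv_def fun_eq_iff multi_apply2 split: list.splits)

lemma lieD_cong_section:
  assumes "X \<in> S" "Y \<in> S" "f \<in> C" "set Vs \<subseteq> S" "P \<in> \<Omega>"
  shows "L (\<lambda>x. X x + Y x) P Vs x = L X P Vs x + L Y P Vs x"
    and "L (\<lambda>x. f x *\<^sub>R X x) P Vs x = f x * L X P Vs x + ev (anchor_form f \<and>\<and> ins X P) Vs x"
proof -
  show "L (\<lambda>x. X x + Y x) P Vs x = L X P Vs x + L Y P Vs x"
    using assms(4,5)
  proof (induction Vs arbitrary: P)
    case Nil
    then show ?case by (simp add: anchor_section_add Forms_smooth)
  next
    case (Cons V Vs)
    then show ?case using assms(1,2)
      by (simp add: Forms_ins brk_add_left ev_Cons ins_plus[OF Forms_altm] ev_add)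
  qed
  show "L (\<lambda>x. f x *\<^sub>R X x) P Vs x = f x * L X P Vs x + ev (anchor_form f \<and>\<and> ins X P) Vs x"
    using assms(4,5)
  proof (induction Vs arbitrary: P)
    case Nil
    have "ev P [] \<in> C" using Nil by (simp add: Forms_smooth)
    moreover have "ev (anchor_form f \<and>\<and> ins X P) [] x = 0" by (simp add: ev_Nil wedge_Nil anchor_form_def)
    ultimately show ?case by (simp add: anchor_section_scale)
  next
    case (Cons V Vs)
    have c: "(\<lambda>x. f x *\<^sub>R brk A X V x - anchor_deriv A V f x *\<^sub>R X x)
      = (\<lambda>x. f x *\<^sub>R brk A X V x + (- anchor_deriv A V f x) *\<^sub>R X x)" by simp
    have "ins (\<lambda>x. f x *\<^sub>R brk A X V x - anchor_deriv A V f x *\<^sub>R X x) P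
        = fsc f (ins (brk A X V) P) + fsc (\<lambda>x. - anchor_deriv A V f x) (ins X P)"
      unfolding c ins_plus[OF Forms_altm[OF Cons.prems(2)]] ins_scale[OF Forms_altm[OF Cons.prems(2)]] ..
    then show ?case using Cons assms(1,3)
      by (simp add: Forms_ins brk_scale_left ev_Cons ev_add ev_fsc ins_wedge ins_anchor_form sg_anchor_form
          of_fun_wedge wedge_minus_left ev_minus ins_swap[OF Forms_altm, of _ V X] wedge_minus_right algebra_simps)
  qed
qed

context
  fixes X assumes X: "X \<in> S"
begin

interpretation dp: derivation_pair "base A" "vbundle A" "anchor_deriv A X" "brk A X"
  by (rule derivation_pair[OF X])

lemmas Lie_smooth = dp.lieD_smooth and Lie_add = dp.lieD_add and Lie_fsc = dp.lieD_fsc and Lie_minus = dp.lieD_minus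
  and Lie_zero = dp.lieD_zero and Lie_sg = dp.lieD_sg and tensorial_Lie = dp.tensorial_lieD
  and Lie_alternating = dp.lieD_alternating and ev_Lie = dp.ev_LD and Forms_Lie = dp.Forms_LD and of_deg_Lie = dp.of_deg_LD
  and Lie_sum = dp.LD_add and Lie_LD_sg = dp.LD_sg and ins_Lie = dp.ins_LD and Lie_wedge = dp.LD_wedge

end

lemma cart_smooth: "P \<in> \<Omega> \<Longrightarrow> set Xs \<subseteq> S \<Longrightarrow> cart P Xs \<in> C"
  by (induction Xs arbitrary: P) (simp_all add: smooth_funs_const smooth_funs_diff Lie_smooth Forms_ins)

lemma cart_add:
  "P \<in> \<Omega> \<Longrightarrow> Q \<in> \<Omega> \<Longrightarrow> set Xs \<subseteq> S \<Longrightarrow> cart (P + Q) Xs x = cart P Xs x + cart Q Xs x"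
  by (induction Xs arbitrary: P Q) (simp_all add: Lie_add ins_add Forms_ins)

lemma cart_fsc:
  "P \<in> \<Omega> \<Longrightarrow> f \<in> C \<Longrightarrow> set Xs \<subseteq> S \<Longrightarrow>
    cart (fsc f P) Xs x = f x * cart P Xs x + ev (anchor_form f \<and>\<and> P) Xs x"
proof (induction Xs arbitrary: P)
  case Nil
  then show ?case by (simp add: ev_Nil wedge_Nil anchor_form_def)
next
  case (Cons X Xs)
  then show ?case
    by (simp add: Lie_fsc ins_fsc Forms_ins ev_Cons ins_wedge ins_anchor_form sg_anchor_form of_fun_wedge
        ev_add ev_diff ev_fsc wedge_minus_left ev_minus algebra_simps)
qed

lemma anchor_form_const: "anchor_form (\<lambda>_. c) = 0"
  using anchor_const[of "\<lambda>_. _" c]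
  by (auto simp: anchor_form_def anchor_deriv_def fun_eq_iff multi_apply2 split: list.splits)

lemma cart_cmult: "P \<in> \<Omega> \<Longrightarrow> set Xs \<subseteq> S \<Longrightarrow> cart (fsc (\<lambda>_. c) P) Xs x = c * cart P Xs x"
  using cart_fsc[OF _ smooth_funs_const[of c]] by (simp add: anchor_form_const wedge_zero_left ev_zero)

lemma cart_minus: "P \<in> \<Omega> \<Longrightarrow> set Xs \<subseteq> S \<Longrightarrow> cart (- P) Xs x = - cart P Xs x"
proof -
  have "- P = fsc (\<lambda>_. -1) P" by (simp add: fsc_def fun_eq_iff multi_apply2)
  then show "P \<in> \<Omega> \<Longrightarrow> set Xs \<subseteq> S \<Longrightarrow> cart (- P) Xs x = - cart P Xs x" using cart_cmult[of P Xs "-1"] by simp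
qed

lemma cart_zero: "set Xs \<subseteq> S \<Longrightarrow> cart 0 Xs x = 0"
  using cart_add[OF Forms_zero Forms_zero] by simp

lemma cart_sg: "P \<in> \<Omega> \<Longrightarrow> set Xs \<subseteq> S \<Longrightarrow> cart (sg P) Xs x = - ((- 1) ^ length Xs * cart P Xs x)"
proof (induction Xs arbitrary: P)
  case (Cons X Xs)
  then show ?case by (simp add: Lie_sg ins_sg cart_minus Forms_sg Forms_ins algebra_simps)
qed simp

lemma tensorial_cart:
  assumes "P \<in> \<Omega>"
  shows "tensorial (cart P)"
proof -
  have "cart P (Us @ (\<lambda>x. X x + Y x) # Vs) x = cart P (Us @ X # Vs) x + cart P (Us @ Y # Vs) x"
    if "set Us \<subseteq> S" "set Vs \<subseteq> S" "X \<in> S" "Y \<in> S" for Us Vs X Y x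
    using that assms
  proof (induction Us arbitrary: P)
    case Nil
    then show ?case
      by (simp add: lieD_cong_section(1)[OF _ _ smooth_funs_const] ins_plus[OF Forms_altm] cart_add Forms_ins)
  next
    case (Cons U Us)
    then show ?case using tensorial_add[OF tensorial_Lie[of U P], of Us Vs X Y] by (simp add: Forms_ins)
  qed
  moreover have "cart P (Us @ (\<lambda>x. f x *\<^sub>R X x) # Vs) x = f x * cart P (Us @ X # Vs) x"
    if "set Us \<subseteq> S" "set Vs \<subseteq> S" "X \<in> S" "f \<in> C" for Us Vs X f x
    using that assms
  proof (induction Us arbitrary: P)
    case Nil
    then show ?case
      by (simp add: lieD_cong_section(2)[OF _ Nil(3)] ins_scale[OF Forms_altm] cart_fsc Forms_ins algebra_simps)
  next
    case (Cons U Us)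
    then show ?case using tensorial_scale[OF tensorial_Lie[of U P], of Us Vs X f] by (simp add: Forms_ins algebra_simps)
  qed
  ultimately show ?thesis unfolding tensorial_def by (intro allI impI ballI conjI ext)
qed

lemma cart_alternating:
  "set Us \<subseteq> S \<Longrightarrow> set Vs \<subseteq> S \<Longrightarrow> X \<in> S \<Longrightarrow> P \<in> \<Omega> \<Longrightarrow> cart P (Us @ X # X # Vs) x = 0"
proof (induction Us arbitrary: P)
  case Nil
  then show ?case
    by (simp add: ins_ins[OF Forms_altm] cart_zero ev_Cons brk_same ins_zero_section[OF Forms_altm] ev_zero)
next
  case (Cons U Us)
  then show ?case by (simp add: Lie_alternating Forms_ins)
qed

lemma ext_d_eq: "P \<in> \<Omega> \<Longrightarrow> ext_d A P = tens (cart P)"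
  by (simp add: ext_d_def tens_def cartan_formula_eq_cart Forms_altm extend_def[abs_def] section_at_def[abs_def])

lemma ev_d: "P \<in> \<Omega> \<Longrightarrow> set Xs \<subseteq> S \<Longrightarrow> ev (ext_d A P) Xs = cart P Xs"
  by (simp add: ext_d_eq ev_tens tensorial_cart)

lemma Forms_d: "P \<in> \<Omega> \<Longrightarrow> ext_d A P \<in> \<Omega>"
  unfolding ext_d_eq by (intro Forms_tens tensorial_cart cart_alternating cart_smooth)

lemma ins_d: "P \<in> \<Omega> \<Longrightarrow> X \<in> S \<Longrightarrow> ins X (ext_d A P) = \<L> X P - ext_d A (ins X P)"
  by (rule multi_eqI, rule ext) (simp add: ev_diff ev_d Forms_ins ev_Lie flip: ev_Cons)

lemma d_add: "P \<in> \<Omega> \<Longrightarrow> Q \<in> \<Omega> \<Longrightarrow> ext_d A (P + Q) = ext_d A P + ext_d A Q"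
  by (rule multi_eqI, rule ext) (simp add: ev_add ev_d Forms_add cart_add)

lemma d_sg: "P \<in> \<Omega> \<Longrightarrow> ext_d A (sg P) = - sg (ext_d A P)"
  by (rule multi_eqI, rule ext) (simp add: ev_minus ev_sg ev_d Forms_sg cart_sg)

text \<open>
  Inserting a section into both sides reduces the claim to products of smaller degree, by the recursion
  for \<open>d\<close> and the derivation rule of the Lie derivative.
\<close>

lemma d_wedge:
  assumes "P \<in> \<Omega>" "Q \<in> \<Omega>"
  shows "ext_d A (P \<and>\<and> Q) = (ext_d A P \<and>\<and> Q) + (sg P \<and>\<and> ext_d A Q)"
proof (rule multi_eqI, rule ext)
  fix Xs x assume "set Xs \<subseteq> S"
  then have "cart (P \<and>\<and> Q) Xs x = ev ((ext_d A P \<and>\<and> Q) + (sg P \<and>\<and> ext_d A Q)) Xs x"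
    using assms
  proof (induction Xs arbitrary: P Q)
    case Nil
    then show ?case using ev_d[of P "[]"] ev_d[of Q "[]"] by (simp add: ev_Nil wedge_Nil fun_eq_iff multi_apply2)
  next
    case (Cons X Xs)
    have l: "L X (P \<and>\<and> Q) Xs x = ev (\<L> X P \<and>\<and> Q) Xs x + ev (P \<and>\<and> \<L> X Q) Xs x"
      using Cons.prems fun_cong[OF ev_Lie[of X "P \<and>\<and> Q" Xs], of x] by (simp add: Forms_wedge Lie_wedge ev_add)
    have "cart (ins X (P \<and>\<and> Q)) Xs x = ev ((ext_d A (ins X P) \<and>\<and> Q) + (sg (ins X P) \<and>\<and> ext_d A Q)) Xs x
        + ev ((ext_d A (sg P) \<and>\<and> ins X Q) + (P \<and>\<and> ext_d A (ins X Q))) Xs x"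
      using Cons.prems Cons.IH[of "ins X P" Q] Cons.IH[of "sg P" "ins X Q"]
      by (simp add: ins_wedge cart_add Forms_wedge Forms_ins Forms_sg sg_sg)
    then show ?case
      using Cons.prems l
      by (simp add: ev_Cons ins_add ins_wedge ins_d ins_sg d_sg sg_sg ev_add ev_diff ev_minus wedge_minus_left
          wedge_diff_left wedge_diff_right)
  qed
  then show "ev (ext_d A (P \<and>\<and> Q)) Xs x = ev ((ext_d A P \<and>\<and> Q) + (sg P \<and>\<and> ext_d A Q)) Xs x"
    using assms \<open>set Xs \<subseteq> S\<close> by (simp add: ev_d Forms_wedge)
qed

lemma of_deg_d:
  assumes "of_deg p P" "P \<in> \<Omega>"
  shows "of_deg (Suc p) (ext_d A P)"
proof -
  have "length Xs \<noteq> Suc p \<Longrightarrow> of_deg p P \<Longrightarrow> P \<in> \<Omega> \<Longrightarrow> set Xs \<subseteq> S \<Longrightarrow> cart P Xs x = 0" for Xs x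
  proof (induction Xs arbitrary: p P)
    case (Cons X Xs)
    have "ev (\<L> X P) Xs x = 0"
      using of_deg_Lie[of X p P] Cons.prems by (simp add: of_deg_def ev_def)
    then have "L X P Xs x = 0" using Cons.prems by (simp add: ev_Lie)
    moreover have "cart (ins X P) Xs x = 0"
    proof (cases p)
      case 0
      then show ?thesis using Cons.prems by (simp add: of_deg_0_ins cart_zero)
    next
      case (Suc q)
      then show ?thesis using Cons.prems by (intro Cons.IH[of q]) (auto intro: of_deg_ins Forms_ins)
    qed
    ultimately show ?case by simp
  qed simp
  from this[OF _ assms] have *: "length Xs \<noteq> Suc p \<Longrightarrow> set Xs \<subseteq> S \<Longrightarrow> cart P Xs x = 0" for Xs x .
  have "length vs \<noteq> Suc p \<Longrightarrow> cart P (map (section_at x) vs) x = 0" for vs x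
    by (rule *) (auto simp: section_at)
  then show ?thesis unfolding of_deg_def ext_d_eq[OF assms(2)] tens_def by simp
qed

lemma d_of_fun: "f \<in> C \<Longrightarrow> ext_d A (of_fun f) = anchor_form f"
proof (rule multi_eqI, rule ext)
  fix Xs x assume f: "f \<in> C" and Xs: "set Xs \<subseteq> S"
  show "ev (ext_d A (of_fun f)) Xs x = ev (anchor_form f) Xs x"
  proof (cases Xs)
    case Nil
    with f show ?thesis by (simp add: ev_d Forms_of_fun) (simp add: ev_def anchor_form_def)
  next
    case (Cons X Ys)
    have X: "X \<in> S" and F: "of_fun f \<in> \<Omega>" using f Xs Cons by (simp_all add: Forms_of_fun)
    have "ev (\<L> X (of_fun f)) Ys x = (if Ys = [] then anchor_deriv A X f x else 0)"
    proof (cases Ys)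
      case Nil
      have "ev (of_fun f :: ('m, 'v) multi) [] = f" by (simp add: ev_def of_fun_def)
      then show ?thesis using Nil ev_Lie[OF X F, of "[]"] by simp
    next
      case (Cons Z Zs)
      then show ?thesis using of_deg_Lie[OF X of_deg_of_fun F] by (simp add: of_deg_def ev_def)
    qed
    then have "ev (\<L> X (of_fun f)) Ys x = ev (of_fun (anchor_deriv A X f)) Ys x"
      by (cases Ys) (simp_all add: ev_def of_fun_def)
    with f Xs Cons show ?thesis
      by (simp add: ev_d Forms_of_fun ins_of_fun cart_zero ev_Lie) (simp add: ev_Cons ins_anchor_form)
  qed
qed

end

section \<open>Derivations and biderivations of a graded algebra\<close>

definition sig :: "int \<Rightarrow> ('m \<Rightarrow> 'l \<Rightarrow> real) \<Rightarrow> 'm \<Rightarrow> 'l \<Rightarrow> real" where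
  "sig n P = (if even n then P else - P)"

lemma sig_simps [simp]:
  "sig n (P + Q) = sig n P + sig n Q" "sig n (P - Q) = sig n P - sig n Q" "sig n (- P) = - sig n P" "sig n 0 = 0"
  "sig n (sig k P) = sig (n + k) P" "sig 0 P = P" "sig 1 P = - P" "even n \<Longrightarrow> sig n P = P" "odd n \<Longrightarrow> sig n P = - P"
  by (auto simp: sig_def)

lemma double_eq_0: "P + P = 0 \<Longrightarrow> P = 0" for P :: "'m \<Rightarrow> 'l \<Rightarrow> real"
  by (auto simp: fun_eq_iff multi_apply)

text \<open>
  Degrees are integers, so that the negative degrees of contractions cause no truncation. Operators
  are additive on the space \<open>Tot\<close> of all, possibly inhomogeneous, elements; their derivation rule is
  imposed on homogeneous elements only.
\<close>

locale graded_algebra =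
  fixes Om :: "int \<Rightarrow> ('m \<Rightarrow> 'l \<Rightarrow> real) set" and Tot :: "('m \<Rightarrow> 'l \<Rightarrow> real) set"
    and mul :: "('m \<Rightarrow> 'l \<Rightarrow> real) \<Rightarrow> ('m \<Rightarrow> 'l \<Rightarrow> real) \<Rightarrow> 'm \<Rightarrow> 'l \<Rightarrow> real" (infixl "\<cdot>" 70)
    and s :: "('m \<Rightarrow> 'l \<Rightarrow> real) \<Rightarrow> 'm \<Rightarrow> 'l \<Rightarrow> real"
  assumes Om_Tot: "P \<in> Om p \<Longrightarrow> P \<in> Tot"
    and Tot_add: "P \<in> Tot \<Longrightarrow> Q \<in> Tot \<Longrightarrow> P + Q \<in> Tot"
    and Tot_minus: "P \<in> Tot \<Longrightarrow> - P \<in> Tot"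
    and Om_add: "P \<in> Om p \<Longrightarrow> Q \<in> Om p \<Longrightarrow> P + Q \<in> Om p"
    and Om_minus: "P \<in> Om p \<Longrightarrow> - P \<in> Om p"
    and Om_zero: "0 \<in> Om p"
    and s_Tot: "P \<in> Tot \<Longrightarrow> s P \<in> Tot"
    and s_Om: "P \<in> Om p \<Longrightarrow> s P = sig p P"
    and s_add: "s (P + Q) = s P + s Q"
    and mul_Om: "P \<in> Om p \<Longrightarrow> Q \<in> Om q \<Longrightarrow> P \<cdot> Q \<in> Om (p + q)"
    and mul_add_left: "(P + P') \<cdot> Q = P \<cdot> Q + P' \<cdot> Q"
    and mul_add_right: "P \<cdot> (Q + Q') = P \<cdot> Q + P \<cdot> Q'"
begin

lemma Tot_zero: "0 \<in> Tot" by (rule Om_Tot[OF Om_zero])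

lemma Tot_diff: "P \<in> Tot \<Longrightarrow> Q \<in> Tot \<Longrightarrow> P - Q \<in> Tot"
  using Tot_add[of P "- Q"] Tot_minus by simp

lemma Om_diff: "P \<in> Om p \<Longrightarrow> Q \<in> Om p \<Longrightarrow> P - Q \<in> Om p"
  using Om_add[of P p "- Q"] Om_minus by simp

lemma Om_sig: "P \<in> Om p \<Longrightarrow> sig n P \<in> Om p"
  by (simp add: sig_def Om_minus)

lemma Tot_sig: "P \<in> Tot \<Longrightarrow> sig n P \<in> Tot"
  by (simp add: sig_def Tot_minus)

lemma mul_zero_left: "0 \<cdot> Q = 0"
  using mul_add_left[of 0 0 Q] by simp

lemma mul_zero_right: "P \<cdot> 0 = 0"
  using mul_add_right[of P 0 0] by simp

lemma mul_minus_left: "(- P) \<cdot> Q = - (P \<cdot> Q)"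
  using mul_add_left[of P "- P" Q] by (simp add: mul_zero_left eq_neg_iff_add_eq_0 add.commute)

lemma mul_minus_right: "P \<cdot> (- Q) = - (P \<cdot> Q)"
  using mul_add_right[of P Q "- Q"] by (simp add: mul_zero_right eq_neg_iff_add_eq_0 add.commute)

lemma mul_sig_left: "sig n P \<cdot> Q = sig n (P \<cdot> Q)"
  and mul_sig_right: "P \<cdot> sig n Q = sig n (P \<cdot> Q)"
  by (simp_all add: sig_def mul_minus_left mul_minus_right)

lemma s_zero: "s 0 = 0"
  using s_add[of 0 0] by simp

lemma s_minus: "s (- P) = - s P"
  using s_add[of P "- P"] by (simp add: s_zero eq_neg_iff_add_eq_0 add.commute)

lemma s_diff: "s (P - Q) = s P - s Q"
  using s_add[of P "- Q"] by (simp add: s_minus)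

definition hom :: "('m \<Rightarrow> 'l \<Rightarrow> real) \<Rightarrow> bool" where "hom P \<longleftrightarrow> (\<exists>p. P \<in> Om p)"

lemma hom_Om: "P \<in> Om p \<Longrightarrow> hom P"
  by (auto simp: hom_def)

lemma hom_Tot: "hom P \<Longrightarrow> P \<in> Tot"
  by (auto simp: hom_def intro: Om_Tot)

lemma hom_s: "hom P \<Longrightarrow> hom (s P)"
  unfolding hom_def using s_Om Om_sig by metis

lemma s_s: "hom P \<Longrightarrow> s (s P) = P"
  by (auto simp: hom_def s_Om) (auto simp: sig_def s_minus s_Om)

definition der :: "int \<Rightarrow> (('m \<Rightarrow> 'l \<Rightarrow> real) \<Rightarrow> 'm \<Rightarrow> 'l \<Rightarrow> real) \<Rightarrow> bool" where
  "der e D \<longleftrightarrow> (\<forall>P\<in>Tot. D P \<in> Tot) \<and> (\<forall>P\<in>Tot. \<forall>Q\<in>Tot. D (P + Q) = D P + D Q) \<and>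
     (\<forall>p. \<forall>P\<in>Om p. D P \<in> Om (p + e)) \<and>
     (\<forall>p q. \<forall>P\<in>Om p. \<forall>Q\<in>Om q. D (P \<cdot> Q) = D P \<cdot> Q + sig (e * p) (P \<cdot> D Q))"

lemma
  assumes "der e D"
  shows der_Tot: "P \<in> Tot \<Longrightarrow> D P \<in> Tot"
    and der_add: "P \<in> Tot \<Longrightarrow> Q \<in> Tot \<Longrightarrow> D (P + Q) = D P + D Q"
    and der_Om: "P \<in> Om p \<Longrightarrow> D P \<in> Om (p + e)"
    and der_mul: "P \<in> Om p \<Longrightarrow> Q \<in> Om q \<Longrightarrow> D (P \<cdot> Q) = D P \<cdot> Q + sig (e * p) (P \<cdot> D Q)"
  using assms by (auto simp: der_def)

lemma der_zero: "der e D \<Longrightarrow> D 0 = 0"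
  using der_add[OF _ Tot_zero Tot_zero] by simp

lemma der_minus: "der e D \<Longrightarrow> P \<in> Tot \<Longrightarrow> D (- P) = - D P"
  using der_add[of e D P "- P"] by (simp add: Tot_minus der_zero eq_neg_iff_add_eq_0 add.commute)

lemma der_diff: "der e D \<Longrightarrow> P \<in> Tot \<Longrightarrow> Q \<in> Tot \<Longrightarrow> D (P - Q) = D P - D Q"
  using der_add[of e D P "- Q"] by (simp add: Tot_minus der_minus)

lemma der_sig: "der e D \<Longrightarrow> P \<in> Tot \<Longrightarrow> D (sig n P) = sig n (D P)"
  by (simp add: sig_def der_minus)

lemma der_hom: "der e D \<Longrightarrow> hom P \<Longrightarrow> hom (D P)"
  unfolding hom_def by (elim exE) (rule exI, erule (1) der_Om)

lemma s_der: "der e D \<Longrightarrow> hom P \<Longrightarrow> s (D P) = sig e (D (s P))"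
proof -
  assume D: "der e D" and "hom P"
  then obtain p where P: "P \<in> Om p" by (auto simp: hom_def)
  show "s (D P) = sig e (D (s P))"
    by (simp add: s_Om[OF P] s_Om[OF der_Om[OF D P]] der_sig[OF D Om_Tot[OF P]] add.commute)
qed

lemma der_cong:
  assumes D: "der e D" and eq: "\<And>P. P \<in> Tot \<Longrightarrow> D P = D' P"
  shows "der e D'"
  unfolding der_def
proof (intro conjI ballI allI)
  fix P Q p q
  show "D' P \<in> Tot" if "P \<in> Tot" using der_Tot[OF D that] eq[OF that] by simp
  show "D' (P + Q) = D' P + D' Q" if "P \<in> Tot" "Q \<in> Tot"
    using der_add[OF D that] eq[OF that(1)] eq[OF that(2)] eq[OF Tot_add[OF that]] by simp
  assume P: "P \<in> Om p"
  show "D' P \<in> Om (p + e)" using der_Om[OF D P] eq[OF Om_Tot[OF P]] by simp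
  assume Q: "Q \<in> Om q"
  show "D' (P \<cdot> Q) = D' P \<cdot> Q + sig (e * p) (P \<cdot> D' Q)"
    using der_mul[OF D P Q] eq[OF Om_Tot[OF P]] eq[OF Om_Tot[OF Q]] eq[OF Om_Tot[OF mul_Om[OF P Q]]] by simp
qed

lemma der_sum: "der e D \<Longrightarrow> der e D' \<Longrightarrow> der e (\<lambda>P. D P + D' P)"
  unfolding der_def by (auto simp: Tot_add Om_add mul_add_left mul_add_right algebra_simps)

lemma der_neg: "der e D \<Longrightarrow> der e (\<lambda>P. - D P)"
  unfolding der_def by (auto simp: Tot_minus Om_minus mul_minus_left mul_minus_right algebra_simps)

lemma der_subtract: "der e D \<Longrightarrow> der e D' \<Longrightarrow> der e (\<lambda>P. D P - D' P)"
  using der_sum[OF _ der_neg] by fastforce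

lemma der_signed: "der e D \<Longrightarrow> der e (\<lambda>P. sig n (D P))"
  by (cases "even n") (simp_all add: der_neg)

lemma der_commutator:
  assumes D: "der e D" and D': "der f D'"
  shows "der (e + f) (\<lambda>P. D (D' P) - sig (e * f) (D' (D P)))"
  unfolding der_def
proof (intro conjI ballI allI)
  fix P Q p q
  show "D (D' P) - sig (e * f) (D' (D P)) \<in> Tot" if "P \<in> Tot"
    using that by (intro Tot_diff Tot_sig der_Tot[OF D] der_Tot[OF D'])
  show "D (D' (P + Q)) - sig (e * f) (D' (D (P + Q))) =
      D (D' P) - sig (e * f) (D' (D P)) + (D (D' Q) - sig (e * f) (D' (D Q)))" if "P \<in> Tot" "Q \<in> Tot"
    using that by (simp add: der_add[OF D] der_add[OF D'] der_Tot[OF D] der_Tot[OF D'])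
  assume P: "P \<in> Om p"
  show "D (D' P) - sig (e * f) (D' (D P)) \<in> Om (p + (e + f))"
    using der_Om[OF D der_Om[OF D' P]] der_Om[OF D' der_Om[OF D P]]
    by (intro Om_diff Om_sig) (simp_all add: algebra_simps)
  assume Q: "Q \<in> Om q"
  have T: "X \<cdot> Y \<in> Tot" if "X \<in> Om i" "Y \<in> Om j" for X Y i j using that mul_Om Om_Tot by blast
  note o = P Q der_Om[OF D P] der_Om[OF D Q] der_Om[OF D' P] der_Om[OF D' Q]
  have 1: "D (D' (P \<cdot> Q)) = D (D' P) \<cdot> Q + sig (e * (p + f)) (D' P \<cdot> D Q)
      + sig (f * p) (D P \<cdot> D' Q + sig (e * p) (P \<cdot> D (D' Q)))"
    by (simp add: der_mul[OF D' P Q] der_add[OF D] der_sig[OF D] T[OF o(5,2)] T[OF o(1,6)] Tot_sig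
        der_mul[OF D o(5,2)] der_mul[OF D o(1,6)])
  have 2: "D' (D (P \<cdot> Q)) = D' (D P) \<cdot> Q + sig (f * (p + e)) (D P \<cdot> D' Q)
      + sig (e * p) (D' P \<cdot> D Q + sig (f * p) (P \<cdot> D' (D Q)))"
    by (simp add: der_mul[OF D P Q] der_add[OF D'] der_sig[OF D'] T[OF o(3,2)] T[OF o(1,4)] Tot_sig
        der_mul[OF D' o(3,2)] der_mul[OF D' o(1,4)])
  have m: "(X - Y) \<cdot> Z = X \<cdot> Z - Y \<cdot> Z" "Z \<cdot> (X - Y) = Z \<cdot> X - Z \<cdot> Y" for X Y Z
    using mul_add_left[of X "- Y" Z] mul_add_right[of Z X "- Y"] by (simp_all add: mul_minus_left mul_minus_right)
  show "D (D' (P \<cdot> Q)) - sig (e * f) (D' (D (P \<cdot> Q))) =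
      (D (D' P) - sig (e * f) (D' (D P))) \<cdot> Q + sig ((e + f) * p) (P \<cdot> (D (D' Q) - sig (e * f) (D' (D Q))))"
    unfolding 1 2 m mul_sig_left mul_sig_right
    by (cases "even e"; cases "even f"; cases "even p") (simp_all add: algebra_simps)
qed

text \<open>
  Biderivations of degree \<open>e\<close> with the symmetry \<open>m(P, Q) = (-1)\<^bsup>pq\<^esup> m(Q, P)\<close>. Among the conventions for
  brackets of odd degree, this one makes every \<open>m(P, \<cdot>)\<close> a derivation of degree \<open>p + e\<close> without further
  signs. The Schouten bracket differs from such an \<open>m\<close> by the sign \<open>(-1)\<^bsup>p + 1\<^esup>\<close>.
\<close>

definition bider :: "int \<Rightarrow> (('m \<Rightarrow> 'l \<Rightarrow> real) \<Rightarrow> ('m \<Rightarrow> 'l \<Rightarrow> real) \<Rightarrow> 'm \<Rightarrow> 'l \<Rightarrow> real) \<Rightarrow> bool" where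
  "bider e m \<longleftrightarrow> (\<forall>P\<in>Tot. \<forall>Q\<in>Tot. m P Q \<in> Tot) \<and>
     (\<forall>P\<in>Tot. \<forall>P'\<in>Tot. \<forall>Q\<in>Tot. m (P + P') Q = m P Q + m P' Q \<and> m Q (P + P') = m Q P + m Q P') \<and>
     (\<forall>p. \<forall>P\<in>Om p. der (p + e) (m P)) \<and>
     (\<forall>p q. \<forall>P\<in>Om p. \<forall>Q\<in>Om q. m P Q = sig (p * q) (m Q P))"

lemma
  assumes "bider e m"
  shows bider_Tot: "P \<in> Tot \<Longrightarrow> Q \<in> Tot \<Longrightarrow> m P Q \<in> Tot"
    and bider_add_left: "P \<in> Tot \<Longrightarrow> P' \<in> Tot \<Longrightarrow> Q \<in> Tot \<Longrightarrow> m (P + P') Q = m P Q + m P' Q"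
    and bider_add_right: "P \<in> Tot \<Longrightarrow> P' \<in> Tot \<Longrightarrow> Q \<in> Tot \<Longrightarrow> m Q (P + P') = m Q P + m Q P'"
    and bider_der: "P \<in> Om p \<Longrightarrow> der (p + e) (m P)"
    and bider_sym: "P \<in> Om p \<Longrightarrow> Q \<in> Om q \<Longrightarrow> m P Q = sig (p * q) (m Q P)"
  using assms unfolding bider_def by blast+

lemma bider_zero_left: "bider e m \<Longrightarrow> Q \<in> Tot \<Longrightarrow> m 0 Q = 0"
  using bider_add_left[of e m 0 0 Q] Tot_zero by simp

lemma bider_zero_right: "bider e m \<Longrightarrow> P \<in> Tot \<Longrightarrow> m P 0 = 0"
  using bider_add_right[of e m 0 0 P] Tot_zero by simp

lemma bider_minus_left: "bider e m \<Longrightarrow> P \<in> Tot \<Longrightarrow> Q \<in> Tot \<Longrightarrow> m (- P) Q = - m P Q"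
  using bider_add_left[of e m P "- P" Q] by (simp add: Tot_minus bider_zero_left eq_neg_iff_add_eq_0 add.commute)

lemma bider_minus_right: "bider e m \<Longrightarrow> P \<in> Tot \<Longrightarrow> Q \<in> Tot \<Longrightarrow> m P (- Q) = - m P Q"
  using bider_add_right[of e m Q "- Q" P] by (simp add: Tot_minus bider_zero_right eq_neg_iff_add_eq_0 add.commute)

lemma bider_diff_left: "bider e m \<Longrightarrow> P \<in> Tot \<Longrightarrow> P' \<in> Tot \<Longrightarrow> Q \<in> Tot \<Longrightarrow> m (P - P') Q = m P Q - m P' Q"
  using bider_add_left[of e m P "- P'" Q] by (simp add: Tot_minus bider_minus_left)

lemma bider_diff_right: "bider e m \<Longrightarrow> P \<in> Tot \<Longrightarrow> P' \<in> Tot \<Longrightarrow> Q \<in> Tot \<Longrightarrow> m Q (P - P') = m Q P - m Q P'"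
  using bider_add_right[of e m P "- P'" Q] by (simp add: Tot_minus bider_minus_right)

lemma bider_sig_left: "bider e m \<Longrightarrow> P \<in> Tot \<Longrightarrow> Q \<in> Tot \<Longrightarrow> m (sig n P) Q = sig n (m P Q)"
  by (simp add: sig_def bider_minus_left)

lemma bider_hom: "bider e m \<Longrightarrow> hom P \<Longrightarrow> hom Q \<Longrightarrow> hom (m P Q)"
  unfolding hom_def by (elim exE) (rule exI, erule (2) der_Om[OF bider_der])

lemma bider_Om: "bider e m \<Longrightarrow> P \<in> Om p \<Longrightarrow> Q \<in> Om q \<Longrightarrow> m P Q \<in> Om (q + (p + e))"
  by (rule der_Om[OF bider_der])

lemma bider_neg:
  assumes m: "bider e m"
  shows "bider e (\<lambda>P Q. - m P Q)"
  unfolding bider_def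
proof (intro conjI ballI allI)
  fix P P' Q p q
  show "- m P Q \<in> Tot" if "P \<in> Tot" "Q \<in> Tot" using bider_Tot[OF m that] by (rule Tot_minus)
  show "- m (P + P') Q = - m P Q + - m P' Q" "- m Q (P + P') = - m Q P + - m Q P'"
    if "P \<in> Tot" "P' \<in> Tot" "Q \<in> Tot" using that by (simp_all add: bider_add_left[OF m] bider_add_right[OF m])
  assume P: "P \<in> Om p"
  show "der (p + e) (\<lambda>Q. - m P Q)" by (rule der_neg[OF bider_der[OF m P]])
  assume Q: "Q \<in> Om q"
  show "- m P Q = sig (p * q) (- m Q P)" using bider_sym[OF m P Q] by simp
qed

lemma bider_sum:
  assumes m: "bider e m" "bider e m'"
  shows "bider e (\<lambda>P Q. m P Q + m' P Q)"
  unfolding bider_def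
proof (intro conjI ballI allI)
  fix P P' Q p q
  show "m P Q + m' P Q \<in> Tot" if "P \<in> Tot" "Q \<in> Tot"
    using bider_Tot[OF m(1) that] bider_Tot[OF m(2) that] by (rule Tot_add)
  show "m (P + P') Q + m' (P + P') Q = m P Q + m' P Q + (m P' Q + m' P' Q)"
    "m Q (P + P') + m' Q (P + P') = m Q P + m' Q P + (m Q P' + m' Q P')"
    if "P \<in> Tot" "P' \<in> Tot" "Q \<in> Tot"
    using that by (simp_all add: bider_add_left[OF m(1)] bider_add_right[OF m(1)] bider_add_left[OF m(2)] bider_add_right[OF m(2)])
  assume P: "P \<in> Om p"
  show "der (p + e) (\<lambda>Q. m P Q + m' P Q)" by (rule der_sum[OF bider_der[OF m(1) P] bider_der[OF m(2) P]])
  assume Q: "Q \<in> Om q"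
  show "m P Q + m' P Q = sig (p * q) (m Q P + m' Q P)" using bider_sym[OF m(1) P Q] bider_sym[OF m(2) P Q] by simp
qed

text \<open>
  The Lie derivative of a bilinear operation \<open>m\<close> of degree \<open>e\<close> along a derivation \<open>D\<close> of degree \<open>f\<close>,
  that is, the defect of \<open>D\<close> being a derivation of \<open>m\<close>. It is again a biderivation; all compatibility
  conditions below are statements about such defects and can be checked on generators.
\<close>

definition act :: "int \<Rightarrow> int \<Rightarrow> (('m \<Rightarrow> 'l \<Rightarrow> real) \<Rightarrow> 'm \<Rightarrow> 'l \<Rightarrow> real) \<Rightarrow>
    (('m \<Rightarrow> 'l \<Rightarrow> real) \<Rightarrow> ('m \<Rightarrow> 'l \<Rightarrow> real) \<Rightarrow> 'm \<Rightarrow> 'l \<Rightarrow> real) \<Rightarrow>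
    ('m \<Rightarrow> 'l \<Rightarrow> real) \<Rightarrow> ('m \<Rightarrow> 'l \<Rightarrow> real) \<Rightarrow> 'm \<Rightarrow> 'l \<Rightarrow> real" where
  "act f e D m P Q = D (m P Q) - sig (f * e) (m (D P) Q) - sig (f * e) (m (if even f then P else s P) (D Q))"

lemma act_bider:
  assumes D: "der f D" and m: "bider e m"
  shows "bider (e + f) (act f e D m)"
proof -
  let ?t = "\<lambda>P. if even f then P else s P"
  have t: "?t P \<in> Tot" "?t (P + P') = ?t P + ?t P'" if "P \<in> Tot" for P P' using that by (auto simp: s_Tot s_add)
  have t': "?t P = sig (f * p) P" if "P \<in> Om p" for p P using that s_Om[of P p] by (auto simp: sig_def)
  show ?thesis
    unfolding bider_def
  proof (intro conjI ballI allI)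
    fix P P' Q p q
    show "act f e D m P Q \<in> Tot" if "P \<in> Tot" "Q \<in> Tot"
      unfolding act_def using that by (intro Tot_diff Tot_sig der_Tot[OF D] bider_Tot[OF m] t)
    show "act f e D m (P + P') Q = act f e D m P Q + act f e D m P' Q"
      "act f e D m Q (P + P') = act f e D m Q P + act f e D m Q P'"
      if "P \<in> Tot" "P' \<in> Tot" "Q \<in> Tot"
      unfolding act_def using that
      by (simp_all add: t(2) t(1) bider_add_left[OF m] bider_add_right[OF m] der_add[OF D] der_Tot[OF D] bider_Tot[OF m]
          s_Tot s_add)
    assume P: "P \<in> Om p"
    have e: "f + (p + e) = p + (e + f)" "p + f + e = p + (e + f)" by simp_all
    have "der (p + (e + f)) (\<lambda>Q. (D (m P Q) - sig (f * (p + e)) (m P (D Q))) - sig (f * e) (m (D P) Q))"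
      by (rule der_subtract[OF der_commutator[OF D bider_der[OF m P], unfolded e]
            der_signed[OF bider_der[OF m der_Om[OF D P]], unfolded e]])
    then show "der (p + (e + f)) (act f e D m P)"
      by (rule der_cong)
        (simp add: act_def t'[OF P] bider_sig_left[OF m Om_Tot[OF P] der_Tot[OF D]] algebra_simps
          del: sig_simps(8,9) split del: if_split)
    assume Q: "Q \<in> Om q"
    have 1: "m (D P) Q = sig ((p + f) * q) (m Q (D P))" by (rule bider_sym[OF m der_Om[OF D P] Q])
    have 2: "m P (D Q) = sig (p * (q + f)) (m (D Q) P)" by (rule bider_sym[OF m P der_Om[OF D Q]])
    have 3: "D (m P Q) = sig (p * q) (D (m Q P))"
      using bider_sym[OF m P Q] by (simp add: der_sig[OF D] bider_Tot[OF m] Om_Tot[OF P] Om_Tot[OF Q])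
    show "act f e D m P Q = sig (p * q) (act f e D m Q P)"
      unfolding act_def t'[OF P] t'[OF Q] bider_sig_left[OF m Om_Tot[OF P] der_Tot[OF D Om_Tot[OF Q]]]
        bider_sig_left[OF m Om_Tot[OF Q] der_Tot[OF D Om_Tot[OF P]]] 1 2 3
      by (cases "even e"; cases "even f"; cases "even p"; cases "even q") (simp_all add: algebra_simps)
  qed
qed

end

text \<open>
  The algebra of forms is generated, locally, by functions and 1-forms. The axiom is the consequence of
  this for derivations, which for forms follows from a cutoff at a single point.
\<close>

locale generated_algebra = graded_algebra +
  assumes determined: "der e D \<Longrightarrow> der e D' \<Longrightarrow> (\<And>f. f \<in> Om 0 \<Longrightarrow> D f = D' f) \<Longrightarrow>
    (\<And>\<alpha>. \<alpha> \<in> Om 1 \<Longrightarrow> D \<alpha> = D' \<alpha>) \<Longrightarrow> P \<in> Om p \<Longrightarrow> D P = D' P"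
begin

lemma bider_determined:
  assumes m: "bider e m" "bider e m'"
    and eq: "\<And>f g. f \<in> Om 0 \<Longrightarrow> g \<in> Om 0 \<Longrightarrow> m f g = m' f g"
      "\<And>f \<beta>. f \<in> Om 0 \<Longrightarrow> \<beta> \<in> Om 1 \<Longrightarrow> m f \<beta> = m' f \<beta>"
      "\<And>\<alpha> \<beta>. \<alpha> \<in> Om 1 \<Longrightarrow> \<beta> \<in> Om 1 \<Longrightarrow> m \<alpha> \<beta> = m' \<alpha> \<beta>"
    and P: "P \<in> Om p" and Q: "Q \<in> Om q"
  shows "m P Q = m' P Q"
proof -
  have 0: "m f Q = m' f Q" if f: "f \<in> Om 0" for f
    by (rule determined[OF bider_der[OF m(1) f] bider_der[OF m(2) f] _ _ Q]) (use eq f in auto)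
  have 1: "m \<alpha> Q = m' \<alpha> Q" if a: "\<alpha> \<in> Om 1" for \<alpha>
  proof (rule determined[OF bider_der[OF m(1) a] bider_der[OF m(2) a] _ _ Q])
    show "m \<alpha> f = m' \<alpha> f" if f: "f \<in> Om 0" for f
      using eq(2)[OF f a] bider_sym[OF m(1) a f] bider_sym[OF m(2) a f] by simp
  qed (rule eq(3)[OF a])
  have "m Q P = m' Q P"
  proof (rule determined[OF bider_der[OF m(1) Q] bider_der[OF m(2) Q] _ _ P])
    show "m Q f = m' Q f" if f: "f \<in> Om 0" for f
      using 0[OF f] bider_sym[OF m(1) Q f] bider_sym[OF m(2) Q f] by simp
    show "m Q \<alpha> = m' Q \<alpha>" if a: "\<alpha> \<in> Om 1" for \<alpha>
      using 1[OF a] bider_sym[OF m(1) Q a] bider_sym[OF m(2) Q a] by simp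
  qed
  then show ?thesis using bider_sym[OF m(1) P Q] bider_sym[OF m(2) P Q] by simp
qed

lemma der_const_zero: "der e (\<lambda>P. 0)"
  by (simp add: der_def Tot_zero Om_zero mul_zero_left mul_zero_right)

end

section \<open>The bracket generated by a pairing and a differential\<close>

text \<open>
  Forms are real functions and thus elements of a ring of functions. Sums \<open>P + P\<close> must not be collected
  to products with the constant function 2, since operators on forms are only known to be additive.
\<close>

declare [[simproc del: int_combine_numerals]]

text \<open>
  For forms, \<open>\<kappa>\<close> is the biderivation of degree \<open>-2\<close> that is given by a bivector \<open>\<pi>\<close>: it vanishes on functions
  and equals \<open>- \<pi>\<close> on 1-forms, and \<open>\<kappa>(\<alpha>, \<cdot>)\<close> is the contraction with \<open>- \<pi>\<^sup>\<sharp>\<alpha>\<close>.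
\<close>

locale paired_algebra = generated_algebra Om Tot mul s
  for Om :: "int \<Rightarrow> ('m \<Rightarrow> 'l \<Rightarrow> real) set" and Tot and mul (infixl "\<cdot>" 70) and s +
  fixes d :: "('m \<Rightarrow> 'l \<Rightarrow> real) \<Rightarrow> 'm \<Rightarrow> 'l \<Rightarrow> real"
    and \<kappa> :: "('m \<Rightarrow> 'l \<Rightarrow> real) \<Rightarrow> ('m \<Rightarrow> 'l \<Rightarrow> real) \<Rightarrow> 'm \<Rightarrow> 'l \<Rightarrow> real"
  assumes d_der: "der 1 d"
    and d_d_gen: "f \<in> Om 0 \<Longrightarrow> d (d f) = 0" "\<alpha> \<in> Om 1 \<Longrightarrow> d (d \<alpha>) = 0"
    and \<kappa>_bider: "bider (- 2) \<kappa>"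
    and \<kappa>_fun: "f \<in> Om 0 \<Longrightarrow> Q \<in> Om q \<Longrightarrow> \<kappa> f Q = 0"
begin

lemma d_d: "hom P \<Longrightarrow> d (d P) = 0"
proof -
  assume "hom P"
  then obtain p where P: "P \<in> Om p" by (auto simp: hom_def)
  have "d (d P) - sig (1 * 1) (d (d P)) = 0"
    by (rule determined[OF der_commutator[OF d_der d_der] der_const_zero _ _ P]) (auto simp: d_d_gen)
  then have "d (d P) + d (d P) = 0" by simp
  then show ?thesis by (rule double_eq_0)
qed

lemma \<kappa>_fun_right: "P \<in> Om p \<Longrightarrow> f \<in> Om 0 \<Longrightarrow> \<kappa> P f = 0"
  using bider_sym[OF \<kappa>_bider, of P p f 0] \<kappa>_fun by simp

lemmas d_Tot = der_Tot[OF d_der] and d_add = der_add[OF d_der] and d_minus = der_minus[OF d_der]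
  and d_diff = der_diff[OF d_der] and d_zero = der_zero[OF d_der] and d_hom = der_hom[OF d_der]
  and d_Om = der_Om[OF d_der]
lemmas \<kappa>_Tot = bider_Tot[OF \<kappa>_bider] and \<kappa>_hom = bider_hom[OF \<kappa>_bider]
  and \<kappa>_linear = bider_add_left[OF \<kappa>_bider] bider_add_right[OF \<kappa>_bider] bider_minus_left[OF \<kappa>_bider]
    bider_minus_right[OF \<kappa>_bider] bider_diff_left[OF \<kappa>_bider] bider_diff_right[OF \<kappa>_bider]
    bider_zero_left[OF \<kappa>_bider] bider_zero_right[OF \<kappa>_bider]
lemmas d_linear = d_add d_minus d_diff d_zero
lemmas Tot_closed = hom_Tot Tot_add Tot_minus Tot_diff Tot_zero d_Tot \<kappa>_Tot s_Tot
lemmas hom_closed = d_hom \<kappa>_hom hom_s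
lemmas s_linear = s_add s_minus s_diff s_zero

lemma s_d: "hom P \<Longrightarrow> s (d P) = - d (s P)"
  using s_der[OF d_der] by simp

lemmas expand = Tot_closed hom_closed d_linear \<kappa>_linear s_linear s_d s_s d_d

text \<open>
  Up to sign the defect of \<open>d\<close> being a derivation of \<open>\<kappa>\<close>. On 1-forms it is the bracket \<open>[\<alpha>, \<beta>]\<^sub>\<pi>\<close>, and
  \<open>b(\<alpha>, f)\<close> is the derivative of \<open>f\<close> along \<open>\<pi>\<^sup>\<sharp>\<alpha>\<close>; so it is the Schouten bracket of \<open>A\<^sup>*\<^sub>\<pi>\<close>, in the sign convention
  for biderivations.
\<close>

definition b :: "('m \<Rightarrow> 'l \<Rightarrow> real) \<Rightarrow> ('m \<Rightarrow> 'l \<Rightarrow> real) \<Rightarrow> 'm \<Rightarrow> 'l \<Rightarrow> real" where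
  "b P Q = - d (\<kappa> P Q) + \<kappa> (d P) Q + \<kappa> (s P) (d Q)"

lemma b_bider: "bider (- 1) b"
proof -
  have "b = (\<lambda>P Q. - act 1 (- 2) d \<kappa> P Q)"
    by (intro ext) (simp add: b_def act_def multi_apply2)
  then show ?thesis using bider_neg[OF act_bider[OF d_der \<kappa>_bider]] by simp
qed

lemmas b_linear = bider_add_left[OF b_bider] bider_add_right[OF b_bider] bider_minus_left[OF b_bider]
    bider_minus_right[OF b_bider] bider_diff_left[OF b_bider] bider_diff_right[OF b_bider]
    bider_zero_left[OF b_bider] bider_zero_right[OF b_bider]

lemma \<kappa>_1_1: "\<alpha> \<in> Om 1 \<Longrightarrow> \<beta> \<in> Om 1 \<Longrightarrow> \<kappa> \<alpha> \<beta> \<in> Om 0"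
  and \<kappa>_1_3: "\<alpha> \<in> Om 1 \<Longrightarrow> P \<in> Om 3 \<Longrightarrow> \<kappa> \<alpha> P \<in> Om 2"
  using bider_Om[OF \<kappa>_bider, of \<alpha> 1 \<beta> 1]
    bider_Om[OF \<kappa>_bider, of \<alpha> 1 P 3] by simp_all

lemma d_0: "f \<in> Om 0 \<Longrightarrow> d f \<in> Om 1" and d_1: "\<alpha> \<in> Om 1 \<Longrightarrow> d \<alpha> \<in> Om 2" and d_2: "P \<in> Om 2 \<Longrightarrow> d P \<in> Om 3"
  using d_Om[of f 0] d_Om[of \<alpha> 1] d_Om[of P 2] by simp_all

lemma s_1: "\<alpha> \<in> Om 1 \<Longrightarrow> s \<alpha> = - \<alpha>" and s_0: "f \<in> Om 0 \<Longrightarrow> s f = f" and s_2: "P \<in> Om 2 \<Longrightarrow> s P = P"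
  and s_3: "P \<in> Om 3 \<Longrightarrow> s P = - P"
  by (auto simp: s_Om)

lemma \<kappa>_sym_odd_even: "P \<in> Om p \<Longrightarrow> Q \<in> Om q \<Longrightarrow> even (p * q) \<Longrightarrow> \<kappa> P Q = \<kappa> Q P"
  and \<kappa>_sym_odd_odd: "P \<in> Om p \<Longrightarrow> Q \<in> Om q \<Longrightarrow> odd (p * q) \<Longrightarrow> \<kappa> P Q = - \<kappa> Q P"
  using bider_sym[OF \<kappa>_bider, of P p Q q] by (simp_all add: sig_def)

lemma b_1: "\<alpha> \<in> Om 1 \<Longrightarrow> b \<alpha> Q = - d (\<kappa> \<alpha> Q) + \<kappa> (d \<alpha>) Q + \<kappa> (- \<alpha>) (d Q)"
  by (simp add: b_def s_1)

lemma b_1_1: "\<alpha> \<in> Om 1 \<Longrightarrow> \<beta> \<in> Om 1 \<Longrightarrow> b \<alpha> \<beta> = \<kappa> \<beta> (d \<alpha>) - d (\<kappa> \<alpha> \<beta>) - \<kappa> \<alpha> (d \<beta>)"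
  using \<kappa>_sym_odd_even[OF d_1, of \<alpha> \<beta> 1]
  by (simp add: b_1 \<kappa>_linear hom_Om Tot_closed Om_Tot d_Om)

lemma b_1_1_Om: "\<alpha> \<in> Om 1 \<Longrightarrow> \<beta> \<in> Om 1 \<Longrightarrow> b \<alpha> \<beta> \<in> Om 1"
  using bider_Om[OF b_bider, of \<alpha> 1 \<beta> 1] by simp

lemma b_1_1_antisym: "\<alpha> \<in> Om 1 \<Longrightarrow> \<beta> \<in> Om 1 \<Longrightarrow> b \<alpha> \<beta> = - b \<beta> \<alpha>"
  using bider_sym[OF b_bider, of \<alpha> 1 \<beta> 1] by simp

lemma b_1_0: "\<alpha> \<in> Om 1 \<Longrightarrow> f \<in> Om 0 \<Longrightarrow> b \<alpha> f = - \<kappa> \<alpha> (d f)"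
  by (simp add: b_1 \<kappa>_fun_right[of _ 1] \<kappa>_fun_right[OF d_1] d_zero \<kappa>_linear Om_Tot[of _ 1] d_0)

lemma b_0_0: "f \<in> Om 0 \<Longrightarrow> g \<in> Om 0 \<Longrightarrow> b f g = 0"
  by (simp add: b_def s_0 \<kappa>_fun[of _ g 0] \<kappa>_fun_right[OF d_0] \<kappa>_fun[OF _ d_0] d_zero)

lemma \<kappa>_1_anticommute:
  assumes a: "\<alpha> \<in> Om 1" and b: "\<beta> \<in> Om 1" and "hom Q"
  shows "\<kappa> \<alpha> (\<kappa> \<beta> Q) = - \<kappa> \<beta> (\<kappa> \<alpha> Q)"
proof -
  obtain q where Q: "Q \<in> Om q" using \<open>hom Q\<close> by (auto simp: hom_def)
  have "\<kappa> \<alpha> (\<kappa> \<beta> Q) - sig ((1 + - 2) * (1 + - 2)) (\<kappa> \<beta> (\<kappa> \<alpha> Q)) = 0"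
  proof (rule determined[OF der_commutator[OF bider_der[OF \<kappa>_bider a] bider_der[OF \<kappa>_bider b]] der_const_zero _ _ Q])
    show "\<kappa> \<alpha> (\<kappa> \<beta> f) - sig ((1 + - 2) * (1 + - 2)) (\<kappa> \<beta> (\<kappa> \<alpha> f)) = 0" if f: "f \<in> Om 0" for f
      by (simp add: \<kappa>_fun_right[OF a f] \<kappa>_fun_right[OF b f] \<kappa>_linear Om_Tot[OF a] Om_Tot[OF b])
    show "\<kappa> \<alpha> (\<kappa> \<beta> \<gamma>) - sig ((1 + - 2) * (1 + - 2)) (\<kappa> \<beta> (\<kappa> \<alpha> \<gamma>)) = 0" if c: "\<gamma> \<in> Om 1" for \<gamma>
      by (simp add: \<kappa>_fun_right[OF a \<kappa>_1_1[OF b c]] \<kappa>_fun_right[OF b \<kappa>_1_1[OF a c]])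
  qed
  then show ?thesis by (simp add: eq_neg_iff_add_eq_0)
qed

end

text \<open>
  The Poisson condition, in the form in which it comes out of the vanishing of the differential of the
  bivector with respect to its own bracket.
\<close>

locale poisson_algebra = paired_algebra +
  assumes poisson: "\<alpha> \<in> Om 1 \<Longrightarrow> \<beta> \<in> Om 1 \<Longrightarrow> \<gamma> \<in> Om 1 \<Longrightarrow>
    \<kappa> \<alpha> (d (\<kappa> \<beta> \<gamma>)) + \<kappa> \<beta> (d (\<kappa> \<gamma> \<alpha>)) + \<kappa> \<gamma> (d (\<kappa> \<alpha> \<beta>)) +
    \<kappa> (b \<alpha> \<beta>) \<gamma> + \<kappa> (b \<beta> \<gamma>) \<alpha> + \<kappa> (b \<gamma> \<alpha>) \<beta> = 0"
begin

context
  fixes \<alpha> \<beta> \<gamma> assumes a: "\<alpha> \<in> Om 1" and b: "\<beta> \<in> Om 1" and c: "\<gamma> \<in> Om 1"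
begin

lemma \<kappa>_b_swap:
  "\<kappa> (b \<alpha> \<beta>) \<gamma> = - (\<kappa> \<gamma> (\<kappa> \<beta> (d \<alpha>)) - \<kappa> \<gamma> (d (\<kappa> \<alpha> \<beta>)) - \<kappa> \<gamma> (\<kappa> \<alpha> (d \<beta>)))"
proof -
  have "\<kappa> (b \<alpha> \<beta>) \<gamma> = - \<kappa> \<gamma> (b \<alpha> \<beta>)" by (rule \<kappa>_sym_odd_odd[OF b_1_1_Om[OF a b] c]) simp
  then show ?thesis by (simp add: b_1_1[OF a b] expand hom_Om[OF a] hom_Om[OF b] hom_Om[OF c])
qed

end

lemma poisson_cyclic:
  assumes a: "\<alpha> \<in> Om 1" and b: "\<beta> \<in> Om 1" and c: "\<gamma> \<in> Om 1"
  shows "\<kappa> \<alpha> (d (\<kappa> \<beta> \<gamma>)) + \<kappa> \<beta> (d (\<kappa> \<gamma> \<alpha>)) + \<kappa> \<gamma> (d (\<kappa> \<alpha> \<beta>))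
    = \<kappa> \<alpha> (\<kappa> \<gamma> (d \<beta>)) + \<kappa> \<beta> (\<kappa> \<alpha> (d \<gamma>)) + \<kappa> \<gamma> (\<kappa> \<beta> (d \<alpha>))" (is "?X = ?Y")
proof -
  note h = hom_Om[OF a] hom_Om[OF b] hom_Om[OF c]
  have "(?X - ?Y) + (?X - ?Y) = 0"
    using poisson[OF a b c]
    unfolding \<kappa>_b_swap[OF a b c] \<kappa>_b_swap[OF b c a] \<kappa>_b_swap[OF c a b]
      \<kappa>_1_anticommute[OF c a d_hom[OF h(2)]] \<kappa>_1_anticommute[OF a b d_hom[OF h(3)]] \<kappa>_1_anticommute[OF b c d_hom[OF h(1)]]
    by (simp add: algebra_simps)
  then show ?thesis using double_eq_0 by (metis eq_iff_diff_eq_0)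
qed

text \<open>
  The identity \<open>\<pi>\<^sup>\<sharp>[\<alpha>, \<beta>]\<^sub>\<pi> = [\<pi>\<^sup>\<sharp>\<alpha>, \<pi>\<^sup>\<sharp>\<beta>]\<close> as an equation between derivations of forms: the right-hand
  side is the commutator of a Lie derivative with a contraction. On 1-forms it is the Poisson condition.
\<close>

lemma \<kappa>_b:
  assumes a: "\<alpha> \<in> Om 1" and b: "\<beta> \<in> Om 1" and "hom Q"
  shows "\<kappa> (b \<alpha> \<beta>) Q = - \<kappa> \<alpha> (d (\<kappa> \<beta> Q)) - d (\<kappa> \<alpha> (\<kappa> \<beta> Q)) + \<kappa> \<beta> (d (\<kappa> \<alpha> Q)) + \<kappa> \<beta> (\<kappa> \<alpha> (d Q))"
proof -
  obtain q where Q: "Q \<in> Om q" using \<open>hom Q\<close> by (auto simp: hom_def)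
  note h = hom_Om[OF a] hom_Om[OF b] hom_Om[OF b_1_1_Om[OF a b]]
  let ?a = "\<kappa> \<alpha>" and ?b = "\<kappa> \<beta>"
  have da: "der (1 + - 2) ?a" "der (1 + - 2) ?b" using bider_der[OF \<kappa>_bider a] bider_der[OF \<kappa>_bider b] by auto
  have l: "der (1 + - 2 + 1) (\<lambda>Q. ?a (d Q) - sig ((1 + - 2) * 1) (d (?a Q)))"
    by (rule der_commutator[OF da(1) d_der])
  let ?L = "\<lambda>Q. ?a (d Q) - sig ((1 + - 2) * 1) (d (?a Q))"
  have "der (1 + - 2 + 1 + (1 + - 2)) (\<lambda>Q. ?L (?b Q) - sig ((1 + - 2 + 1) * (1 + - 2)) (?b (?L Q)))"
    by (rule der_commutator[OF l da(2)])
  then have D: "der (1 + - 2) (\<lambda>Q. - (?L (?b Q) - sig ((1 + - 2 + 1) * (1 + - 2)) (?b (?L Q))))"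
    by (intro der_neg) simp
  have "\<kappa> (b \<alpha> \<beta>) Q = - (?L (?b Q) - sig ((1 + - 2 + 1) * (1 + - 2)) (?b (?L Q)))"
  proof (rule determined[OF bider_der[OF \<kappa>_bider b_1_1_Om[OF a b]] D _ _ Q])
    fix f assume f: "f \<in> Om 0"
    show "\<kappa> (b \<alpha> \<beta>) f = - (?L (?b f) - sig ((1 + - 2 + 1) * (1 + - 2)) (?b (?L f)))"
      by (simp add: \<kappa>_fun_right[OF a f] \<kappa>_fun_right[OF b f] \<kappa>_fun_right[OF b_1_1_Om[OF a b] f]
          \<kappa>_fun_right[OF b \<kappa>_1_1[OF a d_0[OF f]]] expand h)
  next
    fix \<gamma> assume c: "\<gamma> \<in> Om 1"
    have z: "?a (?b \<gamma>) = 0" by (rule \<kappa>_fun_right[OF a \<kappa>_1_1[OF b c]])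
    have ac: "\<kappa> \<gamma> \<alpha> = - \<kappa> \<alpha> \<gamma>" by (rule \<kappa>_sym_odd_odd[OF c a]) simp
    note h' = h hom_Om[OF c]
    have "\<kappa> \<gamma> (d (\<kappa> \<alpha> \<beta>)) - \<kappa> \<gamma> (\<kappa> \<beta> (d \<alpha>)) + \<kappa> \<gamma> (\<kappa> \<alpha> (d \<beta>))
      = - ?a (d (?b \<gamma>)) + ?b (d (?a \<gamma>)) + ?b (?a (d \<gamma>))"
      using poisson_cyclic[OF a b c] \<kappa>_1_anticommute[OF a c d_hom[OF h(2)]]
      by (simp add: ac expand h' algebra_simps)
    then show "\<kappa> (b \<alpha> \<beta>) \<gamma> = - (?L (?b \<gamma>) - sig ((1 + - 2 + 1) * (1 + - 2)) (?b (?L \<gamma>)))"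
      by (simp add: \<kappa>_b_swap[OF a b c] z expand h' algebra_simps)
  qed
  then show ?thesis by (simp add: expand h \<open>hom Q\<close> algebra_simps)
qed

text \<open>
  With \<open>\<kappa>_b\<close> the double brackets are expanded in \<open>d\<close>, \<open>\<kappa>(\<alpha>, \<cdot>)\<close>, \<open>\<kappa>(\<beta>, \<cdot>)\<close> and \<open>\<kappa>(\<gamma>, \<cdot>)\<close>. In the cyclic sum
  everything cancels except the differential of the Poisson condition.
\<close>

theorem b_jacobi:
  assumes a: "\<alpha> \<in> Om 1" and b: "\<beta> \<in> Om 1" and c: "\<gamma> \<in> Om 1"
  shows "b \<alpha> (b \<beta> \<gamma>) + b \<beta> (b \<gamma> \<alpha>) + b \<gamma> (b \<alpha> \<beta>) = 0"
proof -
  have one: "b \<alpha> (b \<beta> \<gamma>) =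
      - \<kappa> \<beta> (d (\<kappa> \<gamma> (d \<alpha>))) - d (\<kappa> \<beta> (\<kappa> \<gamma> (d \<alpha>))) + \<kappa> \<gamma> (d (\<kappa> \<beta> (d \<alpha>)))
      - d (\<kappa> \<alpha> (\<kappa> \<gamma> (d \<beta>))) + d (\<kappa> \<alpha> (d (\<kappa> \<beta> \<gamma>))) + d (\<kappa> \<alpha> (\<kappa> \<beta> (d \<gamma>)))
      - \<kappa> \<alpha> (d (\<kappa> \<gamma> (d \<beta>))) + \<kappa> \<alpha> (d (\<kappa> \<beta> (d \<gamma>)))"
    if a: "\<alpha> \<in> Om 1" and b: "\<beta> \<in> Om 1" and c: "\<gamma> \<in> Om 1" for \<alpha> \<beta> \<gamma>
  proof -
    note h = hom_Om[OF a] hom_Om[OF b] hom_Om[OF c]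
    have "b \<alpha> (b \<beta> \<gamma>) = \<kappa> (b \<beta> \<gamma>) (d \<alpha>) - d (\<kappa> \<alpha> (b \<beta> \<gamma>)) - \<kappa> \<alpha> (d (b \<beta> \<gamma>))"
      by (rule b_1_1[OF a b_1_1_Om[OF b c]])
    also have "\<kappa> (b \<beta> \<gamma>) (d \<alpha>) = - \<kappa> \<beta> (d (\<kappa> \<gamma> (d \<alpha>))) - d (\<kappa> \<beta> (\<kappa> \<gamma> (d \<alpha>))) + \<kappa> \<gamma> (d (\<kappa> \<beta> (d \<alpha>)))"
      by (subst \<kappa>_b[OF b c]) (simp_all add: expand h)
    finally show ?thesis by (simp add: b_1_1[OF b c] expand h algebra_simps)
  qed
  note h = hom_Om[OF a] hom_Om[OF b] hom_Om[OF c]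
  have "d (\<kappa> \<alpha> (d (\<kappa> \<beta> \<gamma>))) + d (\<kappa> \<beta> (d (\<kappa> \<gamma> \<alpha>))) + d (\<kappa> \<gamma> (d (\<kappa> \<alpha> \<beta>)))
    = d (\<kappa> \<alpha> (\<kappa> \<gamma> (d \<beta>))) + d (\<kappa> \<beta> (\<kappa> \<alpha> (d \<gamma>))) + d (\<kappa> \<gamma> (\<kappa> \<beta> (d \<alpha>)))"
    using arg_cong[OF poisson_cyclic[OF a b c], of d] by (simp add: expand h)
  then show ?thesis unfolding one[OF a b c] one[OF b c a] one[OF c a b] by (simp add: algebra_simps)
qed

end

section \<open>The algebraic core of the theorem\<close>

text \<open>
  The operators \<open>n\<close> and \<open>n2\<close> stand for \<open>i\<^sub>N\<close> and \<open>i\<close> of the square of \<open>N\<close>. The torsion of \<open>N\<close> enters through the latter: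
  \<open>[i\<^sub>N, d\<^sub>N]\<close> and \<open>[i\<^bsub>NN\<^esub>, d]\<close> differ by twice the insertion of the torsion.
\<close>

locale background_algebra = poisson_algebra Om Tot mul s d \<kappa>
  for Om :: "int \<Rightarrow> ('m \<Rightarrow> 'l \<Rightarrow> real) set" and Tot and mul (infixl "\<cdot>" 70) and s and d \<kappa> +
  fixes n n2 :: "('m \<Rightarrow> 'l \<Rightarrow> real) \<Rightarrow> 'm \<Rightarrow> 'l \<Rightarrow> real" and H \<psi> :: "'m \<Rightarrow> 'l \<Rightarrow> real"
  assumes n_der: "der 0 n" and n2_der: "der 0 n2"
    and n_fun: "f \<in> Om 0 \<Longrightarrow> n f = 0" and n2_fun: "f \<in> Om 0 \<Longrightarrow> n2 f = 0"
    and n2_1: "\<alpha> \<in> Om 1 \<Longrightarrow> n2 \<alpha> = n (n \<alpha>)"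
    and H: "H \<in> Om 3" and \<psi>: "\<psi> \<in> Om 3" and dH: "d H = 0" and d\<psi>: "d \<psi> = 0"
    and n_\<kappa>: "\<alpha> \<in> Om 1 \<Longrightarrow> \<beta> \<in> Om 1 \<Longrightarrow> \<kappa> (n \<alpha>) \<beta> = \<kappa> \<alpha> (n \<beta>)"
begin

definition dN :: "('m \<Rightarrow> 'l \<Rightarrow> real) \<Rightarrow> 'm \<Rightarrow> 'l \<Rightarrow> real" where
  "dN P = n (d P) - d (n P)"

definition K :: "('m \<Rightarrow> 'l \<Rightarrow> real) \<Rightarrow> 'm \<Rightarrow> 'l \<Rightarrow> real" where
  "K P = \<kappa> H P"

definition \<delta> :: "('m \<Rightarrow> 'l \<Rightarrow> real) \<Rightarrow> 'm \<Rightarrow> 'l \<Rightarrow> real" where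
  "\<delta> P = dN P - K P"

text \<open>
  The concomitant \<open>C\<^bsub>\<pi>,N\<^esub>\<close>, extended from 1-forms to all forms: the bracket generated by \<open>d\<^sub>N\<close> minus the
  deformation of \<open>b\<close> by \<open>i\<^sub>N\<close>. Correspondingly \<open>KK\<close>, the defect of \<open>K\<close> being a derivation of \<open>\<kappa>\<close>, extends the form
  \<open>2 i(\<pi>\<^sup>\<sharp>\<alpha> \<and> \<pi>\<^sup>\<sharp>\<beta>) H\<close>.
\<close>

definition C :: "('m \<Rightarrow> 'l \<Rightarrow> real) \<Rightarrow> ('m \<Rightarrow> 'l \<Rightarrow> real) \<Rightarrow> 'm \<Rightarrow> 'l \<Rightarrow> real" where
  "C P Q = (- dN (\<kappa> P Q) + \<kappa> (dN P) Q + \<kappa> (s P) (dN Q)) - (b (n P) Q + b P (n Q) - n (b P Q))"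

definition KK :: "('m \<Rightarrow> 'l \<Rightarrow> real) \<Rightarrow> ('m \<Rightarrow> 'l \<Rightarrow> real) \<Rightarrow> 'm \<Rightarrow> 'l \<Rightarrow> real" where
  "KK P Q = K (\<kappa> P Q) - \<kappa> (K P) Q - \<kappa> (s P) (K Q)"

text \<open>Twice the derivation \<open>\<alpha> \<mapsto> \<alpha> \<circ> T\<^sub>N\<close>, as prescribed by the torsion condition.\<close>

definition \<tau> :: "('m \<Rightarrow> 'l \<Rightarrow> real) \<Rightarrow> 'm \<Rightarrow> 'l \<Rightarrow> real" where
  "\<tau> P = - \<kappa> \<psi> P - \<kappa> \<psi> P - \<kappa> (n H) P - (n (K P) - K (n P))"

lemma dN_der: "der 1 dN"
  using der_commutator[OF n_der d_der] by (simp add: dN_def[abs_def])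

lemma K_der: "der 1 K"
  using bider_der[OF \<kappa>_bider H] by (simp add: K_def[abs_def])

lemma \<delta>_der: "der 1 \<delta>"
  using der_subtract[OF dN_der K_der] by (simp add: \<delta>_def[abs_def])

lemma nH: "n H \<in> Om 3"
  using der_Om[OF n_der H] by simp

lemma \<tau>_der: "der 1 \<tau>"
proof -
  have 1: "der 1 (\<kappa> \<psi>)" "der 1 (\<kappa> (n H))" using bider_der[OF \<kappa>_bider \<psi>] bider_der[OF \<kappa>_bider nH] by auto
  have "der 1 (\<lambda>P. n (K P) - K (n P))" using der_commutator[OF n_der K_der] by simp
  from der_subtract[OF der_subtract[OF der_subtract[OF der_neg[OF 1(1)] 1(1)] 1(2)] this]
  show ?thesis by (simp add: \<tau>_def[abs_def])
qed

lemma C_bider: "bider (- 1) C"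
proof -
  have 1: "bider (- 1) (\<lambda>P Q. - act 1 (- 2) dN \<kappa> P Q)" using bider_neg[OF act_bider[OF dN_der \<kappa>_bider]] by simp
  have 2: "bider (- 1) (act 0 (- 1) n b)" using act_bider[OF n_der b_bider] by simp
  have "C = (\<lambda>P Q. - act 1 (- 2) dN \<kappa> P Q + act 0 (- 1) n b P Q)"
    by (intro ext) (simp add: C_def act_def multi_apply2)
  then show ?thesis using bider_sum[OF 1 2] by simp
qed

lemma KK_bider: "bider (- 1) KK"
proof -
  have "KK = act 1 (- 2) K \<kappa>" by (intro ext) (simp add: KK_def act_def multi_apply2)
  then show ?thesis using act_bider[OF K_der \<kappa>_bider] by simp
qed

lemmas n_linear = der_add[OF n_der] der_minus[OF n_der] der_diff[OF n_der] der_zero[OF n_der]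
lemmas n2_linear = der_add[OF n2_der] der_minus[OF n2_der] der_diff[OF n2_der] der_zero[OF n2_der]
lemmas K_linear = der_add[OF K_der] der_minus[OF K_der] der_diff[OF K_der] der_zero[OF K_der]

lemma s_n: "hom P \<Longrightarrow> s (n P) = n (s P)"
  using s_der[OF n_der] by simp

lemma s_K: "hom P \<Longrightarrow> s (K P) = - K (s P)"
  using s_der[OF K_der] by simp

lemmas expand_n = expand n_linear n2_linear s_n der_Tot[OF n_der] der_hom[OF n_der] der_Tot[OF n2_der] der_hom[OF n2_der]
lemmas expand_K = expand_n K_linear s_K der_Tot[OF K_der] der_hom[OF K_der]

lemma K_1: "\<alpha> \<in> Om 1 \<Longrightarrow> K \<alpha> = - \<kappa> \<alpha> H"
  unfolding K_def by (rule \<kappa>_sym_odd_odd[OF H]) auto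

lemma K_fun: "f \<in> Om 0 \<Longrightarrow> K f = 0"
  unfolding K_def by (rule \<kappa>_fun_right[OF H])

lemma K_H: "K H = 0"
proof -
  have "K H = - K H" unfolding K_def by (rule \<kappa>_sym_odd_odd[OF H H]) simp
  then have "K H + K H = 0" by (simp add: eq_neg_iff_add_eq_0)
  then show ?thesis by (rule double_eq_0)
qed

subsection \<open>The first structure equation: compatibility with the bracket\<close>

lemma n_1: "\<alpha> \<in> Om 1 \<Longrightarrow> n \<alpha> \<in> Om 1" and K_Om_1: "\<alpha> \<in> Om 1 \<Longrightarrow> K \<alpha> \<in> Om 2" and K_Om_2: "P \<in> Om 2 \<Longrightarrow> K P \<in> Om 3"
  using der_Om[OF n_der, of \<alpha> 1] der_Om[OF K_der, of \<alpha> 1] der_Om[OF K_der, of P 2] by auto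

lemma dN_fun: "f \<in> Om 0 \<Longrightarrow> dN f = n (d f)"
  by (simp add: dN_def n_fun d_zero)

text \<open>
  Both sides are biderivations. On a function and a 1-form both vanish, which for \<open>C\<close> is the symmetry
  of \<open>\<pi>\<^sup>\<sharp> \<circ> N\<^sup>t\<close>, so the condition on 1-forms decides.
\<close>

lemma C_eq_KK:
  assumes C: "\<And>\<alpha> \<beta>. \<alpha> \<in> Om 1 \<Longrightarrow> \<beta> \<in> Om 1 \<Longrightarrow> C \<alpha> \<beta> = - KK \<alpha> \<beta>"
    and PQ: "P \<in> Om p" "Q \<in> Om q"
  shows "C P Q = - KK P Q"
proof (rule bider_determined[OF C_bider bider_neg[OF KK_bider] _ _ C PQ])
  have b: "b f Q = \<kappa> (d f) Q" if "f \<in> Om 0" "Q \<in> Om q" for f Q q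
    using that by (simp add: b_def s_0 \<kappa>_fun[of f Q q] \<kappa>_fun[OF _ d_Om] d_zero)
  show "C f g = - KK f g" if f: "f \<in> Om 0" and g: "g \<in> Om 0" for f g
    using n_1[OF d_0[OF f]] n_1[OF d_0[OF g]]
    by (simp add: C_def KK_def s_0[OF f] n_fun[OF f] n_fun[OF g] \<kappa>_fun[OF f g] dN_fun f g b[OF f g]
        \<kappa>_fun_right[of _ 1 g] \<kappa>_fun[of f _ 1] K_fun b_linear der_zero[OF dN_der] d_0 Om_Tot[OF f] Om_Tot[OF g] expand_K \<kappa>_fun[OF f Om_zero])
  show "C f \<beta> = - KK f \<beta>" if f: "f \<in> Om 0" and \<beta>: "\<beta> \<in> Om 1" for f \<beta>
  proof -
    have dN\<beta>: "dN \<beta> \<in> Om 2" using der_Om[OF dN_der \<beta>] by simp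
    have "n (\<kappa> (d f) \<beta>) = 0" by (rule n_fun[OF \<kappa>_1_1[OF d_0[OF f] \<beta>]])
    then show ?thesis
      by (simp add: C_def KK_def s_0[OF f] n_fun[OF f] \<kappa>_fun[OF f \<beta>] dN_fun[OF f] b[OF f \<beta>] b[OF f n_1[OF \<beta>]]
        \<kappa>_fun[OF f dN\<beta>] \<kappa>_fun[OF f K_Om_1[OF \<beta>]] K_fun[OF f] n_\<kappa>[OF d_0[OF f] \<beta>] b_linear Om_Tot[OF \<beta>]
        der_zero[OF dN_der] expand_K)
  qed
qed

lemma K_\<kappa>_1:
  assumes \<beta>: "\<beta> \<in> Om 1" and "hom Q"
  shows "K (\<kappa> \<beta> Q) + \<kappa> \<beta> (K Q) = \<kappa> (\<kappa> \<beta> H) Q"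
proof -
  obtain q where Q: "Q \<in> Om q" using \<open>hom Q\<close> by (auto simp: hom_def)
  have h: "hom \<beta>" "hom H" using \<beta> H hom_Om by auto
  have D: "der (1 + - 2 + 1) (\<lambda>Q. \<kappa> \<beta> (K Q) - sig ((1 + - 2) * 1) (K (\<kappa> \<beta> Q)))"
    by (rule der_commutator[OF bider_der[OF \<kappa>_bider \<beta>] K_der])
  have D': "der (1 + - 2 + 1) (\<kappa> (\<kappa> \<beta> H))" using bider_der[OF \<kappa>_bider \<kappa>_1_3[OF \<beta> H]] by simp
  have "\<kappa> \<beta> (K Q) - sig ((1 + - 2) * 1) (K (\<kappa> \<beta> Q)) = \<kappa> (\<kappa> \<beta> H) Q"
  proof (rule determined[OF D D' _ _ Q])
    show "\<kappa> \<beta> (K f) - sig ((1 + - 2) * 1) (K (\<kappa> \<beta> f)) = \<kappa> (\<kappa> \<beta> H) f" if f: "f \<in> Om 0" for f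
      by (simp add: K_fun[OF f] \<kappa>_fun_right[OF \<beta> f] \<kappa>_fun_right[OF \<kappa>_1_3[OF \<beta> H] f] expand_K h)
    show "\<kappa> \<beta> (K \<gamma>) - sig ((1 + - 2) * 1) (K (\<kappa> \<beta> \<gamma>)) = \<kappa> (\<kappa> \<beta> H) \<gamma>" if c: "\<gamma> \<in> Om 1" for \<gamma>
      using \<kappa>_1_anticommute[OF \<beta> c h(2)] \<kappa>_sym_odd_even[OF \<kappa>_1_3[OF \<beta> H] c]
      by (simp add: K_1[OF c] K_fun[OF \<kappa>_1_1[OF \<beta> c]] expand_K h hom_Om[OF c])
  qed
  then show ?thesis by (simp add: add.commute)
qed

lemma K_act_b_bider: "bider 0 (act 1 (- 1) K b)" and d_act_KK_bider: "bider 0 (act 1 (- 1) d KK)"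
  using act_bider[OF K_der b_bider] act_bider[OF d_der KK_bider] by simp_all

text \<open>
  Both sides are biderivations, so only contractions of \<open>H\<close> with 1-forms have to be computed. Closedness of
  \<open>H\<close> and, through \<open>\<kappa>_b\<close>, the Poisson condition enter in the value of \<open>K\<close> on a bracket of 1-forms.
\<close>

lemma K_act_b:
  assumes "hom P" "hom Q"
  shows "act 1 (- 1) K b P Q + act 1 (- 1) K b P Q = act 1 (- 1) d KK P Q"
proof -
  obtain p q where PQ: "P \<in> Om p" "Q \<in> Om q" using assms by (auto simp: hom_def)
  have kb: "act 1 (- 1) K b P Q = K (b P Q) + b (K P) Q + b (s P) (K Q)"
    and dk: "act 1 (- 1) d KK P Q = d (KK P Q) + KK (d P) Q + KK (s P) (d Q)" for P Q
    by (simp_all add: act_def)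
  show ?thesis
  proof (rule bider_determined[OF bider_sum[OF K_act_b_bider K_act_b_bider] d_act_KK_bider _ _ _ PQ])
    have hH: "hom H" using H hom_Om by auto
    have bf: "b f Q = \<kappa> (d f) Q" if "f \<in> Om 0" "Q \<in> Om q" for f Q q
      using that by (simp add: b_def s_0 \<kappa>_fun[of f Q q] \<kappa>_fun[OF _ d_Om] d_zero)
    have KKf: "KK f Q = 0" if "f \<in> Om 0" "Q \<in> Om q" for f Q q
      using that \<kappa>_fun[OF that(1) der_Om[OF K_der that(2)]]
      by (simp add: KK_def s_0 \<kappa>_fun[of f Q q] K_fun expand_K Om_Tot[of Q q])
    show "act 1 (- 1) K b f g + act 1 (- 1) K b f g = act 1 (- 1) d KK f g" if f: "f \<in> Om 0" and g: "g \<in> Om 0" for f g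
    proof -
      have "KK (d f) g = 0" using f g
        using \<kappa>_fun_right[OF d_0[OF f] g] \<kappa>_fun_right[OF K_Om_1[OF d_0[OF f]] g]
        by (simp add: KK_def K_fun expand_K d_0 hom_Om[OF f])
      then show ?thesis unfolding kb dk
        by (simp add: K_fun[OF f] K_fun[OF g] s_0[OF f] b_0_0[OF f g] KKf[OF f g] KKf[OF f d_0[OF g]]
            b_linear Om_Tot[OF f] Om_Tot[OF g] expand_K)
    qed
    show "act 1 (- 1) K b f \<beta> + act 1 (- 1) K b f \<beta> = act 1 (- 1) d KK f \<beta>" if f: "f \<in> Om 0" and \<beta>: "\<beta> \<in> Om 1" for f \<beta>
    proof -
      note h = hom_Om[OF f] hom_Om[OF \<beta>] hH
      have 1: "\<kappa> (d f) (K \<beta>) = - \<kappa> (K (d f)) \<beta>"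
      proof -
        have "\<kappa> (K (d f)) \<beta> = \<kappa> \<beta> (K (d f))" by (rule \<kappa>_sym_odd_even[OF K_Om_1[OF d_0[OF f]] \<beta>]) simp
        also have "\<dots> = - \<kappa> \<beta> (\<kappa> (d f) H)" by (simp add: K_1[OF d_0[OF f]] expand_K h)
        also have "\<dots> = \<kappa> (d f) (\<kappa> \<beta> H)" using \<kappa>_1_anticommute[OF \<beta> d_0[OF f] hH] by simp
        also have "\<dots> = - \<kappa> (d f) (K \<beta>)" by (simp add: K_1[OF \<beta>] expand_K h)
        finally show ?thesis by simp
      qed
      have 2: "KK (d f) \<beta> = \<kappa> (d f) (K \<beta>) + \<kappa> (d f) (K \<beta>)"
        by (simp add: KK_def K_fun[OF \<kappa>_1_1[OF d_0[OF f] \<beta>]] 1 s_1[OF d_0[OF f]] expand_K h)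
      show ?thesis unfolding kb dk
        using bf[OF f K_Om_1[OF \<beta>]]
        by (simp add: K_fun[OF f] s_0[OF f] bf[OF f \<beta>] K_fun[OF \<kappa>_1_1[OF d_0[OF f] \<beta>]] 2 KKf[OF f \<beta>] KKf[OF f d_1[OF \<beta>]]
            b_linear Om_Tot[OF \<beta>] d_zero)
    qed
    show "act 1 (- 1) K b \<alpha> \<beta> + act 1 (- 1) K b \<alpha> \<beta> = act 1 (- 1) d KK \<alpha> \<beta>" if \<alpha>: "\<alpha> \<in> Om 1" and \<beta>: "\<beta> \<in> Om 1" for \<alpha> \<beta>
    proof -
      note h = hom_Om[OF \<alpha>] hom_Om[OF \<beta>] hH
      let ?ha = "\<kappa> \<alpha> H" and ?hb = "\<kappa> \<beta> H"
      have ha: "?ha \<in> Om 2" and hb: "?hb \<in> Om 2" using \<kappa>_1_3 \<alpha> \<beta> H by auto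
      note h2 = h hom_Om[OF ha] hom_Om[OF hb]
      have Kb: "K (b \<alpha> \<beta>) = \<kappa> \<alpha> (d ?hb) + d (\<kappa> \<alpha> ?hb) - \<kappa> \<beta> (d ?ha)"
        by (simp add: K_1[OF b_1_1_Om[OF \<alpha> \<beta>]] \<kappa>_b[OF \<alpha> \<beta> hH] dH expand_K h)
      have "b ?ha \<beta> = - d (\<kappa> ?ha \<beta>) + \<kappa> (d ?ha) \<beta> + \<kappa> ?ha (d \<beta>)"
        by (simp add: b_def s_2[OF ha])
      also have "\<kappa> ?ha \<beta> = \<kappa> \<beta> ?ha" by (rule \<kappa>_sym_odd_even[OF ha \<beta>]) simp
      also have "\<kappa> (d ?ha) \<beta> = - \<kappa> \<beta> (d ?ha)" by (rule \<kappa>_sym_odd_odd[OF d_2[OF ha] \<beta>]) simp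
      finally have bha: "b (K \<alpha>) \<beta> = d (\<kappa> \<beta> ?ha) + \<kappa> \<beta> (d ?ha) - \<kappa> ?ha (d \<beta>)"
        by (simp add: K_1[OF \<alpha>] b_linear expand_K h2)
      have bhb: "b (s \<alpha>) (K \<beta>) = - d (\<kappa> \<alpha> ?hb) + \<kappa> (d \<alpha>) ?hb - \<kappa> \<alpha> (d ?hb)"
        by (simp add: s_1[OF \<alpha>] K_1[OF \<beta>] b_linear b_1[OF \<alpha>] expand_K h2)
      have lhs: "act 1 (- 1) K b \<alpha> \<beta> = d (\<kappa> \<beta> ?ha) - \<kappa> ?ha (d \<beta>) + \<kappa> (d \<alpha>) ?hb"
        unfolding kb Kb bha bhb by (simp add: algebra_simps)
      have anti: "\<kappa> \<alpha> ?hb = - \<kappa> \<beta> ?ha" by (rule \<kappa>_1_anticommute[OF \<alpha> \<beta> hH])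
      have "\<kappa> ?ha \<beta> = \<kappa> \<beta> ?ha" by (rule \<kappa>_sym_odd_even[OF ha \<beta>]) simp
      then have KK1: "KK \<alpha> \<beta> = \<kappa> \<beta> ?ha + \<kappa> \<beta> ?ha"
        by (simp add: KK_def K_fun[OF \<kappa>_1_1[OF \<alpha> \<beta>]] K_1[OF \<alpha>] K_1[OF \<beta>] s_1[OF \<alpha>] anti expand_K h2)
      have e1: "\<kappa> (d \<alpha>) \<beta> = \<kappa> \<beta> (d \<alpha>)" by (rule \<kappa>_sym_odd_even[OF d_1[OF \<alpha>] \<beta>]) simp
      have e2: "\<kappa> (K (d \<alpha>)) \<beta> = - \<kappa> \<beta> (K (d \<alpha>))" by (rule \<kappa>_sym_odd_odd[OF K_Om_2[OF d_1[OF \<alpha>]] \<beta>]) simp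
      have e3: "\<kappa> (d \<alpha>) ?hb = \<kappa> ?hb (d \<alpha>)" by (rule \<kappa>_sym_odd_even[OF d_1[OF \<alpha>] hb]) simp
      have KK2: "KK (d \<alpha>) \<beta> = \<kappa> (d \<alpha>) ?hb + \<kappa> (d \<alpha>) ?hb"
        using K_\<kappa>_1[OF \<beta> d_hom[OF h(1)]]
        by (simp add: KK_def e1 e2 e3 s_2[OF d_1[OF \<alpha>]] K_1[OF \<beta>] expand_K h2 algebra_simps)
      have KK3: "KK (s \<alpha>) (d \<beta>) = - (\<kappa> ?ha (d \<beta>) + \<kappa> ?ha (d \<beta>))"
        using K_\<kappa>_1[OF \<alpha> d_hom[OF h(2)]]
        by (simp add: KK_def s_1[OF \<alpha>] K_1[OF \<alpha>] expand_K h2 algebra_simps)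
      show ?thesis unfolding lhs dk KK1 KK2 KK3 by (simp add: expand_K h2 algebra_simps)
    qed
  qed
qed

text \<open>
  The Jacobi identity for the action of derivations on biderivations, together with
  \<open>d\<^sup>2 = 0\<close>, expresses the defect of \<open>d\<^sub>N\<close> through \<open>C\<close>.
\<close>

lemma dN_act_b:
  assumes P: "hom P" and Q: "hom Q"
  shows "dN (b P Q) + b (dN P) Q + b (s P) (dN Q) + (dN (b P Q) + b (dN P) Q + b (s P) (dN Q))
    + (d (C P Q) + C (d P) Q + C (s P) (d Q)) = 0"
  by (simp add: C_def b_def dN_def expand_n P Q algebra_simps)

text \<open>
  Twice the defect of \<open>d\<^sub>N\<close> is the defect of \<open>d\<close> with respect to \<open>- C\<close>, twice the defect of \<open>K\<close> is the defect of \<open>d\<close>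
  with respect to \<open>KK\<close>; as \<open>C = - KK\<close>, they cancel in \<open>\<delta> = d\<^sub>N - K\<close>.
\<close>

theorem \<delta>_b:
  assumes C: "\<And>\<alpha> \<beta>. \<alpha> \<in> Om 1 \<Longrightarrow> \<beta> \<in> Om 1 \<Longrightarrow> C \<alpha> \<beta> = - KK \<alpha> \<beta>"
    and P: "hom P" and Q: "hom Q"
  shows "\<delta> (b P Q) + b (\<delta> P) Q + b (s P) (\<delta> Q) = 0"
proof -
  have Ceq: "C P Q = - KK P Q" if "hom P" "hom Q" for P Q
    using that C_eq_KK[OF C] by (auto simp: hom_def)
  have hKK: "KK P Q \<in> Tot" by (rule bider_Tot[OF KK_bider hom_Tot[OF P] hom_Tot[OF Q]])
  have 1: "dN (b P Q) + b (dN P) Q + b (s P) (dN Q) + (dN (b P Q) + b (dN P) Q + b (s P) (dN Q))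
    = d (KK P Q) + KK (d P) Q + KK (s P) (d Q)"
    using dN_act_b[OF P Q] by (simp add: Ceq P Q hom_closed d_minus[OF hKK] algebra_simps)
  have 2: "(K (b P Q) + b (K P) Q + b (s P) (K Q)) + (K (b P Q) + b (K P) Q + b (s P) (K Q))
    = d (KK P Q) + KK (d P) Q + KK (s P) (d Q)"
    using K_act_b[OF P Q] by (simp add: act_def)
  have 3: "b (\<delta> P) Q = b (dN P) Q - b (K P) Q" "b (s P) (\<delta> Q) = b (s P) (dN Q) - b (s P) (K Q)"
    using P Q by (simp_all add: \<delta>_def b_linear expand_K der_Tot[OF dN_der])
  show ?thesis
    unfolding 3 by (rule double_eq_0) (use 1 2 in \<open>simp add: \<delta>_def algebra_simps\<close>)
qed

subsection \<open>The second structure equation: the square of the differential\<close>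

text \<open>
  The torsion condition, extended from 1-forms to all forms.
\<close>

lemma torsion_determined:
  assumes T: "\<And>\<alpha>. \<alpha> \<in> Om 1 \<Longrightarrow> n (dN \<alpha>) - dN (n \<alpha>) = n2 (d \<alpha>) - d (n2 \<alpha>) - \<tau> \<alpha>"
    and Q: "hom Q"
  shows "n (dN Q) - dN (n Q) = n2 (d Q) - d (n2 Q) - \<tau> Q"
proof -
  obtain q where q: "Q \<in> Om q" using Q by (auto simp: hom_def)
  have 1: "der 1 (\<lambda>Q. n (dN Q) - dN (n Q))" using der_commutator[OF n_der dN_der] by simp
  have 2: "der 1 (\<lambda>Q. n2 (d Q) - d (n2 Q) - \<tau> Q)" using der_subtract[OF der_commutator[OF n2_der d_der]] \<tau>_der by simp
  show ?thesis
  proof (rule determined[OF 1 2 _ T q])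
    fix f assume f: "f \<in> Om 0"
    have "\<tau> f = 0" by (simp add: \<tau>_def K_fun[OF f] n_fun[OF f] \<kappa>_fun_right[OF \<psi> f] \<kappa>_fun_right[OF nH f] expand_K)
    then show "n (dN f) - dN (n f) = n2 (d f) - d (n2 f) - \<tau> f"
      by (simp add: dN_fun[OF f] n_fun[OF f] n2_fun[OF f] der_zero[OF dN_der] n2_1[OF d_0[OF f]] d_zero)
  qed
qed

text \<open>
  The commutator of \<open>d\<close> with the torsion condition gives \<open>2 d\<^sub>N\<^sup>2 = [d, \<tau>]\<close>, and the extended compatibility
  condition, applied to \<open>H\<close> and an arbitrary form, gives \<open>K\<^sup>2\<close>. What is left over of these two expressions
  and the mixed terms \<open>[d\<^sub>N, K]\<close> is the bracket with \<open>\<psi> + i\<^sub>N H\<close>.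
\<close>

theorem \<delta>_\<delta>:
  assumes C: "\<And>\<alpha> \<beta>. \<alpha> \<in> Om 1 \<Longrightarrow> \<beta> \<in> Om 1 \<Longrightarrow> C \<alpha> \<beta> = - KK \<alpha> \<beta>"
    and T: "\<And>\<alpha>. \<alpha> \<in> Om 1 \<Longrightarrow> n (dN \<alpha>) - dN (n \<alpha>) = n2 (d \<alpha>) - d (n2 \<alpha>) - \<tau> \<alpha>"
    and Q: "hom Q"
  shows "\<delta> (\<delta> Q) = b (\<psi> + n H) Q"
proof -
  have hH: "hom H" and h\<psi>: "hom \<psi>" using H \<psi> hom_Om by auto
  have T1: "n (dN Q) - dN (n Q) = n2 (d Q) - d (n2 Q) - \<tau> Q"
    and T2: "n (dN (d Q)) - dN (n (d Q)) = n2 (d (d Q)) - d (n2 (d Q)) - \<tau> (d Q)"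
    using torsion_determined[OF T] Q d_hom[OF Q] by auto
  have tT: "\<tau> Q \<in> Tot" by (rule der_Tot[OF \<tau>_der hom_Tot[OF Q]])
  have "d (n (dN Q) - dN (n Q)) = d (n2 (d Q) - d (n2 Q) - \<tau> Q)" using T1 by simp
  then have "dN (dN Q) + dN (dN Q) = d (\<tau> Q) + \<tau> (d Q)"
    using T2 tT by (simp add: dN_def expand_n Q algebra_simps)
  then have 1: "dN (dN Q) + dN (dN Q) = d (\<tau> Q) + \<tau> (d Q)" .
  have "C H Q = - KK H Q" using C_eq_KK[OF C H] Q by (auto simp: hom_def)
  moreover have "KK H Q = K (K Q) + K (K Q)"
    by (simp add: KK_def K_H s_3[OF H] expand_K hH Q) (simp add: K_def)
  ultimately have 2: "C H Q + (K (K Q) + K (K Q)) = 0" by simp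
  have CH: "C H Q = - n (d (K Q)) + d (n (K Q)) - \<kappa> (d (n H)) Q - K (n (d Q)) + K (d (n Q))
     - (- d (\<kappa> (n H) Q) + \<kappa> (d (n H)) Q - \<kappa> (n H) (d Q) + (- d (K (n Q)) - K (d (n Q))) - n (- d (K Q) - K (d Q)))"
    by (simp add: C_def b_def dN_def dH s_3[OF H] s_3[OF nH] K_def expand_n hH Q)
  have 3: "d (\<tau> Q) + \<tau> (d Q) = - d (\<kappa> \<psi> Q) - d (\<kappa> \<psi> Q) - d (\<kappa> (n H) Q) - d (n (K Q)) + d (K (n Q))
     - \<kappa> \<psi> (d Q) - \<kappa> \<psi> (d Q) - \<kappa> (n H) (d Q) - n (K (d Q)) + K (n (d Q))"
    by (simp add: \<tau>_def expand_K hH h\<psi> Q)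
  have 4: "b (\<psi> + n H) Q = - d (\<kappa> \<psi> Q) - d (\<kappa> (n H) Q) + \<kappa> (d (n H)) Q - \<kappa> \<psi> (d Q) - \<kappa> (n H) (d Q)"
    by (simp add: b_def d\<psi> s_3[OF \<psi>] s_3[OF nH] expand_n hH h\<psi> Q)
  have 5: "\<delta> (\<delta> Q) = dN (dN Q) - (n (d (K Q)) - d (n (K Q))) - (K (n (d Q)) - K (d (n Q))) + K (K Q)"
    by (simp add: \<delta>_def der_diff[OF dN_der] der_Tot[OF dN_der] expand_K Q) (simp add: dN_def expand_K Q)
  have "(\<delta> (\<delta> Q) - b (\<psi> + n H) Q) + (\<delta> (\<delta> Q) - b (\<psi> + n H) Q) = 0"
  proof (intro ext)
    fix x l
    have n: "n (- d (K Q) - K (d Q)) = - n (d (K Q)) - n (K (d Q))" by (simp add: expand_K Q)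
    show "((\<delta> (\<delta> Q) - b (\<psi> + n H) Q) + (\<delta> (\<delta> Q) - b (\<psi> + n H) Q)) x l = 0 x l"
      using fun_cong[OF fun_cong[OF 1], of x l] fun_cong[OF fun_cong[OF 2], of x l]
      unfolding CH 3 4 5 n multi_apply2 by linarith
  qed
  from double_eq_0[OF this] show ?thesis by simp
qed

subsection \<open>The third structure equation\<close>

text \<open>
  Here the torsion condition is applied to \<open>H\<close> itself. It expresses the term \<open>i\<^sub>N d i\<^sub>N H\<close> by terms that cancel
  against the condition on \<open>d\<^sub>N\<psi>\<close> and against \<open>\<kappa>(H, \<psi> + i\<^sub>N H)\<close>.
\<close>

theorem \<delta>_closed:
  assumes T: "\<And>\<alpha>. \<alpha> \<in> Om 1 \<Longrightarrow> n (dN \<alpha>) - dN (n \<alpha>) = n2 (d \<alpha>) - d (n2 \<alpha>) - \<tau> \<alpha>"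
    and W: "dN \<psi> + dN \<psi> = d (n (n H)) - d (n2 H)"
  shows "\<delta> (\<psi> + n H) = 0"
proof -
  have hH: "hom H" and h\<psi>: "hom \<psi>" using H \<psi> hom_Om by auto
  have T1: "n (dN H) - dN (n H) = n2 (d H) - d (n2 H) - \<tau> H" by (rule torsion_determined[OF T hH])
  have e: "\<kappa> \<psi> H = - K \<psi>" "\<kappa> (n H) H = - K (n H)" unfolding K_def
    by (rule \<kappa>_sym_odd_odd[OF \<psi> H], simp, rule \<kappa>_sym_odd_odd[OF nH H], simp)
  have t: "\<tau> H = K \<psi> + K \<psi> + K (n H) + K (n H)" by (simp add: \<tau>_def e K_H expand_n algebra_simps)
  have "\<delta> (\<psi> + n H) + \<delta> (\<psi> + n H) = 0"
  proof (intro ext)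
    fix x l
    have 1: "\<delta> (\<psi> + n H) = dN \<psi> + n (d (n H)) - d (n (n H)) - K \<psi> - K (n H)"
      by (simp add: \<delta>_def der_add[OF dN_der] expand_K hH h\<psi>) (simp add: dN_def)
    have 2: "n (dN H) - dN (n H) = - n (d (n H)) - n (d (n H)) + d (n (n H))" "n2 (d H) = 0"
      by (simp_all add: dN_def dH expand_n hH algebra_simps)
    show "(\<delta> (\<psi> + n H) + \<delta> (\<psi> + n H)) x l = 0 x l"
      using fun_cong[OF fun_cong[OF T1], of x l] fun_cong[OF fun_cong[OF W], of x l]
      unfolding 1 2 t multi_apply2 by linarith
  qed
  then show ?thesis by (rule double_eq_0)
qed

end

section \<open>Forms are generated by functions and 1-forms\<close>

context smooth_bundle
begin

text \<open>
  Euler's identity: contracting with a frame and wedging with its coframe multiplies a form by its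
  degree, here up to the cutoff of the frame.
\<close>

lemma euler:
  fixes \<theta> e :: "'b \<Rightarrow> 'm \<Rightarrow> 'v" and P :: "('m, 'v) multi"
  assumes fr: "\<forall>y v. (\<Sum>b\<in>B. (\<theta> b y \<bullet> v) *\<^sub>R e b y) = \<zeta> y *\<^sub>R v" and P: "altm P"
  shows "(\<Sum>b\<in>B. of_sec (\<theta> b) \<and>\<and> ins (e b) P) = (\<lambda>x vs. real (length vs) * (\<zeta> x * P x vs))"
proof -
  have "(\<Sum>b\<in>B. of_sec (\<theta> b) \<and>\<and> ins (e b) P) x vs = real (length vs) * (\<zeta> x * P x vs)" for x vs
    using P
  proof (induction vs arbitrary: P)
    case Nil
    have "(\<Sum>b\<in>B. R b) x [] = (\<Sum>b\<in>B. R b x [])" for R :: "_ \<Rightarrow> ('m, 'v) multi"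
      by (induction B rule: infinite_finite_induct) (simp_all add: multi_apply2)
    then show ?case by (simp add: wedge_Nil of_sec_def)
  next
    case (Cons v vs)
    let ?X = "\<lambda>_. v"
    have "ins ?X (\<Sum>b\<in>B. of_sec (\<theta> b) \<and>\<and> ins (e b) P)
        = (\<Sum>b\<in>B. fsc (\<lambda>y. \<theta> b y \<bullet> v) (ins (e b) P)) + (\<Sum>b\<in>B. of_sec (\<theta> b) \<and>\<and> ins (e b) (ins ?X P))"
      by (simp add: ins_sum ins_wedge ins_of_sec of_fun_wedge sg_of_sec wedge_minus_left wedge_minus_right
          ins_swap[OF Cons.prems, of ?X] sum.distrib)
    also have "(\<Sum>b\<in>B. fsc (\<lambda>y. \<theta> b y \<bullet> v) (ins (e b) P)) = fsc \<zeta> (ins ?X P)"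
      using ins_sum_section[OF Cons.prems, of "\<lambda>b y. (\<theta> b y \<bullet> v) *\<^sub>R e b y" B] fr
      by (simp add: ins_scale[OF Cons.prems])
    finally have "ins ?X (\<Sum>b\<in>B. of_sec (\<theta> b) \<and>\<and> ins (e b) P) x vs
        = fsc \<zeta> (ins ?X P) x vs + (\<Sum>b\<in>B. of_sec (\<theta> b) \<and>\<and> ins (e b) (ins ?X P)) x vs"
      by (simp only: multi_apply2)
    moreover have "ins ?X R x vs = R x (v # vs)" for R :: "('m, 'v) multi" by (simp add: ins_def)
    ultimately have "(\<Sum>b\<in>B. of_sec (\<theta> b) \<and>\<and> ins (e b) P) x (v # vs)
        = fsc \<zeta> (ins ?X P) x vs + (\<Sum>b\<in>B. of_sec (\<theta> b) \<and>\<and> ins (e b) (ins ?X P)) x vs"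
      by (simp only:)
    then show ?case
      using Cons.IH[OF altm_ins[OF Cons.prems, of ?X]] by (simp add: fsc_def ins_def algebra_simps)
  qed
  then show ?thesis by (simp add: fun_eq_iff)
qed

text \<open>
  The minimal derivation rule that determines an operator by its values on generators. It is imposed in
  each degree separately, so that it applies to the partial operators of a bracket that is only known
  on homogeneous multivectors.
\<close>

definition leibniz :: "real \<Rightarrow> (('m, 'v) multi \<Rightarrow> ('m, 'v) multi) \<Rightarrow> bool" where
  "leibniz c D \<longleftrightarrow>
     (\<forall>p. \<forall>P\<in>Forms M E. \<forall>Q\<in>Forms M E. of_deg p P \<longrightarrow> of_deg p Q \<longrightarrow> D (P + Q) = D P + D Q) \<and>
     (\<forall>p. \<forall>P\<in>Forms M E. of_deg p P \<longrightarrow>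
        (\<forall>f\<in>smooth_funs M. D (of_fun f \<and>\<and> P) = (D (of_fun f) \<and>\<and> P) + (of_fun f \<and>\<and> D P)) \<and>
        (\<forall>\<alpha>\<in>sections M (dual_bundle E). D (of_sec \<alpha> \<and>\<and> P) = (D (of_sec \<alpha>) \<and>\<and> P) + fsc (\<lambda>_. c) (of_sec \<alpha> \<and>\<and> D P)))"

lemma
  assumes "leibniz c D" "P \<in> Forms M E" "of_deg p P"
  shows leibniz_fun: "f \<in> smooth_funs M \<Longrightarrow> D (of_fun f \<and>\<and> P) = (D (of_fun f) \<and>\<and> P) + (of_fun f \<and>\<and> D P)"
    and leibniz_sec: "\<alpha> \<in> sections M (dual_bundle E) \<Longrightarrow>
      D (of_sec \<alpha> \<and>\<and> P) = (D (of_sec \<alpha>) \<and>\<and> P) + fsc (\<lambda>_. c) (of_sec \<alpha> \<and>\<and> D P)"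
proof -
  have "\<forall>P\<in>Forms M E. of_deg p P \<longrightarrow>
        (\<forall>f\<in>smooth_funs M. D (of_fun f \<and>\<and> P) = (D (of_fun f) \<and>\<and> P) + (of_fun f \<and>\<and> D P)) \<and>
        (\<forall>\<alpha>\<in>sections M (dual_bundle E). D (of_sec \<alpha> \<and>\<and> P) = (D (of_sec \<alpha>) \<and>\<and> P) + fsc (\<lambda>_. c) (of_sec \<alpha> \<and>\<and> D P))"
    using assms(1) unfolding leibniz_def by (elim conjE) (erule spec)
  note * = mp[OF bspec[OF this assms(2)] assms(3)]
  show "f \<in> smooth_funs M \<Longrightarrow> D (of_fun f \<and>\<and> P) = (D (of_fun f) \<and>\<and> P) + (of_fun f \<and>\<and> D P)"
    by (rule bspec[OF conjunct1[OF *]])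
  show "\<alpha> \<in> sections M (dual_bundle E) \<Longrightarrow>
      D (of_sec \<alpha> \<and>\<and> P) = (D (of_sec \<alpha>) \<and>\<and> P) + fsc (\<lambda>_. c) (of_sec \<alpha> \<and>\<and> D P)"
    by (rule bspec[OF conjunct2[OF *]])
qed

lemma leibniz_sum:
  assumes D: "leibniz c D" and P: "\<And>i. i \<in> I \<Longrightarrow> P i \<in> Forms M E \<and> of_deg p (P i)"
  shows "D (\<Sum>i\<in>I. P i) = (\<Sum>i\<in>I. D (P i))"
proof -
  have add: "D (P + Q) = D P + D Q" if "P \<in> Forms M E" "Q \<in> Forms M E" "of_deg p P" "of_deg p Q" for P Q
    using D that by (auto simp: leibniz_def)
  have z: "D 0 = 0" using add[OF Forms_zero Forms_zero] by (simp add: of_deg_zero)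
  show ?thesis using P
    by (induction I rule: infinite_finite_induct) (simp_all add: z add Forms_sum of_deg_sum)
qed

text \<open>
  Near each point a form is a sum of products of 1-forms with contractions of it. Multiplying by the
  cutoff makes this decomposition global; the cutoff is removed by the derivation rule itself, so no
  locality of the operators needs to be established.
\<close>

theorem forms_determined:
  assumes D: "leibniz c D" and D': "leibniz c D'"
    and 0: "\<And>f. f \<in> smooth_funs M \<Longrightarrow> D (of_fun f) = D' (of_fun f)"
    and 1: "\<And>\<alpha>. \<alpha> \<in> sections M (dual_bundle E) \<Longrightarrow> D (of_sec \<alpha>) = D' (of_sec \<alpha>)"
    and P: "P \<in> Forms M E" "of_deg p P"
  shows "D P = D' P"
  using P
proof (induction p arbitrary: P)
  case 0
  have P: "P = of_fun (\<lambda>x. P x [])" using of_deg_0_eq[OF "0.prems"(2)] .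
  moreover have "(\<lambda>x. P x []) \<in> smooth_funs M" using Forms_smooth[OF "0.prems"(1), of "[]"] by (simp add: ev_Nil)
  ultimately show ?case using assms(3) by metis
next
  case (Suc p)
  show ?case
  proof (intro ext)
    fix x vs
    obtain \<zeta> B e \<theta> where fr: "\<zeta> \<in> smooth_funs M" "\<zeta> x = 1" "finite (B :: 'v set)"
      "\<forall>b. e b \<in> sections M E" "\<forall>b. \<theta> b \<in> sections M (dual_bundle E)"
      "\<forall>y v. (\<Sum>b\<in>B. (\<theta> b y \<bullet> v) *\<^sub>R e b y) = \<zeta> y *\<^sub>R v"
      by (rule frame_at[of x])
    define Q where "Q b = fsc (\<lambda>_. 1 / real (Suc p)) (ins (e b) P)" for b
    have Q: "Q b \<in> Forms M E" "of_deg p (Q b)" for b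
      unfolding Q_def using Suc.prems fr(4) by (auto intro!: Forms_fsc Forms_ins smooth_funs_const of_deg_fsc of_deg_ins)
    have "(\<Sum>b\<in>B. of_sec (\<theta> b) \<and>\<and> Q b) = fsc (\<lambda>_. 1 / real (Suc p)) (\<Sum>b\<in>B. of_sec (\<theta> b) \<and>\<and> ins (e b) P)"
      by (induction B rule: infinite_finite_induct) (simp_all add: Q_def wedge_fsc_right fsc_add fsc_zero)
    also have "\<dots> = fsc \<zeta> P"
    proof -
      have "real (length vs) * (\<zeta> x * P x vs) / real (Suc p) = \<zeta> x * P x vs" for x vs
        using Suc.prems(2) by (cases "length vs = Suc p") (simp_all add: of_deg_def)
      then show ?thesis unfolding euler[OF fr(6) Forms_altm[OF Suc.prems(1)]] by (simp add: fsc_def fun_eq_iff)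
    qed
    finally have dec: "of_fun \<zeta> \<and>\<and> P = (\<Sum>b\<in>B. of_sec (\<theta> b) \<and>\<and> Q b)" by (simp add: of_fun_wedge)
    have s: "of_sec (\<theta> b) \<and>\<and> Q b \<in> Forms M E \<and> of_deg (Suc p) (of_sec (\<theta> b) \<and>\<and> Q b)" for b
      using Q fr(5) of_deg_wedge[OF of_deg_of_sec Q(2)] by (simp add: Forms_wedge Forms_of_sec)
    have exp: "F (of_fun \<zeta> \<and>\<and> P) = (\<Sum>b\<in>B. (F (of_sec (\<theta> b)) \<and>\<and> Q b) + fsc (\<lambda>_. c) (of_sec (\<theta> b) \<and>\<and> F (Q b)))"
      if F: "leibniz c F" for F
      unfolding dec leibniz_sum[OF F s] using leibniz_sec[OF F Q] fr(5) by (intro sum.cong refl) simp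
    have "D (of_fun \<zeta> \<and>\<and> P) = D' (of_fun \<zeta> \<and>\<and> P)"
      unfolding exp[OF D] exp[OF D'] using 1 Suc.IH[OF Q] fr(5) by simp
    moreover have val: "F P x vs = F (of_fun \<zeta> \<and>\<and> P) x vs - (F (of_fun \<zeta>) \<and>\<and> P) x vs" if F: "leibniz c F" for F
    proof -
      have "F (of_fun \<zeta> \<and>\<and> P) = (F (of_fun \<zeta>) \<and>\<and> P) + (of_fun \<zeta> \<and>\<and> F P)"
        by (rule leibniz_fun[OF F Suc.prems fr(1)])
      then show ?thesis using fr(2) by (simp add: of_fun_wedge multi_apply2 fsc_def)
    qed
    ultimately show "D P x vs = D' P x vs" using val[OF D] val[OF D'] 0[OF fr(1)] by simp
  qed
qed

definition Omega :: "int \<Rightarrow> ('m, 'v) multi set" where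
  "Omega n = (if n < 0 then {0} else {P \<in> Forms M E. of_deg (nat n) P})"

lemma Omega_of_nat: "P \<in> Omega (int p) \<longleftrightarrow> P \<in> Forms M E \<and> of_deg p P"
  by (simp add: Omega_def)

lemma Omega_cases:
  assumes "P \<in> Omega n"
  obtains (neg) "n < 0" "P = 0" | (nat) p where "n = int p" "P \<in> Forms M E" "of_deg p P"
  using assms by (cases "n < 0") (auto simp: Omega_def intro: that(2)[of "nat n"])

lemma Omega_Forms: "P \<in> Omega p \<Longrightarrow> P \<in> Forms M E"
  by (auto simp: Omega_def Forms_zero split: if_splits)

lemma Omega_0: "P \<in> Omega 0 \<longleftrightarrow> (\<exists>f\<in>smooth_funs M. P = of_fun f)"
proof
  assume "P \<in> Omega 0"
  then have P: "P \<in> Forms M E" "of_deg 0 P" by (auto simp: Omega_def)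
  from of_deg_0_eq[OF P(2)] show "\<exists>f\<in>smooth_funs M. P = of_fun f"
    using Forms_smooth[OF P(1), of "[]"] by (intro bexI[of _ "\<lambda>x. P x []"]) (auto simp: ev_Nil)
qed (auto simp: Omega_def Forms_of_fun of_deg_of_fun)

lemma Omega_1: "P \<in> Omega 1 \<longleftrightarrow> (\<exists>\<alpha>\<in>sections M (dual_bundle E). P = of_sec \<alpha>)"
proof
  assume "P \<in> Omega 1"
  then have P: "P \<in> Forms M E" "of_deg 1 P" by (auto simp: Omega_def)
  have e: "of_sec (to_sec P) = P" by (rule of_sec_to_sec[OF Forms_altm[OF P(1)] P(2)])
  moreover have "to_sec P \<in> sections M (dual_bundle E)" using P(1) e Forms_of_sec[of "to_sec P"] by simp
  ultimately show "\<exists>\<alpha>\<in>sections M (dual_bundle E). P = of_sec \<alpha>" by (intro bexI[of _ "to_sec P"]) auto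
next
  assume "\<exists>\<alpha>\<in>sections M (dual_bundle E). P = of_sec \<alpha>"
  then show "P \<in> Omega 1" using of_deg_of_sec by (auto simp: Omega_def Forms_of_sec)
qed

lemma sig_eq_fsc: "sig n P = fsc (\<lambda>_. if even n then 1 else - 1) P"
  by (auto simp: sig_def fsc_def fun_eq_iff multi_apply2)

sublocale fa: graded_algebra Omega "Forms M E" wedge sg
proof
  fix P Q R :: "('m, 'v) multi" and p q :: int
  show "P \<in> Forms M E" if "P \<in> Omega p" using that by (rule Omega_Forms)
  show "P + Q \<in> Forms M E" if "P \<in> Forms M E" "Q \<in> Forms M E" using that by (rule Forms_add)
  show "- P \<in> Forms M E" if "P \<in> Forms M E" using that by (rule Forms_minus)
  show "P + Q \<in> Omega p" if "P \<in> Omega p" "Q \<in> Omega p"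
    using that by (auto simp: Omega_def Forms_add of_deg_add split: if_splits)
  show "- P \<in> Omega p" if "P \<in> Omega p"
    using that by (auto simp: Omega_def Forms_minus of_deg_minus split: if_splits)
  show "0 \<in> Omega p" by (simp add: Omega_def Forms_zero of_deg_zero)
  show "sg P \<in> Forms M E" if "P \<in> Forms M E" using that by (rule Forms_sg)
  show "sg P = sig p P" if "P \<in> Omega p"
    using that by (cases rule: Omega_cases) (simp_all add: sg_zero of_deg_sg sig_def)
  show "sg (P + Q) = sg P + sg Q" by (rule sg_add)
  show "P \<and>\<and> Q \<in> Omega (p + q)" if P: "P \<in> Omega p" and Q: "Q \<in> Omega q"
    using P
  proof (cases rule: Omega_cases)
    case neg
    then show ?thesis by (simp add: wedge_zero_left Omega_def Forms_zero of_deg_zero)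
  next
    case (nat p')
    note P = this
    from Q show ?thesis
    proof (cases rule: Omega_cases)
      case neg
      then show ?thesis by (simp add: wedge_zero_right Omega_def Forms_zero of_deg_zero)
    next
      case (nat q')
      with P show ?thesis using Omega_of_nat[of "P \<and>\<and> Q" "p' + q'"] by (simp add: Forms_wedge of_deg_wedge)
    qed
  qed
  show "(P + Q) \<and>\<and> R = (P \<and>\<and> R) + (Q \<and>\<and> R)" "R \<and>\<and> (P + Q) = (R \<and>\<and> P) + (R \<and>\<and> Q)"
    by (rule wedge_add_left, rule wedge_add_right)
qed

lemma der_leibniz:
  assumes "fa.der e D"
  shows "leibniz (if even e then 1 else - 1) D"
  unfolding leibniz_def
proof (intro conjI allI ballI impI)
  fix P Q :: "('m, 'v) multi" and p
  assume P: "P \<in> Forms M E"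
  show "D (P + Q) = D P + D Q" if "Q \<in> Forms M E" using fa.der_add[OF assms P that] .
  assume p: "of_deg p P"
  then have Pp: "P \<in> Omega (int p)" using P by (simp add: Omega_of_nat)
  show "D (of_fun f \<and>\<and> P) = (D (of_fun f) \<and>\<and> P) + (of_fun f \<and>\<and> D P)" if "f \<in> smooth_funs M" for f
    using fa.der_mul[OF assms _ Pp, of "of_fun f" 0] that by (auto simp: Omega_0)
  show "D (of_sec \<alpha> \<and>\<and> P) = (D (of_sec \<alpha>) \<and>\<and> P) + fsc (\<lambda>_. if even e then 1 else - 1) (of_sec \<alpha> \<and>\<and> D P)"
    if "\<alpha> \<in> sections M (dual_bundle E)" for \<alpha>
  proof -
    have "of_sec \<alpha> \<in> Omega 1" by (subst Omega_1, rule bexI[OF refl that])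
    from fa.der_mul[OF assms this Pp] show ?thesis by (simp add: sig_eq_fsc)
  qed
qed

sublocale fa: generated_algebra Omega "Forms M E" wedge sg
proof
  fix e D D' P p
  assume D: "fa.der e D" and D': "fa.der e D'" and eq: "\<And>f. f \<in> Omega 0 \<Longrightarrow> D f = D' f"
    "\<And>\<alpha>. \<alpha> \<in> Omega 1 \<Longrightarrow> D \<alpha> = D' \<alpha>" and "P \<in> Omega p"
  from \<open>P \<in> Omega p\<close> show "D P = D' P"
  proof (cases rule: Omega_cases)
    case neg
    then show ?thesis using fa.der_zero[OF D] fa.der_zero[OF D'] by simp
  next
    case (nat k)
    show ?thesis
      by (rule forms_determined[OF der_leibniz[OF D] der_leibniz[OF D'] _ _ nat(2,3)])
        (use eq in \<open>auto simp: Omega_0 Omega_1\<close>)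
  qed
qed

lemma derI:
  assumes "\<And>P. P \<in> Forms M E \<Longrightarrow> D P \<in> Forms M E"
    and "\<And>P Q. P \<in> Forms M E \<Longrightarrow> Q \<in> Forms M E \<Longrightarrow> D (P + Q) = D P + D Q"
    and "\<And>p P. P \<in> Forms M E \<Longrightarrow> of_deg p P \<Longrightarrow> D P \<in> Omega (int p + e)"
    and "\<And>p q P Q. P \<in> Forms M E \<Longrightarrow> Q \<in> Forms M E \<Longrightarrow> of_deg p P \<Longrightarrow> of_deg q Q \<Longrightarrow>
      D (P \<and>\<and> Q) = (D P \<and>\<and> Q) + sig (e * int p) (P \<and>\<and> D Q)"
  shows "fa.der e D"
proof -
  have z: "D 0 = 0" using assms(2)[OF Forms_zero Forms_zero] by simp
  show ?thesis
    unfolding fa.der_def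
  proof (intro conjI ballI allI)
    fix P Q p q
    show "D P \<in> Forms M E" if "P \<in> Forms M E" using assms(1)[OF that] .
    show "D (P + Q) = D P + D Q" if "P \<in> Forms M E" "Q \<in> Forms M E" using assms(2)[OF that] .
    assume P: "P \<in> Omega p"
    then show "D P \<in> Omega (p + e)"
      by (cases rule: Omega_cases) (simp_all add: z fa.Om_zero assms(3))
    assume Q: "Q \<in> Omega q"
    from P show "D (P \<and>\<and> Q) = (D P \<and>\<and> Q) + sig (e * p) (P \<and>\<and> D Q)"
    proof (cases rule: Omega_cases)
      case neg
      then show ?thesis by (simp add: z wedge_zero_left)
    next
      case (nat p')
      note P = this
      from Q show ?thesis
        by (cases rule: Omega_cases) (simp_all add: z wedge_zero_right P assms(4))
    qed
  qed
qed

lemma derI_odd: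
  assumes "odd e" "\<And>P. P \<in> Forms M E \<Longrightarrow> D P \<in> Forms M E"
    and "\<And>P Q. P \<in> Forms M E \<Longrightarrow> Q \<in> Forms M E \<Longrightarrow> D (P + Q) = D P + D Q"
    and "\<And>p P. P \<in> Forms M E \<Longrightarrow> of_deg p P \<Longrightarrow> D P \<in> Omega (int p + e)"
    and "\<And>P Q. P \<in> Forms M E \<Longrightarrow> Q \<in> Forms M E \<Longrightarrow> D (P \<and>\<and> Q) = (D P \<and>\<and> Q) + (sg P \<and>\<and> D Q)"
  shows "fa.der e D"
  by (rule derI[OF assms(2-4)]) (use assms(1) in \<open>simp_all add: assms(5) of_deg_sg sig_def wedge_minus_left\<close>)

lemma ins_der:
  assumes X: "X \<in> sections M E"
  shows "fa.der (- 1) (ins X)"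
proof (rule derI_odd)
  show "ins X P \<in> Omega (int p + - 1)" if "P \<in> Forms M E" "of_deg p P" for p P
  proof (cases p)
    case 0
    with that show ?thesis by (simp add: of_deg_0_ins Omega_def)
  next
    case (Suc k)
    with that X show ?thesis using Omega_of_nat[of "ins X P" k] by (simp add: Forms_ins of_deg_ins)
  qed
qed (simp_all add: X Forms_ins ins_add ins_wedge)

lemma Omega_eq_forms: "ext_power M (dual_bundle E) k = Omega (int k)"
  by (auto simp: ext_power_dual Omega_def)

section \<open>The derivation of forms given by an endomorphism\<close>

text \<open>
  With \<open>ins_N_Cons\<close> this is the recursion over the argument list for \<open>i\<^sub>N\<close>; the derivation rule follows by the
  same induction as for the Lie derivative.
\<close>

lemma ins_ins_N: "ins X (ins_N N P) = ins_N N (ins X P) + ins (app N X) P"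
  by (simp add: ins_def ins_N_def app_def fun_eq_iff multi_apply2 sum.lessThan_Suc_shift del: sum.lessThan_Suc)

lemma ins_N_Nil: "ins_N N P x [] = 0"
  by (simp add: ins_N_def)

lemma ins_N_add: "ins_N N (P + Q) = ins_N N P + ins_N N Q"
  by (simp add: ins_N_def fun_eq_iff multi_apply2 sum.distrib)

lemma ins_N_sg: "ins_N N (sg P) = sg (ins_N N P)"
  by (simp add: ins_N_def sg_def fun_eq_iff sum_distrib_left)

lemma of_deg_ins_N: "of_deg p P \<Longrightarrow> of_deg p (ins_N N P)"
  by (simp add: of_deg_def ins_N_def)

lemma ins_N_Cons: "ins_N N P x (v # vs) = ins_N N (ins (\<lambda>_. v) P) x vs + P x (N x v # vs)"
  by (simp add: ins_def ins_N_def sum.lessThan_Suc_shift del: sum.lessThan_Suc)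

lemma ins_N_wedge: "ins_N N (P \<and>\<and> Q) = (ins_N N P \<and>\<and> Q) + (P \<and>\<and> ins_N N Q)"
proof -
  have "ins_N N (P \<and>\<and> Q) x vs = ((ins_N N P \<and>\<and> Q) + (P \<and>\<and> ins_N N Q)) x vs" for x vs
  proof (induction vs arbitrary: P Q)
    case Nil
    then show ?case by (simp add: ins_N_Nil wedge_Nil multi_apply2)
  next
    case (Cons v vs)
    let ?X = "\<lambda>_. v"
    have "ins_N N (P \<and>\<and> Q) x (v # vs) = ins ?X (ins_N N (P \<and>\<and> Q)) x vs" by (simp add: ins_def)
    also have "\<dots> = ins ?X ((ins_N N P \<and>\<and> Q) + (P \<and>\<and> ins_N N Q)) x vs"
      by (simp add: ins_ins_N ins_wedge ins_add ins_N_add Cons.IH multi_apply2 wedge_add_left wedge_add_right ins_N_sg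
          ins_sg)
    finally show ?case by (simp add: ins_def)
  qed
  then show ?thesis by (simp add: fun_eq_iff)
qed

lemma altm_ins_N:
  assumes N: "\<And>x. linear (N x)" and P: "altm P"
  shows "altm (ins_N N P)"
proof
  fix x
  have "linear (\<lambda>v. ins_N N P x (us @ v # vs))" for us vs
    using P
  proof (induction us arbitrary: P)
    case Nil
    have 1: "linear (\<lambda>v. P x (N x v # vs))"
      using linear_compose[OF N[of x] altf_linear[OF Nil[rule_format, of x], of "[]" vs]] by (simp add: o_def)
    have "linear (\<lambda>v. \<Sum>j<length vs. P x (v # vs[j := N x (vs ! j)]))"
      using altf_linear[OF Nil[rule_format, of x], of "[]"] by (intro linear_compose_sum) auto
    then have 2: "linear (\<lambda>v. ins_N N (ins (\<lambda>_. v) P) x vs)" by (simp add: ins_N_def ins_def)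
    show ?case using linear_compose_add[OF 2 1] by (simp add: ins_N_Cons)
  next
    case (Cons u us)
    show ?case
      using linear_compose_add[OF Cons.IH[OF altm_ins[OF Cons.prems]] altf_linear[OF Cons.prems[rule_format, of x], of "N x u # us"]]
      by (simp add: ins_N_Cons)
  qed
  moreover have "ins_N N P x (us @ v # v # vs) = 0" for us v vs
    using P
  proof (induction us arbitrary: P)
    case Nil
    have z: "ins (\<lambda>_. v) (ins (\<lambda>_. v) P) = 0" by (rule ins_ins[OF Nil])
    have "ins_N N 0 x vs = 0" by (simp add: ins_N_def multi_apply2)
    then show ?case using altf_swap[OF Nil[rule_format, of x], of "[]" v "N x v" vs]
      by (simp add: ins_N_Cons z) (simp add: ins_def)
  next
    case (Cons u us)
    then show ?case
      using altf_adjacent[OF Cons.prems[rule_format, of x], of "N x u # us"] by (simp add: ins_N_Cons altm_ins)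
  qed
  ultimately show "altf (ins_N N P x)" by (simp add: altf_def)
qed

lemma Forms_ins_N:
  assumes lin: "\<And>x. linear (N x)" and N: "\<And>X. X \<in> sections M E \<Longrightarrow> app N X \<in> sections M E"
    and P: "P \<in> Forms M E"
  shows "ins_N N P \<in> Forms M E"
proof (rule FormsI[OF altm_ins_N[OF lin Forms_altm[OF P]]])
  fix Xs assume "set Xs \<subseteq> sections M E"
  then show "ev (ins_N N P) Xs \<in> smooth_funs M"
    using P
  proof (induction Xs arbitrary: P)
    case Nil
    then show ?case by (simp add: ev_Nil ins_N_Nil smooth_funs_const)
  next
    case (Cons X Xs)
    then show ?case by (simp add: ev_Cons ins_ins_N ev_add smooth_funs_add Forms_ins N Forms_smooth)
  qed
qed

lemma ins_N_der:
  assumes lin: "\<And>x. linear (N x)" and N: "\<And>X. X \<in> sections M E \<Longrightarrow> app N X \<in> sections M E"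
  shows "fa.der 0 (ins_N N)"
proof (rule derI)
  show "ins_N N P \<in> Omega (int p + 0)" if "P \<in> Forms M E" "of_deg p P" for p P
    using that Omega_of_nat[of "ins_N N P" p] by (simp add: Forms_ins_N[OF lin N] of_deg_ins_N)
qed (simp_all add: Forms_ins_N[OF lin N] ins_N_add ins_N_wedge)

lemma ins_N_of_fun: "ins_N N (of_fun f) = 0"
  by (simp add: ins_N_def of_fun_def fun_eq_iff multi_apply2)

lemma ins_N_of_sec:
  assumes "\<And>x. linear (N x :: 'v \<Rightarrow> 'v)"
  shows "ins_N N (of_sec \<alpha>) = of_sec (app (transp N) \<alpha>)"
proof (intro ext)
  fix x vs
  show "ins_N N (of_sec \<alpha>) x vs = of_sec (app (transp N) \<alpha>) x vs"
  proof (cases "length vs = 1")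
    case True
    then obtain v where "vs = [v]" by (cases vs) auto
    then show ?thesis by (simp add: ins_N_def of_sec_def app_def transp_def adjoint_inner[OF fd assms])
  next
    case False
    then show ?thesis using of_deg_ins_N[OF of_deg_of_sec, of N \<alpha>] of_deg_of_sec[of "app (transp N) \<alpha>"]
      by (simp add: of_deg_def)
  qed
qed

end

section \<open>Lie algebroids\<close>

context almost_algebroid
begin

lemma cart_2: "cart P [X, Y] x = anchor_deriv A X (ev P [Y]) x - anchor_deriv A Y (ev P [X]) x - ev P [brk A X Y] x"
  by (simp add: ev_Cons)

lemma cart_3: "cart P [X, Y, Z] x = anchor_deriv A X (ev P [Y, Z]) x - anchor_deriv A Y (ev P [X, Z]) x
    + anchor_deriv A Z (ev P [X, Y]) x - ev P [brk A X Y, Z] x - ev P [Y, brk A X Z] x + ev P [X, brk A Y Z] x"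
  by (simp add: ev_Cons)

lemma anchor_minus:
  assumes "f \<in> C"
  shows "anchor_deriv A X (\<lambda>x. - f x) = (\<lambda>x. - anchor_deriv A X f x)"
  using anchor_mult[OF smooth_funs_const[of "-1"] assms] by (simp add: anchor_const)

lemma anchor_diff:
  assumes "f \<in> C" "g \<in> C"
  shows "anchor_deriv A X (\<lambda>x. f x - g x) = (\<lambda>x. anchor_deriv A X f x - anchor_deriv A X g x)"
  using anchor_add[OF assms(1) smooth_funs_minus[OF assms(2)]] anchor_minus[OF assms(2)] by simp

lemma form_zeroI:
  assumes "of_deg k P" "\<And>Xs x. set Xs \<subseteq> S \<Longrightarrow> length Xs = k \<Longrightarrow> ev P Xs x = 0"
  shows "P = 0"
proof (rule multi_eqI, rule ext)
  fix Xs x assume "set Xs \<subseteq> S"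
  then show "ev P Xs x = ev 0 Xs x"
    using assms by (cases "length Xs = k") (simp_all add: ev_zero, simp add: ev_def of_deg_def)
qed

lemma d_der: "fa.der 1 (ext_d A)"
proof (rule derI_odd)
  show "ext_d A P \<in> Omega (int p + 1)" if "P \<in> \<Omega>" "of_deg p P" for p P
    using that Omega_of_nat[of "ext_d A P" "Suc p"] by (simp add: Forms_d of_deg_d add.commute)
qed (simp_all add: Forms_d d_add d_wedge)

lemma anchor_form_Forms: "f \<in> C \<Longrightarrow> anchor_form f \<in> \<Omega>"
  using Forms_d[of "of_fun f"] by (simp add: d_of_fun Forms_of_fun)

lemma of_deg_anchor_form: "of_deg 1 (anchor_form f)"
  by (auto simp: of_deg_def anchor_form_def split: list.splits)

lemma ev_anchor_form: "ev (anchor_form f) [X] = anchor_deriv A X f"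
  by (simp add: ev_def anchor_form_def anchor_deriv_def)

end

locale lie_algebroid_structure = almost_algebroid +
  assumes jacobi: "X \<in> secs A \<Longrightarrow> Y \<in> secs A \<Longrightarrow> Z \<in> secs A \<Longrightarrow>
    brk A X (brk A Y Z) + brk A Y (brk A Z X) + brk A Z (brk A X Y) = 0"
begin

lemma jacobi_left:
  assumes "X \<in> S" "Y \<in> S" "Z \<in> S"
  shows "brk A X (brk A Y Z) x - brk A Y (brk A X Z) x - brk A (brk A X Y) Z x = 0"
proof -
  have m: "brk A U (- V) = - brk A U V" if "U \<in> S" "V \<in> S" for U V
    using brk_leibniz[OF that smooth_funs_const[of "- 1"]] by (simp add: fun_eq_iff uminus_apply anchor_const fun_Compl_def)
  show ?thesis
    using fun_cong[OF jacobi[OF assms], of x] brk_antisym[OF assms(3,1)] brk_antisym[OF assms(3) brk_sec[OF assms(1,2)]]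
      m[OF assms(2) brk_sec[OF assms(1,3)]]
    by (simp add: multi_apply algebra_simps)
qed

text \<open>
  Apply the Jacobi identity to \<open>X\<close>, \<open>Y\<close> and \<open>f Z\<close>: the difference of both sides, times \<open>Z(x)\<close>, vanishes. If all
  sections vanish at \<open>x\<close>, so do all anchors at \<open>x\<close>.
\<close>

lemma anchor_brk:
  assumes X: "X \<in> S" and Y: "Y \<in> S" and f: "f \<in> C"
  shows "anchor_deriv A (brk A X Y) f x = anchor_deriv A X (anchor_deriv A Y f) x - anchor_deriv A Y (anchor_deriv A X f) x"
proof -
  let ?c = "anchor_deriv A X (anchor_deriv A Y f) x - anchor_deriv A Y (anchor_deriv A X f) x - anchor_deriv A (brk A X Y) f x"
  have *: "?c *\<^sub>R Z x = 0" if Z: "Z \<in> S" for Z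
  proof -
    have s: "(\<lambda>x. f x *\<^sub>R brk A V Z x) \<in> S" "(\<lambda>x. anchor_deriv A V f x *\<^sub>R Z x) \<in> S" if "V \<in> S" for V
      using f Z that by (auto intro!: sections_scale brk_sec anchor_smooth)
    have 2: "brk A U (brk A V (\<lambda>x. f x *\<^sub>R Z x)) x = f x *\<^sub>R brk A U (brk A V Z) x + anchor_deriv A U f x *\<^sub>R brk A V Z x
        + anchor_deriv A V f x *\<^sub>R brk A U Z x + anchor_deriv A U (anchor_deriv A V f) x *\<^sub>R Z x"
      if "U \<in> S" "V \<in> S" for U V
      by (simp add: brk_leibniz[OF that(2) Z f] brk_add_right[OF that(1) s(1)[OF that(2)] s(2)[OF that(2)]]
          brk_leibniz[OF that(1) brk_sec[OF that(2) Z] f] brk_leibniz[OF that(1) Z anchor_smooth[OF that(2) f]])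
    have "brk A (brk A X Y) (\<lambda>x. f x *\<^sub>R Z x) x = f x *\<^sub>R brk A (brk A X Y) Z x + anchor_deriv A (brk A X Y) f x *\<^sub>R Z x"
      by (simp add: brk_leibniz[OF brk_sec[OF X Y] Z f])
    with jacobi_left[OF X Y sections_scale[OF f Z], of x]
    have "f x *\<^sub>R (brk A X (brk A Y Z) x - brk A Y (brk A X Z) x - brk A (brk A X Y) Z x) + ?c *\<^sub>R Z x = 0"
      by (simp add: 2[OF X Y] 2[OF Y X] algebra_simps)
    then show ?thesis using jacobi_left[OF X Y Z] by simp
  qed
  show ?thesis
  proof (cases "\<exists>Z\<in>S. Z x \<noteq> 0")
    case True
    then obtain Z where "Z \<in> S" "Z x \<noteq> 0" by auto
    then show ?thesis using *[of Z] by simp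
  next
    case False
    then have z: "\<forall>Z\<in>S. Z x = 0" by simp
    have "anchor_deriv A Z h x = 0" if "Z \<in> S" "h \<in> C" for Z h
      using linear_0[OF linear_anc[OF that(2)], of x] bspec[OF z that(1)] by (simp add: anchor_deriv_def)
    then show ?thesis using X Y f by (simp add: brk_sec anchor_smooth)
  qed
qed

lemma d_d_0:
  assumes f: "f \<in> C"
  shows "ext_d A (ext_d A (of_fun f)) = 0"
proof (rule form_zeroI)
  have F: "anchor_form f \<in> \<Omega>" by (rule anchor_form_Forms[OF f])
  show "of_deg 2 (ext_d A (ext_d A (of_fun f)))"
    using of_deg_d[OF of_deg_anchor_form F] by (simp add: d_of_fun[OF f] numeral_2_eq_2)
  fix Xs x assume Xs: "set Xs \<subseteq> S" "length Xs = 2"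
  then obtain X Y where XY: "Xs = [X, Y]" by (auto simp: length_Suc_conv numeral_2_eq_2)
  show "ev (ext_d A (ext_d A (of_fun f))) Xs x = 0"
    using Xs f by (simp add: d_of_fun[OF f] ev_d[OF F] XY cart_2 ev_anchor_form anchor_brk del: cart.simps)
qed

lemma d_d_1:
  assumes \<alpha>: "\<alpha> \<in> cosecs A"
  shows "ext_d A (ext_d A (of_sec \<alpha>)) = 0"
proof (rule form_zeroI)
  have F: "of_sec \<alpha> \<in> \<Omega>" using \<alpha> by (simp add: Forms_of_sec)
  show "of_deg 3 (ext_d A (ext_d A (of_sec \<alpha>)))"
    using of_deg_d[OF of_deg_d[OF of_deg_of_sec F] Forms_d[OF F]] by (simp add: numeral_3_eq_3)
  fix Xs x assume Xs: "set Xs \<subseteq> S" "length Xs = 3"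
  then obtain X Y Z where XYZ: "Xs = [X, Y, Z]" by (auto simp: length_Suc_conv numeral_3_eq_3)
  then have s: "X \<in> S" "Y \<in> S" "Z \<in> S" using Xs by auto
  define a where "a U = ev (of_sec \<alpha>) [U]" for U
  have aC: "a U \<in> C" if "U \<in> S" for U unfolding a_def using F that by (simp add: Forms_smooth)
  have a_plus: "a W x = a U x + a V x" if "W x = U x + V x" for U V W
    using that by (simp add: a_def ev_def of_sec_def inner_add_right)
  have w: "ev (ext_d A (of_sec \<alpha>)) [U, V] = (\<lambda>x. anchor_deriv A U (a V) x - anchor_deriv A V (a U) x - a (brk A U V) x)"
    if "U \<in> S" "V \<in> S" for U V
    using ev_d[OF F, of "[U, V]"] that by (simp add: fun_eq_iff cart_2 a_def del: cart.simps)
  have A: "anchor_deriv A T (\<lambda>x. anchor_deriv A U (a V) x - anchor_deriv A V (a U) x - a (brk A U V) x)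
      = (\<lambda>x. anchor_deriv A T (anchor_deriv A U (a V)) x - anchor_deriv A T (anchor_deriv A V (a U)) x - anchor_deriv A T (a (brk A U V)) x)"
    if "T \<in> S" "U \<in> S" "V \<in> S" for T U V
    using that by (simp add: anchor_diff aC anchor_smooth brk_sec smooth_funs_diff)
  have J: "a (brk A X (brk A Y Z)) x - a (brk A Y (brk A X Z)) x - a (brk A (brk A X Y) Z) x = 0"
    using a_plus[of "brk A X (brk A Y Z)" "brk A Y (brk A X Z)" "brk A (brk A X Y) Z"] jacobi_left[OF s, of x]
    by (simp add: algebra_simps)
  show "ev (ext_d A (ext_d A (of_sec \<alpha>))) Xs x = 0"
    using s J
    by (simp add: XYZ ev_d[OF Forms_d[OF F]] cart_3 w brk_sec A anchor_brk aC del: cart.simps)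
qed

end

lemma lie_algebroid_structureI:
  assumes "lie_algebroid A"
  shows "lie_algebroid_structure A"
proof -
  have M: "smooth_manifold (base A)" "vector_bundle (base A) (vbundle A)"
    and tv: "\<forall>x v. tangent_vector (base A) x (anc A x v)"
    and la: "\<forall>x. \<forall>f\<in>smooth_funs (base A). linear (\<lambda>v. anc A x v f)"
    and as: "\<forall>X\<in>secs A. \<forall>f\<in>smooth_funs (base A). anchor_deriv A X f \<in> smooth_funs (base A)"
    and b1: "\<forall>X\<in>secs A. \<forall>Y\<in>secs A. brk A X Y \<in> secs A \<and> brk A X Y = - brk A Y X"
    and b2: "\<forall>X\<in>secs A. \<forall>Y\<in>secs A. \<forall>Z\<in>secs A. brk A X (Y + Z) = brk A X Y + brk A X Z"
    and b3: "\<forall>X\<in>secs A. \<forall>Y\<in>secs A. \<forall>Z\<in>secs A.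
        brk A X (brk A Y Z) + brk A Y (brk A Z X) + brk A Z (brk A X Y) = 0"
    and b4: "\<forall>X\<in>secs A. \<forall>Y\<in>secs A. \<forall>f\<in>smooth_funs (base A).
        brk A X (\<lambda>x. f x *\<^sub>R Y x) = (\<lambda>x. f x *\<^sub>R brk A X Y x + anchor_deriv A X f x *\<^sub>R Y x)"
    using assms unfolding lie_algebroid_def by - (elim conjE, assumption)+
  have "smooth_bundle (base A) (vbundle A)" by unfold_locales (rule M)+
  then show ?thesis
  proof (intro lie_algebroid_structure.intro almost_algebroid.intro lie_algebroid_structure_axioms.intro
      almost_algebroid_axioms.intro)
    show "tangent_vector (base A) x (anc A x v)" for x v using tv by simp
    show "linear (\<lambda>v. anc A x v f)" if "f \<in> smooth_funs (base A)" for f x using la that by simp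
    show "anchor_deriv A X f \<in> smooth_funs (base A)" if "X \<in> secs A" "f \<in> smooth_funs (base A)" for X f
      using as that by simp
    fix X Y assume X: "X \<in> secs A" and Y: "Y \<in> secs A"
    show "brk A X Y \<in> secs A" "brk A X Y = - brk A Y X"
      by (rule conjunct1[OF bspec[OF bspec[OF b1 X] Y]], rule conjunct2[OF bspec[OF bspec[OF b1 X] Y]])
    show "brk A X (\<lambda>x. f x *\<^sub>R Y x) = (\<lambda>x. f x *\<^sub>R brk A X Y x + anchor_deriv A X f x *\<^sub>R Y x)"
      if "f \<in> smooth_funs (base A)" for f
      by (rule bspec[OF bspec[OF bspec[OF b4 X] Y] that])
    fix Z assume Z: "Z \<in> secs A"
    show "brk A X (Y + Z) = brk A X Y + brk A X Z" by (rule bspec[OF bspec[OF bspec[OF b2 X] Y] Z])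
    show "brk A X (brk A Y Z) + brk A Y (brk A Z X) + brk A Z (brk A X Y) = 0"
      by (rule bspec[OF bspec[OF bspec[OF b3 X] Y] Z])
  qed
qed

section \<open>The pairing of forms by a bivector\<close>

locale bivector_algebroid = lie_algebroid_structure A
  for A :: "('m::{t2_space, second_countable_topology}, 'e::real_inner, 'v::real_inner) lie_alg_data" +
  fixes \<pi> :: "('m, 'v) multi"
  assumes bivector: "\<pi> \<in> multivectors A 2"
begin

sublocale dual: smooth_bundle "base A" "dual_bundle (vbundle A)"
  by (rule bundle_dual)

abbreviation "MV \<equiv> Forms (base A) (dual_bundle (vbundle A))"

lemma multivectors_eq: "multivectors A k = {P \<in> MV. of_deg k P}"
  using dual.ext_power_dual[of k] ext_power_dual_dual[of k] by simp

lemma \<pi>_MV: "\<pi> \<in> MV" and \<pi>_deg: "of_deg 2 \<pi>" and \<pi>_alt: "altm \<pi>"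
  using bivector multivectors_eq[of 2] dual.Forms_altm by auto

lemma \<pi>_antisym: "\<pi> x [a, b] = - \<pi> x [b, a]"
  using altf_swap[of "\<pi> x" "[]" a b "[]"] \<pi>_alt by simp

lemma linear_\<pi>: "linear (\<lambda>b. \<pi> x [a, b])" "linear (\<lambda>a. \<pi> x [a, b])"
  using altf_linear[of "\<pi> x" "[a]" "[]"] altf_linear[of "\<pi> x" "[]" "[b]"] \<pi>_alt by simp_all

lemma sharp_inner: "b \<bullet> sharp \<pi> x a = \<pi> x [a, b]"
  unfolding sharp_def by (subst inner_commute) (rule riesz_inner[OF fd linear_\<pi>(1)])

lemma sharp_adjoint: "b \<bullet> sharp \<pi> x a = - (a \<bullet> sharp \<pi> x b)"
  by (simp add: sharp_inner \<pi>_antisym[of x a b])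

lemma linear_sharp: "linear (sharp \<pi> x)"
proof (rule linearI)
  show "sharp \<pi> x (a + b) = sharp \<pi> x a + sharp \<pi> x b" for a b
    by (rule vector_eq_ldot[THEN iffD1], rule allI)
      (simp add: inner_add_right sharp_inner linear_add[OF linear_\<pi>(2)])
  show "sharp \<pi> x (c *\<^sub>R a) = c *\<^sub>R sharp \<pi> x a" for c a
    by (rule vector_eq_ldot[THEN iffD1], rule allI)
      (simp add: sharp_inner linear_cmul[OF linear_\<pi>(2)])
qed

abbreviation sh :: "('m \<Rightarrow> 'v) \<Rightarrow> 'm \<Rightarrow> 'v" where "sh \<alpha> \<equiv> app (sharp \<pi>) \<alpha>"

lemma smooth_\<pi>:
  assumes "\<alpha> \<in> cosecs A" "\<beta> \<in> cosecs A"
  shows "(\<lambda>x. \<pi> x [\<alpha> x, \<beta> x]) \<in> C"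
  using dual.Forms_smooth[OF \<pi>_MV, of "[\<alpha>, \<beta>]"] assms by (simp add: ev_def)

lemma sh_sec: "\<alpha> \<in> cosecs A \<Longrightarrow> sh \<alpha> \<in> S"
  unfolding sections_iff_pairing by (simp add: app_def sharp_inner smooth_\<pi>)

definition onb :: "'v set" where "onb = (SOME B. orthonormal_basis B)"

lemma onb: "orthonormal_basis onb"
  unfolding onb_def using orthonormal_basis_exists[OF fd] by (rule someI_ex)

text \<open>
  The polarization of the contraction with \<open>\<pi>\<close>. On 1-forms it is \<open>-\<pi>\<close>; the signs are arranged
  so that \<open>\<kappa>(P, \<cdot>)\<close> is a derivation and \<open>\<kappa>\<close> is graded symmetric. The sum is independent
  of the basis, which is only used fibre by fibre.
\<close>

definition kap :: "('m, 'v) multi \<Rightarrow> ('m, 'v) multi \<Rightarrow> ('m, 'v) multi" where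
  "kap P Q = (\<Sum>a\<in>onb. ins (\<lambda>_. a) (sg P) \<and>\<and> ins (\<lambda>x. sharp \<pi> x a) Q)"

lemma fsc_sum: "fsc f (\<Sum>i\<in>I. R i) = (\<Sum>i\<in>I. fsc f (R i))"
  by (induction I rule: infinite_finite_induct) (simp_all add: fsc_zero fsc_add)

lemma ins_expand:
  assumes "altm P"
  shows "ins X P = (\<Sum>a\<in>onb. fsc (\<lambda>x. a \<bullet> X x) (ins (\<lambda>_. a) P))"
proof -
  have "ins X P = ins (\<lambda>x. \<Sum>a\<in>onb. (a \<bullet> X x) *\<^sub>R a) P" using onb by (simp add: orthonormal_basis_def)
  then show ?thesis by (simp add: ins_sum_section[OF assms] ins_scale[OF assms])
qed

lemma kap_of_sec:
  assumes "altm Q"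
  shows "kap (of_sec \<alpha>) Q = - ins (sh \<alpha>) Q"
proof -
  have "sh \<alpha> = (\<lambda>x. \<Sum>a\<in>onb. (a \<bullet> \<alpha> x) *\<^sub>R sharp \<pi> x a)"
    unfolding app_def by (subst linear_basis_expand[OF onb linear_sharp]) (rule refl)
  then have "ins (sh \<alpha>) Q = (\<Sum>a\<in>onb. fsc (\<lambda>x. a \<bullet> \<alpha> x) (ins (\<lambda>x. sharp \<pi> x a) Q))"
    by (simp add: ins_sum_section[OF assms] ins_scale[OF assms])
  then show ?thesis
    by (simp add: kap_def sg_of_sec ins_minus ins_of_sec wedge_minus_left of_fun_wedge sum_negf inner_commute)
qed

lemma kap_of_fun: "kap (of_fun f) Q = 0"
  by (simp add: kap_def sg_of_fun ins_of_fun wedge_zero_left)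

lemma kap_add: "kap (P + P') Q = kap P Q + kap P' Q" "kap P (Q + Q') = kap P Q + kap P Q'"
  by (simp_all add: kap_def sg_add ins_add wedge_add_left wedge_add_right sum.distrib)

lemma altm_kap:
  assumes "altm P" "altm Q"
  shows "altm (kap P Q)"
proof -
  have "altm (\<Sum>i\<in>I. R i)" if "\<And>i. altm (R i)" for I and R :: "'v \<Rightarrow> ('m, 'v) multi"
    using that by (induction I rule: infinite_finite_induct) (simp_all add: altm_zero altm_add)
  then show ?thesis unfolding kap_def using assms by (simp add: altm_wedge altm_ins altm_sg)
qed

text \<open>
  The orthonormal basis consists of constant vector fields, which are not smooth sections. After
  multiplication with a cutoff, the sum over the basis can be replaced by a sum over a smooth frame and
  its coframe.
\<close>

lemma Forms_kap:
  assumes P: "P \<in> \<Omega>" and Q: "Q \<in> \<Omega>"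
  shows "kap P Q \<in> \<Omega>"
proof (rule FormsI[OF altm_kap[OF Forms_altm[OF P] Forms_altm[OF Q]]], rule smooth_funs_local_division)
  fix Xs x assume Xs: "set Xs \<subseteq> S"
  obtain \<zeta> B e \<theta> where fr: "\<zeta> \<in> smooth_funs (base A)" "\<zeta> x = 1" "finite (B :: 'v set)"
    "\<forall>b. e b \<in> sections (base A) (vbundle A)" "\<forall>b. \<theta> b \<in> sections (base A) (dual_bundle (vbundle A))"
    "\<forall>y v. (\<Sum>b\<in>B. (\<theta> b y \<bullet> v) *\<^sub>R e b y) = \<zeta> y *\<^sub>R v"
    by (rule frame_at[of x])
  have aP: "altm (sg P)" and aQ: "altm Q" using P Q Forms_altm Forms_sg by auto
  have "(\<Sum>b\<in>B. ins (e b) (sg P) \<and>\<and> ins (sh (\<theta> b)) Q)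
      = (\<Sum>b\<in>B. \<Sum>a\<in>onb. ins (\<lambda>x. (\<theta> b x \<bullet> a) *\<^sub>R e b x) (sg P) \<and>\<and> ins (\<lambda>x. sharp \<pi> x a) Q)"
  proof (rule sum.cong[OF refl])
    fix b
    have "sh (\<theta> b) = (\<lambda>x. \<Sum>a\<in>onb. (\<theta> b x \<bullet> a) *\<^sub>R sharp \<pi> x a)"
      unfolding app_def by (subst linear_basis_expand[OF onb linear_sharp]) (simp add: inner_commute)
    then show "ins (e b) (sg P) \<and>\<and> ins (sh (\<theta> b)) Q
        = (\<Sum>a\<in>onb. ins (\<lambda>x. (\<theta> b x \<bullet> a) *\<^sub>R e b x) (sg P) \<and>\<and> ins (\<lambda>x. sharp \<pi> x a) Q)"
      by (simp add: ins_sum_section[OF aQ] ins_scale[OF aQ] ins_scale[OF aP] wedge_sum_right wedge_fsc_left wedge_fsc_right)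
  qed
  also have "\<dots> = (\<Sum>a\<in>onb. \<Sum>b\<in>B. ins (\<lambda>x. (\<theta> b x \<bullet> a) *\<^sub>R e b x) (sg P) \<and>\<and> ins (\<lambda>x. sharp \<pi> x a) Q)"
    by (rule sum.swap)
  also have "\<dots> = (\<Sum>a\<in>onb. ins (\<lambda>x. \<zeta> x *\<^sub>R a) (sg P) \<and>\<and> ins (\<lambda>x. sharp \<pi> x a) Q)"
    using fr(6) ins_sum_section[OF aP, of "\<lambda>b x. (\<theta> b x \<bullet> _) *\<^sub>R e b x" B] by (simp flip: wedge_sum_left)
  also have "\<dots> = fsc \<zeta> (kap P Q)"
    by (simp add: kap_def ins_scale[OF aP] wedge_fsc_left fsc_sum)
  finally have eq: "fsc \<zeta> (kap P Q) = (\<Sum>b\<in>B. ins (e b) (sg P) \<and>\<and> ins (sh (\<theta> b)) Q)" ..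
  have "fsc \<zeta> (kap P Q) \<in> \<Omega>"
    unfolding eq using fr(4,5) P Q by (intro Forms_sum Forms_wedge Forms_ins Forms_sg sh_sec) simp_all
  from Forms_smooth[OF this Xs] have "(\<lambda>y. \<zeta> y * ev (kap P Q) Xs y) \<in> C" by (simp add: ev_fsc)
  with fr(1,2) show "\<exists>\<zeta>\<in>C. \<zeta> x \<noteq> 0 \<and> (\<lambda>y. \<zeta> y * ev (kap P Q) Xs y) \<in> C" by (intro bexI[of _ \<zeta>]) auto
qed

lemma kap_Omega:
  assumes "P \<in> \<Omega>" "of_deg p P" "Q \<in> \<Omega>" "of_deg q Q"
  shows "kap P Q \<in> Omega (int q + (int p - 2))"
proof (cases p)
  case 0
  then have "kap P Q = 0" using assms(2) by (simp add: kap_def ins_sg of_deg_0_ins sg_zero wedge_zero_left)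
  then show ?thesis by (simp add: fa.Om_zero)
next
  case (Suc p')
  note p = this
  show ?thesis
  proof (cases q)
    case 0
    then have "kap P Q = 0" using assms(4) by (simp add: kap_def of_deg_0_ins wedge_zero_right)
    then show ?thesis by (simp add: fa.Om_zero)
  next
    case (Suc q')
    have "of_deg p (sg P)" using assms(2) by (simp add: of_deg_def sg_def)
    then have "of_deg (p' + q') (kap P Q)" unfolding kap_def
      using assms p Suc by (intro of_deg_sum of_deg_wedge of_deg_ins) auto
    moreover have e: "int q + (int p - 2) = int (p' + q')" by (simp add: p Suc)
    ultimately show ?thesis using Forms_kap[OF assms(1,3)] unfolding e Omega_of_nat by simp
  qed
qed

text \<open>
  Antisymmetry of \<open>\<pi>\<close> exchanges the two contractions at the cost of a sign; the remaining sign comes from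
  the commutativity of the wedge product.
\<close>

lemma kap_sym:
  assumes P: "altm P" "of_deg p P" and Q: "altm Q" "of_deg q Q"
  shows "kap P Q = sig (int p * int q) (kap Q P)"
proof (cases "p = 0 \<or> q = 0")
  case True
  then have "kap P Q = 0" "kap Q P = 0"
    using assms by (auto simp: kap_def ins_sg of_deg_0_ins sg_zero wedge_zero_left wedge_zero_right)
  then show ?thesis by simp
next
  case False
  then obtain p' q' where pq: "p = Suc p'" "q = Suc q'" by (metis not0_implies_Suc)
  let ?i = "\<lambda>a R. ins (\<lambda>_. a) R" and ?j = "\<lambda>a R. ins (\<lambda>x. sharp \<pi> x a) R"
  have d: "of_deg p' (ins X P)" "of_deg q' (ins X Q)" for X using assms pq by (auto intro: of_deg_ins)
  have flip: "(\<Sum>a\<in>onb. ?i a P \<and>\<and> ?j a Q) = - (\<Sum>a\<in>onb. ?j a P \<and>\<and> ?i a Q)"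
  proof -
    have "?i a P \<and>\<and> ?j a Q = (\<Sum>c\<in>onb. fsc (\<lambda>x. \<pi> x [a, c]) (?i a P \<and>\<and> ?i c Q))" for a
      using ins_expand[OF Q(1), of "\<lambda>x. sharp \<pi> x a"]
      by (simp add: sharp_inner wedge_sum_right wedge_fsc_right)
    then have 1: "(\<Sum>a\<in>onb. ?i a P \<and>\<and> ?j a Q) = (\<Sum>a\<in>onb. \<Sum>c\<in>onb. fsc (\<lambda>x. \<pi> x [a, c]) (?i a P \<and>\<and> ?i c Q))" by simp
    have 2: "(\<Sum>a\<in>onb. \<Sum>c\<in>onb. fsc (\<lambda>x. \<pi> x [a, c]) (?i a P \<and>\<and> ?i c Q))
        = (\<Sum>c\<in>onb. \<Sum>a\<in>onb. fsc (\<lambda>x. \<pi> x [a, c]) (?i a P \<and>\<and> ?i c Q))" by (rule sum.swap)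
    have 3: "(\<Sum>a\<in>onb. fsc (\<lambda>x. \<pi> x [a, c]) (?i a P \<and>\<and> ?i c Q)) = - (?j c P \<and>\<and> ?i c Q)" for c
    proof -
      have m: "fsc (\<lambda>x. \<pi> x [a, c]) R = - fsc (\<lambda>x. \<pi> x [c, a]) R" for a and R :: "('m, 'v) multi"
        using \<pi>_antisym[of _ a c] by (simp add: fsc_def fun_eq_iff multi_apply2)
      show ?thesis
        using ins_expand[OF P(1), of "\<lambda>x. sharp \<pi> x c"]
        by (simp add: m sharp_inner wedge_sum_left wedge_fsc_left sum_negf)
    qed
    show ?thesis unfolding 1 2 3 by (simp add: sum_negf)
  qed
  have k1: "kap P Q = (if even p then \<Sum>a\<in>onb. ?i a P \<and>\<and> ?j a Q else - (\<Sum>a\<in>onb. ?i a P \<and>\<and> ?j a Q))"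
    using of_deg_sg[OF P(2)] by (simp add: kap_def ins_minus wedge_minus_left sum_negf)
  have k2: "kap Q P = (if even q then \<Sum>a\<in>onb. ?i a Q \<and>\<and> ?j a P else - (\<Sum>a\<in>onb. ?i a Q \<and>\<and> ?j a P))"
    using of_deg_sg[OF Q(2)] by (simp add: kap_def ins_minus wedge_minus_left sum_negf)
  have c: "?j a P \<and>\<and> ?i a Q = (if even (p' * q') then ?i a Q \<and>\<and> ?j a P else - (?i a Q \<and>\<and> ?j a P))" for a
    by (rule wedge_commute[OF d])
  show ?thesis
    unfolding k1 k2 flip c by (cases "even p'"; cases "even q'") (simp_all add: pq sum_negf)
qed

lemma kap_wedge:
  assumes P: "altm P" "of_deg p P" and Q: "of_deg q Q"
  shows "kap P (Q \<and>\<and> R) = (kap P Q \<and>\<and> R) + sig ((int p - 2) * int q) (Q \<and>\<and> kap P R)"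
proof (cases p)
  case 0
  then have "kap P S' = 0" for S' using P by (simp add: kap_def ins_sg of_deg_0_ins sg_zero wedge_zero_left)
  then show ?thesis by (simp add: wedge_zero_left wedge_zero_right)
next
  case (Suc p')
  have dP: "of_deg p' (ins X (sg P))" for X using P Suc of_deg_sg[OF P(2)] by (auto intro!: of_deg_ins of_deg_minus)
  have "ins X (sg P) \<and>\<and> ins Y (Q \<and>\<and> R) = ((ins X (sg P) \<and>\<and> ins Y Q) \<and>\<and> R) + sig ((int p - 2) * int q) (Q \<and>\<and> (ins X (sg P) \<and>\<and> ins Y R))" for X Y
  proof -
    have c: "ins X (sg P) \<and>\<and> Q = (if even (p' * q) then Q \<and>\<and> ins X (sg P) else - (Q \<and>\<and> ins X (sg P)))"
      by (rule wedge_commute[OF dP Q])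
    have "ins X (sg P) \<and>\<and> (sg Q \<and>\<and> ins Y R) = sig ((int p - 2) * int q) (Q \<and>\<and> (ins X (sg P) \<and>\<and> ins Y R))"
      using Suc of_deg_sg[OF Q]
      by (cases "even p'"; cases "even q") (simp_all add: wedge_minus_left wedge_minus_right c flip: wedge_assoc)
    then show ?thesis by (simp add: ins_wedge wedge_add_right wedge_assoc)
  qed
  then show ?thesis
    by (simp add: kap_def sum.distrib wedge_sum_left wedge_sum_right) (simp add: sig_def sum_negf)
qed

lemma kap_bider: "fa.bider (- 2) kap"
  unfolding fa.bider_def
proof (intro conjI ballI allI)
  fix P P' Q :: "('m, 'v) multi" and p q :: int
  show "kap P Q \<in> \<Omega>" if "P \<in> \<Omega>" "Q \<in> \<Omega>" using that by (rule Forms_kap)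
  show "kap (P + P') Q = kap P Q + kap P' Q" "kap Q (P + P') = kap Q P + kap Q P'" by (rule kap_add)+
  have z: "kap 0 R = 0" "kap R 0 = 0" for R using kap_add(1)[of 0 0 R] kap_add(2)[of R 0 0] by simp_all
  assume P: "P \<in> Omega p"
  then show "fa.der (p + - 2) (kap P)"
  proof (cases rule: Omega_cases)
    case neg
    then show ?thesis using fa.der_const_zero[of "p - 2"] by (simp add: z[abs_def])
  next
    case (nat k)
    show ?thesis
    proof (rule derI)
      show "kap P R \<in> Omega (int j + (p + - 2))" if "R \<in> \<Omega>" "of_deg j R" for j R
        using kap_Omega[OF nat(2,3) that] nat(1) by simp
      show "kap P (R \<and>\<and> R') = (kap P R \<and>\<and> R') + sig ((p + - 2) * int j) (R \<and>\<and> kap P R')"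
        if "R \<in> \<Omega>" "R' \<in> \<Omega>" "of_deg j R" "of_deg i R'" for j i R R'
        using kap_wedge[OF Forms_altm[OF nat(2)] nat(3) that(3)] nat(1) by simp
    qed (use nat(2) in \<open>simp_all add: Forms_kap kap_add\<close>)
  qed
  assume Q: "Q \<in> Omega q"
  from P show "kap P Q = sig (p * q) (kap Q P)"
  proof (cases rule: Omega_cases)
    case neg
    then show ?thesis by (simp add: z)
  next
    case (nat k)
    note P = this
    from Q show ?thesis
      by (cases rule: Omega_cases) (simp_all add: z P kap_sym[OF Forms_altm P(3) Forms_altm])
  qed
qed

sublocale pa: paired_algebra Omega \<Omega> wedge sg "ext_d A" kap
proof
  show "fa.der 1 (ext_d A)" by (rule d_der)
  show "ext_d A (ext_d A f) = 0" if "f \<in> Omega 0" for f using that d_d_0 by (auto simp: Omega_0)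
  show "ext_d A (ext_d A \<alpha>) = 0" if "\<alpha> \<in> Omega 1" for \<alpha> using that d_d_1 by (auto simp: Omega_1)
  show "fa.bider (- 2) kap" by (rule kap_bider)
  show "kap f Q = 0" if "f \<in> Omega 0" for f Q q using that kap_of_fun by (auto simp: Omega_0)
qed

end

section \<open>The algebroid structure on the dual bundle\<close>

lemma dual_algebroid_sel [simp]:
  "base (dual_algebroid A \<pi>) = base A" "vbundle (dual_algebroid A \<pi>) = dual_bundle (vbundle A)"
  "brk (dual_algebroid A \<pi>) = brk_pi A \<pi>" "anc (dual_algebroid A \<pi>) = (\<lambda>x a. anc A x (sharp \<pi> x a))"
  by (simp_all add: dual_algebroid_def)

lemma of_sec_add: "of_sec (\<lambda>x. \<alpha> x + \<beta> x) = of_sec \<alpha> + of_sec \<beta>"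
  and of_sec_minus: "of_sec (\<lambda>x. - \<alpha> x) = - of_sec \<alpha>"
  and of_sec_scale: "of_sec (\<lambda>x. f x *\<^sub>R \<alpha> x) = fsc f (of_sec \<alpha>)"
  and of_sec_zero: "of_sec (\<lambda>x. 0) = 0"
  by (auto simp: of_sec_def fsc_def fun_eq_iff multi_apply2 inner_add_left split: list.splits)

lemma of_sec_plus: "of_sec (\<alpha> + \<beta>) = of_sec \<alpha> + of_sec \<beta>"
  and of_sec_uminus: "of_sec (- \<alpha>) = - of_sec \<alpha>"
  and of_sec_diff: "of_sec (\<alpha> - \<beta>) = of_sec \<alpha> - of_sec \<beta>"
  using of_sec_add[of \<alpha> \<beta>] of_sec_minus[of \<alpha>] of_sec_add[of \<alpha> "\<lambda>x. - \<beta> x"] of_sec_minus[of \<beta>]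
  by (simp_all add: plus_fun_def fun_Compl_def fun_diff_def)

context smooth_bundle
begin

lemma of_sec_inject: "of_sec \<alpha> = of_sec \<beta> \<longleftrightarrow> \<alpha> = (\<beta> :: 'm \<Rightarrow> 'v)"
  using to_sec_of_sec by metis

lemma deg_eqI:
  assumes "of_deg k P" "of_deg k Q" "\<And>Xs x. set Xs \<subseteq> sections M E \<Longrightarrow> length Xs = k \<Longrightarrow> ev P Xs x = ev Q Xs x"
  shows "P = Q"
proof (rule multi_eqI, rule ext)
  fix Xs x assume "set Xs \<subseteq> sections M E"
  then show "ev P Xs x = ev Q Xs x"
    using assms by (cases "length Xs = k") (simp_all add: ev_def of_deg_def)
qed

end

context derivation_pair
begin

lemma leibniz_LD: "leibniz 1 (LD D0 D1)"
proof -
  have "fsc (\<lambda>_. 1) R = R" for R :: "('m, 'v) multi" by (simp add: fsc_def)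
  then show ?thesis by (simp add: leibniz_def LD_add LD_wedge Forms_of_fun Forms_of_sec)
qed

lemma LD_of_fun:
  assumes "f \<in> smooth_funs M"
  shows "LD D0 D1 (of_fun f) = of_fun (D0 f)"
proof (rule deg_eqI[OF of_deg_LD[OF of_deg_of_fun] of_deg_of_fun])
  show "of_fun f \<in> Forms M E" using assms by (simp add: Forms_of_fun)
  then show "ev (LD D0 D1 (of_fun f)) Xs x = ev (of_fun (D0 f)) Xs x" if "set Xs \<subseteq> sections M E" "length Xs = 0" for Xs x
    using that ev_LD[of "of_fun f" "[]"] by (simp add: ev_def of_fun_def)
qed

end

context almost_algebroid
begin

lemma Lie_of_fun: "X \<in> S \<Longrightarrow> f \<in> C \<Longrightarrow> \<L> X (of_fun f) = of_fun (anchor_deriv A X f)"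
  by (rule derivation_pair.LD_of_fun[OF derivation_pair])

lemma to_sec_anchor_form:
  assumes "f \<in> C"
  shows "of_sec (to_sec (anchor_form f)) = anchor_form f" "to_sec (anchor_form f) \<in> cosecs A"
    "to_sec (anchor_form f) x \<bullet> v = anc A x v f"
proof -
  show 1: "of_sec (to_sec (anchor_form f)) = anchor_form f"
    by (rule of_sec_to_sec[OF Forms_altm[OF anchor_form_Forms[OF assms]] of_deg_anchor_form])
  then show "to_sec (anchor_form f) \<in> cosecs A" using anchor_form_Forms[OF assms] Forms_of_sec by metis
  show "to_sec (anchor_form f) x \<bullet> v = anc A x v f"
    using fun_cong[OF fun_cong[OF 1], of x "[v]"] by (simp add: of_sec_def anchor_form_def)
qed

lemma ev_Lie_1:
  assumes "X \<in> S" "Y \<in> S" "P \<in> \<Omega>"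
  shows "ev (\<L> X P) [Y] x = anchor_deriv A X (ev P [Y]) x - ev P [brk A X Y] x"
  using ev_Lie[OF assms(1,3), of "[Y]"] assms(2) by (simp add: ev_Cons)

text \<open>The Lie derivative of 1-forms, as the operator on sections of the dual bundle that it defines.\<close>

definition lie_cosec :: "('m \<Rightarrow> 'v) \<Rightarrow> ('m \<Rightarrow> 'v) \<Rightarrow> 'm \<Rightarrow> 'v" where
  "lie_cosec X \<alpha> = to_sec (\<L> X (of_sec \<alpha>))"

lemma of_sec_lie_cosec:
  assumes "X \<in> S" "\<alpha> \<in> cosecs A"
  shows "of_sec (lie_cosec X \<alpha>) = \<L> X (of_sec \<alpha>)" "lie_cosec X \<alpha> \<in> cosecs A"
proof -
  have F: "of_sec \<alpha> \<in> \<Omega>" using assms(2) by (simp add: Forms_of_sec)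
  note L = Forms_Lie[OF assms(1) F]
  show 1: "of_sec (lie_cosec X \<alpha>) = \<L> X (of_sec \<alpha>)"
    unfolding lie_cosec_def by (rule of_sec_to_sec[OF Forms_altm[OF L] of_deg_Lie[OF assms(1) of_deg_of_sec F]])
  then show "lie_cosec X \<alpha> \<in> cosecs A" using L Forms_of_sec by metis
qed

lemma lie_cosec_inner:
  assumes "X \<in> S" "\<alpha> \<in> cosecs A" "Y \<in> S"
  shows "lie_cosec X \<alpha> x \<bullet> Y x = anchor_deriv A X (\<lambda>x. \<alpha> x \<bullet> Y x) x - \<alpha> x \<bullet> brk A X Y x"
proof -
  have "lie_cosec X \<alpha> x \<bullet> Y x = ev (of_sec (lie_cosec X \<alpha>)) [Y] x" by (simp add: ev_def of_sec_def)
  also have "\<dots> = anchor_deriv A X (ev (of_sec \<alpha>) [Y]) x - ev (of_sec \<alpha>) [brk A X Y] x"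
    unfolding of_sec_lie_cosec(1)[OF assms(1,2)] using assms by (intro ev_Lie_1) (simp_all add: Forms_of_sec)
  finally show ?thesis by (simp add: ev_def of_sec_def)
qed

lemma derivation_pair_lie_cosec:
  assumes X: "X \<in> S"
  shows "derivation_pair (base A) (dual_bundle (vbundle A)) (anchor_deriv A X) (lie_cosec X)"
proof -
  interpret dual: smooth_bundle "base A" "dual_bundle (vbundle A)" by (rule bundle_dual)
  have "lie_cosec X (\<lambda>x. \<alpha> x + \<beta> x) = (\<lambda>x. lie_cosec X \<alpha> x + lie_cosec X \<beta> x)"
    if "\<alpha> \<in> cosecs A" "\<beta> \<in> cosecs A" for \<alpha> \<beta>
  proof -
    have "of_sec (lie_cosec X (\<lambda>x. \<alpha> x + \<beta> x)) = of_sec (\<lambda>x. lie_cosec X \<alpha> x + lie_cosec X \<beta> x)"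
      using that by (simp add: of_sec_add of_sec_lie_cosec[OF X] dual.sections_add Lie_sum[OF X] Forms_of_sec)
    then show ?thesis by (simp add: of_sec_inject)
  qed
  moreover have "lie_cosec X (\<lambda>x. f x *\<^sub>R \<alpha> x) = (\<lambda>x. f x *\<^sub>R lie_cosec X \<alpha> x + anchor_deriv A X f x *\<^sub>R \<alpha> x)"
    if "\<alpha> \<in> cosecs A" "f \<in> C" for \<alpha> f
  proof -
    have "of_sec (lie_cosec X (\<lambda>x. f x *\<^sub>R \<alpha> x)) = of_sec (\<lambda>x. f x *\<^sub>R lie_cosec X \<alpha> x + anchor_deriv A X f x *\<^sub>R \<alpha> x)"
      using that Lie_wedge[OF X, of "of_fun f" "of_sec \<alpha>"]
      by (simp add: of_sec_add of_sec_scale of_sec_lie_cosec[OF X] dual.sections_scale Forms_of_sec Forms_of_fun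
          of_fun_wedge Lie_of_fun[OF X])
    then show ?thesis by (simp add: of_sec_inject)
  qed
  ultimately show ?thesis
    by unfold_locales (simp add: dual.der_pair_def anchor_smooth[OF X] anchor_const anchor_add anchor_mult of_sec_lie_cosec[OF X])
qed

end

context bivector_algebroid
begin

lemma of_sec_Omega: "\<alpha> \<in> cosecs A \<Longrightarrow> of_sec \<alpha> \<in> Omega 1"
  using Omega_1 by blast

lemma of_fun_Omega: "f \<in> C \<Longrightarrow> of_fun f \<in> Omega 0"
  using Omega_0 by blast

lemma kap_of_sec_of_sec: "kap (of_sec \<alpha>) (of_sec \<beta>) = - of_fun (\<lambda>x. \<pi> x [\<alpha> x, \<beta> x])"
  by (simp add: kap_of_sec[OF altm_of_sec] ins_of_sec app_def sharp_inner)

lemma ins_sh: "altm Q \<Longrightarrow> ins (sh \<alpha>) Q = - kap (of_sec \<alpha>) Q"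
  by (simp add: kap_of_sec)

text \<open>
  The Cartan formula turns the definition of \<open>[\<alpha>, \<beta>]\<^sub>\<pi>\<close> into the bracket generated by \<open>\<kappa>\<close> and \<open>d\<close>; all properties of
  the former are inherited from the derivation rules of the latter.
\<close>

lemma of_sec_brk_pi:
  assumes \<alpha>: "\<alpha> \<in> cosecs A" and \<beta>: "\<beta> \<in> cosecs A"
  shows "of_sec (brk_pi A \<pi> \<alpha> \<beta>) = pa.b (of_sec \<alpha>) (of_sec \<beta>)" "brk_pi A \<pi> \<alpha> \<beta> \<in> cosecs A"
proof -
  note o = of_sec_Omega[OF \<alpha>] of_sec_Omega[OF \<beta>]
  note F = o[THEN Omega_Forms]
  let ?a = "of_sec \<alpha>" and ?b = "of_sec \<beta>"
  have anti: "kap ?b ?a = - kap ?a ?b" using \<pi>_antisym[of _ "\<beta> _" "\<alpha> _"] by (simp add: kap_of_sec_of_sec of_fun_def fun_eq_iff multi_apply2 split: list.splits)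
  have pair: "pair \<pi> \<alpha> \<beta> = - kap ?a ?b" by (simp add: pair_def kap_of_sec_of_sec)
  have "lie_deriv A (sh \<alpha>) ?b - lie_deriv A (sh \<beta>) ?a - ext_d A (pair \<pi> \<alpha> \<beta>) = pa.b ?a ?b"
    unfolding lie_deriv_def pair pa.b_1_1[OF o]
    by (simp add: ins_sh Forms_altm Forms_d F anti pa.d_minus Forms_kap)
  then have e: "brk_pi A \<pi> \<alpha> \<beta> = to_sec (pa.b ?a ?b)" by (simp add: brk_pi_def)
  have "pa.b ?a ?b \<in> Omega 1" by (rule pa.b_1_1_Om[OF o])
  then obtain \<gamma> where "\<gamma> \<in> cosecs A" "pa.b ?a ?b = of_sec \<gamma>" unfolding Omega_1 by (elim bexE)
  then show "of_sec (brk_pi A \<pi> \<alpha> \<beta>) = pa.b ?a ?b" "brk_pi A \<pi> \<alpha> \<beta> \<in> cosecs A"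
    by (simp_all add: e to_sec_of_sec)
qed

lemma anchor_deriv_dual: "anchor_deriv (dual_algebroid A \<pi>) \<alpha> f = anchor_deriv A (sh \<alpha>) f"
  by (simp add: anchor_deriv_def app_def)

lemma b_of_sec_of_fun:
  assumes \<alpha>: "\<alpha> \<in> cosecs A" and f: "f \<in> C"
  shows "pa.b (of_sec \<alpha>) (of_fun f) = of_fun (anchor_deriv A (sh \<alpha>) f)"
  using kap_of_sec[of "anchor_form f" \<alpha>] Forms_altm[OF anchor_form_Forms[OF f]]
  by (simp add: pa.b_1_0[OF of_sec_Omega[OF \<alpha>] of_fun_Omega[OF f]] d_of_fun[OF f] ins_anchor_form)

lemma brk_pi_antisym:
  assumes "\<alpha> \<in> cosecs A" "\<beta> \<in> cosecs A"
  shows "brk_pi A \<pi> \<alpha> \<beta> = - brk_pi A \<pi> \<beta> \<alpha>"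
proof -
  have "of_sec (brk_pi A \<pi> \<alpha> \<beta>) = of_sec (- brk_pi A \<pi> \<beta> \<alpha>)"
    unfolding of_sec_uminus of_sec_brk_pi(1)[OF assms] of_sec_brk_pi(1)[OF assms(2,1)]
    by (rule pa.b_1_1_antisym[OF of_sec_Omega[OF assms(1)] of_sec_Omega[OF assms(2)]])
  then show ?thesis by (simp add: of_sec_inject)
qed

lemma brk_pi_add:
  assumes "\<alpha> \<in> cosecs A" "\<beta> \<in> cosecs A" "\<gamma> \<in> cosecs A"
  shows "brk_pi A \<pi> \<alpha> (\<beta> + \<gamma>) = brk_pi A \<pi> \<alpha> \<beta> + brk_pi A \<pi> \<alpha> \<gamma>"
proof -
  have s: "\<beta> + \<gamma> \<in> cosecs A" using dual.sections_add[OF assms(2,3)] by (simp add: plus_fun_def)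
  have "of_sec (brk_pi A \<pi> \<alpha> (\<beta> + \<gamma>)) = of_sec (brk_pi A \<pi> \<alpha> \<beta> + brk_pi A \<pi> \<alpha> \<gamma>)"
    unfolding of_sec_plus of_sec_brk_pi(1)[OF assms(1) s] of_sec_brk_pi(1)[OF assms(1,2)] of_sec_brk_pi(1)[OF assms(1,3)]
    by (rule fa.bider_add_right[OF pa.b_bider]) (use assms in \<open>simp_all add: Forms_of_sec\<close>)
  then show ?thesis by (simp add: of_sec_inject)
qed

lemma brk_pi_leibniz:
  assumes "\<alpha> \<in> cosecs A" "\<beta> \<in> cosecs A" "f \<in> C"
  shows "brk_pi A \<pi> \<alpha> (\<lambda>x. f x *\<^sub>R \<beta> x)
    = (\<lambda>x. f x *\<^sub>R brk_pi A \<pi> \<alpha> \<beta> x + anchor_deriv A (sh \<alpha>) f x *\<^sub>R \<beta> x)"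
proof -
  have "of_sec (brk_pi A \<pi> \<alpha> (\<lambda>x. f x *\<^sub>R \<beta> x)) = pa.b (of_sec \<alpha>) (of_fun f \<and>\<and> of_sec \<beta>)"
    by (simp add: of_sec_brk_pi(1)[OF assms(1) dual.sections_scale[OF assms(3,2)]] of_sec_scale of_fun_wedge)
  also have "\<dots> = of_fun (anchor_deriv A (sh \<alpha>) f) \<and>\<and> of_sec \<beta> + of_fun f \<and>\<and> pa.b (of_sec \<alpha>) (of_sec \<beta>)"
    using fa.der_mul[OF fa.bider_der[OF pa.b_bider of_sec_Omega[OF assms(1)]] of_fun_Omega[OF assms(3)] of_sec_Omega[OF assms(2)]]
    by (simp add: b_of_sec_of_fun[OF assms(1,3)])
  also have "\<dots> = of_sec (\<lambda>x. f x *\<^sub>R brk_pi A \<pi> \<alpha> \<beta> x + anchor_deriv A (sh \<alpha>) f x *\<^sub>R \<beta> x)"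
    by (simp add: of_sec_add of_sec_scale of_fun_wedge of_sec_brk_pi(1)[OF assms(1,2)] add.commute)
  finally show ?thesis by (simp add: of_sec_inject)
qed

lemma almost_algebroid_dual: "almost_algebroid (dual_algebroid A \<pi>)"
proof -
  have sb: "smooth_bundle (base (dual_algebroid A \<pi>)) (vbundle (dual_algebroid A \<pi>))"
    using bundle_dual by simp
  show ?thesis
  proof (intro almost_algebroid.intro[OF sb] almost_algebroid_axioms.intro, unfold dual_algebroid_sel anchor_deriv_dual)
    show "tangent_vector (base A) x (anc A x (sharp \<pi> x v))" for x v by (rule tangent_anc)
    show "linear (\<lambda>v. anc A x (sharp \<pi> x v) f)" if "f \<in> C" for f x
      using linear_compose[OF linear_sharp linear_anc[OF that]] by (simp add: o_def)
    show "anchor_deriv A (sh \<alpha>) f \<in> C" if "\<alpha> \<in> cosecs A" "f \<in> C" for \<alpha> f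
      using that by (intro anchor_smooth sh_sec)
  qed (rule of_sec_brk_pi(2) brk_pi_antisym brk_pi_add brk_pi_leibniz; assumption)+
qed

section \<open>The Poisson condition\<close>

text \<open>
  The Schouten bracket is only given by its characterization. Each of its partial operators is a
  derivation of multivectors, hence determined by its values on functions and sections; in this way
  \<open>[f, \<cdot>]\<close> is a contraction, \<open>[X, \<cdot>]\<close> a Lie derivative, and \<open>[\<pi>, \<cdot>]\<close> the differential of
  the algebroid structure on the dual bundle. So \<open>[\<pi>, \<pi>] = 0\<close> says that \<open>\<pi>\<close> is closed for
  that differential, which is the cyclic identity between \<open>\<pi>\<close> and its bracket on 1-forms.
\<close>

context
  fixes bb assumes bb: "schouten_bracket A bb"
begin

lemma
  assumes "P \<in> multivectors A p" "Q \<in> multivectors A q"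
  shows schouten_antisym: "bb P Q = (\<lambda>x vs. - ((- 1) ^ ((p + 1) * (q + 1)) * bb Q P x vs))"
    and schouten_add: "Q' \<in> multivectors A q \<Longrightarrow> bb P (Q + Q') = bb P Q + bb P Q'"
    and schouten_wedge: "R \<in> multivectors A r \<Longrightarrow>
      bb P (Q \<and>\<and> R) = (bb P Q \<and>\<and> R) + (\<lambda>x vs. (- 1) ^ ((p + 1) * q) * (Q \<and>\<and> bb P R) x vs)"
proof -
  have *: "bb P Q \<in> multivectors A (p + q - 1) \<and>
        bb P Q = (\<lambda>x vs. - ((- 1) ^ ((p + 1) * (q + 1)) * bb Q P x vs)) \<and>
        (\<forall>Q'\<in>multivectors A q. bb P (Q + Q') = bb P Q + bb P Q') \<and>
        (\<forall>c. bb P (\<lambda>x vs. c * Q x vs) = (\<lambda>x vs. c * bb P Q x vs)) \<and>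
        (\<forall>r. \<forall>R\<in>multivectors A r.
           bb P (Q \<and>\<and> R) = (bb P Q \<and>\<and> R) + (\<lambda>x vs. (- 1) ^ ((p + 1) * q) * (Q \<and>\<and> bb P R) x vs))"
    by (rule bspec[OF bspec[OF spec[OF spec[OF conjunct1[OF bb[unfolded schouten_bracket_def]]]] assms(1)] assms(2)])
  show "bb P Q = (\<lambda>x vs. - ((- 1) ^ ((p + 1) * (q + 1)) * bb Q P x vs))"
    by (rule conjunct1[OF conjunct2[OF *]])
  show "Q' \<in> multivectors A q \<Longrightarrow> bb P (Q + Q') = bb P Q + bb P Q'"
    by (rule bspec[OF conjunct1[OF conjunct2[OF conjunct2[OF *]]]])
  show "R \<in> multivectors A r \<Longrightarrow>
      bb P (Q \<and>\<and> R) = (bb P Q \<and>\<and> R) + (\<lambda>x vs. (- 1) ^ ((p + 1) * q) * (Q \<and>\<and> bb P R) x vs)"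
    by (rule bspec[OF spec[OF conjunct2[OF conjunct2[OF conjunct2[OF conjunct2[OF *]]]]]])
qed

lemma
  shows schouten_sec_sec: "X \<in> S \<Longrightarrow> Y \<in> S \<Longrightarrow> bb (of_sec X) (of_sec Y) = of_sec (brk A X Y)"
    and schouten_sec_fun: "X \<in> S \<Longrightarrow> f \<in> C \<Longrightarrow> bb (of_sec X) (of_fun f) = of_fun (anchor_deriv A X f)"
    and schouten_fun_fun: "f \<in> C \<Longrightarrow> h \<in> C \<Longrightarrow> bb (of_fun f) (of_fun h) = 0"
  using bb unfolding schouten_bracket_def by - (elim conjE, simp only:)+

lemma MV_of_fun: "f \<in> C \<Longrightarrow> of_fun f \<in> multivectors A 0"
  and MV_of_sec: "X \<in> S \<Longrightarrow> of_sec X \<in> multivectors A 1"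
  using of_deg_of_sec[of X] by (simp_all add: multivectors_eq dual.Forms_of_fun dual.Forms_of_sec sections_dual_dual of_deg_of_fun)

lemma schouten_leibniz:
  assumes P: "P \<in> multivectors A p"
  shows "dual.leibniz (if even p then - 1 else 1) (bb P)"
  unfolding dual.leibniz_def
proof (intro conjI allI ballI impI)
  fix Q and q :: nat
  assume "Q \<in> MV" "of_deg q Q"
  then have Q: "Q \<in> multivectors A q" by (simp add: multivectors_eq)
  show "bb P (Q + Q') = bb P Q + bb P Q'" if "Q' \<in> MV" "of_deg q Q'" for Q'
    using that by (intro schouten_add[OF P Q]) (simp add: multivectors_eq)
  show "bb P (of_fun f \<and>\<and> Q) = bb P (of_fun f) \<and>\<and> Q + of_fun f \<and>\<and> bb P Q" if "f \<in> C" for f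
    using schouten_wedge[OF P MV_of_fun[OF that] Q] by simp
  show "bb P (of_sec X \<and>\<and> Q) = bb P (of_sec X) \<and>\<and> Q + fsc (\<lambda>_. if even p then - 1 else 1) (of_sec X \<and>\<and> bb P Q)"
    if "X \<in> sections (base A) (dual_bundle (dual_bundle (vbundle A)))" for X
    using schouten_wedge[OF P MV_of_sec Q, of X] that by (simp add: sections_dual_dual fsc_def)
qed

lemma schouten_fun:
  assumes f: "f \<in> C" and Q: "Q \<in> multivectors A q"
  shows "bb (of_fun f) Q = - ins (to_sec (anchor_form f)) Q"
proof -
  let ?\<theta> = "to_sec (anchor_form f)"
  have 1: "dual.leibniz (- 1) (bb (of_fun f))" using schouten_leibniz[OF MV_of_fun[OF f]] by simp
  have 2: "dual.leibniz (- 1) (\<lambda>P. - ins ?\<theta> P)"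
    using dual.der_leibniz[OF dual.fa.der_neg[OF dual.ins_der[OF to_sec_anchor_form(2)[OF f]]]] by simp
  show ?thesis
  proof (rule dual.forms_determined[OF 1 2, where p = q])
    show "bb (of_fun f) (of_fun g) = - ins ?\<theta> (of_fun g)" if "g \<in> C" for g
      using that f by (simp add: schouten_fun_fun ins_of_fun)
    show "bb (of_fun f) (of_sec Y) = - ins ?\<theta> (of_sec Y)"
      if "Y \<in> sections (base A) (dual_bundle (dual_bundle (vbundle A)))" for Y
    proof -
      have Y: "Y \<in> S" using that by (simp add: sections_dual_dual)
      have "bb (of_fun f) (of_sec Y) = - bb (of_sec Y) (of_fun f)"
        using schouten_antisym[OF MV_of_fun[OF f] MV_of_sec[OF Y]] by (simp add: fun_eq_iff multi_apply2)
      also have "\<dots> = - ins ?\<theta> (of_sec Y)"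
        using schouten_sec_fun[OF Y f] to_sec_anchor_form(3)[OF f]
        by (simp add: ins_of_sec anchor_deriv_def inner_commute)
      finally show ?thesis .
    qed
  qed (use Q in \<open>simp_all add: multivectors_eq\<close>)
qed

lemma schouten_sec:
  assumes X: "X \<in> S" and Q: "Q \<in> multivectors A q"
  shows "bb (of_sec X) Q = dual.LD (anchor_deriv A X) (lie_cosec X) Q"
proof -
  interpret dp: derivation_pair "base A" "dual_bundle (vbundle A)" "anchor_deriv A X" "lie_cosec X"
    by (rule derivation_pair_lie_cosec[OF X])
  have 1: "dual.leibniz 1 (bb (of_sec X))" using schouten_leibniz[OF MV_of_sec[OF X]] by simp
  show ?thesis
  proof (rule dual.forms_determined[OF 1 dp.leibniz_LD, where p = q])
    show "bb (of_sec X) (of_fun f) = dual.LD (anchor_deriv A X) (lie_cosec X) (of_fun f)" if "f \<in> C" for f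
      using that X by (simp add: schouten_sec_fun dp.LD_of_fun)
    show "bb (of_sec X) (of_sec Y) = dual.LD (anchor_deriv A X) (lie_cosec X) (of_sec Y)"
      if "Y \<in> sections (base A) (dual_bundle (dual_bundle (vbundle A)))" for Y
    proof -
      have Y: "Y \<in> S" using that by (simp add: sections_dual_dual)
      have F: "of_sec Y \<in> MV" using MV_of_sec[OF Y] by (simp add: multivectors_eq)
      have "of_sec (brk A X Y) = dual.LD (anchor_deriv A X) (lie_cosec X) (of_sec Y)"
      proof (rule dual.deg_eqI[OF of_deg_of_sec dp.of_deg_LD[OF of_deg_of_sec F]])
        fix as x assume as: "set as \<subseteq> cosecs A" "length as = 1"
        then obtain \<alpha> where \<alpha>: "as = [\<alpha>]" "\<alpha> \<in> cosecs A" by (cases as) auto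
        show "ev (of_sec (brk A X Y)) as x = ev (dual.LD (anchor_deriv A X) (lie_cosec X) (of_sec Y)) as x"
          unfolding dp.ev_LD[OF F as(1)] unfolding \<alpha>(1)
          using lie_cosec_inner[OF X \<alpha>(2) Y, of x]
          by (simp add: ev_def ins_def of_sec_def inner_commute)
      qed
      then show ?thesis by (simp add: schouten_sec_sec[OF X Y])
    qed
  qed (use Q in \<open>simp_all add: multivectors_eq\<close>)
qed

lemma schouten_\<pi>:
  assumes Q: "Q \<in> multivectors A q"
  shows "bb \<pi> Q = ext_d (dual_algebroid A \<pi>) Q"
proof -
  interpret B: almost_algebroid "dual_algebroid A \<pi>" by (rule almost_algebroid_dual)
  have 1: "dual.leibniz (- 1) (bb \<pi>)" using schouten_leibniz[OF bivector] by simp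
  have 2: "dual.leibniz (- 1) (ext_d (dual_algebroid A \<pi>))" using B.der_leibniz[OF B.d_der] by simp
  show ?thesis
  proof (rule dual.forms_determined[OF 1 2, where p = q])
    show "bb \<pi> (of_fun f) = ext_d (dual_algebroid A \<pi>) (of_fun f)" if f: "f \<in> C" for f
    proof -
      have "bb \<pi> (of_fun f) = bb (of_fun f) \<pi>"
        using schouten_antisym[OF bivector MV_of_fun[OF f]] by simp
      also have "\<dots> = - ins (to_sec (anchor_form f)) \<pi>" by (rule schouten_fun[OF f bivector])
      also have "\<dots> = B.anchor_form f"
      proof (rule dual.deg_eqI[where k = 1])
        show "of_deg 1 (- ins (to_sec (anchor_form f)) \<pi>)"
          using of_deg_ins[of 1 \<pi>] \<pi>_deg by (intro of_deg_minus) (simp add: numeral_2_eq_2)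
        fix as x assume as: "set as \<subseteq> cosecs A" "length as = 1"
        then obtain \<alpha> where \<alpha>: "as = [\<alpha>]" by (cases as) auto
        show "ev (- ins (to_sec (anchor_form f)) \<pi>) as x = ev (B.anchor_form f) as x"
          using to_sec_anchor_form(3)[OF f, of x "sharp \<pi> x (\<alpha> x)"] \<pi>_antisym[of x "to_sec (anchor_form f) x" "\<alpha> x"]
          by (simp add: \<alpha> ev_def ins_def B.anchor_form_def multi_apply2 sharp_inner)
      qed (rule B.of_deg_anchor_form)
      finally show ?thesis using B.d_of_fun[of f] f by simp
    qed
    show "bb \<pi> (of_sec X) = ext_d (dual_algebroid A \<pi>) (of_sec X)"
      if "X \<in> sections (base A) (dual_bundle (dual_bundle (vbundle A)))" for X
    proof -
      have X: "X \<in> S" using that by (simp add: sections_dual_dual)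
      interpret dp: derivation_pair "base A" "dual_bundle (vbundle A)" "anchor_deriv A X" "lie_cosec X"
        by (rule derivation_pair_lie_cosec[OF X])
      have F: "of_sec X \<in> MV" using MV_of_sec[OF X] by (simp add: multivectors_eq)
      have "bb \<pi> (of_sec X) = - bb (of_sec X) \<pi>"
        using schouten_antisym[OF bivector MV_of_sec[OF X]] by (simp add: fun_eq_iff multi_apply2)
      also have "\<dots> = - dual.LD (anchor_deriv A X) (lie_cosec X) \<pi>" by (simp add: schouten_sec[OF X bivector])
      also have "\<dots> = ext_d (dual_algebroid A \<pi>) (of_sec X)"
      proof (rule dual.deg_eqI[where k = 2])
        show "of_deg 2 (- dual.LD (anchor_deriv A X) (lie_cosec X) \<pi>)"
          by (intro of_deg_minus dp.of_deg_LD \<pi>_deg \<pi>_MV)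
        show "of_deg 2 (ext_d (dual_algebroid A \<pi>) (of_sec X))"
          using B.of_deg_d[OF of_deg_of_sec] F by (simp add: numeral_2_eq_2)
        fix as x assume as: "set as \<subseteq> cosecs A" "length as = 2"
        then obtain \<alpha> \<beta> where ab: "as = [\<alpha>, \<beta>]" by (auto simp: length_Suc_conv numeral_2_eq_2)
        then have \<alpha>: "\<alpha> \<in> cosecs A" and \<beta>: "\<beta> \<in> cosecs A" using as by auto
        have F\<alpha>: "of_sec \<alpha> \<in> \<Omega>" and F\<beta>: "of_sec \<beta> \<in> \<Omega>" using \<alpha> \<beta> by (simp_all add: Forms_of_sec)
        have l: "\<pi> x [lie_cosec X \<alpha> x, \<beta> x] = anchor_deriv A X (\<lambda>x. \<pi> x [\<alpha> x, \<beta> x]) x + \<alpha> x \<bullet> brk A X (sh \<beta>) x"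
          "\<pi> x [\<alpha> x, lie_cosec X \<beta> x] = anchor_deriv A X (\<lambda>x. \<pi> x [\<alpha> x, \<beta> x]) x - \<beta> x \<bullet> brk A X (sh \<alpha>) x"
        proof -
          have "\<pi> x [lie_cosec X \<alpha> x, \<beta> x] = - (lie_cosec X \<alpha> x \<bullet> sh \<beta> x)"
            by (simp add: app_def sharp_inner \<pi>_antisym[of x "\<beta> x"])
          also have "(\<lambda>x. \<alpha> x \<bullet> sh \<beta> x) = (\<lambda>x. - \<pi> x [\<alpha> x, \<beta> x])"
            by (simp add: app_def sharp_inner \<pi>_antisym[of _ "\<beta> _"])
          then have "lie_cosec X \<alpha> x \<bullet> sh \<beta> x = - anchor_deriv A X (\<lambda>x. \<pi> x [\<alpha> x, \<beta> x]) x - \<alpha> x \<bullet> brk A X (sh \<beta>) x"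
            using lie_cosec_inner[OF X \<alpha> sh_sec[OF \<beta>], of x] by (simp add: anchor_minus[OF smooth_\<pi>[OF \<alpha> \<beta>]])
          finally show "\<pi> x [lie_cosec X \<alpha> x, \<beta> x] = anchor_deriv A X (\<lambda>x. \<pi> x [\<alpha> x, \<beta> x]) x + \<alpha> x \<bullet> brk A X (sh \<beta>) x"
            by simp
          have "\<pi> x [\<alpha> x, lie_cosec X \<beta> x] = lie_cosec X \<beta> x \<bullet> sh \<alpha> x" by (simp add: app_def sharp_inner)
          also have "(\<lambda>x. \<beta> x \<bullet> sh \<alpha> x) = (\<lambda>x. \<pi> x [\<alpha> x, \<beta> x])" by (simp add: app_def sharp_inner)
          then have "lie_cosec X \<beta> x \<bullet> sh \<alpha> x = anchor_deriv A X (\<lambda>x. \<pi> x [\<alpha> x, \<beta> x]) x - \<beta> x \<bullet> brk A X (sh \<alpha>) x"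
            using lie_cosec_inner[OF X \<beta> sh_sec[OF \<alpha>], of x] by simp
          finally show "\<pi> x [\<alpha> x, lie_cosec X \<beta> x] = anchor_deriv A X (\<lambda>x. \<pi> x [\<alpha> x, \<beta> x]) x - \<beta> x \<bullet> brk A X (sh \<alpha>) x" .
        qed
        have ev\<alpha>: "ev (of_sec \<gamma>) [Y] = (\<lambda>x. \<gamma> x \<bullet> Y x)" for \<gamma> Y :: "'m \<Rightarrow> 'v" by (simp add: ev_def of_sec_def)
        have br: "brk_pi A \<pi> \<alpha> \<beta> x \<bullet> X x = - ev (ext_d A (of_sec \<alpha>)) [sh \<beta>, X] x
            + anchor_deriv A X (\<lambda>x. \<pi> x [\<alpha> x, \<beta> x]) x + ev (ext_d A (of_sec \<beta>)) [sh \<alpha>, X] x"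
        proof -
          have "ev (of_sec (brk_pi A \<pi> \<alpha> \<beta>)) [X] x = brk_pi A \<pi> \<alpha> \<beta> x \<bullet> X x" by (simp add: ev\<alpha>)
          moreover have "of_sec (brk_pi A \<pi> \<alpha> \<beta>) = - ins (sh \<beta>) (ext_d A (of_sec \<alpha>))
              + anchor_form (\<lambda>x. \<pi> x [\<alpha> x, \<beta> x]) + ins (sh \<alpha>) (ext_d A (of_sec \<beta>))"
            unfolding of_sec_brk_pi(1)[OF \<alpha> \<beta>] pa.b_1_1[OF of_sec_Omega[OF \<alpha>] of_sec_Omega[OF \<beta>]] kap_of_sec_of_sec
            using smooth_\<pi>[OF \<alpha> \<beta>]
            by (simp add: kap_of_sec Forms_altm Forms_d F\<alpha> F\<beta> pa.d_minus Forms_of_fun d_of_fun)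
          ultimately show ?thesis by (simp add: ev_add ev_minus ev_diff ev_anchor_form flip: ev_Cons)
        qed
        have dd: "ev (ext_d A (of_sec \<alpha>)) [sh \<beta>, X] x = anchor_deriv A (sh \<beta>) (\<lambda>x. \<alpha> x \<bullet> X x) x
             + anchor_deriv A X (\<lambda>x. \<pi> x [\<alpha> x, \<beta> x]) x + \<alpha> x \<bullet> brk A X (sh \<beta>) x"
          "ev (ext_d A (of_sec \<beta>)) [sh \<alpha>, X] x = anchor_deriv A (sh \<alpha>) (\<lambda>x. \<beta> x \<bullet> X x) x
             - anchor_deriv A X (\<lambda>x. \<pi> x [\<alpha> x, \<beta> x]) x + \<beta> x \<bullet> brk A X (sh \<alpha>) x"
        proof -
          have "(\<lambda>x. \<alpha> x \<bullet> sh \<beta> x) = (\<lambda>x. - \<pi> x [\<alpha> x, \<beta> x])" "(\<lambda>x. \<beta> x \<bullet> sh \<alpha> x) = (\<lambda>x. \<pi> x [\<alpha> x, \<beta> x])"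
            by (simp_all add: app_def sharp_inner \<pi>_antisym[of _ "\<beta> _"])
          then show "ev (ext_d A (of_sec \<alpha>)) [sh \<beta>, X] x = anchor_deriv A (sh \<beta>) (\<lambda>x. \<alpha> x \<bullet> X x) x
             + anchor_deriv A X (\<lambda>x. \<pi> x [\<alpha> x, \<beta> x]) x + \<alpha> x \<bullet> brk A X (sh \<beta>) x"
            "ev (ext_d A (of_sec \<beta>)) [sh \<alpha>, X] x = anchor_deriv A (sh \<alpha>) (\<lambda>x. \<beta> x \<bullet> X x) x
             - anchor_deriv A X (\<lambda>x. \<pi> x [\<alpha> x, \<beta> x]) x + \<beta> x \<bullet> brk A X (sh \<alpha>) x"
            using ev_d[OF F\<alpha>, of "[sh \<beta>, X]"] ev_d[OF F\<beta>, of "[sh \<alpha>, X]"] X sh_sec[OF \<alpha>] sh_sec[OF \<beta>]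
              anchor_minus[OF smooth_\<pi>[OF \<alpha> \<beta>], of X] fun_cong[OF brk_antisym[OF sh_sec[OF \<beta>] X], of x]
              fun_cong[OF brk_antisym[OF sh_sec[OF \<alpha>] X], of x]
            by (simp_all add: cart_2 ev\<alpha> uminus_apply del: cart.simps)
        qed
        have rhs: "ev (ext_d (dual_algebroid A \<pi>) (of_sec X)) as x
            = anchor_deriv A (sh \<alpha>) (\<lambda>x. \<beta> x \<bullet> X x) x - anchor_deriv A (sh \<beta>) (\<lambda>x. \<alpha> x \<bullet> X x) x - brk_pi A \<pi> \<alpha> \<beta> x \<bullet> X x"
          using B.ev_d[of "of_sec X" "[\<alpha>, \<beta>]"] F as
          by (simp add: ab B.cart_2 anchor_deriv_dual ev\<alpha> inner_commute del: B.cart.simps)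
        have "ev (dual.LD (anchor_deriv A X) (lie_cosec X) \<pi>) as x = anchor_deriv A X (\<lambda>x. \<pi> x [\<alpha> x, \<beta> x]) x
            - \<pi> x [\<alpha> x, lie_cosec X \<beta> x] - \<pi> x [lie_cosec X \<alpha> x, \<beta> x]"
          unfolding dp.ev_LD[OF \<pi>_MV as(1)] unfolding ab by (simp add: ev_def ins_def)
        then show "ev (- dual.LD (anchor_deriv A X) (lie_cosec X) \<pi>) as x = ev (ext_d (dual_algebroid A \<pi>) (of_sec X)) as x"
          unfolding rhs br dd l by (simp add: ev_minus l)
      qed
      finally show ?thesis .
    qed
  qed (use Q in \<open>simp_all add: multivectors_eq\<close>)
qed

theorem poisson_cyclic_identity:
  assumes "bb \<pi> \<pi> = 0" and "a \<in> Omega 1" "b \<in> Omega 1" "c \<in> Omega 1"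
  shows "kap a (ext_d A (kap b c)) + kap b (ext_d A (kap c a)) + kap c (ext_d A (kap a b)) +
    kap (pa.b a b) c + kap (pa.b b c) a + kap (pa.b c a) b = 0"
proof -
  interpret B: almost_algebroid "dual_algebroid A \<pi>" by (rule almost_algebroid_dual)
  obtain \<alpha> \<beta> \<gamma> where s: "\<alpha> \<in> cosecs A" "\<beta> \<in> cosecs A" "\<gamma> \<in> cosecs A"
    and e: "a = of_sec \<alpha>" "b = of_sec \<beta>" "c = of_sec \<gamma>"
    using assms(2-4) unfolding Omega_1 by (elim bexE)
  have k: "kap (of_sec \<mu>) (ext_d A (kap (of_sec \<nu>) (of_sec \<rho>)))
      = of_fun (anchor_deriv A (sh \<mu>) (\<lambda>x. \<pi> x [\<nu> x, \<rho> x]))"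
    if "\<nu> \<in> cosecs A" "\<rho> \<in> cosecs A" for \<mu> \<nu> \<rho>
    using smooth_\<pi>[OF that] Forms_altm[OF anchor_form_Forms[OF smooth_\<pi>[OF that]]]
    by (simp add: kap_of_sec_of_sec pa.d_minus Forms_of_fun d_of_fun kap_of_sec altm_minus ins_minus ins_anchor_form)
  have k2: "kap (pa.b (of_sec \<mu>) (of_sec \<nu>)) (of_sec \<rho>) = of_fun (\<lambda>x. - \<pi> x [brk_pi A \<pi> \<mu> \<nu> x, \<rho> x])"
    if "\<mu> \<in> cosecs A" "\<nu> \<in> cosecs A" for \<mu> \<nu> \<rho>
    by (simp add: kap_of_sec_of_sec flip: of_sec_brk_pi(1)[OF that]) (simp add: of_fun_def fun_eq_iff multi_apply2)
  have ev\<pi>: "ev \<pi> [\<mu>, \<nu>] = (\<lambda>x. \<pi> x [\<mu> x, \<nu> x])" for \<mu> \<nu> by (simp add: ev_def)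
  have "ext_d (dual_algebroid A \<pi>) \<pi> = 0" using schouten_\<pi>[OF bivector] assms(1) by simp
  then have z: "B.cart \<pi> [\<alpha>, \<beta>, \<gamma>] x = 0" for x
    using fun_cong[OF B.ev_d[of \<pi> "[\<alpha>, \<beta>, \<gamma>]"], of x] \<pi>_MV s by (simp add: ev_zero del: B.cart.simps)
  have ga: "(\<lambda>x. \<pi> x [\<gamma> x, \<alpha> x]) = (\<lambda>x. - \<pi> x [\<alpha> x, \<gamma> x])" using \<pi>_antisym[of _ "\<gamma> _" "\<alpha> _"] by simp
  have "anchor_deriv A (sh \<alpha>) (\<lambda>x. \<pi> x [\<beta> x, \<gamma> x]) x + anchor_deriv A (sh \<beta>) (\<lambda>x. \<pi> x [\<gamma> x, \<alpha> x]) x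
      + anchor_deriv A (sh \<gamma>) (\<lambda>x. \<pi> x [\<alpha> x, \<beta> x]) x - \<pi> x [brk_pi A \<pi> \<alpha> \<beta> x, \<gamma> x]
      - \<pi> x [brk_pi A \<pi> \<beta> \<gamma> x, \<alpha> x] - \<pi> x [brk_pi A \<pi> \<gamma> \<alpha> x, \<beta> x] = 0" for x
  proof -
    have "\<pi> x [\<beta> x, brk_pi A \<pi> \<alpha> \<gamma> x] = \<pi> x [brk_pi A \<pi> \<gamma> \<alpha> x, \<beta> x]"
      using linear_neg[OF linear_\<pi>(1), of x "\<beta> x" "brk_pi A \<pi> \<gamma> \<alpha> x"] \<pi>_antisym[of x "\<beta> x" "brk_pi A \<pi> \<gamma> \<alpha> x"]
      by (simp add: fun_cong[OF brk_pi_antisym[OF s(1,3)], of x] uminus_apply)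
    moreover have "\<pi> x [\<alpha> x, brk_pi A \<pi> \<beta> \<gamma> x] = - \<pi> x [brk_pi A \<pi> \<beta> \<gamma> x, \<alpha> x]" by (rule \<pi>_antisym)
    ultimately show ?thesis
      using z[of x] unfolding B.cart_3 anchor_deriv_dual ev\<pi> dual_algebroid_sel ga
      by (simp add: anchor_minus[OF smooth_\<pi>[OF s(1,3)]])
  qed
  then show ?thesis
    unfolding e k[OF s(2,3)] k[OF s(3,1)] k[OF s(1,2)] k2[OF s(1,2)] k2[OF s(2,3)] k2[OF s(3,1)]
    by (simp add: of_fun_def fun_eq_iff multi_apply2)
qed

end

end

section \<open>From the geometric structure equations to the algebraic ones\<close>

lemma sig_pow: "(\<lambda>x vs. (- 1) ^ k * P x vs) = sig (int k) P"
  by (cases "even k") (simp_all add: fun_eq_iff multi_apply2)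

lemma altf_cycle:
  assumes "altf h"
  shows "h [u, v, w] = h [v, w, u]"
  using altf_swap[OF assms, of "[]" u v "[w]"] altf_swap[OF assms, of "[v]" u w "[]"] by simp

locale background_structure = bivector_algebroid A \<pi>
  for A :: "('m::{t2_space, second_countable_topology}, 'e::real_inner, 'v::real_inner) lie_alg_data" and \<pi> +
  fixes N :: "'m \<Rightarrow> 'v \<Rightarrow> 'v" and \<psi> H :: "('m, 'v) multi"
  assumes pqn: "pqn_background A \<pi> N \<psi> H"
begin

lemma N_endo: "N \<in> bundle_endos (base A) (vbundle A)"
  and \<psi>_form: "\<psi> \<in> Omega 3" and H_form: "H \<in> Omega 3"
  and N_sharp: "N x (sharp \<pi> x a) = sharp \<pi> x (transp N x a)"
  and d\<psi>: "ext_d A \<psi> = 0" and dH: "ext_d A H = 0"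
  and poisson: "poisson_bivector A \<pi>"
  and C_condition: "\<alpha> \<in> cosecs A \<Longrightarrow> \<beta> \<in> cosecs A \<Longrightarrow>
    C_piN A \<pi> N \<alpha> \<beta> = (\<lambda>x vs. - 2 * ins2 (app (sharp \<pi>) \<alpha>) (app (sharp \<pi>) \<beta>) H x vs)"
  and T_condition: "X \<in> S \<Longrightarrow> Y \<in> S \<Longrightarrow> torsion A N X Y = app (sharp \<pi>)
    (to_sec (ins2 (app N X) Y H - ins2 (app N Y) X H + ins2 X Y \<psi>))"
  and W_condition: "d_N A N \<psi> = ext_d A (calH N H)"
proof -
  have *: "\<pi> \<in> multivectors A 2 \<and> N \<in> bundle_endos (base A) (vbundle A) \<and>
     \<psi> \<in> forms A 3 \<and> H \<in> forms A 3 \<and>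
     (\<forall>x a. N x (sharp \<pi> x a) = sharp \<pi> x (transp N x a)) \<and>
     ext_d A \<psi> = 0 \<and> ext_d A H = 0 \<and>
     poisson_bivector A \<pi> \<and>
     (\<forall>\<alpha>\<in>cosecs A. \<forall>\<beta>\<in>cosecs A.
        C_piN A \<pi> N \<alpha> \<beta> = (\<lambda>x vs. - 2 * ins2 (app (sharp \<pi>) \<alpha>) (app (sharp \<pi>) \<beta>) H x vs)) \<and>
     (\<forall>X\<in>secs A. \<forall>Y\<in>secs A.
        torsion A N X Y = app (sharp \<pi>)
          (to_sec (ins2 (app N X) Y H - ins2 (app N Y) X H + ins2 X Y \<psi>))) \<and>
     d_N A N \<psi> = ext_d A (calH N H)"
    using pqn unfolding pqn_background_def .
  then show "N \<in> bundle_endos (base A) (vbundle A)" by (elim conjE)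
  show "\<psi> \<in> Omega 3" "H \<in> Omega 3" using * Omega_eq_forms[of 3] by (elim conjE, simp)+
  show "N x (sharp \<pi> x a) = sharp \<pi> x (transp N x a)" using * by (elim conjE allE)
  show "ext_d A \<psi> = 0" "ext_d A H = 0" "poisson_bivector A \<pi>" "d_N A N \<psi> = ext_d A (calH N H)"
    using * by - (elim conjE, assumption)+
  show "C_piN A \<pi> N \<alpha> \<beta> = (\<lambda>x vs. - 2 * ins2 (app (sharp \<pi>) \<alpha>) (app (sharp \<pi>) \<beta>) H x vs)"
    if "\<alpha> \<in> cosecs A" "\<beta> \<in> cosecs A"
    by (rule bspec[OF bspec[OF _ that(1)] that(2)]) (use * in \<open>elim conjE\<close>)
  show "torsion A N X Y = app (sharp \<pi>) (to_sec (ins2 (app N X) Y H - ins2 (app N Y) X H + ins2 X Y \<psi>))"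
    if "X \<in> S" "Y \<in> S"
    by (rule bspec[OF bspec[OF _ that(1)] that(2)]) (use * in \<open>elim conjE\<close>)
qed

lemma linear_N: "linear (N x)"
  using N_endo by (auto simp: bundle_endos_def)

lemma N_sec: "X \<in> S \<Longrightarrow> app N X \<in> S"
  by (rule app_endo_sections[OF N_endo])

abbreviation "N2 \<equiv> \<lambda>x v. N x (N x v)"

lemma linear_N2: "linear (N2 x)"
  using linear_compose[OF linear_N linear_N] by (simp add: o_def)

lemma app_N2: "app N2 X = app N (app N X)"
  by (simp add: app_def)

lemma app_transp_N2: "app (transp N2) \<alpha> = app (transp N) (app (transp N) \<alpha>)"
  by (simp add: app_def transp_def adjoint_compose[OF fd linear_N linear_N])

lemma sh_transp: "sh (app (transp N) \<alpha>) = app N (sh \<alpha>)"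
  by (simp add: app_def N_sharp)

lemma \<pi>_transp: "\<pi> x [transp N x a, b] = \<pi> x [a, transp N x b]"
proof -
  have "\<pi> x [transp N x a, b] = b \<bullet> N x (sharp \<pi> x a)" by (simp add: N_sharp sharp_inner)
  also have "\<dots> = transp N x b \<bullet> sharp \<pi> x a" by (simp add: transp_def adjoint_inner[OF fd linear_N])
  finally show ?thesis by (simp add: sharp_inner)
qed

sublocale alg: background_algebra Omega \<Omega> wedge sg "ext_d A" kap "ins_N N" "ins_N N2" H \<psi>
proof
  obtain bb where bb: "schouten_bracket A bb" "bb \<pi> \<pi> = 0"
    using poisson unfolding poisson_bivector_def by (elim conjE exE)
  show "kap a (ext_d A (kap b c)) + kap b (ext_d A (kap c a)) + kap c (ext_d A (kap a b)) +
    kap (pa.b a b) c + kap (pa.b b c) a + kap (pa.b c a) b = 0"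
    if "a \<in> Omega 1" "b \<in> Omega 1" "c \<in> Omega 1" for a b c
    by (rule poisson_cyclic_identity[OF bb that])
  show "fa.der 0 (ins_N N)" by (rule ins_N_der[OF linear_N N_sec])
  show "fa.der 0 (ins_N N2)" by (rule ins_N_der[OF linear_N2]) (simp_all add: app_N2 N_sec)
  show "ins_N N f = 0" "ins_N N2 f = 0" if "f \<in> Omega 0" for f
    using that by (auto simp: Omega_0 ins_N_of_fun)
  show "ins_N N2 a = ins_N N (ins_N N a)" if "a \<in> Omega 1" for a
    using that by (auto simp: Omega_1 ins_N_of_sec[OF linear_N] ins_N_of_sec[OF linear_N2] app_transp_N2)
  show "kap (ins_N N a) b = kap a (ins_N N b)" if "a \<in> Omega 1" "b \<in> Omega 1" for a b
    using that by (auto simp: Omega_1 ins_N_of_sec[OF linear_N] kap_of_sec_of_sec app_def \<pi>_transp)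
qed (rule H_form \<psi>_form dH d\<psi>)+

lemma dN_eq: "alg.dN = d_N A N"
  by (intro ext) (simp add: alg.dN_def d_N_def)

lemma K_of_sec: "\<alpha> \<in> cosecs A \<Longrightarrow> alg.K (of_sec \<alpha>) = ins (sh \<alpha>) H"
  by (simp add: alg.K_1[OF of_sec_Omega] ins_sh[OF Forms_altm[OF Omega_Forms[OF H_form]]])

lemma C_eq:
  assumes \<alpha>: "\<alpha> \<in> cosecs A" and \<beta>: "\<beta> \<in> cosecs A"
  shows "alg.C (of_sec \<alpha>) (of_sec \<beta>) = C_piN A \<pi> N \<alpha> \<beta>"
proof -
  let ?a = "of_sec \<alpha>" and ?b = "of_sec \<beta>"
  note o = of_sec_Omega[OF \<alpha>] of_sec_Omega[OF \<beta>]
  have t: "app (transp N) \<gamma> \<in> cosecs A" if "\<gamma> \<in> cosecs A" for \<gamma> using that by (rule app_transp_sections[OF N_endo])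
  have dN: "alg.dN ?a \<in> Omega 2" "alg.dN ?b \<in> Omega 2"
    using fa.der_Om[OF alg.dN_der o(1)] fa.der_Om[OF alg.dN_der o(2)] by simp_all
  have alt: "altm (alg.dN ?a)" "altm (alg.dN ?b)" using dN by (simp_all add: Omega_Forms Forms_altm)
  have ia: "ins (sh \<alpha>) ?b = pair \<pi> \<alpha> \<beta>" by (simp add: ins_of_sec app_def sharp_inner pair_def)
  have ib: "ins (sh \<beta>) ?a = - pair \<pi> \<alpha> \<beta>"
    using \<pi>_antisym[of _ "\<beta> _" "\<alpha> _"]
    by (simp add: ins_of_sec app_def sharp_inner pair_def of_fun_def fun_eq_iff multi_apply2 split: list.splits)
  have k: "kap ?a ?b = - pair \<pi> \<alpha> \<beta>" by (simp add: kap_of_sec_of_sec pair_def)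
  have pF: "pair \<pi> \<alpha> \<beta> \<in> \<Omega>" using smooth_\<pi>[OF \<alpha> \<beta>] by (simp add: pair_def Forms_of_fun)
  have 1: "kap (alg.dN ?a) ?b = - ins (sh \<beta>) (alg.dN ?a)"
    using pa.\<kappa>_sym_odd_even[OF dN(1) o(2)] by (simp add: kap_of_sec[OF alt(1)])
  have 2: "kap (sg ?a) (alg.dN ?b) = ins (sh \<alpha>) (alg.dN ?b)"
    using fa.bider_minus_left[OF kap_bider fa.Om_Tot[OF o(1)] fa.Om_Tot[OF dN(2)]]
    by (simp add: sg_of_sec kap_of_sec[OF alt(2)])
  have 3: "pa.b (ins_N N ?a) ?b = of_sec (brk_pi A \<pi> (app (transp N) \<alpha>) \<beta>)"
    "pa.b ?a (ins_N N ?b) = of_sec (brk_pi A \<pi> \<alpha> (app (transp N) \<beta>))"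
    "ins_N N (pa.b ?a ?b) = of_sec (app (transp N) (brk_pi A \<pi> \<alpha> \<beta>))"
    by (simp_all add: ins_N_of_sec[OF linear_N] of_sec_brk_pi(1)[OF t[OF \<alpha>] \<beta>] of_sec_brk_pi(1)[OF \<alpha> t[OF \<beta>]]
        flip: of_sec_brk_pi(1)[OF \<alpha> \<beta>])
  have m: "d_N A N (- pair \<pi> \<alpha> \<beta>) = - d_N A N (pair \<pi> \<alpha> \<beta>)"
    using fa.der_minus[OF alg.dN_der pF] by (simp add: dN_eq)
  show ?thesis
    unfolding alg.C_def C_piN_def lie_deriv_N_def 1 2 3 ia ib k of_sec_diff of_sec_plus unfolding dN_eq m by simp
qed

lemma KK_eq:
  assumes \<alpha>: "\<alpha> \<in> cosecs A" and \<beta>: "\<beta> \<in> cosecs A"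
  shows "alg.KK (of_sec \<alpha>) (of_sec \<beta>) = ins2 (sh \<alpha>) (sh \<beta>) H + ins2 (sh \<alpha>) (sh \<beta>) H"
proof -
  let ?a = "of_sec \<alpha>" and ?b = "of_sec \<beta>"
  note o = of_sec_Omega[OF \<alpha>] of_sec_Omega[OF \<beta>]
  have H: "H \<in> \<Omega>" by (rule Omega_Forms[OF H_form])
  have Ka: "alg.K ?a = ins (sh \<alpha>) H" and Kb: "alg.K ?b = ins (sh \<beta>) H" by (simp_all add: K_of_sec \<alpha> \<beta>)
  have F: "ins (sh \<alpha>) H \<in> \<Omega>" "ins (sh \<beta>) H \<in> \<Omega>" using H \<alpha> \<beta> by (simp_all add: Forms_ins sh_sec)
  have 0: "alg.K (kap ?a ?b) = 0" by (rule alg.K_fun[OF pa.\<kappa>_1_1[OF o]])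
  have 1: "kap (ins (sh \<alpha>) H) ?b = - ins (sh \<beta>) (ins (sh \<alpha>) H)"
    using pa.\<kappa>_sym_odd_even[OF alg.K_Om_1[OF o(1)] o(2)] by (simp add: Ka kap_of_sec Forms_altm F)
  have 2: "kap (sg ?a) (ins (sh \<beta>) H) = ins (sh \<alpha>) (ins (sh \<beta>) H)"
    using fa.bider_minus_left[OF kap_bider fa.Om_Tot[OF o(1)] F(2)] by (simp add: sg_of_sec kap_of_sec Forms_altm F)
  have 3: "ins (sh \<alpha>) (ins (sh \<beta>) H) = - ins (sh \<beta>) (ins (sh \<alpha>) H)" by (rule ins_swap[OF Forms_altm[OF H]])
  show ?thesis
    unfolding alg.KK_def 0 Ka Kb 1 2 3 by (simp add: ins_def ins2_def fun_eq_iff)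
qed

lemma compatibility_equation:
  assumes "a \<in> Omega 1" "b \<in> Omega 1"
  shows "alg.C a b = - alg.KK a b"
proof -
  obtain \<alpha> \<beta> where s: "\<alpha> \<in> cosecs A" "\<beta> \<in> cosecs A" and e: "a = of_sec \<alpha>" "b = of_sec \<beta>"
    using assms unfolding Omega_1 by (elim bexE)
  show ?thesis
    unfolding e C_eq[OF s] KK_eq[OF s] C_condition[OF s] by (simp add: fun_eq_iff multi_apply2)
qed

lemma ev_ins_N_2: "ev (ins_N N P) [X, Y] x = ev P [app N X, Y] x + ev P [X, app N Y] x"
  by (simp add: ev_Cons ins_ins_N ev_add ins_add) (simp add: ev_def ins_N_def)

text \<open>
  On two sections \<open>X\<close>, \<open>Y\<close> the operator \<open>[i\<^sub>N, d\<^sub>N] - [i\<^bsub>NN\<^esub>, d]\<close> applied to \<open>\<alpha>\<close> is \<open>-2 \<alpha>(T\<^sub>N(X, Y))\<close>. By the torsion condition and the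
  antisymmetry of \<open>\<pi>\<^sup>\<sharp>\<close> this is twice the value on \<open>\<pi>\<^sup>\<sharp>\<alpha>\<close> of the form in that condition, hence \<open>- \<tau>(\<alpha>)\<close>.
\<close>

lemma torsion_equation:
  assumes "a \<in> Omega 1"
  shows "ins_N N (alg.dN a) - alg.dN (ins_N N a) = ins_N N2 (ext_d A a) - ext_d A (ins_N N2 a) - alg.\<tau> a"
proof -
  obtain \<alpha> where \<alpha>: "\<alpha> \<in> cosecs A" and a: "a = of_sec \<alpha>" using assms unfolding Omega_1 by (elim bexE)
  let ?Z = "sh \<alpha>"
  have t: "app (transp N) \<gamma> \<in> cosecs A" if "\<gamma> \<in> cosecs A" for \<gamma> using that by (rule app_transp_sections[OF N_endo])
  have F: "of_sec \<gamma> \<in> \<Omega>" if "\<gamma> \<in> cosecs A" for \<gamma> using that by (simp add: Forms_of_sec)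
  have aH: "altm H" and a\<psi>: "altm \<psi>" using H_form \<psi>_form by (simp_all add: Omega_Forms Forms_altm)
  have anH: "altm (ins_N N H)" by (rule altm_ins_N[OF linear_N aH])
  have \<tau>: "alg.\<tau> a = - ins ?Z \<psi> - ins ?Z \<psi> - ins_N N (ins ?Z H) - ins_N N (ins ?Z H)"
  proof -
    have s: "kap P a = ins ?Z P" if "P \<in> Omega 3" for P
      using pa.\<kappa>_sym_odd_odd[OF that assms] that by (simp add: a kap_of_sec Forms_altm[OF Omega_Forms])
    have "alg.K (ins_N N a) = ins (app N ?Z) H" "alg.K a = ins ?Z H"
      using K_of_sec[OF t[OF \<alpha>]] K_of_sec[OF \<alpha>] by (simp_all add: a ins_N_of_sec[OF linear_N] sh_transp)
    then show ?thesis
      unfolding alg.\<tau>_def s[OF \<psi>_form] s[OF alg.nH] by (simp add: ins_ins_N)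
  qed
  have na: "ins_N N a = of_sec (app (transp N) \<alpha>)" "ins_N N2 a = of_sec (app (transp N) (app (transp N) \<alpha>))"
    by (simp_all add: a ins_N_of_sec[OF linear_N] ins_N_of_sec[OF linear_N2] app_transp_N2)
  have o: "alg.dN a \<in> Omega 2" "alg.dN (ins_N N a) \<in> Omega 2" "ext_d A a \<in> Omega 2" "ext_d A (ins_N N2 a) \<in> Omega 2" "alg.\<tau> a \<in> Omega 2"
    using fa.der_Om[OF alg.dN_der assms] fa.der_Om[OF alg.dN_der alg.n_1[OF assms]] fa.der_Om[OF alg.\<tau>_der assms]
      pa.d_1[OF assms] pa.d_1[OF of_sec_Omega[OF t[OF t[OF \<alpha>]]]] by (simp_all add: na(2))
  have deg: "of_deg 2 P" if "P \<in> Omega 2" for P using that Omega_of_nat[of P 2] by simp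
  show ?thesis
  proof (rule deg_eqI)
    show "of_deg 2 (ins_N N (alg.dN a) - alg.dN (ins_N N a))"
      "of_deg 2 (ins_N N2 (ext_d A a) - ext_d A (ins_N N2 a) - alg.\<tau> a)"
      using fa.der_Om[OF alg.n_der o(1)] fa.der_Om[OF alg.n2_der o(3)] o
      by (auto intro!: deg fa.Om_diff)
    fix Xs x assume Xs: "set Xs \<subseteq> S" "length Xs = 2"
    then obtain X Y where XY: "Xs = [X, Y]" by (auto simp: length_Suc_conv numeral_2_eq_2)
    then have X: "X \<in> S" and Y: "Y \<in> S" using Xs by auto
    let ?NX = "app N X" and ?NY = "app N Y"
    note s = X Y N_sec[OF X] N_sec[OF Y]
    have ev1: "ev (of_sec (app (transp N) \<gamma>)) [U] = ev (of_sec \<gamma>) [app N U]" for \<gamma> U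
      by (simp add: ev_def of_sec_def app_def transp_def adjoint_inner[OF fd linear_N])
    have dd: "ev (ext_d A (of_sec \<gamma>)) [U, V] x = anchor_deriv A U (ev (of_sec \<gamma>) [V]) x
        - anchor_deriv A V (ev (of_sec \<gamma>) [U]) x - ev (of_sec \<gamma>) [brk A U V] x"
      if "\<gamma> \<in> cosecs A" "U \<in> S" "V \<in> S" for \<gamma> U V
      using ev_d[OF F[OF that(1)], of "[U, V]"] that by (simp add: cart_2 del: cart.simps)
    have ev2: "ev (ins_N N2 P) [X, Y] x = ev P [app N ?NX, Y] x + ev P [X, app N ?NY] x" for P
      by (simp add: ev_Cons ins_ins_N ev_add ins_add app_N2) (simp add: ev_def ins_N_def)
    define W where "W = ins2 ?NX Y H - ins2 ?NY X H + ins2 X Y \<psi>"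
    have tor: "ev a [torsion A N X Y] x = - ev W [?Z] x"
    proof -
      have dW: "of_deg 1 W" "altm W"
      proof -
        have "ins2 U V P = ins V (ins U P)" for U V and P :: "('m, 'v) multi" by (simp add: ins2_def ins_def)
        moreover have "ins V (ins U P) \<in> Omega 1" if "U \<in> S" "V \<in> S" "P \<in> Omega 3" for U V P
          using fa.der_Om[OF ins_der[OF that(2)] fa.der_Om[OF ins_der[OF that(1)] that(3)]] by simp
        ultimately have "W \<in> Omega 1" unfolding W_def
          using H_form \<psi>_form s by (simp add: fa.Om_add fa.Om_diff)
        then show "of_deg 1 W" "altm W" using Omega_of_nat[of W 1] by (simp_all add: Forms_altm)
      qed
      have "ev a [torsion A N X Y] x = \<alpha> x \<bullet> sharp \<pi> x (to_sec W x)"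
        by (simp add: T_condition[OF X Y] a W_def ev_def of_sec_def app_def)
      also have "\<dots> = - (to_sec W x \<bullet> ?Z x)" by (subst sharp_adjoint) (simp add: app_def)
      also have "to_sec W x \<bullet> ?Z x = ev (of_sec (to_sec W)) [?Z] x" by (simp add: ev_def of_sec_def)
      finally show ?thesis by (simp add: of_sec_to_sec[OF dW(2,1)])
    qed
    have tor2: "ev a [torsion A N X Y] x = ev a [brk A ?NX ?NY] x - ev a [app N (brk A ?NX Y)] x
        - ev a [app N (brk A X ?NY)] x + ev a [app N (app N (brk A X Y))] x"
      by (simp add: torsion_def brk_N_def a ev_def of_sec_def app_def multi_apply linear_add[OF linear_N]
          linear_diff[OF linear_N] inner_add_right inner_diff_right)
    have Wx: "ev W [?Z] x = ev (ins ?Z \<psi>) [X, Y] x + ev (ins ?Z H) [?NX, Y] x + ev (ins ?Z H) [X, ?NY] x"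
      using altf_cycle[OF aH[rule_format, of x], of "?Z x" "?NX x" "Y x"] altf_cycle[OF aH[rule_format, of x], of "?Z x" "X x" "?NY x"]
        altf_swap[OF aH[rule_format, of x], of "[]" "X x" "?NY x" "[?Z x]"]
        altf_cycle[OF a\<psi>[rule_format, of x], of "?Z x" "X x" "Y x"]
      by (simp add: W_def ev_def ins2_def ins_def multi_apply2)
    have l: "ev (ins_N N (alg.dN a) - alg.dN (ins_N N a)) Xs x - ev (ins_N N2 (ext_d A a) - ext_d A (ins_N N2 a)) Xs x
       = - 2 * ev a [torsion A N X Y] x"
      unfolding tor2 XY alg.dN_def ev_diff ev_ins_N_2 ev2 na
      unfolding na a
      using s \<alpha>  t[OF \<alpha>] t[OF t[OF \<alpha>]]
      by (simp add: dd ev1 ins_N_of_sec[OF linear_N])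
    have r: "ev (alg.\<tau> a) Xs x = - 2 * ev W [?Z] x"
      unfolding \<tau> Wx XY ev_diff ev_minus ev_ins_N_2 by simp
    show "ev (ins_N N (alg.dN a) - alg.dN (ins_N N a)) Xs x
        = ev (ins_N N2 (ext_d A a) - ext_d A (ins_N N2 a) - alg.\<tau> a) Xs x"
      using l r tor by (simp add: ev_diff)
  qed
qed

text \<open>
  In \<open>i\<^sub>N i\<^sub>N H\<close> the endomorphism hits two different arguments, in either order, or the same argument twice.
\<close>

lemma calH_eq: "ins_N N (ins_N N H) - ins_N N2 H = calH N H + calH N H"
proof (intro ext)
  fix x vs
  have aH: "altf (H x)" using Forms_altm[OF Omega_Forms[OF H_form]] by auto
  have deg: "of_deg 3 H" using H_form Omega_of_nat[of H 3] by simp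
  show "(ins_N N (ins_N N H) - ins_N N2 H) x vs = (calH N H + calH N H) x vs"
  proof (cases "length vs = 3")
    case True
    then obtain u v w where vs: "vs = [u, v, w]" by (auto simp: length_Suc_conv numeral_3_eq_3)
    have "H x [N x u, v, N x w] = H x [N x w, N x u, v]" "H x [u, N x v, N x w] = H x [N x v, N x w, u]"
      using altf_cycle[OF aH] by metis+
    then show ?thesis
      by (simp add: vs calH_def ins_N_def multi_apply2 numeral_3_eq_3)
  next
    case False
    then have "calH N H x vs = 0" by (auto simp: calH_def split: list.splits)
    then show ?thesis
      using False of_deg_ins_N[OF of_deg_ins_N[OF deg], of N N] of_deg_ins_N[OF deg, of N2] by (simp add: of_deg_def multi_apply2)
  qed
qed

lemma closedness_equation: "alg.dN \<psi> + alg.dN \<psi> = ext_d A (ins_N N (ins_N N H)) - ext_d A (ins_N N2 H)"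
proof -
  have o: "ins_N N (ins_N N H) \<in> \<Omega>" "ins_N N2 H \<in> \<Omega>"
    using fa.der_Tot[OF alg.n_der] fa.der_Tot[OF alg.n2_der] Omega_Forms[OF H_form] by auto
  have "calH N H = fsc (\<lambda>_. 1 / 2) (ins_N N (ins_N N H) - ins_N N2 H)"
    unfolding calH_eq by (simp add: fsc_def fun_eq_iff multi_apply2)
  then have F: "calH N H \<in> \<Omega>" using o by (simp add: Forms_fsc smooth_funs_const fa.Tot_diff)
  show ?thesis
    using calH_eq W_condition d_add[OF F F] by (simp add: dN_eq flip: pa.d_diff[OF o])
qed

section \<open>The Lie quasi-bialgebroid\<close>

lemma dual_lie_algebroid: "lie_algebroid (dual_algebroid A \<pi>)"
proof -
  interpret B: almost_algebroid "dual_algebroid A \<pi>" by (rule almost_algebroid_dual)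
  show ?thesis
    unfolding lie_algebroid_def
  proof (intro conjI allI ballI)
    show "smooth_manifold (base (dual_algebroid A \<pi>))" by (rule B.smooth_manifold)
    show "vector_bundle (base (dual_algebroid A \<pi>)) (vbundle (dual_algebroid A \<pi>))" by (rule B.vector_bundle)
    show "tangent_vector (base (dual_algebroid A \<pi>)) x (anc (dual_algebroid A \<pi>) x v)" for x v
      by (rule B.tangent_anc)
    show "linear (\<lambda>v. anc (dual_algebroid A \<pi>) x v f)" if "f \<in> smooth_funs (base (dual_algebroid A \<pi>))" for x f
      by (rule B.linear_anc[OF that])
    fix X assume X: "X \<in> secs (dual_algebroid A \<pi>)"
    show "anchor_deriv (dual_algebroid A \<pi>) X f \<in> smooth_funs (base (dual_algebroid A \<pi>))"
      if "f \<in> smooth_funs (base (dual_algebroid A \<pi>))" for f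
      by (rule B.anchor_smooth[OF X that])
    fix Y assume Y: "Y \<in> secs (dual_algebroid A \<pi>)"
    show "brk (dual_algebroid A \<pi>) X Y \<in> secs (dual_algebroid A \<pi>)" by (rule B.brk_sec[OF X Y])
    show "brk (dual_algebroid A \<pi>) X Y = - brk (dual_algebroid A \<pi>) Y X" by (rule B.brk_antisym[OF X Y])
    show "brk (dual_algebroid A \<pi>) X (\<lambda>x. f x *\<^sub>R Y x)
        = (\<lambda>x. f x *\<^sub>R brk (dual_algebroid A \<pi>) X Y x + anchor_deriv (dual_algebroid A \<pi>) X f x *\<^sub>R Y x)"
      if "f \<in> smooth_funs (base (dual_algebroid A \<pi>))" for f
      by (rule B.brk_leibniz[OF X Y that])
    show "brk (dual_algebroid A \<pi>) X (\<lambda>x. c *\<^sub>R Y x) = (\<lambda>x. c *\<^sub>R brk (dual_algebroid A \<pi>) X Y x)" for c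
      using B.brk_leibniz[OF X Y B.smooth_funs_const[of c]] by (simp add: B.anchor_const)
    fix Z assume Z: "Z \<in> secs (dual_algebroid A \<pi>)"
    show "brk (dual_algebroid A \<pi>) X (Y + Z) = brk (dual_algebroid A \<pi>) X Y + brk (dual_algebroid A \<pi>) X Z"
      by (rule B.brk_add[OF X Y Z])
    have s: "X \<in> cosecs A" "Y \<in> cosecs A" "Z \<in> cosecs A" using X Y Z by simp_all
    note c = of_sec_brk_pi(2)[OF s(2,3)] of_sec_brk_pi(2)[OF s(3,1)] of_sec_brk_pi(2)[OF s(1,2)]
    have "of_sec (brk_pi A \<pi> X (brk_pi A \<pi> Y Z) + brk_pi A \<pi> Y (brk_pi A \<pi> Z X) + brk_pi A \<pi> Z (brk_pi A \<pi> X Y)) = of_sec 0"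
      unfolding of_sec_plus of_sec_brk_pi(1)[OF s(1) c(1)] of_sec_brk_pi(1)[OF s(2) c(2)] of_sec_brk_pi(1)[OF s(3) c(3)]
        of_sec_brk_pi(1)[OF s(1,2)] of_sec_brk_pi(1)[OF s(2,3)] of_sec_brk_pi(1)[OF s(3,1)]
      by (subst alg.b_jacobi[OF of_sec_Omega[OF s(1)] of_sec_Omega[OF s(2)] of_sec_Omega[OF s(3)]])
        (simp add: of_sec_zero zero_fun_def)
    then show "brk (dual_algebroid A \<pi>) X (brk (dual_algebroid A \<pi>) Y Z) +
        brk (dual_algebroid A \<pi>) Y (brk (dual_algebroid A \<pi>) Z X) +
        brk (dual_algebroid A \<pi>) Z (brk (dual_algebroid A \<pi>) X Y) = 0"
      by (simp add: of_sec_inject)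
  qed
qed

lemma multivectors_dual: "multivectors (dual_algebroid A \<pi>) p = Omega (int p)"
  by (simp add: Omega_eq_forms)

lemma of_fun_const_Omega: "of_fun (\<lambda>_. c) \<in> Omega 0"
  by (rule of_fun_Omega[OF smooth_funs_const])

text \<open>
  Derivations are additive by definition; linearity over the real numbers amounts to vanishing on constant
  functions.
\<close>

lemma der_scale:
  assumes D: "fa.der e D" and c: "D (of_fun (\<lambda>_. c)) = 0" and P: "P \<in> Omega p"
  shows "D (\<lambda>x vs. c * P x vs) = (\<lambda>x vs. c * D P x vs)"
proof -
  have e: "(\<lambda>x vs. c * Q x vs) = of_fun (\<lambda>_. c) \<and>\<and> Q" for Q :: "('m, 'v) multi"
    by (simp add: of_fun_wedge fsc_def)
  show ?thesis using fa.der_mul[OF D of_fun_const_Omega[of c] P] unfolding e c by (simp add: wedge_zero_left)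
qed

lemma \<delta>_const: "alg.\<delta> (of_fun (\<lambda>_. c)) = 0"
  using alg.dN_fun[OF of_fun_const_Omega] alg.K_fun[OF of_fun_const_Omega] fa.der_zero[OF alg.n_der]
  by (simp add: alg.\<delta>_def d_of_fun smooth_funs_const anchor_form_const)

lemma is_d_NH_\<delta>: "is_d_NH A \<pi> N H alg.\<delta>"
  unfolding is_d_NH_def wedge_derivation_def multivectors_dual
proof (intro conjI allI ballI)
  fix p P assume P: "P \<in> Omega (int p)"
  show "alg.\<delta> P \<in> Omega (int (p + 1))" using fa.der_Om[OF alg.\<delta>_der P] by (simp add: add.commute)
  show "alg.\<delta> (P + Q) = alg.\<delta> P + alg.\<delta> Q" if "Q \<in> Omega (int p)" for Q
    by (rule fa.der_add[OF alg.\<delta>_der fa.Om_Tot[OF P] fa.Om_Tot[OF that]])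
  show "alg.\<delta> (\<lambda>x vs. c * P x vs) = (\<lambda>x vs. c * alg.\<delta> P x vs)" for c
    by (rule der_scale[OF alg.\<delta>_der \<delta>_const P])
  show "alg.\<delta> (P \<and>\<and> Q) = (alg.\<delta> P \<and>\<and> Q) + (\<lambda>x vs. (- 1) ^ p * (P \<and>\<and> alg.\<delta> Q) x vs)"
    if "Q \<in> Omega (int q)" for q Q
    using fa.der_mul[OF alg.\<delta>_der P that] by (simp add: sig_pow)
next
  show "alg.\<delta> (of_fun f) = d_N A N (of_fun f)" if "f \<in> C" for f
    using alg.K_fun[OF of_fun_Omega[OF that]] by (simp add: alg.\<delta>_def dN_eq)
  show "alg.\<delta> (of_sec \<alpha>) = d_N A N (of_sec \<alpha>) - ins (sh \<alpha>) H" if "\<alpha> \<in> cosecs A" for \<alpha>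
    using that by (simp add: alg.\<delta>_def dN_eq K_of_sec)
qed

text \<open>
  The defining properties fix an operator on forms, so the statement about all such operators is one about
  \<open>d\<^sub>N - \<kappa>(H, \<cdot>)\<close>.
\<close>

lemma is_d_NH_unique:
  assumes D: "is_d_NH A \<pi> N H \<delta>" and P: "P \<in> Omega (int p)"
  shows "\<delta> P = alg.\<delta> P"
proof -
  have leib: "leibniz (- 1) D" if "is_d_NH A \<pi> N H D" for D
  proof -
    have w: "\<forall>p. \<forall>P\<in>Omega (int p). D P \<in> Omega (int (p + 1)) \<and>
        (\<forall>Q\<in>Omega (int p). D (P + Q) = D P + D Q) \<and>
        (\<forall>c. D (\<lambda>x vs. c * P x vs) = (\<lambda>x vs. c * D P x vs)) \<and>
        (\<forall>q. \<forall>Q\<in>Omega (int q). D (P \<and>\<and> Q) = (D P \<and>\<and> Q) + sig (int p) (P \<and>\<and> D Q))"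
      using that unfolding is_d_NH_def wedge_derivation_def multivectors_dual sig_pow by (elim conjE)
    have add: "D (P + Q) = D P + D Q" if "P \<in> Omega (int p)" "Q \<in> Omega (int p)" for p P Q
      by (rule bspec[OF conjunct1[OF conjunct2[OF bspec[OF spec[OF w] that(1)]]] that(2)])
    have mul: "D (P \<and>\<and> Q) = (D P \<and>\<and> Q) + sig (int p) (P \<and>\<and> D Q)" if "P \<in> Omega (int p)" "Q \<in> Omega (int q)" for p q P Q
      by (rule bspec[OF spec[OF conjunct2[OF conjunct2[OF conjunct2[OF bspec[OF spec[OF w] that(1)]]]]] that(2)])
    show ?thesis
      unfolding leibniz_def
    proof (intro conjI allI ballI impI)
      fix p P assume "P \<in> \<Omega>" "of_deg p P"
      then have P: "P \<in> Omega (int p)" by (simp add: Omega_of_nat)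
      show "D (P + Q) = D P + D Q" if "Q \<in> \<Omega>" "of_deg p Q" for Q
        using that by (intro add[OF P]) (simp add: Omega_of_nat)
      show "D (of_fun f \<and>\<and> P) = (D (of_fun f) \<and>\<and> P) + (of_fun f \<and>\<and> D P)" if "f \<in> C" for f
        using mul[of "of_fun f" 0, OF _ P] of_fun_Omega[OF that] by simp
      show "D (of_sec \<alpha> \<and>\<and> P) = (D (of_sec \<alpha>) \<and>\<and> P) + fsc (\<lambda>_. - 1) (of_sec \<alpha> \<and>\<and> D P)" if "\<alpha> \<in> cosecs A" for \<alpha>
        using mul[of "of_sec \<alpha>" 1, OF _ P] of_sec_Omega[OF that] by (simp add: sig_eq_fsc)
    qed
  qed
  have vals: "D (of_fun f) = d_N A N (of_fun f)" "D (of_sec \<alpha>) = d_N A N (of_sec \<alpha>) - ins (sh \<alpha>) H"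
    if "is_d_NH A \<pi> N H D" "f \<in> C" "\<alpha> \<in> cosecs A" for D f \<alpha>
    using that unfolding is_d_NH_def by auto
  have z: "(\<lambda>_. 0) \<in> cosecs A" by (rule dual.sections_zero)
  show ?thesis
  proof (rule forms_determined[OF leib[OF D] leib[OF is_d_NH_\<delta>], where p = p])
    show "\<delta> (of_fun f) = alg.\<delta> (of_fun f)" if "f \<in> C" for f
      by (simp add: vals(1)[OF D that z] vals(1)[OF is_d_NH_\<delta> that z])
    show "\<delta> (of_sec \<alpha>) = alg.\<delta> (of_sec \<alpha>)" if "\<alpha> \<in> cosecs A" for \<alpha>
      by (simp add: vals(2)[OF D smooth_funs_const[of 0] that] vals(2)[OF is_d_NH_\<delta> smooth_funs_const[of 0] that])
  qed (use P in \<open>simp_all add: Omega_of_nat\<close>)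
qed

text \<open>
  The Schouten bracket of \<open>A\<^sup>*\<^sub>\<pi>\<close>. The sign \<open>(-1)\<^bsup>p + 1\<^esup>\<close> in degree \<open>p\<close> passes from the symmetry convention for
  biderivations to that of a Gerstenhaber bracket.
\<close>

definition sch :: "('m, 'v) multi \<Rightarrow> ('m, 'v) multi \<Rightarrow> ('m, 'v) multi" where
  "sch P Q = - pa.b (sg P) Q"

lemma sch_eq:
  assumes P: "P \<in> Omega p" and Q: "Q \<in> \<Omega>"
  shows "sch P Q = sig (p + 1) (pa.b P Q)"
  using fa.bider_sig_left[OF pa.b_bider fa.Om_Tot[OF P] Q, of p] by (simp add: sch_def fa.s_Om[OF P] sig_def)

lemma sch_Omega:
  assumes P: "P \<in> Omega (int p)" and Q: "Q \<in> Omega (int q)"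
  shows "sch P Q \<in> Omega (int (p + q - 1))"
proof (cases "p = 0 \<and> q = 0")
  case True
  then show ?thesis using P Q pa.b_0_0[of P Q] by (simp add: sch_eq[OF P Omega_Forms[OF Q]] fa.Om_zero)
next
  case False
  then have "int q + (int p + - 1) = int (p + q - 1)" by auto
  with fa.bider_Om[OF pa.b_bider P Q] show ?thesis
    by (simp add: sch_eq[OF P Omega_Forms[OF Q]] fa.Om_sig)
qed

lemma schouten_dual: "schouten_bracket (dual_algebroid A \<pi>) sch"
  unfolding schouten_bracket_def multivectors_dual
proof (intro conjI allI ballI)
  fix p q P Q assume P: "P \<in> Omega (int p)" and Q: "Q \<in> Omega (int q)"
  note e = sch_eq[OF P]
  have F: "P \<in> \<Omega>" "Q \<in> \<Omega>" using P Q by (simp_all add: Omega_Forms)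
  note D = fa.bider_der[OF pa.b_bider P]
  show "sch P Q \<in> Omega (int (p + q - 1))" by (rule sch_Omega[OF P Q])
  show "sch P Q = (\<lambda>x vs. - ((- 1) ^ ((p + 1) * (q + 1)) * sch Q P x vs))"
  proof -
    have "sch P Q = - sig (int ((p + 1) * (q + 1))) (sch Q P)"
      unfolding e[OF F(2)] sch_eq[OF Q F(1)] fa.bider_sym[OF pa.b_bider P Q]
      by (cases "even p"; cases "even q") simp_all
    moreover have "(\<lambda>x vs. - ((- 1) ^ k * R x vs)) = - (\<lambda>x vs. (- 1) ^ k * R x vs)" for k and R :: "('m, 'v) multi"
      by (simp add: fun_eq_iff multi_apply2)
    ultimately show ?thesis by (simp only: sig_pow)
  qed
  show "sch P (Q + Q') = sch P Q + sch P Q'" if "Q' \<in> Omega (int q)" for Q'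
    using fa.Om_Tot[OF that] F by (simp add: sch_def fa.bider_add_right[OF pa.b_bider] fa.s_Tot)
  have c0: "pa.b P (of_fun (\<lambda>_. c)) = 0" for c
    using pa.\<kappa>_fun_right[OF P of_fun_const_Omega] pa.\<kappa>_fun_right[OF pa.d_Om[OF P] of_fun_const_Omega]
    by (simp add: pa.b_def d_of_fun smooth_funs_const anchor_form_const pa.d_zero pa.\<kappa>_linear fa.s_Tot F)
  show "sch P (\<lambda>x vs. c * Q x vs) = (\<lambda>x vs. c * sch P Q x vs)" for c
  proof -
    have "(\<lambda>x vs. c * Q x vs) = of_fun (\<lambda>_. c) \<and>\<and> Q" by (simp add: of_fun_wedge fsc_def)
    then have "(\<lambda>x vs. c * Q x vs) \<in> \<Omega>"
      using fa.Om_Tot[OF fa.mul_Om[OF of_fun_const_Omega Q]] by simp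
    then show ?thesis
      by (simp add: e F der_scale[OF D c0 Q]) (simp add: sig_def fun_eq_iff multi_apply2)
  qed
  show "sch P (Q \<and>\<and> R) = (sch P Q \<and>\<and> R) + (\<lambda>x vs. (- 1) ^ ((p + 1) * q) * (Q \<and>\<and> sch P R) x vs)"
    if R: "R \<in> Omega (int r)" for r R
  proof -
    have e2: "(int p + - 1) * int q = int ((p + 1) * q) + 2 * (- int q)" by (simp add: algebra_simps)
    have "sig ((int p + - 1) * int q) X = sig (int ((p + 1) * q)) X" for X :: "('m, 'v) multi"
      unfolding e2 sig_def by simp
    then show ?thesis
      unfolding sig_pow e[OF F(2)] e[OF fa.Om_Tot[OF R]] e[OF fa.Om_Tot[OF fa.mul_Om[OF Q R]]] fa.der_mul[OF D Q R]
      by (simp add: fa.mul_sig_left fa.mul_sig_right add.commute)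
  qed
next
  show "sch (of_sec X) (of_sec Y) = of_sec (brk (dual_algebroid A \<pi>) X Y)"
    if "X \<in> secs (dual_algebroid A \<pi>)" "Y \<in> secs (dual_algebroid A \<pi>)" for X Y
    using that of_sec_brk_pi(1)[of X Y]
    by (simp add: sch_eq[OF of_sec_Omega] Forms_of_sec)
  show "sch (of_sec X) (of_fun f) = of_fun (anchor_deriv (dual_algebroid A \<pi>) X f)"
    if "X \<in> secs (dual_algebroid A \<pi>)" "f \<in> smooth_funs (base (dual_algebroid A \<pi>))" for X f
    using that by (simp add: sch_eq[OF of_sec_Omega] Forms_of_fun b_of_sec_of_fun anchor_deriv_dual)
  show "sch (of_fun f) (of_fun h) = 0"
    if "f \<in> smooth_funs (base (dual_algebroid A \<pi>))" "h \<in> smooth_funs (base (dual_algebroid A \<pi>))" for f h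
    using that by (simp add: sch_eq[OF of_fun_Omega] Forms_of_fun pa.b_0_0[OF of_fun_Omega of_fun_Omega])
qed

theorem lie_quasi_bialgebroid_dual:
  assumes D: "is_d_NH A \<pi> N H \<delta>"
  shows "lie_quasi_bialgebroid (dual_algebroid A \<pi>) \<delta> (\<psi> + ins_N N H)"
  unfolding lie_quasi_bialgebroid_def
proof (intro conjI exI[of _ sch] allI ballI)
  let ?\<phi> = "\<psi> + ins_N N H"
  note eq = is_d_NH_unique[OF D]
  have \<phi>: "?\<phi> \<in> Omega (int 3)" using fa.Om_add[OF \<psi>_form alg.nH] by simp
  have \<delta>: "alg.\<delta> P \<in> Omega (int (Suc p))" if "P \<in> Omega (int p)" for p P
    using fa.der_Om[OF alg.\<delta>_der that] by (simp add: add.commute)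
  show "lie_algebroid (dual_algebroid A \<pi>)" by (rule dual_lie_algebroid)
  show "?\<phi> \<in> multivectors (dual_algebroid A \<pi>) 3" using \<phi> by (simp only: multivectors_dual)
  show "wedge_derivation (dual_algebroid A \<pi>) \<delta>" using D unfolding is_d_NH_def by (elim conjE)
  show "schouten_bracket (dual_algebroid A \<pi>) sch" by (rule schouten_dual)
  show "bracket_derivation (dual_algebroid A \<pi>) sch \<delta>"
    unfolding bracket_derivation_def multivectors_dual sig_pow
  proof (intro allI ballI)
    fix p q P Q assume P: "P \<in> Omega (int p)" and Q: "Q \<in> Omega (int q)"
    have F: "P \<in> \<Omega>" "Q \<in> \<Omega>" using P Q by (simp_all add: Omega_Forms)
    have G: "alg.\<delta> P \<in> \<Omega>" "alg.\<delta> Q \<in> \<Omega>" using \<delta>[OF P] \<delta>[OF Q] by (simp_all add: Omega_Forms)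
    have "alg.\<delta> (pa.b P Q) + pa.b (alg.\<delta> P) Q + sig (int p) (pa.b P (alg.\<delta> Q)) = 0"
      using alg.\<delta>_b[OF compatibility_equation fa.hom_Om[OF P] fa.hom_Om[OF Q]]
        fa.bider_sig_left[OF pa.b_bider F(1) G(2), of "int p"] by (simp add: fa.s_Om[OF P])
    then have "alg.\<delta> (pa.b P Q) = - pa.b (alg.\<delta> P) Q - sig (int p) (pa.b P (alg.\<delta> Q))"
      by (simp add: eq_neg_iff_add_eq_0 algebra_simps)
    then have "sig (int p + 1) (alg.\<delta> (pa.b P Q)) = sig (int (Suc p) + 1) (pa.b (alg.\<delta> P) Q)
        + sig (int (p + 1)) (sig (int p + 1) (pa.b P (alg.\<delta> Q)))"
      by (cases "even p") simp_all
    then show "\<delta> (sch P Q) = sch (\<delta> P) Q + sig (int (p + 1)) (sch P (\<delta> Q))"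
      unfolding eq[OF sch_Omega[OF P Q]] eq[OF P] eq[OF Q] unfolding sch_eq[OF P F(2)] sch_eq[OF \<delta>[OF P] F(2)]
        sch_eq[OF P G(2)] fa.der_sig[OF alg.\<delta>_der fa.bider_Tot[OF pa.b_bider F]] .
  qed
  show "\<delta> (\<delta> P) = sch ?\<phi> P" if "P \<in> multivectors (dual_algebroid A \<pi>) p" for p P
  proof -
    have P: "P \<in> Omega (int p)" using that by (simp only: multivectors_dual)
    show ?thesis
      using alg.\<delta>_\<delta>[OF compatibility_equation torsion_equation fa.hom_Om[OF P]]
      unfolding eq[OF P] eq[OF \<delta>[OF P]] sch_eq[OF \<phi> Omega_Forms[OF P]] by simp
  qed
  show "\<delta> ?\<phi> = 0"
    unfolding eq[OF \<phi>] by (rule alg.\<delta>_closed[OF torsion_equation closedness_equation])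
qed

end

theorem theorem3p2:
  fixes A :: "('m::{t2_space, second_countable_topology}, 'e::real_inner, 'v::real_inner) lie_alg_data"
    and \<pi> :: "('m, 'v) multi" and N :: "'m \<Rightarrow> 'v \<Rightarrow> 'v" and \<psi> H :: "('m, 'v) multi"
  assumes "lie_algebroid A"
    and "pqn_background A \<pi> N \<psi> H"
  shows "(\<exists>\<delta>. is_d_NH A \<pi> N H \<delta>) \<and>
    (\<forall>\<delta>. is_d_NH A \<pi> N H \<delta> \<longrightarrow>
       lie_quasi_bialgebroid (dual_algebroid A \<pi>) \<delta> (\<psi> + ins_N N H))"
proof -
  interpret lie_algebroid_structure A by (rule lie_algebroid_structureI[OF assms(1)])
  interpret background_structure A \<pi> N \<psi> H
  proof
    show "\<pi> \<in> multivectors A 2" using assms(2) unfolding pqn_background_def by (elim conjE)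
  qed (rule assms(2))
  show ?thesis
    by (intro conjI exI[of _ alg.\<delta>] allI impI) (rule is_d_NH_\<delta>, rule lie_quasi_bialgebroid_dual)
qed

end
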